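(* Let $R$ be a principal ideal domain containing $\frac12$ and let $(A,d_A)$ and $(B,d_B)$ be two commutative differential graded algebras over $R$ satisfying (i) $H^0(A,d_A)=H^0(B,d_B)=R$ and $H^1(A,d_A)=H^1(B,d_B)=0$; (ii) $H^i(A,d_A)$ and $H^i(B,d_B)$ are finitely generated $R$-modules for all $i$; (iii) $H^2(B,d_B)$ is a free $R$-module; (iv) $A$ is $R$-free. Let $f:(A,d_A)\to(B,d_B)$ be a morphism of commutative differential graded algebras over $R$ such that (v) $H^2(f):H^2(A,d_A)\to H^2(B,d_B)$ is injective. Then there exist a free graded $R$-module $V$, a differential $d$ on $A\otimes\Lambda V$ (where $\Lambda V$ is the free graded commutative algebra over $V$) such that the inclusion $i:(A,d_A)\hookrightarrow(A\otimes\Lambda V,d)$, $i(a)=a$, is a morphism of commutative differential graded algebras, and a quasi-isomorphism of commutative differential graded algebras $\varphi:(A\otimes\Lambda V,d)\to(B,d_B)$ such that $\varphi\circ i=f$.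
   Context: Commutative differential graded algebras are unital, graded commutative ($aa'=(-1)^{|a||a'|}a'a$), and cohomologically graded in degrees $\ge0$, with differential of degree $+1$ that is a derivation. A quasi-isomorphism is a morphism inducing an isomorphism in (co)homology. *)

theory Defs
  imports "HOL-Algebra.Module" "HOL-Algebra.QuotRing" "HOL-Algebra.Ring_Divisibility"
begin

section \<open>Free and finitely generated modules\<close>

text \<open>The requirement that the coefficient function vanishes outside \<open>X\<close> makes it
  unique as a function on the whole type.\<close>

definition is_basis :: "('r, 'e) ring_scheme \<Rightarrow> ('r, 'm, 'f) module_scheme \<Rightarrow> 'm set \<Rightarrow> bool" where
  "is_basis R M X \<longleftrightarrow> X \<subseteq> carrier M \<and>
     (\<forall>x\<in>carrier M. \<exists>!c.
        c ` X \<subseteq> carrier R \<and> (\<forall>b. b \<notin> X \<longrightarrow> c b = \<zero>\<^bsub>R\<^esub>) \<and> finite {b. c b \<noteq> \<zero>\<^bsub>R\<^esub>} \<and>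
        x = finsum M (\<lambda>b. c b \<odot>\<^bsub>M\<^esub> b) {b. c b \<noteq> \<zero>\<^bsub>R\<^esub>})"

definition free_module :: "('r, 'e) ring_scheme \<Rightarrow> ('r, 'm, 'f) module_scheme \<Rightarrow> bool" where
  "free_module R M \<longleftrightarrow> module R M \<and> (\<exists>X. is_basis R M X)"

definition fin_gen_module :: "('r, 'e) ring_scheme \<Rightarrow> ('r, 'm, 'f) module_scheme \<Rightarrow> bool" where
  "fin_gen_module R M \<longleftrightarrow> module R M \<and>
     (\<exists>S. finite S \<and> S \<subseteq> carrier M \<and>
        (\<forall>x\<in>carrier M. \<exists>c. c ` S \<subseteq> carrier R \<and> x = finsum M (\<lambda>s. c s \<odot>\<^bsub>M\<^esub> s) S))"

section \<open>Graded modules and commutative graded algebras\<close>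

text \<open>A graded object is a single carrier together with its homogeneous parts.  As in
  \<^theory>\<open>HOL-Algebra.Module\<close>, the fields \<^const>\<open>mult\<close> and \<^const>\<open>one\<close> carry no meaning when
  the record is only used as a module.\<close>

record ('r, 'm) gmod = "('r, 'm) module" +
  grade :: "nat \<Rightarrow> 'm set"

definition is_decomp :: "('r, 'm, 'f) gmod_scheme \<Rightarrow> 'm \<Rightarrow> (nat \<Rightarrow> 'm) \<Rightarrow> bool" where
  "is_decomp M x c \<longleftrightarrow> (\<forall>n. c n \<in> grade M n) \<and> finite {n. c n \<noteq> \<zero>\<^bsub>M\<^esub>} \<and>
     x = finsum M c {n. c n \<noteq> \<zero>\<^bsub>M\<^esub>}"

definition hcomp :: "('r, 'm, 'f) gmod_scheme \<Rightarrow> 'm \<Rightarrow> nat \<Rightarrow> 'm" where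
  "hcomp M x = (THE c. is_decomp M x c)"

locale graded_module = module R M
  for R :: "('r, 'e) ring_scheme" (structure) and M :: "('r, 'm, 'f) gmod_scheme" (structure) +
  assumes grade_submodule: "submodule (grade M n) R M"
    and direct_sum: "x \<in> carrier M \<Longrightarrow> \<exists>!c. is_decomp M x c"

definition free_graded_module :: "('r, 'e) ring_scheme \<Rightarrow> ('r, 'm, 'f) gmod_scheme \<Rightarrow> bool" where
  "free_graded_module R V \<longleftrightarrow> graded_module R V \<and>
     (\<exists>X. is_basis R V X \<and> X \<subseteq> (\<Union>n. grade V n))"

text \<open>The Koszul sign \<open>(-1)\<^sup>n\<close> applied to an element of \<open>G\<close>.\<close>

definition ksgn :: "('m, 'f) ring_scheme \<Rightarrow> nat \<Rightarrow> 'm \<Rightarrow> 'm" where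
  "ksgn G n x = (if even n then x else \<ominus>\<^bsub>G\<^esub> x)"

locale comm_graded_algebra = graded_module R A + A?: ring A
  for R :: "('r, 'e) ring_scheme" (structure) and A :: "('r, 'a, 'f) gmod_scheme" (structure) +
  assumes smult_mult_left:
      "\<lbrakk>r \<in> carrier R; x \<in> carrier A; y \<in> carrier A\<rbrakk> \<Longrightarrow>
       (r \<odot>\<^bsub>A\<^esub> x) \<otimes>\<^bsub>A\<^esub> y = r \<odot>\<^bsub>A\<^esub> (x \<otimes>\<^bsub>A\<^esub> y)"
    and smult_mult_right:
      "\<lbrakk>r \<in> carrier R; x \<in> carrier A; y \<in> carrier A\<rbrakk> \<Longrightarrow>
       x \<otimes>\<^bsub>A\<^esub> (r \<odot>\<^bsub>A\<^esub> y) = r \<odot>\<^bsub>A\<^esub> (x \<otimes>\<^bsub>A\<^esub> y)"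
    and one_grade: "\<one>\<^bsub>A\<^esub> \<in> grade A 0"
    and mult_grade:
      "\<lbrakk>x \<in> grade A i; y \<in> grade A j\<rbrakk> \<Longrightarrow> x \<otimes>\<^bsub>A\<^esub> y \<in> grade A (i + j)"
    and graded_comm:
      "\<lbrakk>x \<in> grade A i; y \<in> grade A j\<rbrakk> \<Longrightarrow> x \<otimes>\<^bsub>A\<^esub> y = ksgn A (i * j) (y \<otimes>\<^bsub>A\<^esub> x)"

section \<open>Commutative differential graded algebras and their cohomology\<close>

locale cdga = comm_graded_algebra R A
  for R :: "('r, 'e) ring_scheme" (structure) and A :: "('r, 'a, 'f) gmod_scheme" (structure)
    and d :: "'a \<Rightarrow> 'a" +
  assumes diff_add:
      "\<lbrakk>x \<in> carrier A; y \<in> carrier A\<rbrakk> \<Longrightarrow> d (x \<oplus>\<^bsub>A\<^esub> y) = d x \<oplus>\<^bsub>A\<^esub> d y"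
    and diff_smult:
      "\<lbrakk>r \<in> carrier R; x \<in> carrier A\<rbrakk> \<Longrightarrow> d (r \<odot>\<^bsub>A\<^esub> x) = r \<odot>\<^bsub>A\<^esub> d x"
    and diff_grade: "x \<in> grade A i \<Longrightarrow> d x \<in> grade A (Suc i)"
    and diff_diff: "x \<in> carrier A \<Longrightarrow> d (d x) = \<zero>\<^bsub>A\<^esub>"
    and diff_mult:
      "\<lbrakk>x \<in> grade A i; y \<in> carrier A\<rbrakk> \<Longrightarrow>
       d (x \<otimes>\<^bsub>A\<^esub> y) = (d x \<otimes>\<^bsub>A\<^esub> y) \<oplus>\<^bsub>A\<^esub> ksgn A i (x \<otimes>\<^bsub>A\<^esub> d y)"

definition cdga_hom ::
  "('r, 'e) ring_scheme \<Rightarrow> ('r, 'a, 'f) gmod_scheme \<Rightarrow> ('a \<Rightarrow> 'a) \<Rightarrow>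
   ('r, 'b, 'g) gmod_scheme \<Rightarrow> ('b \<Rightarrow> 'b) \<Rightarrow> ('a \<Rightarrow> 'b) \<Rightarrow> bool" where
  "cdga_hom R A dA B dB h \<longleftrightarrow>
     h \<in> ring_hom A B \<and>
     (\<forall>r\<in>carrier R. \<forall>x\<in>carrier A. h (r \<odot>\<^bsub>A\<^esub> x) = r \<odot>\<^bsub>B\<^esub> h x) \<and>
     (\<forall>n. h ` grade A n \<subseteq> grade B n) \<and>
     (\<forall>x\<in>carrier A. h (dA x) = dB (h x))"

definition cocycles :: "('r, 'a, 'f) gmod_scheme \<Rightarrow> ('a \<Rightarrow> 'a) \<Rightarrow> nat \<Rightarrow> 'a set" where
  "cocycles A d n = {z \<in> grade A n. d z = \<zero>\<^bsub>A\<^esub>}"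

definition coboundaries :: "('r, 'a, 'f) gmod_scheme \<Rightarrow> ('a \<Rightarrow> 'a) \<Rightarrow> nat \<Rightarrow> 'a set" where
  "coboundaries A d n = (case n of 0 \<Rightarrow> {\<zero>\<^bsub>A\<^esub>} | Suc k \<Rightarrow> d ` grade A k)"

text \<open>\<open>H\<^sup>n(A, d)\<close> as an \<open>R\<close>-module, whose elements are the cosets of the coboundaries.  There
  is no product on a single \<open>H\<^sup>n\<close>, so the ring multiplication and its unit are left
  undefined.\<close>

definition cohom ::
  "('r, 'a, 'f) gmod_scheme \<Rightarrow> ('a \<Rightarrow> 'a) \<Rightarrow> nat \<Rightarrow> ('r, 'a set) module" where
  "cohom A d n =
     \<lparr>carrier = (\<lambda>z. coboundaries A d n +>\<^bsub>A\<^esub> z) ` cocycles A d n,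
      mult = undefined, one = undefined,
      zero = coboundaries A d n, add = set_add A,
      smult = (\<lambda>r X. set_add A (coboundaries A d n) ((\<lambda>x. r \<odot>\<^bsub>A\<^esub> x) ` X))\<rparr>"

text \<open>\<open>H\<^sup>n(h)\<close>: the coset of \<open>z\<close> is sent to the coset of \<open>h z\<close>.\<close>

definition cohom_map ::
  "('r, 'b, 'g) gmod_scheme \<Rightarrow> ('b \<Rightarrow> 'b) \<Rightarrow> nat \<Rightarrow> ('a \<Rightarrow> 'b) \<Rightarrow> 'a set \<Rightarrow> 'b set" where
  "cohom_map B dB n h X = set_add B (coboundaries B dB n) (h ` X)"

definition quasi_iso ::
  "('r, 'e) ring_scheme \<Rightarrow> ('r, 'a, 'f) gmod_scheme \<Rightarrow> ('a \<Rightarrow> 'a) \<Rightarrow>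
   ('r, 'b, 'g) gmod_scheme \<Rightarrow> ('b \<Rightarrow> 'b) \<Rightarrow> ('a \<Rightarrow> 'b) \<Rightarrow> bool" where
  "quasi_iso R A dA B dB h \<longleftrightarrow> cdga_hom R A dA B dB h \<and>
     (\<forall>n. bij_betw (cohom_map B dB n h) (carrier (cohom A dA n)) (carrier (cohom B dB n)))"

text \<open>\<open>H\<^sup>0(A, d) = R\<close>, the identification being the canonical one \<open>r \<mapsto> [r \<cdot> 1]\<close>.\<close>

definition H0_is_base ::
  "('r, 'e) ring_scheme \<Rightarrow> ('r, 'a, 'f) gmod_scheme \<Rightarrow> ('a \<Rightarrow> 'a) \<Rightarrow> bool" where
  "H0_is_base R A d \<longleftrightarrow>
     bij_betw (\<lambda>r. coboundaries A d 0 +>\<^bsub>A\<^esub> (r \<odot>\<^bsub>A\<^esub> \<one>\<^bsub>A\<^esub>)) (carrier R) (carrier (cohom A d 0))"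

section \<open>Graded algebras by generators and relations\<close>

text \<open>The free module on the elements of a monoid \<open>M\<close>, multiplied by
  \<open>u \<cdot> v = (-1)\<^bsup>\<sigma> u v\<^esup> uv\<close> on basis elements and graded by \<open>dg\<close>.  Its elements are the finitely
  supported functions on \<open>M\<close>.\<close>

definition monoid_alg ::
  "('r, 'e) ring_scheme \<Rightarrow> ('m, 'f) monoid_scheme \<Rightarrow> ('m \<Rightarrow> nat) \<Rightarrow> ('m \<Rightarrow> 'm \<Rightarrow> nat) \<Rightarrow>
   ('r, 'm \<Rightarrow> 'r) gmod" where
  "monoid_alg R M dg \<sigma> =
     (let C = {f. range f \<subseteq> carrier R \<and> finite {m. f m \<noteq> \<zero>\<^bsub>R\<^esub>} \<and> {m. f m \<noteq> \<zero>\<^bsub>R\<^esub>} \<subseteq> carrier M} in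
     \<lparr>carrier = C,
      mult = (\<lambda>f g m. finsum R (\<lambda>(u, v). ksgn R (\<sigma> u v) (f u \<otimes>\<^bsub>R\<^esub> g v))
                {(u, v). f u \<noteq> \<zero>\<^bsub>R\<^esub> \<and> g v \<noteq> \<zero>\<^bsub>R\<^esub> \<and> u \<otimes>\<^bsub>M\<^esub> v = m}),
      one = (\<lambda>m. if m = \<one>\<^bsub>M\<^esub> then \<one>\<^bsub>R\<^esub> else \<zero>\<^bsub>R\<^esub>),
      zero = (\<lambda>m. \<zero>\<^bsub>R\<^esub>),
      add = (\<lambda>f g m. f m \<oplus>\<^bsub>R\<^esub> g m),
      smult = (\<lambda>r f m. r \<otimes>\<^bsub>R\<^esub> f m),
      grade = (\<lambda>n. {f \<in> C. \<forall>m. f m \<noteq> \<zero>\<^bsub>R\<^esub> \<longrightarrow> dg m = n})\<rparr>)"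

definition single :: "('r, 'e) ring_scheme \<Rightarrow> 'm \<Rightarrow> 'm \<Rightarrow> 'r" where
  "single R m = (\<lambda>m'. if m' = m then \<one>\<^bsub>R\<^esub> else \<zero>\<^bsub>R\<^esub>)"

text \<open>The quotient of a graded algebra by the two-sided ideal generated by a set \<open>S\<close> of
  homogeneous elements.  It extends the quotient ring by the induced scalar
  multiplication and grading.\<close>

definition graded_quot :: "('r, 'g) gmod \<Rightarrow> 'g set \<Rightarrow> ('r, 'g set) gmod" where
  "graded_quot G S =
     (let I = genideal G S; Q = G Quot I in
     \<lparr>carrier = carrier Q, mult = mult Q, one = one Q, zero = zero Q, add = add Q,
      smult = (\<lambda>r X. set_add G I ((\<lambda>x. r \<odot>\<^bsub>G\<^esub> x) ` X)),
      grade = (\<lambda>n. (\<lambda>x. I +>\<^bsub>G\<^esub> x) ` grade G n)\<rparr>)"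

section \<open>The free graded commutative algebra on a graded module\<close>

text \<open>\<open>\<Lambda>V\<close> is the tensor algebra of \<open>V\<close> modulo the elements
  \<open>v \<otimes> w - (-1)\<^bsup>ij\<^esup> w \<otimes> v\<close> for \<open>v \<in> V\<^sup>i\<close> and \<open>w \<in> V\<^sup>j\<close>.  The tensor algebra is presented in
  turn by words in the homogeneous elements of \<open>V\<close>, subject to linearity in each letter;
  a letter \<open>(n, v)\<close> is an element \<open>v\<close> of \<open>V\<^sup>n\<close>.  No relation \<open>v\<^sup>2 = 0\<close> in odd degree is
  imposed, as it follows when 2 is invertible.\<close>

definition words :: "('r, 'v, 'f) gmod_scheme \<Rightarrow> (nat \<times> 'v) list monoid" where
  "words V = \<lparr>carrier = lists {(n, v). v \<in> grade V n}, mult = (@), one = []\<rparr>"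

definition word_alg ::
  "('r, 'e) ring_scheme \<Rightarrow> ('r, 'v, 'f) gmod_scheme \<Rightarrow> ('r, (nat \<times> 'v) list \<Rightarrow> 'r) gmod" where
  "word_alg R V = monoid_alg R (words V) (\<lambda>w. sum_list (map fst w)) (\<lambda>_ _. 0)"

definition Lambda_rels ::
  "('r, 'e) ring_scheme \<Rightarrow> ('r, 'v, 'f) gmod_scheme \<Rightarrow> ((nat \<times> 'v) list \<Rightarrow> 'r) set" where
  "Lambda_rels R V =
     (let F = word_alg R V; e = single R in
      {e [(n, v \<oplus>\<^bsub>V\<^esub> w)] \<ominus>\<^bsub>F\<^esub> (e [(n, v)] \<oplus>\<^bsub>F\<^esub> e [(n, w)]) | n v w.
         v \<in> grade V n \<and> w \<in> grade V n}
    \<union> {e [(n, r \<odot>\<^bsub>V\<^esub> v)] \<ominus>\<^bsub>F\<^esub> (r \<odot>\<^bsub>F\<^esub> e [(n, v)]) | n r v.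
         r \<in> carrier R \<and> v \<in> grade V n}
    \<union> {e [(i, v), (j, w)] \<ominus>\<^bsub>F\<^esub> ksgn F (i * j) (e [(j, w), (i, v)]) | i j v w.
         v \<in> grade V i \<and> w \<in> grade V j})"

definition Lambda ::
  "('r, 'e) ring_scheme \<Rightarrow> ('r, 'v, 'f) gmod_scheme \<Rightarrow> ('r, ((nat \<times> 'v) list \<Rightarrow> 'r) set) gmod" where
  "Lambda R V = graded_quot (word_alg R V) (Lambda_rels R V)"

section \<open>The tensor product of graded algebras\<close>

text \<open>\<open>A \<otimes> L = \<Oplus>\<^sub>p\<^sub>,\<^sub>q A\<^sup>p \<otimes> L\<^sup>q\<close>, generated by symbols \<open>(p, a, q, x)\<close> with \<open>a \<in> A\<^sup>p\<close> and
  \<open>x \<in> L\<^sup>q\<close>, standing for \<open>a \<otimes> x\<close>, subject to bilinearity, with the product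
  \<open>(a \<otimes> x)(b \<otimes> y) = (-1)\<^bsup>|x||b|\<^esup> ab \<otimes> xy\<close>.  The bilinearity relations already span a
  two-sided ideal, so passing to the ideal they generate imposes nothing further.\<close>

definition pure_pairs ::
  "('r, 'a, 'f) gmod_scheme \<Rightarrow> ('r, 'l, 'g) gmod_scheme \<Rightarrow> (nat \<times> 'a \<times> nat \<times> 'l) monoid" where
  "pure_pairs A L =
     \<lparr>carrier = {(p, a, q, x). a \<in> grade A p \<and> x \<in> grade L q},
      mult = (\<lambda>(p, a, q, x) (p', b, q', y). (p + p', a \<otimes>\<^bsub>A\<^esub> b, q + q', x \<otimes>\<^bsub>L\<^esub> y)),
      one = (0, \<one>\<^bsub>A\<^esub>, 0, \<one>\<^bsub>L\<^esub>)\<rparr>"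

definition pair_alg ::
  "('r, 'e) ring_scheme \<Rightarrow> ('r, 'a, 'f) gmod_scheme \<Rightarrow> ('r, 'l, 'g) gmod_scheme \<Rightarrow>
   ('r, nat \<times> 'a \<times> nat \<times> 'l \<Rightarrow> 'r) gmod" where
  "pair_alg R A L = monoid_alg R (pure_pairs A L) (\<lambda>(p, a, q, x). p + q)
     (\<lambda>(p, a, q, x) (p', b, q', y). q * p')"

definition bilinear_rels ::
  "('r, 'e) ring_scheme \<Rightarrow> ('r, 'a, 'f) gmod_scheme \<Rightarrow> ('r, 'l, 'g) gmod_scheme \<Rightarrow>
   (nat \<times> 'a \<times> nat \<times> 'l \<Rightarrow> 'r) set" where
  "bilinear_rels R A L =
     (let F = pair_alg R A L; e = single R in
      {e (p, a \<oplus>\<^bsub>A\<^esub> b, q, x) \<ominus>\<^bsub>F\<^esub> (e (p, a, q, x) \<oplus>\<^bsub>F\<^esub> e (p, b, q, x)) | p a b q x.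
         a \<in> grade A p \<and> b \<in> grade A p \<and> x \<in> grade L q}
    \<union> {e (p, a, q, x \<oplus>\<^bsub>L\<^esub> y) \<ominus>\<^bsub>F\<^esub> (e (p, a, q, x) \<oplus>\<^bsub>F\<^esub> e (p, a, q, y)) | p a q x y.
         a \<in> grade A p \<and> x \<in> grade L q \<and> y \<in> grade L q}
    \<union> {e (p, r \<odot>\<^bsub>A\<^esub> a, q, x) \<ominus>\<^bsub>F\<^esub> (r \<odot>\<^bsub>F\<^esub> e (p, a, q, x)) | p r a q x.
         r \<in> carrier R \<and> a \<in> grade A p \<and> x \<in> grade L q}
    \<union> {e (p, a, q, r \<odot>\<^bsub>L\<^esub> x) \<ominus>\<^bsub>F\<^esub> (r \<odot>\<^bsub>F\<^esub> e (p, a, q, x)) | p r a q x.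
         r \<in> carrier R \<and> a \<in> grade A p \<and> x \<in> grade L q})"

definition tensor_alg ::
  "('r, 'e) ring_scheme \<Rightarrow> ('r, 'a, 'f) gmod_scheme \<Rightarrow> ('r, 'l, 'g) gmod_scheme \<Rightarrow>
   ('r, (nat \<times> 'a \<times> nat \<times> 'l \<Rightarrow> 'r) set) gmod" where
  "tensor_alg R A L = graded_quot (pair_alg R A L) (bilinear_rels R A L)"

definition pure_tensor ::
  "('r, 'e) ring_scheme \<Rightarrow> ('r, 'a, 'f) gmod_scheme \<Rightarrow> ('r, 'l, 'g) gmod_scheme \<Rightarrow>
   nat \<Rightarrow> 'a \<Rightarrow> nat \<Rightarrow> 'l \<Rightarrow> (nat \<times> 'a \<times> nat \<times> 'l \<Rightarrow> 'r) set" where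
  "pure_tensor R A L p a q x =
     genideal (pair_alg R A L) (bilinear_rels R A L) +>\<^bsub>pair_alg R A L\<^esub> single R (p, a, q, x)"

text \<open>The map \<open>a \<mapsto> a \<otimes> 1\<close>, computed on the homogeneous components of \<open>a\<close>.\<close>

definition tensor_incl ::
  "('r, 'e) ring_scheme \<Rightarrow> ('r, 'a, 'f) gmod_scheme \<Rightarrow> ('r, 'l, 'g) gmod_scheme \<Rightarrow>
   'a \<Rightarrow> (nat \<times> 'a \<times> nat \<times> 'l \<Rightarrow> 'r) set" where
  "tensor_incl R A L a =
     finsum (tensor_alg R A L) (\<lambda>p. pure_tensor R A L p (hcomp A a p) 0 \<one>\<^bsub>L\<^esub>)
       {p. hcomp A a p \<noteq> \<zero>\<^bsub>A\<^esub>}"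

end

theory Submission
  imports Defs "HOL-Library.Multiset" "HOL-Library.Nat_Bijection"
begin

text \<open>The morphism \<open>f\<close> is made a quasi-isomorphism by adjoining generators to \<open>A\<close>.  What remains to be
 done at each stage \<open>\<phi>: K \<rightarrow> B\<close> is measured by the cohomology of the mapping cone: a class of degree \<open>n\<close>
 is given by a cocycle \<open>z\<close> of \<open>K\<close> in degree \<open>n + 1\<close> and \<open>b\<close> with \<open>d b = \<phi> z\<close>.  The hypotheses on \<open>H\<^sup>0\<close>,
 \<open>H\<^sup>1\<close> and \<open>H\<^sup>2(f)\<close> say that the cone of \<open>f\<close> is exact in degrees 0 and 1, and a morphism whose cone
 is exact in all degrees is a quasi-isomorphism (\<open>quasi_iso_from_cone\<close>).

 Let the cone be exact below degree \<open>n \<ge> 2\<close>.  Over a principal ideal domain its cohomology in degree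
 \<open>n\<close> is finitely generated (\<open>cone_fin_gen\<close>), so it suffices to kill one class \<open>(z, b)\<close> without
 creating others in degrees up to \<open>n\<close>.  A generator \<open>x\<close> of degree \<open>n\<close> with \<open>d x = z\<close> and image \<open>b\<close>
 kills it.  Let \<open>q\<close> generate the annihilator of the class, say \<open>d w + q z = 0\<close>.  If \<open>q \<noteq> 0\<close>, then
 \<open>q x + w\<close> is a new cocycle, and a second generator \<open>y\<close> of degree \<open>n - 1\<close> with \<open>d y = q x + w\<close> is
 adjoined.  The only danger is a cocycle \<open>a + s y\<close> of degree \<open>n + 1\<close>; but then \<open>q s\<close> is a boundary in
 degree 2, where the cohomology embeds in the free module \<open>H\<^sup>2(B)\<close>, so \<open>s\<close> is a boundary and \<open>s y\<close> can
 be removed (\<open>kill_torsion_class\<close>).  That 2 is invertible makes squares of odd elements vanish, and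
 \<open>2 q\<close> is not zero.  Adjoining a generator preserves finite generation of the cohomology, as one sees
 by filtering by its powers (\<open>fin_gen_cohom_ext\<close>).  So every degree takes finitely many steps
 (\<open>next_level\<close>), and the union over all degrees is the model (\<open>full_model\<close>).

 All stages are realised as \<open>gen_ext\<close>: families of coefficients in \<open>A\<close> indexed by monomials in
 generators numbered by natural numbers, a new generator always being the last.  Then each stage is
 a subset of the next one and the union is literally a union.  That this algebra is \<open>A \<otimes> \<Lambda>V\<close>
 (\<open>to_model_iso\<close>) follows from the presentation by generators and relations, which gives a map to
 the model, and from the fact that sorted words span \<open>\<Lambda>V\<close>, which makes its inverse onto.\<close>

section \<open>Additive maps and finitely supported functions\<close>

abbreviation (input) elem :: "'a => ('a, 'e) partial_object_scheme => bool" (infix ".:" 50) where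
  "x .: S \<equiv> x \<in> carrier S"

lemmas (in abelian_group) ab = abelian_group_axioms

definition additive_map :: "('a, 'e) ring_scheme => ('b, 'f) ring_scheme => ('a => 'b) => bool" where
 "additive_map G H h \<longleftrightarrow> (\<forall>x\<in>carrier G. h x .: H) \<and>
   (\<forall>x\<in>carrier G. \<forall>y\<in>carrier G. h (x \<oplus>\<^bsub>G\<^esub> y) = h x \<oplus>\<^bsub>H\<^esub> h y)"

lemma additiveI:
 assumes "!!x. x .: G ==> h x .: H"
  and "!!x y. x .: G ==> y .: G ==> h (x \<oplus>\<^bsub>G\<^esub> y) = h x \<oplus>\<^bsub>H\<^esub> h y"
 shows "additive_map G H h"
 using assms by (simp add: additive_map_def)

lemma additive_closed: "additive_map G H h ==> x .: G ==> h x .: H"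
 by (simp add: additive_map_def)

lemma additive_add:
 "additive_map G H h ==> x .: G ==> y .: G ==> h (x \<oplus>\<^bsub>G\<^esub> y) = h x \<oplus>\<^bsub>H\<^esub> h y"
 by (simp add: additive_map_def)

lemma additive_zero:
 assumes "abelian_group G" "abelian_group H" "additive_map G H h"
 shows "h \<zero>\<^bsub>G\<^esub> = \<zero>\<^bsub>H\<^esub>"
proof -
 interpret G: abelian_group G by fact
 interpret H: abelian_group H by fact
 have "h \<zero>\<^bsub>G\<^esub> \<oplus>\<^bsub>H\<^esub> h \<zero>\<^bsub>G\<^esub> = h \<zero>\<^bsub>G\<^esub>"
  using additive_add[OF assms(3) G.zero_closed G.zero_closed] by simp
 thus ?thesis
  using additive_closed[OF assms(3) G.zero_closed] by simp
qed

lemma additive_neg: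
 assumes "abelian_group G" "abelian_group H" "additive_map G H h" "x .: G"
 shows "h (\<ominus>\<^bsub>G\<^esub> x) = \<ominus>\<^bsub>H\<^esub> h x"
proof -
 interpret G: abelian_group G by fact
 interpret H: abelian_group H by fact
 have "h (\<ominus>\<^bsub>G\<^esub> x) \<oplus>\<^bsub>H\<^esub> h x = \<zero>\<^bsub>H\<^esub>"
  using additive_add[OF assms(3) G.a_inv_closed[OF assms(4)] assms(4)] additive_zero[OF assms(1-3)]
   assms(4) by (simp add: G.l_neg)
 thus ?thesis
  using H.minus_equality additive_closed[OF assms(3)] assms(4) by (metis G.a_inv_closed)
qed

lemma additive_diff:
 assumes "abelian_group G" "abelian_group H" "additive_map G H h" "x .: G" "y .: G"
 shows "h (x \<ominus>\<^bsub>G\<^esub> y) = h x \<ominus>\<^bsub>H\<^esub> h y"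
 using additive_neg[OF assms(1-3,5)] additive_add[OF assms(3,4)] assms
 by (simp add: a_minus_def abelian_group.a_inv_closed)

lemma additive_ksgn:
 assumes "abelian_group G" "abelian_group H" "additive_map G H h" "x .: G"
 shows "h (ksgn G n x) = ksgn H n (h x)"
 using additive_neg[OF assms] by (simp add: ksgn_def)

lemma additive_finsum:
 assumes "abelian_group G" "abelian_group H" "additive_map G H h" "f \<in> I \<rightarrow> carrier G"
 shows "h (finsum G f I) = finsum H (%i. h (f i)) I"
proof -
 interpret G: abelian_group G by fact
 interpret H: abelian_group H by fact
 show ?thesis
 proof (cases "finite I")
  case False
  thus ?thesis using additive_zero[OF assms(1-3)] by simp
 next
  case True
  thus ?thesis using assms(4)
  proof (induction I)
   case empty
   thus ?case using additive_zero[OF assms(1-3)] by simp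
  next
   case (insert i I)
   hence f: "f \<in> I \<rightarrow> carrier G" "f i .: G" by auto
   hence hf: "(%i. h (f i)) \<in> I \<rightarrow> carrier H" "h (f i) .: H"
    using additive_closed[OF assms(3)] by auto
   have "h (finsum G f (insert i I)) = h (f i \<oplus>\<^bsub>G\<^esub> finsum G f I)"
    using insert f by (simp add: G.finsum_insert)
   also have "\<dots> = h (f i) \<oplus>\<^bsub>H\<^esub> h (finsum G f I)"
    using additive_add[OF assms(3) f(2)] f by (simp add: G.finsum_closed)
   also have "\<dots> = finsum H (%i. h (f i)) (insert i I)"
    using insert f hf by (simp add: H.finsum_insert)
   finally show ?case .
  qed
 qed
qed

lemma additive_comp:
 "additive_map G H h ==> additive_map H L k ==> additive_map G L (%x. k (h x))"
 by (simp add: additive_map_def)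

lemma (in abelian_group) ksgn_closed[simp, intro]: "x .: G ==> ksgn G n x .: G"
 by (simp add: ksgn_def)

lemma (in abelian_group) ksgn_zero[simp]: "ksgn G n \<zero> = \<zero>"
 by (simp add: ksgn_def)

lemma (in abelian_group) ksgn_add:
 "x .: G ==> y .: G ==> ksgn G n (x \<oplus> y) = ksgn G n x \<oplus> ksgn G n y"
 by (simp add: ksgn_def minus_add)

lemma (in abelian_group) ksgn_ksgn:
 "x .: G ==> ksgn G m (ksgn G n x) = ksgn G (m + n) x"
 by (simp add: ksgn_def)

lemma ksgn_cong: "even m = even n ==> ksgn G m x = ksgn G n x"
 by (simp add: ksgn_def)

lemma (in ring) ksgn_mult_left:
 "x .: R ==> y .: R ==> ksgn R n x \<otimes> y = ksgn R n (x \<otimes> y)"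
 by (simp add: ksgn_def l_minus)

lemma (in ring) ksgn_mult_right:
 "x .: R ==> y .: R ==> x \<otimes> ksgn R n y = ksgn R n (x \<otimes> y)"
 by (simp add: ksgn_def r_minus)

lemma (in module) ksgn_smult:
 "r .: R ==> x .: M ==> r \<odot>\<^bsub>M\<^esub> ksgn M n x = ksgn M n (r \<odot>\<^bsub>M\<^esub> x)"
 by (simp add: ksgn_def smult_r_minus)

lemma (in abelian_group) finsum_supp:
 assumes "finite P" "!!i. i \<in> P ==> f i .: G" "Q \<subseteq> P" "!!i. i \<in> P - Q ==> f i = \<zero>"
 shows "finsum G f Q = finsum G f P"
 using assms by (intro add.finprod_mono_neutral_cong_left) auto

lemma (in abelian_group) finsum_single:
 assumes "finite P" "i \<in> P" "f i .: G" "!!j. j \<in> P ==> j ~= i ==> f j = \<zero>"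
 shows "finsum G f P = f i"
proof -
 have "finsum G f {i} = finsum G f P"
  using assms by (intro finsum_supp) (auto, metis zero_closed)
 thus ?thesis using assms(3) by simp
qed

definition fin_funs :: "'m set => ('a, 'e) ring_scheme => ('m => 'a) set" where
 "fin_funs S K = {f. range f \<subseteq> carrier K \<and> finite {m. f m ~= \<zero>\<^bsub>K\<^esub>} \<and> {m. f m ~= \<zero>\<^bsub>K\<^esub>} \<subseteq> S}"

definition fs_single :: "('a, 'e) ring_scheme => 'm => 'a => 'm => 'a" where
 "fs_single K m a = (%m'. if m' = m then a else \<zero>\<^bsub>K\<^esub>)"

text \<open>Several records below have finitely supported functions as their elements and the
 pointwise addition as their sum; what they have in common is stated for all of them.\<close>

definition fun_group :: "('m => 'a, 'f) ring_scheme => 'm set => ('a, 'e) ring_scheme => bool" where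
 "fun_group Q S K \<longleftrightarrow> carrier Q = fin_funs S K \<and> zero Q = (%m. \<zero>\<^bsub>K\<^esub>) \<and>
   add Q = (%f g m. f m \<oplus>\<^bsub>K\<^esub> g m)"

lemma fin_funs_val: "f \<in> fin_funs S K ==> f m .: K"
 by (auto simp: fin_funs_def)

lemma fin_funs_finite: "f \<in> fin_funs S K ==> finite {m. f m ~= \<zero>\<^bsub>K\<^esub>}"
 by (auto simp: fin_funs_def)

lemma fin_funs_supp: "f \<in> fin_funs S K ==> f m ~= \<zero>\<^bsub>K\<^esub> ==> m \<in> S"
 by (auto simp: fin_funs_def)

lemma fin_funs_outside: "f \<in> fin_funs S K ==> m \<notin> S ==> f m = \<zero>\<^bsub>K\<^esub>"
 by (auto simp: fin_funs_def)

lemma fs_single_same[simp]: "fs_single K m a m = a"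
 by (simp add: fs_single_def)

context abelian_group
begin

lemma fs_single_fin_funs: "m \<in> S \<or> a = \<zero> ==> a .: G ==> fs_single G m a \<in> fin_funs S G"
 by (auto simp: fin_funs_def fs_single_def)

lemma fin_funs_add:
 assumes f: "f \<in> fin_funs S G" and g: "g \<in> fin_funs S G"
 shows "(%m. f m \<oplus> g m) \<in> fin_funs S G"
proof -
 have "{m. f m \<oplus> g m ~= \<zero>} \<subseteq> {m. f m ~= \<zero>} \<union> {m. g m ~= \<zero>}" by auto
 hence "finite {m. f m \<oplus> g m ~= \<zero>}"
  using fin_funs_finite[OF f] fin_funs_finite[OF g] by (meson finite_Un finite_subset)
 moreover have "{m. f m \<oplus> g m ~= \<zero>} \<subseteq> S"
 proof
  fix m assume "m \<in> {m. f m \<oplus> g m ~= \<zero>}"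
  hence "f m ~= \<zero> \<or> g m ~= \<zero>" by auto
  thus "m \<in> S" using fin_funs_supp[OF f] fin_funs_supp[OF g] by blast
 qed
 ultimately show ?thesis
  using fin_funs_val[OF f] fin_funs_val[OF g] by (auto simp: fin_funs_def)
qed

lemma fin_funs_zero: "(%m. \<zero>) \<in> fin_funs S G"
 by (auto simp: fin_funs_def)

lemma fin_funs_induct [consumes 1, case_names zero add single]:
 assumes f: "f \<in> fin_funs S G"
  and z: "P (%m. \<zero>)"
  and a: "!!f g. f \<in> fin_funs S G ==> g \<in> fin_funs S G ==> P f ==> P g ==> P (%m. f m \<oplus> g m)"
  and s: "!!m a. m \<in> S ==> a .: G ==> P (fs_single G m a)"
 shows "P f"
 using f
proof (induction "card {m. f m ~= \<zero>}" arbitrary: f)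
 case 0
 hence "{m. f m ~= \<zero>} = {}" using fin_funs_finite[OF \<open>f \<in> fin_funs S G\<close>] by simp
 hence "f = (%m. \<zero>)" by auto
 thus ?case using z by simp
next
 case (Suc n)
 then obtain m where m: "f m ~= \<zero>" by (metis (mono_tags) card_eq_0_iff empty_Collect_eq nat.distinct(1))
 define g where "g = f(m := \<zero>)"
 have sg: "{i. g i ~= \<zero>} = {i. f i ~= \<zero>} - {m}" by (auto simp: g_def)
 have g: "g \<in> fin_funs S G"
  unfolding fin_funs_def mem_Collect_eq sg
  using Suc.prems by (auto simp: g_def fin_funs_def)
 have "card {i. g i ~= \<zero>} = n"
  using Suc.hyps(2) m fin_funs_finite[OF Suc.prems] unfolding sg by simp
 hence Pg: "P g" using Suc.hyps(1) g by simp
 have mS: "m \<in> S" "f m .: G" using Suc.prems m fin_funs_supp fin_funs_val by metis+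
 have "f = (%i. fs_single G m (f m) i \<oplus> g i)"
  using fin_funs_val[OF Suc.prems] by (auto simp: fun_eq_iff g_def fs_single_def)
 moreover have "P (%i. fs_single G m (f m) i \<oplus> g i)"
  using a[OF fs_single_fin_funs g s[OF mS] Pg] mS by simp
 ultimately show ?case by simp
qed

lemma fun_group_abelian_group:
 assumes "fun_group Q S G"
 shows "abelian_group Q"
proof -
 note Q = assms[unfolded fun_group_def]
 show ?thesis
 proof (rule abelian_groupI)
  fix f assume f: "f .: Q"
  hence fv: "f m .: G" for m using Q fin_funs_val by metis
  have "(%m. \<ominus> f m) \<in> fin_funs S G"
   using f Q fv by (auto simp: fin_funs_def)
  moreover have "(%m. \<ominus> f m) \<oplus>\<^bsub>Q\<^esub> f = \<zero>\<^bsub>Q\<^esub>" using fv Q by (auto simp: l_neg)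
  ultimately show "\<exists>y\<in>carrier Q. y \<oplus>\<^bsub>Q\<^esub> f = \<zero>\<^bsub>Q\<^esub>" using Q by metis
 next
  fix x y z assume "x .: Q" "y .: Q" "z .: Q"
  thus "x \<oplus>\<^bsub>Q\<^esub> y \<oplus>\<^bsub>Q\<^esub> z = x \<oplus>\<^bsub>Q\<^esub> (y \<oplus>\<^bsub>Q\<^esub> z)"
   using Q fin_funs_val[of _ S G] by (auto simp: a_assoc)
 next
  fix x y assume "x .: Q" "y .: Q"
  thus "x \<oplus>\<^bsub>Q\<^esub> y = y \<oplus>\<^bsub>Q\<^esub> x"
   using Q fin_funs_val[of _ S G] by (auto simp: a_comm)
 next
  fix x assume "x .: Q"
  thus "\<zero>\<^bsub>Q\<^esub> \<oplus>\<^bsub>Q\<^esub> x = x"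
   using Q fin_funs_val[of _ S G] by (auto simp: fun_eq_iff)
 qed (use Q fin_funs_add fin_funs_zero in auto)
qed

lemma fun_group_minus:
 assumes "fun_group Q S G" "f .: Q"
 shows "(\<ominus>\<^bsub>Q\<^esub> f) m = \<ominus> f m"
proof -
 note Q = assms(1)[unfolded fun_group_def]
 interpret Q: abelian_group Q using fun_group_abelian_group[OF assms(1)] .
 have "((\<ominus>\<^bsub>Q\<^esub> f) \<oplus>\<^bsub>Q\<^esub> f) m = \<zero>" using Q.l_neg[OF assms(2)] Q by simp
 moreover have "(\<ominus>\<^bsub>Q\<^esub> f) m .: G" "f m .: G"
  using Q.a_inv_closed[OF assms(2)] assms(2) Q fin_funs_val by metis+
 ultimately show ?thesis using Q minus_equality by simp
qed

lemma fun_group_eval: "fun_group Q S G ==> additive_map Q G (%f. f m)"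
 by (auto simp: additive_map_def fun_group_def fin_funs_val)

lemma fun_group_finsum:
 assumes "fun_group Q S G" "F \<in> I \<rightarrow> carrier Q"
 shows "finsum Q F I m = finsum G (%i. F i m) I"
 using additive_finsum[OF fun_group_abelian_group[OF assms(1)] ab
   fun_group_eval[OF assms(1)] assms(2)] .

end

text \<open>On finitely supported functions, the additive map that is \<open>h m\<close> on the functions concentrated at \<open>m\<close>.\<close>

definition lin_ext :: "('a, 'e) ring_scheme => ('g, 'f) ring_scheme => ('m => 'a => 'g) => ('m => 'a) => 'g" where
 "lin_ext K G h f = finsum G (%m. h m (f m)) {m. f m ~= \<zero>\<^bsub>K\<^esub>}"

lemma lin_ext_finite:
 assumes "abelian_group K" "abelian_group G" "!!m. m \<in> S ==> additive_map K G (h m)"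
  and "f \<in> fin_funs S K" "finite P" "P \<subseteq> S" "{m. f m ~= \<zero>\<^bsub>K\<^esub>} \<subseteq> P"
 shows "lin_ext K G h f = finsum G (%m. h m (f m)) P"
proof -
 interpret G: abelian_group G by fact
 have "!!m. m \<in> P ==> h m (f m) .: G"
  using assms(3,6) fin_funs_val[OF assms(4)] additive_closed by fastforce
 moreover have "!!m. m \<in> P ==> f m = \<zero>\<^bsub>K\<^esub> ==> h m (f m) = \<zero>\<^bsub>G\<^esub>"
  using assms(3,6) additive_zero[OF assms(1,2)] by (metis in_mono)
 ultimately show ?thesis
  unfolding lin_ext_def using assms by (intro G.finsum_supp) auto
qed

lemma lin_ext_additive:
 assumes "abelian_group K" "abelian_group G" "!!m. m \<in> S ==> additive_map K G (h m)" "fun_group Q S K"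
 shows "additive_map Q G (lin_ext K G h)"
proof -
 interpret K: abelian_group K by fact
 interpret G: abelian_group G by fact
 note Q = assms(4)[unfolded fun_group_def]
 have cl: "m \<in> S ==> f \<in> fin_funs S K ==> h m (f m) .: G" for m f
  using assms(3) fin_funs_val additive_closed by metis
 show ?thesis
 proof (rule additiveI)
  fix f assume "f .: Q"
  thus "lin_ext K G h f .: G"
   unfolding lin_ext_def using Q cl by (intro G.finsum_closed Pi_I) (simp add: fin_funs_supp)
 next
  fix f g assume "f .: Q" "g .: Q"
  hence f: "f \<in> fin_funs S K" and g: "g \<in> fin_funs S K" using Q by auto
  define P where "P = {m. f m ~= \<zero>\<^bsub>K\<^esub>} \<union> {m. g m ~= \<zero>\<^bsub>K\<^esub>}"
  have P: "finite P" "P \<subseteq> S"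
   unfolding P_def using fin_funs_finite[OF f] fin_funs_finite[OF g] fin_funs_supp[OF f] fin_funs_supp[OF g]
   by auto
  have fg: "f \<oplus>\<^bsub>Q\<^esub> g \<in> fin_funs S K" using Q K.fin_funs_add[OF f g] by simp
  have sub: "{m. (f \<oplus>\<^bsub>Q\<^esub> g) m ~= \<zero>\<^bsub>K\<^esub>} \<subseteq> P" using Q by (auto simp: P_def)
  note lf = lin_ext_finite[OF assms(1-3), of S]
  have "lin_ext K G h (f \<oplus>\<^bsub>Q\<^esub> g) = finsum G (%m. h m ((f \<oplus>\<^bsub>Q\<^esub> g) m)) P"
   using assms(1-3) fg P sub by (intro lin_ext_finite) auto
  also have "\<dots> = finsum G (%m. h m (f m) \<oplus>\<^bsub>G\<^esub> h m (g m)) P"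
  proof (rule G.finsum_cong')
   fix m assume "m \<in> P"
   thus "h m ((f \<oplus>\<^bsub>Q\<^esub> g) m) = h m (f m) \<oplus>\<^bsub>G\<^esub> h m (g m)"
    using Q P additive_add[OF assms(3)] fin_funs_val[OF f] fin_funs_val[OF g] by auto
  qed (use P cl f g in auto)
  also have "\<dots> = finsum G (%m. h m (f m)) P \<oplus>\<^bsub>G\<^esub> finsum G (%m. h m (g m)) P"
   using P cl f g by (intro G.finsum_addf) auto
  also have "finsum G (%m. h m (f m)) P = lin_ext K G h f"
   using assms(1-3) f P by (intro lin_ext_finite[symmetric]) (auto simp: P_def)
  also have "finsum G (%m. h m (g m)) P = lin_ext K G h g"
   using assms(1-3) g P by (intro lin_ext_finite[symmetric]) (auto simp: P_def)
  finally show "lin_ext K G h (f \<oplus>\<^bsub>Q\<^esub> g) = lin_ext K G h f \<oplus>\<^bsub>G\<^esub> lin_ext K G h g" .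
 qed
qed

lemma lin_ext_single:
 assumes "abelian_group K" "abelian_group G" "additive_map K G (h m)" "a .: K"
 shows "lin_ext K G h (fs_single K m a) = h m a"
proof -
 interpret K: abelian_group K by fact
 interpret G: abelian_group G by fact
 have "lin_ext K G h (fs_single K m a) = finsum G (%i. h i (fs_single K m a i)) {m}"
  using assms by (intro lin_ext_finite[where S = "{m}"]) (auto simp: K.fs_single_fin_funs, simp add: fs_single_def split: if_splits)
 thus ?thesis using additive_closed[OF assms(3,4)] by simp
qed

section \<open>Twisted convolution algebras\<close>

definition conv :: "('a, 'e) ring_scheme => ('m => 'm => 'm) => ('m => 'm => 'a => 'a => 'a) =>
  ('m => 'a) => ('m => 'a) => 'm => 'a" where
 "conv K op \<beta> f g = (%m. finsum K (%(u, v). \<beta> u v (f u) (g v))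
        {(u, v). f u ~= \<zero>\<^bsub>K\<^esub> \<and> g v ~= \<zero>\<^bsub>K\<^esub> \<and> op u v = m})"

text \<open>The index set \<open>S\<close> need not be closed under the operation, provided that the twist
 \<open>\<beta>\<close> vanishes where the product of two indices leaves \<open>S\<close>: this is how squares of
 odd generators are made zero.\<close>

locale twisted_conv = K?: abelian_group K for K (structure) +
 fixes S :: "'m set" and opr :: "'m => 'm => 'm" and \<beta> and Q :: "('m => 'a, 'f) ring_scheme"
 assumes Q_group: "fun_group Q S K" and Q_mult: "mult Q = conv K opr \<beta>"
  and beta_closed: "\<lbrakk>u \<in> S; v \<in> S; a .: K; b .: K\<rbrakk> \<Longrightarrow> \<beta> u v a b .: K"
  and beta_add_left: "\<lbrakk>u \<in> S; v \<in> S; a .: K; a' .: K; b .: K\<rbrakk> \<Longrightarrow>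
    \<beta> u v (a \<oplus> a') b = \<beta> u v a b \<oplus> \<beta> u v a' b"
  and beta_add_right: "\<lbrakk>u \<in> S; v \<in> S; a .: K; b .: K; b' .: K\<rbrakk> \<Longrightarrow>
    \<beta> u v a (b \<oplus> b') = \<beta> u v a b \<oplus> \<beta> u v a b'"
  and opr_closed: "\<lbrakk>u \<in> S; v \<in> S; opr u v \<notin> S; a .: K; b .: K\<rbrakk> \<Longrightarrow> \<beta> u v a b = \<zero>"
begin

interpretation Q: abelian_group Q using fun_group_abelian_group[OF Q_group] .

lemmas Q_simps = Q_group[unfolded fun_group_def]

lemma beta_zero_left: "\<lbrakk>u \<in> S; v \<in> S; b .: K\<rbrakk> \<Longrightarrow> \<beta> u v \<zero> b = \<zero>"
 by (rule additive_zero[of K K "%a. \<beta> u v a b"])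
  (auto simp: additive_map_def beta_closed beta_add_left ab)

lemma beta_zero_right: "\<lbrakk>u \<in> S; v \<in> S; a .: K\<rbrakk> \<Longrightarrow> \<beta> u v a \<zero> = \<zero>"
 by (rule additive_zero[of K K "%b. \<beta> u v a b"])
  (auto simp: additive_map_def beta_closed beta_add_right ab)

lemma conv_finite:
 assumes f: "f \<in> fin_funs S K" and g: "g \<in> fin_funs S K" and P: "finite P" "P \<subseteq> S" "{m. f m ~= \<zero>} \<subseteq> P"
  and P': "finite P'" "P' \<subseteq> S" "{m. g m ~= \<zero>} \<subseteq> P'"
 shows "conv K opr \<beta> f g m = finsum K (%(u, v). if opr u v = m then \<beta> u v (f u) (g v) else \<zero>) (P \<times> P')"
proof -
 have "conv K opr \<beta> f g m = finsum K (%(u, v). if opr u v = m then \<beta> u v (f u) (g v) else \<zero>)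
   {(u, v). f u ~= \<zero> \<and> g v ~= \<zero> \<and> opr u v = m}"
  unfolding conv_def using P P' fin_funs_val[OF f] fin_funs_val[OF g] fin_funs_supp[OF f] fin_funs_supp[OF g]
  by (intro finsum_cong') (auto intro!: beta_closed)
 also have "\<dots> = finsum K (%(u, v). if opr u v = m then \<beta> u v (f u) (g v) else \<zero>) (P \<times> P')"
 proof (rule finsum_supp)
  fix p assume "p \<in> P \<times> P' - {(u, v). f u ~= \<zero> \<and> g v ~= \<zero> \<and> opr u v = m}"
  thus "(case p of (u, v) => if opr u v = m then \<beta> u v (f u) (g v) else \<zero>) = \<zero>"
   using P P' fin_funs_val[OF f] fin_funs_val[OF g]
   by (cases p) (auto simp: subset_eq beta_zero_left beta_zero_right)
 next
  fix p assume "p \<in> P \<times> P'"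
  thus "(case p of (u, v) => if opr u v = m then \<beta> u v (f u) (g v) else \<zero>) .: K"
   using P P' fin_funs_val[OF f] fin_funs_val[OF g] by (auto intro!: beta_closed)
 qed (use P P' in auto)
 finally show ?thesis .
qed

lemma conv_add_left:
 assumes f: "f \<in> fin_funs S K" and f': "f' \<in> fin_funs S K" and g: "g \<in> fin_funs S K"
 shows "conv K opr \<beta> (%m. f m \<oplus> f' m) g = (%m. conv K opr \<beta> f g m \<oplus> conv K opr \<beta> f' g m)"
proof
 fix m
 define P where "P = {m. f m ~= \<zero>} \<union> {m. f' m ~= \<zero>}"
 define P' where "P' = {m. g m ~= \<zero>}"
 have P: "finite P" "P \<subseteq> S"
  unfolding P_def using fin_funs_finite[OF f] fin_funs_finite[OF f'] fin_funs_supp[OF f] fin_funs_supp[OF f'] by auto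
 have P': "finite P'" "P' \<subseteq> S"
  unfolding P'_def using fin_funs_finite[OF g] fin_funs_supp[OF g] by auto
 have "{m. f m \<oplus> f' m ~= \<zero>} \<subseteq> P" by (auto simp: P_def)
 note e = conv_finite[OF _ g P(1,2) _ P'(1,2), folded P'_def, OF _ _ subset_refl]
 note vals = fin_funs_val[OF f] fin_funs_val[OF f'] fin_funs_val[OF g]
 have "conv K opr \<beta> (%m. f m \<oplus> f' m) g m =
   finsum K (%(u, v). if opr u v = m then \<beta> u v (f u \<oplus> f' u) (g v) else \<zero>) (P \<times> P')"
  by (rule e) (use fin_funs_add[OF f f'] in \<open>auto simp: P_def\<close>)
 also have "\<dots> = finsum K (%p. (case p of (u, v) => if opr u v = m then \<beta> u v (f u) (g v) else \<zero>) \<oplus>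
   (case p of (u, v) => if opr u v = m then \<beta> u v (f' u) (g v) else \<zero>)) (P \<times> P')"
  using P P' vals by (intro finsum_cong') (auto simp: beta_add_left subset_eq intro!: beta_closed a_closed)
 also have "\<dots> = finsum K (%(u, v). if opr u v = m then \<beta> u v (f u) (g v) else \<zero>) (P \<times> P') \<oplus>
   finsum K (%(u, v). if opr u v = m then \<beta> u v (f' u) (g v) else \<zero>) (P \<times> P')"
  using P P' vals by (intro finsum_addf) (auto intro!: beta_closed)
 also have "finsum K (%(u, v). if opr u v = m then \<beta> u v (f u) (g v) else \<zero>) (P \<times> P') = conv K opr \<beta> f g m"
  by (rule e[symmetric]) (use f in \<open>auto simp: P_def\<close>)
 also have "finsum K (%(u, v). if opr u v = m then \<beta> u v (f' u) (g v) else \<zero>) (P \<times> P') = conv K opr \<beta> f' g m"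
  by (rule e[symmetric]) (use f' in \<open>auto simp: P_def\<close>)
 finally show "conv K opr \<beta> (%m. f m \<oplus> f' m) g m = conv K opr \<beta> f g m \<oplus> conv K opr \<beta> f' g m" .
qed

lemma conv_add_right:
 assumes f: "f \<in> fin_funs S K" and g: "g \<in> fin_funs S K" and g': "g' \<in> fin_funs S K"
 shows "conv K opr \<beta> f (%m. g m \<oplus> g' m) = (%m. conv K opr \<beta> f g m \<oplus> conv K opr \<beta> f g' m)"
proof
 fix m
 define P where "P = {m. f m ~= \<zero>}"
 define P' where "P' = {m. g m ~= \<zero>} \<union> {m. g' m ~= \<zero>}"
 have P': "finite P'" "P' \<subseteq> S"
  unfolding P'_def using fin_funs_finite[OF g] fin_funs_finite[OF g'] fin_funs_supp[OF g] fin_funs_supp[OF g'] by auto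
 have P: "finite P" "P \<subseteq> S"
  unfolding P_def using fin_funs_finite[OF f] fin_funs_supp[OF f] by auto
 note e = conv_finite[OF f _ P(1,2) _ P'(1,2), folded P_def, OF _ subset_refl]
 note vals = fin_funs_val[OF f] fin_funs_val[OF g'] fin_funs_val[OF g]
 have "conv K opr \<beta> f (%m. g m \<oplus> g' m) m =
   finsum K (%(u, v). if opr u v = m then \<beta> u v (f u) (g v \<oplus> g' v) else \<zero>) (P \<times> P')"
  by (rule e) (use fin_funs_add[OF g g'] in \<open>auto simp: P'_def\<close>)
 also have "\<dots> = finsum K (%p. (case p of (u, v) => if opr u v = m then \<beta> u v (f u) (g v) else \<zero>) \<oplus>
   (case p of (u, v) => if opr u v = m then \<beta> u v (f u) (g' v) else \<zero>)) (P \<times> P')"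
  using P P' vals by (intro finsum_cong') (auto simp: beta_add_right subset_eq intro!: beta_closed a_closed)
 also have "\<dots> = finsum K (%(u, v). if opr u v = m then \<beta> u v (f u) (g v) else \<zero>) (P \<times> P') \<oplus>
   finsum K (%(u, v). if opr u v = m then \<beta> u v (f u) (g' v) else \<zero>) (P \<times> P')"
  using P P' vals by (intro finsum_addf) (auto intro!: beta_closed)
 also have "finsum K (%(u, v). if opr u v = m then \<beta> u v (f u) (g v) else \<zero>) (P \<times> P') = conv K opr \<beta> f g m"
  by (rule e[symmetric]) (use g in \<open>auto simp: P'_def\<close>)
 also have "finsum K (%(u, v). if opr u v = m then \<beta> u v (f u) (g' v) else \<zero>) (P \<times> P') = conv K opr \<beta> f g' m"
  by (rule e[symmetric]) (use g' in \<open>auto simp: P'_def\<close>)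
 finally show "conv K opr \<beta> f (%m. g m \<oplus> g' m) m = conv K opr \<beta> f g m \<oplus> conv K opr \<beta> f g' m" .
qed

lemma conv_single:
 assumes "u \<in> S" "v \<in> S" "a .: K" "b .: K"
 shows "conv K opr \<beta> (fs_single K u a) (fs_single K v b) = fs_single K (opr u v) (\<beta> u v a b)"
proof
 fix m
 have "conv K opr \<beta> (fs_single K u a) (fs_single K v b) m =
   finsum K (%(u', v'). if opr u' v' = m then \<beta> u' v' (fs_single K u a u') (fs_single K v b v') else \<zero>) ({u} \<times> {v})"
  using assms by (intro conv_finite fs_single_fin_funs) (auto simp: fs_single_def)
 thus "conv K opr \<beta> (fs_single K u a) (fs_single K v b) m = fs_single K (opr u v) (\<beta> u v a b) m"
  using assms beta_closed by (auto simp: fs_single_def)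
qed

lemma conv_closed:
 assumes "f \<in> fin_funs S K" "g \<in> fin_funs S K"
 shows "conv K opr \<beta> f g \<in> fin_funs S K"
 using assms(1)
proof (induction rule: fin_funs_induct)
 case zero
 show ?case by (simp add: conv_def fin_funs_zero)
next
 case (add f f')
 thus ?case using conv_add_left assms(2) fin_funs_add by simp
next
 case (single u a)
 note u = this
 show ?case using assms(2)
 proof (induction rule: fin_funs_induct)
  case zero
  show ?case by (simp add: conv_def fin_funs_zero)
 next
  case (add g g')
  thus ?case using conv_add_right[OF fs_single_fin_funs[of u S a] add(1,2)] fin_funs_add u by simp
 next
  case (single v b)
  hence "opr u v \<in> S \<or> \<beta> u v a b = \<zero>" using u opr_closed by blast
  thus ?case using u single by (simp add: conv_single beta_closed fs_single_fin_funs)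
 qed
qed

lemma Q_additive_left: "g .: Q ==> additive_map Q Q (%f. f \<otimes>\<^bsub>Q\<^esub> g)"
 by (rule additiveI) (auto simp: Q_simps Q_mult conv_closed conv_add_left)

lemma Q_additive_right: "f .: Q ==> additive_map Q Q (%g. f \<otimes>\<^bsub>Q\<^esub> g)"
 by (rule additiveI) (auto simp: Q_simps Q_mult conv_closed conv_add_right)

lemma Q_single_mult:
 assumes "u \<in> S" "v \<in> S" "a .: K" "b .: K"
 shows "fs_single K u a \<otimes>\<^bsub>Q\<^esub> fs_single K v b = fs_single K (opr u v) (\<beta> u v a b)"
 using assms by (simp add: Q_mult conv_single)

lemma Q_induct [consumes 1, case_names zero add single]:
 assumes "f .: Q" "P \<zero>\<^bsub>Q\<^esub>"
  and "!!f g. f .: Q ==> g .: Q ==> P f ==> P g ==> P (f \<oplus>\<^bsub>Q\<^esub> g)"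
  and "!!m a. m \<in> S ==> a .: K ==> P (fs_single K m a)"
 shows "P f"
 by (rule fin_funs_induct[of f S]) (use assms Q_simps in auto)

lemma additive_eq_on:
 assumes "abelian_group G" "additive_map Q G h" "additive_map Q G k"
  and "!!m a. m \<in> S ==> a .: K ==> h (fs_single K m a) = k (fs_single K m a)"
  and "f .: Q"
 shows "h f = k f"
 using assms(5)
proof (induction rule: Q_induct)
 case zero
 thus ?case using additive_zero[OF Q.ab assms(1,2)]
   additive_zero[OF Q.ab assms(1,3)] by simp
next
 case (add f g)
 thus ?case using additive_add[OF assms(2)] additive_add[OF assms(3)] by simp
qed (use assms(4) in auto)

lemma fs_single_zero: "fs_single K u \<zero> = \<zero>\<^bsub>Q\<^esub>"
 by (simp add: Q_simps fs_single_def)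

theorem ring_conv:
 assumes assoc: "!!u v w. u \<in> S ==> v \<in> S ==> w \<in> S ==> opr (opr u v) w = opr u (opr v w)"
  and beta_assoc: "!!u v w a b c. \<lbrakk>u \<in> S; v \<in> S; w \<in> S; opr u v \<in> S; opr v w \<in> S; a .: K; b .: K; c .: K\<rbrakk> \<Longrightarrow>
    \<beta> (opr u v) w (\<beta> u v a b) c = \<beta> u (opr v w) a (\<beta> v w b c)"
  and beta_assoc_null1: "!!u v w a b c. \<lbrakk>u \<in> S; v \<in> S; w \<in> S; opr u v \<notin> S; opr v w \<in> S; a .: K; b .: K; c .: K\<rbrakk> \<Longrightarrow>
    \<beta> u (opr v w) a (\<beta> v w b c) = \<zero>"
  and beta_assoc_null2: "!!u v w a b c. \<lbrakk>u \<in> S; v \<in> S; w \<in> S; opr u v \<in> S; opr v w \<notin> S; a .: K; b .: K; c .: K\<rbrakk> \<Longrightarrow>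
    \<beta> (opr u v) w (\<beta> u v a b) c = \<zero>"
  and unit: "e \<in> S" "k1 .: K" "one Q = fs_single K e k1"
   "!!u. u \<in> S ==> opr e u = u" "!!u. u \<in> S ==> opr u e = u"
   "!!u a. u \<in> S ==> a .: K ==> \<beta> e u k1 a = a"
   "!!u a. u \<in> S ==> a .: K ==> \<beta> u e a k1 = a"
 shows "ring Q"
proof -
 note mcl = additive_closed[OF Q_additive_left]
 have sc: "m \<in> S ==> a .: K ==> fs_single K m a .: Q" for m a
  by (simp add: Q_simps fs_single_fin_funs)
 have one: "one Q .: Q" using unit sc by simp
 have zl: "g .: Q ==> \<zero>\<^bsub>Q\<^esub> \<otimes>\<^bsub>Q\<^esub> g = \<zero>\<^bsub>Q\<^esub>" for g
  using additive_zero[OF Q.ab Q.ab Q_additive_left] by simp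
 have zr: "g .: Q ==> g \<otimes>\<^bsub>Q\<^esub> \<zero>\<^bsub>Q\<^esub> = \<zero>\<^bsub>Q\<^esub>" for g
  using additive_zero[OF Q.ab Q.ab Q_additive_right] by simp
 have base: "fs_single K u a \<otimes>\<^bsub>Q\<^esub> fs_single K v b \<otimes>\<^bsub>Q\<^esub> fs_single K w c
   = fs_single K u a \<otimes>\<^bsub>Q\<^esub> (fs_single K v b \<otimes>\<^bsub>Q\<^esub> fs_single K w c)"
  if h: "u \<in> S" "v \<in> S" "w \<in> S" "a .: K" "b .: K" "c .: K" for u v w a b c
 proof -
  have bc: "\<beta> u v a b .: K" "\<beta> v w b c .: K" using h beta_closed by auto
  have z: "fs_single K u x \<otimes>\<^bsub>Q\<^esub> \<zero>\<^bsub>Q\<^esub> = \<zero>\<^bsub>Q\<^esub>" "\<zero>\<^bsub>Q\<^esub> \<otimes>\<^bsub>Q\<^esub> fs_single K u x = \<zero>\<^bsub>Q\<^esub>" if "u \<in> S" "x .: K" for u x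
   using zl zr sc that by auto
  consider "opr u v \<in> S" "opr v w \<in> S" | "opr u v \<notin> S" "opr v w \<in> S" | "opr u v \<in> S" "opr v w \<notin> S"
   | "opr u v \<notin> S" "opr v w \<notin> S" by blast
  thus ?thesis
  proof cases
   case 1
   thus ?thesis using h bc beta_assoc assoc by (simp add: Q_single_mult)
  next
   case 2
   thus ?thesis using h bc beta_assoc_null1 opr_closed z
    by (simp add: Q_single_mult fs_single_zero)
  next
   case 3
   thus ?thesis using h bc beta_assoc_null2 opr_closed z
    by (simp add: Q_single_mult fs_single_zero)
  next
   case 4
   thus ?thesis using h bc opr_closed z
    by (simp add: Q_single_mult fs_single_zero)
  qed
 qed
 have assoc1: "fs_single K u a \<otimes>\<^bsub>Q\<^esub> fs_single K v b \<otimes>\<^bsub>Q\<^esub> h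
   = fs_single K u a \<otimes>\<^bsub>Q\<^esub> (fs_single K v b \<otimes>\<^bsub>Q\<^esub> h)"
  if "u \<in> S" "v \<in> S" "a .: K" "b .: K" "h .: Q" for u v a b h
  by (rule additive_eq_on[OF Q.ab, of _ _ h])
   (use that base sc mcl in \<open>auto intro: Q_additive_right additive_comp[OF Q_additive_right Q_additive_right]\<close>)
 have assoc2: "fs_single K u a \<otimes>\<^bsub>Q\<^esub> g \<otimes>\<^bsub>Q\<^esub> h = fs_single K u a \<otimes>\<^bsub>Q\<^esub> (g \<otimes>\<^bsub>Q\<^esub> h)"
  if "u \<in> S" "a .: K" "g .: Q" "h .: Q" for u a g h
  by (rule additive_eq_on[OF Q.ab, of "%g. fs_single K u a \<otimes>\<^bsub>Q\<^esub> g \<otimes>\<^bsub>Q\<^esub> h" "%g. fs_single K u a \<otimes>\<^bsub>Q\<^esub> (g \<otimes>\<^bsub>Q\<^esub> h)" g])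
   (use that assoc1 sc mcl in \<open>auto intro: additive_comp[OF Q_additive_left Q_additive_right] additive_comp[OF Q_additive_right Q_additive_left]\<close>)
 have assoc3: "f \<otimes>\<^bsub>Q\<^esub> g \<otimes>\<^bsub>Q\<^esub> h = f \<otimes>\<^bsub>Q\<^esub> (g \<otimes>\<^bsub>Q\<^esub> h)"
  if "f .: Q" "g .: Q" "h .: Q" for f g h
  by (rule additive_eq_on[OF Q.ab, of "%f. f \<otimes>\<^bsub>Q\<^esub> g \<otimes>\<^bsub>Q\<^esub> h" "%f. f \<otimes>\<^bsub>Q\<^esub> (g \<otimes>\<^bsub>Q\<^esub> h)" f])
   (use that assoc2 sc mcl in \<open>auto intro: Q_additive_left additive_comp[OF Q_additive_left Q_additive_left]\<close>)
 have ident: "additive_map Q Q (%x. x)" by (simp add: additive_map_def)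
 have one_l: "one Q \<otimes>\<^bsub>Q\<^esub> f = f" if "f .: Q" for f
  by (rule additive_eq_on[OF Q.ab, of _ _ f])
   (use that unit one ident Q_single_mult in \<open>auto intro: Q_additive_right\<close>)
 have one_r: "f \<otimes>\<^bsub>Q\<^esub> one Q = f" if "f .: Q" for f
  by (rule additive_eq_on[OF Q.ab, of "%f. f \<otimes>\<^bsub>Q\<^esub> one Q" _ f])
   (use that unit one ident Q_single_mult Q_additive_left[OF one] in auto)
 have "monoid Q"
  by (rule monoidI) (use mcl one assoc3 one_l one_r in auto)
 thus "ring Q"
  using additive_add[OF Q_additive_left] additive_add[OF Q_additive_right]
  by (intro ringI Q.ab) auto
qed

end

section \<open>Homogeneous components\<close>

context graded_module
begin

lemma grade_carrier: "x \<in> grade M n ==> x .: M"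
 using grade_submodule submoduleE(1) by blast

lemma grade_zero[simp, intro]: "\<zero>\<^bsub>M\<^esub> \<in> grade M n"
 using subgroup.one_closed[OF submodule.axioms(1)[OF grade_submodule]] by simp

lemma grade_add[intro]: "x \<in> grade M n ==> y \<in> grade M n ==> x \<oplus>\<^bsub>M\<^esub> y \<in> grade M n"
 using submoduleE(5)[OF grade_submodule] by blast

lemma grade_smult[intro]: "r .: R ==> x \<in> grade M n ==> r \<odot>\<^bsub>M\<^esub> x \<in> grade M n"
 using submoduleE(4)[OF grade_submodule] by blast

lemma grade_neg[intro]: "x \<in> grade M n ==> \<ominus>\<^bsub>M\<^esub> x \<in> grade M n"
 using submoduleE(3)[OF grade_submodule] by blast

lemma grade_diff[intro]: "x \<in> grade M n ==> y \<in> grade M n ==> x \<ominus>\<^bsub>M\<^esub> y \<in> grade M n"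
 by (simp add: a_minus_def grade_add grade_neg)

lemma grade_ksgn[intro]: "x \<in> grade M n ==> ksgn M i x \<in> grade M n"
 by (simp add: ksgn_def grade_neg)

lemma grade_finsum: "(!!i. i \<in> I ==> f i \<in> grade M n) ==> finsum M f I \<in> grade M n"
proof (induction I rule: infinite_finite_induct)
 case (insert i I)
 thus ?case
  by (subst M.finsum_insert) (auto intro: grade_carrier)
qed auto

lemma hcomp_decomp: "x .: M ==> is_decomp M x (hcomp M x)"
 unfolding hcomp_def using direct_sum by (rule theI')

lemma hcomp_eqI: "x .: M ==> is_decomp M x c ==> hcomp M x = c"
 using hcomp_decomp direct_sum by blast

lemma hcomp_grade: "x .: M ==> hcomp M x n \<in> grade M n"
 using hcomp_decomp by (simp add: is_decomp_def)

lemma hcomp_carrier: "x .: M ==> hcomp M x n .: M"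
 using hcomp_grade grade_carrier by blast

lemma hcomp_finite: "x .: M ==> finite {n. hcomp M x n ~= \<zero>\<^bsub>M\<^esub>}"
 using hcomp_decomp by (simp add: is_decomp_def)

lemma hcomp_sum: "x .: M ==> finsum M (hcomp M x) {n. hcomp M x n ~= \<zero>\<^bsub>M\<^esub>} = x"
 using hcomp_decomp by (simp add: is_decomp_def)

lemma hcomp_homogeneous:
 assumes "x \<in> grade M n"
 shows "hcomp M x = (%i. if i = n then x else \<zero>\<^bsub>M\<^esub>)"
proof (rule hcomp_eqI)
 let ?c = "%i. if i = n then x else \<zero>\<^bsub>M\<^esub>"
 have "finsum M ?c {i. ?c i ~= \<zero>\<^bsub>M\<^esub>} = finsum M ?c {n}"
  using assms grade_carrier by (intro M.finsum_supp) auto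
 thus "is_decomp M x ?c"
  using assms grade_carrier by (auto simp: is_decomp_def)
qed (use assms grade_carrier in auto)

lemma hcomp_add:
 assumes x: "x .: M" and y: "y .: M"
 shows "hcomp M (x \<oplus>\<^bsub>M\<^esub> y) = (%i. hcomp M x i \<oplus>\<^bsub>M\<^esub> hcomp M y i)"
proof (rule hcomp_eqI)
 let ?P = "{i. hcomp M x i ~= \<zero>\<^bsub>M\<^esub>} \<union> {i. hcomp M y i ~= \<zero>\<^bsub>M\<^esub>}"
 let ?c = "%i. hcomp M x i \<oplus>\<^bsub>M\<^esub> hcomp M y i"
 have fin: "finite ?P" using x y hcomp_finite by auto
 have sub: "{i. ?c i ~= \<zero>\<^bsub>M\<^esub>} \<subseteq> ?P" by auto
 have "finsum M ?c {i. ?c i ~= \<zero>\<^bsub>M\<^esub>} = finsum M ?c ?P"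
  using fin sub hcomp_carrier x y by (intro M.finsum_supp) auto
 also have "\<dots> = finsum M (hcomp M x) ?P \<oplus>\<^bsub>M\<^esub> finsum M (hcomp M y) ?P"
  using hcomp_carrier x y by (intro M.finsum_addf) auto
 also have "finsum M (hcomp M x) ?P = finsum M (hcomp M x) {i. hcomp M x i ~= \<zero>\<^bsub>M\<^esub>}"
  using fin hcomp_carrier x by (intro M.finsum_supp[symmetric]) auto
 also have "finsum M (hcomp M y) ?P = finsum M (hcomp M y) {i. hcomp M y i ~= \<zero>\<^bsub>M\<^esub>}"
  using fin hcomp_carrier y by (intro M.finsum_supp[symmetric]) auto
 finally show "is_decomp M (x \<oplus>\<^bsub>M\<^esub> y) ?c"
  using x y hcomp_sum hcomp_grade fin sub by (auto simp: is_decomp_def finite_subset)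
qed (use assms in auto)

lemma hcomp_zero: "hcomp M \<zero>\<^bsub>M\<^esub> = (%i. \<zero>\<^bsub>M\<^esub>)"
 using hcomp_homogeneous[OF grade_zero] by auto

lemma graded_induct [consumes 1, case_names homogeneous add]:
 assumes x: "x .: M"
  and h: "!!n x. x \<in> grade M n ==> P x"
  and a: "!!x y. x .: M ==> y .: M ==> P x ==> P y ==> P (x \<oplus>\<^bsub>M\<^esub> y)"
 shows "P x"
proof -
 have "P (finsum M (hcomp M x) I)" if "finite I" for I
  using that
 proof (induction I)
  case empty
  thus ?case using h[OF grade_zero] by simp
 next
  case (insert i I)
  thus ?case using x hcomp_carrier h[OF hcomp_grade] by (subst M.finsum_insert) (auto intro: a)
 qed
 thus ?thesis using hcomp_sum hcomp_finite x by metis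
qed

lemma additive_eq_on_homogeneous:
 assumes "abelian_group G" "additive_map M G h" "additive_map M G k"
  and "!!n x. x \<in> grade M n ==> h x = k x" and "x .: M"
 shows "h x = k x"
 using assms(5)
 by (induction x rule: graded_induct) (use assms additive_add[OF assms(2)] additive_add[OF assms(3)] in auto)

end

text \<open>The additive map that is \<open>h p\<close> on the elements of degree \<open>p\<close>.\<close>

definition graded_ext :: "('r, 'm, 'f) gmod_scheme => ('g, 'e) ring_scheme => (nat => 'm => 'g) => 'm => 'g" where
 "graded_ext M G h x = finsum G (%p. h p (hcomp M x p)) {p. hcomp M x p ~= \<zero>\<^bsub>M\<^esub>}"

context graded_module
begin

context
 fixes G :: "('g, 'e1) ring_scheme" and h :: "nat => 'm => 'g"
 assumes G: "abelian_group G"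
  and hc: "!!p x. x \<in> grade M p ==> h p x .: G"
  and ha: "!!p x y. x \<in> grade M p ==> y \<in> grade M p ==> h p (x \<oplus>\<^bsub>M\<^esub> y) = h p x \<oplus>\<^bsub>G\<^esub> h p y"
begin

interpretation G: abelian_group G by (rule G)

lemma graded_ext_zero_comp: "h p \<zero>\<^bsub>M\<^esub> = \<zero>\<^bsub>G\<^esub>"
 using ha[OF grade_zero grade_zero, of p] hc[OF grade_zero, of p] by simp

lemma graded_ext_finite:
 assumes "x .: M" "finite P" "{p. hcomp M x p ~= \<zero>\<^bsub>M\<^esub>} \<subseteq> P"
 shows "graded_ext M G h x = finsum G (%p. h p (hcomp M x p)) P"
 unfolding graded_ext_def
 using assms hc hcomp_grade graded_ext_zero_comp by (intro G.finsum_supp) auto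

lemma graded_ext_additive: "additive_map M G (graded_ext M G h)"
proof (rule additiveI)
 fix x assume "x .: M"
 thus "graded_ext M G h x .: G"
  unfolding graded_ext_def using hc hcomp_grade by (intro G.finsum_closed) auto
next
 fix x y assume xy: "x .: M" "y .: M"
 let ?P = "{i. hcomp M x i ~= \<zero>\<^bsub>M\<^esub>} \<union> {i. hcomp M y i ~= \<zero>\<^bsub>M\<^esub>}"
 have fin: "finite ?P" using xy hcomp_finite by auto
 have "graded_ext M G h (x \<oplus>\<^bsub>M\<^esub> y) = finsum G (%p. h p (hcomp M (x \<oplus>\<^bsub>M\<^esub> y) p)) ?P"
  using xy fin by (intro graded_ext_finite) (auto simp: hcomp_add)
 also have "\<dots> = finsum G (%p. h p (hcomp M x p) \<oplus>\<^bsub>G\<^esub> h p (hcomp M y p)) ?P"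
  using xy hc hcomp_grade by (intro G.finsum_cong') (auto simp: hcomp_add ha)
 also have "\<dots> = finsum G (%p. h p (hcomp M x p)) ?P \<oplus>\<^bsub>G\<^esub> finsum G (%p. h p (hcomp M y p)) ?P"
  using xy hc hcomp_grade by (intro G.finsum_addf) auto
 also have "\<dots> = graded_ext M G h x \<oplus>\<^bsub>G\<^esub> graded_ext M G h y"
  using xy fin by (simp add: graded_ext_finite[of x ?P] graded_ext_finite[of y ?P])
 finally show "graded_ext M G h (x \<oplus>\<^bsub>M\<^esub> y) = graded_ext M G h x \<oplus>\<^bsub>G\<^esub> graded_ext M G h y" .
qed

lemma graded_ext_homogeneous:
 assumes "x \<in> grade M p"
 shows "graded_ext M G h x = h p x"
proof -
 have "graded_ext M G h x = finsum G (%i. h i (hcomp M x i)) {p}"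
  using assms grade_carrier by (intro graded_ext_finite) (auto simp: hcomp_homogeneous)
 thus ?thesis using assms hc by (simp add: hcomp_homogeneous)
qed

end

end

text \<open>The involution that acts as \<open>(-1)\<^sup>p\<close> in degree \<open>p\<close>; it records the sign that an
 element acquires when an odd element moves past it.\<close>

definition grade_inv :: "('r, 'm, 'f) gmod_scheme => nat => 'm => 'm" where
 "grade_inv M k = graded_ext M M (%p. ksgn M (k * p))"

context graded_module
begin

lemma grade_inv_additive: "additive_map M M (grade_inv M k)"
 unfolding grade_inv_def using grade_carrier
 by (intro graded_ext_additive) (auto simp: M.ksgn_add intro: M.ab)

lemma grade_inv_homogeneous: "x \<in> grade M p ==> grade_inv M k x = ksgn M (k * p) x"
 unfolding grade_inv_def using grade_carrier
 by (intro graded_ext_homogeneous) (auto simp: M.ksgn_add intro: M.ab)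

lemmas grade_inv_closed[simp, intro] = additive_closed[OF grade_inv_additive]
lemmas grade_inv_add = additive_add[OF grade_inv_additive]
lemmas grade_inv_zero[simp] = additive_zero[OF M.ab M.ab grade_inv_additive]

lemma grade_inv_grade: "x \<in> grade M p ==> grade_inv M k x \<in> grade M p"
 using grade_inv_homogeneous grade_ksgn by simp

lemma grade_inv_inv:
 assumes "x .: M"
 shows "grade_inv M k (grade_inv M l x) = grade_inv M (k + l) x"
proof (rule additive_eq_on_homogeneous[OF M.ab _ _ _ assms])
 fix n x assume x: "x \<in> grade M n"
 thus "grade_inv M k (grade_inv M l x) = grade_inv M (k + l) x"
  using grade_carrier grade_inv_homogeneous[OF grade_ksgn[OF x]]
  by (simp add: grade_inv_homogeneous M.ksgn_ksgn add_mult_distrib)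
qed (auto intro: additive_comp grade_inv_additive)

lemma grade_inv_even:
 assumes "x .: M" "even k"
 shows "grade_inv M k x = x"
 by (rule additive_eq_on_homogeneous[OF M.ab _ _ _ assms(1)])
  (use assms(2) in \<open>auto simp: grade_inv_homogeneous ksgn_def grade_inv_additive, simp add: additive_map_def\<close>)

lemma smult_additive: "r .: R ==> additive_map M M (%x. r \<odot>\<^bsub>M\<^esub> x)"
 by (rule additiveI) (auto simp: smult_r_distr)

lemma grade_inv_smult:
 assumes "r .: R" "x .: M"
 shows "grade_inv M k (r \<odot>\<^bsub>M\<^esub> x) = r \<odot>\<^bsub>M\<^esub> grade_inv M k x"
proof (rule additive_eq_on_homogeneous[OF M.ab _ _ _ assms(2)])
 fix n x assume x: "x \<in> grade M n"
 thus "grade_inv M k (r \<odot>\<^bsub>M\<^esub> x) = r \<odot>\<^bsub>M\<^esub> grade_inv M k x"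
  using grade_carrier assms(1) grade_smult[OF assms(1) x]
  by (simp add: grade_inv_homogeneous ksgn_smult)
qed (auto intro: additive_comp[OF smult_additive grade_inv_additive] additive_comp[OF grade_inv_additive smult_additive] assms)

end

context comm_graded_algebra
begin

lemma mult_additive_left: "y .: A ==> additive_map A A (%x. x \<otimes>\<^bsub>A\<^esub> y)"
 by (rule additiveI) (auto simp: A.l_distr)

lemma mult_additive_right: "x .: A ==> additive_map A A (%y. x \<otimes>\<^bsub>A\<^esub> y)"
 by (rule additiveI) (auto simp: A.r_distr)

lemma grade_inv_mult:
 assumes "x .: A" "y .: A"
 shows "grade_inv A k (x \<otimes>\<^bsub>A\<^esub> y) = grade_inv A k x \<otimes>\<^bsub>A\<^esub> grade_inv A k y"
proof (rule additive_eq_on_homogeneous[OF M.ab _ _ _ assms(1)])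
 fix m x assume x: "x \<in> grade A m"
 show "grade_inv A k (x \<otimes>\<^bsub>A\<^esub> y) = grade_inv A k x \<otimes>\<^bsub>A\<^esub> grade_inv A k y"
 proof (rule additive_eq_on_homogeneous[OF M.ab _ _ _ assms(2)])
  fix n y assume y: "y \<in> grade A n"
  have c: "x .: A" "y .: A" using x y grade_carrier by auto
  show "grade_inv A k (x \<otimes>\<^bsub>A\<^esub> y) = grade_inv A k x \<otimes>\<^bsub>A\<^esub> grade_inv A k y"
   using c x y mult_grade[OF x y]
   by (simp add: grade_inv_homogeneous A.ksgn_mult_left A.ksgn_mult_right M.ksgn_ksgn algebra_simps)
 qed (use x grade_carrier in \<open>auto intro: additive_comp[OF mult_additive_right grade_inv_additive]
   additive_comp[OF grade_inv_additive mult_additive_right]\<close>)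
qed (use assms in \<open>auto intro: additive_comp[OF mult_additive_left grade_inv_additive]
   additive_comp[OF grade_inv_additive mult_additive_left]\<close>)

lemma grade_inv_one: "grade_inv A k \<one>\<^bsub>A\<^esub> = \<one>\<^bsub>A\<^esub>"
 using grade_inv_homogeneous[OF one_grade] by (simp add: ksgn_def)

lemma odd_square_zero:
 assumes "\<one>\<^bsub>R\<^esub> \<oplus>\<^bsub>R\<^esub> \<one>\<^bsub>R\<^esub> \<in> Units R" "x \<in> grade A i" "odd i"
 shows "x \<otimes>\<^bsub>A\<^esub> x = \<zero>\<^bsub>A\<^esub>"
proof -
 have c: "x \<otimes>\<^bsub>A\<^esub> x .: A" using assms(2) grade_carrier by auto
 have "x \<otimes>\<^bsub>A\<^esub> x = \<ominus>\<^bsub>A\<^esub> (x \<otimes>\<^bsub>A\<^esub> x)"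
  using graded_comm[OF assms(2,2)] assms(3) by (simp add: ksgn_def)
 hence "x \<otimes>\<^bsub>A\<^esub> x \<oplus>\<^bsub>A\<^esub> x \<otimes>\<^bsub>A\<^esub> x = \<zero>\<^bsub>A\<^esub>" using c M.r_neg by metis
 hence "(\<one>\<^bsub>R\<^esub> \<oplus>\<^bsub>R\<^esub> \<one>\<^bsub>R\<^esub>) \<odot>\<^bsub>A\<^esub> (x \<otimes>\<^bsub>A\<^esub> x) = \<zero>\<^bsub>A\<^esub>"
  using c by (simp add: smult_l_distr)
 hence h: "inv\<^bsub>R\<^esub> (\<one>\<^bsub>R\<^esub> \<oplus>\<^bsub>R\<^esub> \<one>\<^bsub>R\<^esub>) \<odot>\<^bsub>A\<^esub> ((\<one>\<^bsub>R\<^esub> \<oplus>\<^bsub>R\<^esub> \<one>\<^bsub>R\<^esub>) \<odot>\<^bsub>A\<^esub> (x \<otimes>\<^bsub>A\<^esub> x)) = \<zero>\<^bsub>A\<^esub>"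
  using assms(1) by (simp add: R.Units_inv_closed smult_r_null)
 have "x \<otimes>\<^bsub>A\<^esub> x = (inv\<^bsub>R\<^esub> (\<one>\<^bsub>R\<^esub> \<oplus>\<^bsub>R\<^esub> \<one>\<^bsub>R\<^esub>) \<otimes>\<^bsub>R\<^esub> (\<one>\<^bsub>R\<^esub> \<oplus>\<^bsub>R\<^esub> \<one>\<^bsub>R\<^esub>)) \<odot>\<^bsub>A\<^esub> (x \<otimes>\<^bsub>A\<^esub> x)"
  using c assms(1) by (simp add: R.Units_l_inv)
 also have "\<dots> = \<zero>\<^bsub>A\<^esub>"
  using h c assms(1) R.Units_inv_closed by (subst smult_assoc1) auto
 finally show ?thesis .
qed

lemma smult_as_mult: "r .: R ==> x .: A ==> r \<odot>\<^bsub>A\<^esub> x = (r \<odot>\<^bsub>A\<^esub> \<one>\<^bsub>A\<^esub>) \<otimes>\<^bsub>A\<^esub> x"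
 by (simp add: smult_mult_left)

end

section \<open>Adjoining free graded commutative generators\<close>

text \<open>All gradings below come with explicit projections, from which the unique decomposition
 follows by applying them to a sum of homogeneous elements.\<close>

lemma direct_sum_from_projections:
 fixes M :: "('r, 'm, 'f) gmod_scheme"
 assumes M: "abelian_group M" and gr: "!!n. grade M n \<subseteq> carrier M"
  and add: "!!n. additive_map M M (\<pi> n)"
  and proj: "!!n x. x .: M ==> \<pi> n x \<in> grade M n"
  and same: "!!n x. x \<in> grade M n ==> \<pi> n x = x"
  and other: "!!n k x. x \<in> grade M k ==> k ~= n ==> \<pi> n x = \<zero>\<^bsub>M\<^esub>"
  and fin: "!!x. x .: M ==> finite {n. \<pi> n x ~= \<zero>\<^bsub>M\<^esub>}"
  and faithful: "!!x. x .: M ==> (!!n. \<pi> n x = \<zero>\<^bsub>M\<^esub>) ==> x = \<zero>\<^bsub>M\<^esub>"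
  and x: "x .: M"
 shows "\<exists>!c. is_decomp M x c"
proof -
 interpret M: abelian_group M by fact
 have pc: "\<pi> n x .: M" if "x .: M" for n x using proj[OF that] gr by blast
 have proj_sum: "\<pi> k (finsum M c {n. c n ~= \<zero>\<^bsub>M\<^esub>}) = c k"
  if c: "!!n. c n \<in> grade M n" "finite {n. c n ~= \<zero>\<^bsub>M\<^esub>}" for c k
 proof -
  have cc: "c n .: M" for n using c(1) gr by blast
  have "\<pi> k (finsum M c {n. c n ~= \<zero>\<^bsub>M\<^esub>}) = finsum M (%n. \<pi> k (c n)) {n. c n ~= \<zero>\<^bsub>M\<^esub>}"
   using cc by (intro additive_finsum[OF M M add]) auto
  also have "\<dots> = finsum M (%n. \<pi> k (c n)) (insert k {n. c n ~= \<zero>\<^bsub>M\<^esub>})"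
   using c cc pc by (intro M.finsum_supp) (auto simp: additive_zero[OF M M add])
  also have "\<dots> = \<pi> k (c k)"
   using c cc pc other[OF c(1)] by (intro M.finsum_single) auto
  finally show ?thesis using same c(1) by simp
 qed
 define c where "c n = \<pi> n x" for n
 have c: "!!n. c n \<in> grade M n" "finite {n. c n ~= \<zero>\<^bsub>M\<^esub>}" using proj fin x by (auto simp: c_def)
 have cc: "c n .: M" for n using c(1) gr by blast
 let ?s = "finsum M c {n. c n ~= \<zero>\<^bsub>M\<^esub>}"
 have s: "?s .: M" using cc by (intro M.finsum_closed) auto
 have "\<pi> n (x \<ominus>\<^bsub>M\<^esub> ?s) = \<zero>\<^bsub>M\<^esub>" for n
  using additive_diff[OF M M add x s, of n] proj_sum[OF c, of n] M.r_neg[OF pc[OF x, of n]]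
  by (simp add: c_def[symmetric] M.minus_eq)
 hence "x \<ominus>\<^bsub>M\<^esub> ?s = \<zero>\<^bsub>M\<^esub>" using faithful x s by simp
 hence "x = ?s" using M.add.inv_solve_right'[OF M.zero_closed x s] s by (simp add: M.minus_eq)
 hence "is_decomp M x c" using c by (simp add: is_decomp_def)
 moreover have "c' = c" if "is_decomp M x c'" for c'
  using that proj_sum[of c'] unfolding is_decomp_def c_def by auto
 ultimately show ?thesis by blast
qed

definition mdeg :: "(nat => nat) => nat multiset => nat" where
 "mdeg dg m = (\<Sum>j\<in>#m. dg j)"

definition odd_clash :: "(nat => nat) => nat multiset => bool" where
 "odd_clash dg m \<longleftrightarrow> (\<exists>j. odd (dg j) \<and> 2 \<le> count m j)"

definition monomials :: "(nat => nat) => nat set => nat multiset set" where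
 "monomials dg X = {m. set_mset m \<subseteq> X \<and> \<not> odd_clash dg m}"

text \<open>The number of transpositions of odd generators that sort the product of two sorted
 monomials.\<close>

definition inversions :: "(nat => nat) => nat multiset => nat multiset => nat" where
 "inversions dg m m' = (\<Sum>i\<in>#m. if odd (dg i) then size {#j \<in># m'. j < i \<and> odd (dg j)#} else 0)"

definition ext_twist :: "('r, 'a) gmod => (nat => nat) => nat multiset => nat multiset => 'a => 'a => 'a" where
 "ext_twist A dg m m' a b = (if odd_clash dg (m + m') then \<zero>\<^bsub>A\<^esub>
   else ksgn A (inversions dg m m') (a \<otimes>\<^bsub>A\<^esub> grade_inv A (mdeg dg m) b))"

text \<open>The algebra \<open>A \<otimes> \<Lambda>(v\<^sub>j | j \<in> X)\<close> with \<open>v\<^sub>j\<close> of degree \<open>dg j\<close>: an element is a family of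
 coefficients in \<open>A\<close>, written to the left of the sorted monomials.\<close>

definition gen_ext :: "('r, 'a) gmod => (nat => nat) => nat set => ('r, nat multiset => 'a) gmod" where
 "gen_ext A dg X =
   \<lparr>carrier = fin_funs (monomials dg X) A, mult = conv A (+) (ext_twist A dg),
   one = fs_single A {#} \<one>\<^bsub>A\<^esub>, zero = (%m. \<zero>\<^bsub>A\<^esub>), add = (%f g m. f m \<oplus>\<^bsub>A\<^esub> g m),
   smult = (%r f m. r \<odot>\<^bsub>A\<^esub> f m),
   grade = (%n. {f \<in> fin_funs (monomials dg X) A.
     \<forall>m. f m ~= \<zero>\<^bsub>A\<^esub> \<longrightarrow> mdeg dg m \<le> n \<and> f m \<in> grade A (n - mdeg dg m)})\<rparr>"

lemma mdeg_simps[simp]: "mdeg dg {#} = 0" "mdeg dg (add_mset j m) = dg j + mdeg dg m"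
 "mdeg dg (m + m') = mdeg dg m + mdeg dg m'"
 by (simp_all add: mdeg_def)

lemma inversions_add_left: "inversions dg (m + n) m' = inversions dg m m' + inversions dg n m'"
 by (simp add: inversions_def)

lemma inversions_add_right: "inversions dg m (m' + n) = inversions dg m m' + inversions dg m n"
proof -
 have "inversions dg m (m' + n) = (\<Sum>i\<in>#m. (if odd (dg i) then size {#j \<in># m'. j < i \<and> odd (dg j)#} else 0)
   + (if odd (dg i) then size {#j \<in># n. j < i \<and> odd (dg j)#} else 0))"
  unfolding inversions_def by (intro arg_cong[of _ _ sum_mset] image_mset_cong) simp
 thus ?thesis unfolding inversions_def by (simp only: sum_mset.distrib)
qed

lemma inversions_empty[simp]: "inversions dg {#} m = 0" "inversions dg m {#} = 0"
proof -
 show "inversions dg {#} m = 0" by (simp add: inversions_def)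
 show "inversions dg m {#} = 0"
  using inversions_add_right[of dg m "{#}" "{#}"] by simp
qed

lemma odd_clash_mono: "odd_clash dg m ==> odd_clash dg (m + n)"
 by (auto simp: odd_clash_def intro: trans_le_add1)

lemma odd_clash_mono': "odd_clash dg m ==> odd_clash dg (n + m)"
 using odd_clash_mono by (metis add.commute)

text \<open>Exchanging two monomials costs the transpositions of all pairs of odd generators, except
 for the pairs of equal ones.\<close>

lemma inversions_swap:
 "inversions dg m m' + inversions dg m' m + (\<Sum>i\<in>#m. if odd (dg i) then count m' i else 0) =
  size {#j \<in># m. odd (dg j)#} * size {#j \<in># m'. odd (dg j)#}"
proof (induction m)
 case empty
 thus ?case by simp
next
 case (add i m)
 have one: "inversions dg {#i#} m' + inversions dg m' {#i#} + (if odd (dg i) then count m' i else 0) =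
   (if odd (dg i) then size {#j \<in># m'. odd (dg j)#} else 0)"
  by (induction m') (auto simp: inversions_def)
 have "inversions dg (add_mset i m) m' = inversions dg {#i#} m' + inversions dg m m'"
  "inversions dg m' (add_mset i m) = inversions dg m' {#i#} + inversions dg m' m"
  using inversions_add_left[of dg "{#i#}" m m'] inversions_add_right[of dg m' "{#i#}" m] by auto
 thus ?case using one add.IH by (auto simp: algebra_simps)
qed

lemma even_mdeg_iff: "even (mdeg dg m) \<longleftrightarrow> even (size {#j \<in># m. odd (dg j)#})"
 by (induction m) auto

lemma inversions_swap_parity:
 assumes "\<not> odd_clash dg (m + m')"
 shows "even (inversions dg m m' + inversions dg m' m + mdeg dg m * mdeg dg m')"
proof -
 have "(if odd (dg i) then count m' i else 0) = 0" if "i \<in># m" for i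
 proof (rule ccontr)
  assume "(if odd (dg i) then count m' i else 0) ~= 0"
  hence "odd (dg i)" "count m' i ~= 0" by (auto split: if_splits)
  moreover have "count m i ~= 0" using that by (simp only: count_eq_zero_iff not_not)
  ultimately have "odd (dg i) \<and> 2 \<le> count (m + m') i"
   unfolding count_union by linarith
  thus False using assms by (auto simp: odd_clash_def)
 qed
 hence "(\<Sum>i\<in>#m. if odd (dg i) then count m' i else 0) = 0" by simp
 hence "inversions dg m m' + inversions dg m' m =
  size {#j \<in># m. odd (dg j)#} * size {#j \<in># m'. odd (dg j)#}"
  using inversions_swap[of dg m m'] by linarith
 thus ?thesis using even_mdeg_iff[of dg m] even_mdeg_iff[of dg m'] by simp
qed

locale free_gens = comm_graded_algebra R A
 for R :: "('r, 'e) ring_scheme" and A :: "('r, 'a) gmod" (structure) +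
 fixes dg :: "nat => nat"
begin

abbreviation U where "U X \<equiv> gen_ext A dg X"

lemma U_simps:
 "carrier (U X) = fin_funs (monomials dg X) A" "\<zero>\<^bsub>U X\<^esub> = (%m. \<zero>)"
 "f \<oplus>\<^bsub>U X\<^esub> g = (%m. f m \<oplus> g m)" "r \<odot>\<^bsub>U X\<^esub> f = (%m. r \<odot> f m)"
 "\<one>\<^bsub>U X\<^esub> = fs_single A {#} \<one>" "mult (U X) = conv A (+) (ext_twist A dg)"
 "grade (U X) n = {f \<in> fin_funs (monomials dg X) A.
     \<forall>m. f m ~= \<zero> \<longrightarrow> mdeg dg m \<le> n \<and> f m \<in> grade A (n - mdeg dg m)}"
 by (simp_all add: gen_ext_def)

lemma U_group: "fun_group (U X) (monomials dg X) A"
 by (simp add: fun_group_def gen_ext_def)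

lemma U_twisted: "twisted_conv A (monomials dg X) (+) (ext_twist A dg) (U X)"
proof
 show "fun_group (U X) (monomials dg X) A" by (rule U_group)
 show "(\<otimes>\<^bsub>U X\<^esub>) = conv A (+) (ext_twist A dg)" by (simp add: gen_ext_def)
next
 fix u v a b assume "a .: A" "b .: A"
 thus "ext_twist A dg u v a b .: A" by (simp add: ext_twist_def)
next
 fix u v a a' b assume "a .: A" "a' .: A" "b .: A"
 thus "ext_twist A dg u v (a \<oplus> a') b = ext_twist A dg u v a b \<oplus> ext_twist A dg u v a' b"
  by (simp add: ext_twist_def A.l_distr M.ksgn_add)
next
 fix u v a b b' assume "a .: A" "b .: A" "b' .: A"
 thus "ext_twist A dg u v a (b \<oplus> b') = ext_twist A dg u v a b \<oplus> ext_twist A dg u v a b'"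
  by (simp add: ext_twist_def A.r_distr M.ksgn_add grade_inv_add)
next
 fix u v a b assume "u \<in> monomials dg X" "v \<in> monomials dg X" "u + v \<notin> monomials dg X"
 thus "ext_twist A dg u v a b = \<zero>" by (auto simp: monomials_def ext_twist_def)
qed

lemma inv_ksgn: "x .: A ==> grade_inv A k (ksgn A n x) = ksgn A n (grade_inv A k x)"
 using additive_ksgn[OF M.ab M.ab grade_inv_additive] .

lemma ext_twist_assoc:
 assumes c: "a .: A" "b .: A" "c .: A"
 shows "ext_twist A dg (u + v) w (ext_twist A dg u v a b) c =
  ext_twist A dg u (v + w) a (ext_twist A dg v w b c)"
proof (cases "odd_clash dg (u + (v + w))")
 case True
 thus ?thesis by (simp add: ext_twist_def add.assoc)
next
 case False
 hence n: "\<not> odd_clash dg (u + v)" "\<not> odd_clash dg (v + w)" "\<not> odd_clash dg (u + v + w)"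
  using odd_clash_mono[of dg "u + v" w] odd_clash_mono'[of dg "v + w" u] by (auto simp: add.assoc)
 have l: "ext_twist A dg (u + v) w (ext_twist A dg u v a b) c =
   ksgn A (inversions dg (u + v) w + inversions dg u v)
    (a \<otimes> (grade_inv A (mdeg dg u) b \<otimes> grade_inv A (mdeg dg u + mdeg dg v) c))"
  using n c by (simp add: ext_twist_def A.ksgn_mult_left M.ksgn_ksgn A.m_assoc)
 have r: "ext_twist A dg u (v + w) a (ext_twist A dg v w b c) =
   ksgn A (inversions dg u (v + w) + inversions dg v w)
    (a \<otimes> (grade_inv A (mdeg dg u) b \<otimes> grade_inv A (mdeg dg u + mdeg dg v) c))"
  using n False c by (simp add: ext_twist_def A.ksgn_mult_right M.ksgn_ksgn inv_ksgn grade_inv_mult grade_inv_inv)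
 have "inversions dg (u + v) w + inversions dg u v = inversions dg u (v + w) + inversions dg v w"
  by (simp add: inversions_add_left inversions_add_right)
 thus ?thesis unfolding l r by simp
qed

lemma U_ring: "ring (U X)"
proof -
 interpret tw: twisted_conv A "monomials dg X" "(+)" "ext_twist A dg" "U X" by (rule U_twisted)
 show ?thesis
 proof (rule tw.ring_conv)
  fix u v w a b c
  assume "a .: A" "b .: A" "c .: A"
  thus "ext_twist A dg (u + v) w (ext_twist A dg u v a b) c =
     ext_twist A dg u (v + w) a (ext_twist A dg v w b c)" by (rule ext_twist_assoc)
 next
  fix u v w a b c
  assume "u \<in> monomials dg X" "v \<in> monomials dg X" "u + v \<notin> monomials dg X"
  hence "odd_clash dg (u + v)" by (auto simp: monomials_def)
  thus "ext_twist A dg u (v + w) a (ext_twist A dg v w b c) = \<zero>"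
   using odd_clash_mono[of dg "u + v" w] by (simp add: ext_twist_def add.assoc)
 next
  fix u v w a b c
  assume "v \<in> monomials dg X" "w \<in> monomials dg X" "v + w \<notin> monomials dg X"
  hence "odd_clash dg (v + w)" by (auto simp: monomials_def)
  thus "ext_twist A dg (u + v) w (ext_twist A dg u v a b) c = \<zero>"
   using odd_clash_mono'[of dg "v + w" u] by (simp add: ext_twist_def add.assoc)
 next
  show "\<one>\<^bsub>U X\<^esub> = fs_single A {#} \<one>" by (simp add: U_simps)
  show "{#} \<in> monomials dg X" by (simp add: monomials_def odd_clash_def)
 next
  fix u a assume "u \<in> monomials dg X" "a .: A"
  thus "ext_twist A dg {#} u \<one> a = a" "ext_twist A dg u {#} a \<one> = a"
   by (simp_all add: ext_twist_def monomials_def ksgn_def grade_inv_even grade_inv_one)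
 qed (auto simp: add.assoc)
qed

lemma U_module: "module R (U X)"
proof (rule moduleI)
 show "abelian_group (U X)" using ring.is_abelian_group[OF U_ring] .
 show "cring R" by (rule R.is_cring)
next
 fix r f assume r: "r .: R" and f: "f .: U X"
 have "{m. r \<odot> f m ~= \<zero>} \<subseteq> {m. f m ~= \<zero>}" using r by auto
 thus "r \<odot>\<^bsub>U X\<^esub> f .: U X"
  using f r by (auto simp: U_simps fin_funs_def elim: finite_subset)
qed (auto simp: U_simps fin_funs_val smult_l_distr smult_r_distr smult_assoc1)

lemma U_grade_carrier: "f \<in> grade (U X) n ==> f .: U X"
 by (simp add: U_simps)

lemma U_gradeD: "f \<in> grade (U X) n ==> f m ~= \<zero> ==> mdeg dg m \<le> n \<and> f m \<in> grade A (n - mdeg dg m)"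
 by (simp add: U_simps)

lemma U_gradeI: "f .: U X ==> (!!m. f m ~= \<zero> ==> mdeg dg m \<le> n \<and> f m \<in> grade A (n - mdeg dg m)) ==>
 f \<in> grade (U X) n"
 by (simp add: U_simps)

lemma U_grade_submodule: "submodule (grade (U X) n) R (U X)"
proof -
 interpret U: module R "U X" by (rule U_module)
 have minus: "f .: U X ==> (\<ominus>\<^bsub>U X\<^esub> f) m = \<ominus> f m" for f m
  by (rule M.fun_group_minus[OF U_group])
 show ?thesis
 proof (rule U.submoduleI)
  fix f g assume f: "f \<in> grade (U X) n" and g: "g \<in> grade (U X) n"
  show "f \<oplus>\<^bsub>U X\<^esub> g \<in> grade (U X) n"
  proof (rule U_gradeI)
   fix m assume "(f \<oplus>\<^bsub>U X\<^esub> g) m ~= \<zero>"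
   hence "f m ~= \<zero> \<or> g m ~= \<zero>" by (auto simp: U_simps)
   thus "mdeg dg m \<le> n \<and> (f \<oplus>\<^bsub>U X\<^esub> g) m \<in> grade A (n - mdeg dg m)"
    using U_gradeD[OF f, of m] U_gradeD[OF g, of m] by (cases "f m = \<zero>"; cases "g m = \<zero>")
     (auto simp: U_simps grade_carrier)
  qed (use f g U_grade_carrier in auto)
 next
  fix f assume f: "f \<in> grade (U X) n"
  show "\<ominus>\<^bsub>U X\<^esub> f \<in> grade (U X) n"
   using U_gradeD[OF f] U_grade_carrier[OF f] fin_funs_val[of f "monomials dg X" A]
   by (intro U_gradeI U.a_inv_closed) (auto simp: minus U_simps(1))
 next
  fix r f assume r: "r .: R" and f: "f \<in> grade (U X) n"
  show "r \<odot>\<^bsub>U X\<^esub> f \<in> grade (U X) n"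
  proof (rule U_gradeI)
   fix m assume "(r \<odot>\<^bsub>U X\<^esub> f) m ~= \<zero>"
   hence "f m ~= \<zero>" using r by (auto simp: U_simps)
   thus "mdeg dg m \<le> n \<and> (r \<odot>\<^bsub>U X\<^esub> f) m \<in> grade A (n - mdeg dg m)"
    using U_gradeD[OF f, of m] r by (auto simp: U_simps)
  qed (use r U_grade_carrier[OF f] in auto)
 next
  show "\<zero>\<^bsub>U X\<^esub> \<in> grade (U X) n" by (intro U_gradeI U.zero_closed) (auto simp: U_simps)
 qed (auto simp: U_simps)
qed

definition U_proj :: "nat => (nat multiset => 'a) => nat multiset => 'a" where
 "U_proj n f = (%m. if mdeg dg m \<le> n then hcomp A (f m) (n - mdeg dg m) else \<zero>)"

lemma U_proj_carrier:
 assumes f: "f .: U X"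
 shows "U_proj n f .: U X"
proof -
 have f': "f \<in> fin_funs (monomials dg X) A" using f by (simp add: U_simps)
 have sub: "{m. U_proj n f m ~= \<zero>} \<subseteq> {m. f m ~= \<zero>}"
  by (auto simp: U_proj_def hcomp_zero)
 have "U_proj n f m .: A" for m
  using fin_funs_val[OF f'] hcomp_carrier by (simp add: U_proj_def)
 thus ?thesis
  using f' sub finite_subset[OF sub] by (auto simp: U_simps fin_funs_def)
qed

lemma U_graded_module: "graded_module R (U X)"
proof -
 interpret U: module R "U X" by (rule U_module)
 show ?thesis
 proof (intro graded_module.intro U_module graded_module_axioms.intro U_grade_submodule)
  fix x assume x: "x .: U X"
  show "\<exists>!c. is_decomp (U X) x c"
  proof (rule direct_sum_from_projections[where \<pi> = U_proj])
   show "abelian_group (U X)" by (rule U.ab)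
   show "grade (U X) n \<subseteq> carrier (U X)" for n using U_grade_carrier by blast
   show "additive_map (U X) (U X) (U_proj n)" for n
   proof (rule additiveI)
    fix f g assume "f .: U X" "g .: U X"
    hence "f m .: A" "g m .: A" for m by (auto simp: U_simps fin_funs_val)
    thus "U_proj n (f \<oplus>\<^bsub>U X\<^esub> g) = U_proj n f \<oplus>\<^bsub>U X\<^esub> U_proj n g"
     by (auto simp: fun_eq_iff U_proj_def U_simps hcomp_add)
   qed (rule U_proj_carrier)
  next
   fix n f assume f: "f .: U X"
   thus "U_proj n f \<in> grade (U X) n"
    by (intro U_gradeI U_proj_carrier) (auto simp: U_proj_def U_simps fin_funs_val hcomp_grade split: if_splits)
  next
   fix n f assume f: "f \<in> grade (U X) n"
   show "U_proj n f = f"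
   proof
    fix m show "U_proj n f m = f m"
     using U_gradeD[OF f, of m]
     by (cases "f m = \<zero>") (auto simp: U_proj_def hcomp_zero hcomp_homogeneous)
   qed
  next
   fix n k f assume f: "f \<in> grade (U X) k" and "k ~= n"
   hence "U_proj n f m = \<zero>" for m
    using U_gradeD[OF f, of m]
    by (cases "f m = \<zero>") (auto simp: U_proj_def hcomp_zero hcomp_homogeneous)
   thus "U_proj n f = \<zero>\<^bsub>U X\<^esub>" by (auto simp: U_simps)
  next
   fix f assume f: "f .: U X"
   hence fv: "f m .: A" for m by (simp add: U_simps fin_funs_val)
   have "{n. U_proj n f ~= \<zero>\<^bsub>U X\<^esub>} \<subseteq>
    (\<Union>m\<in>{m. f m ~= \<zero>}. (%p. p + mdeg dg m) ` {p. hcomp A (f m) p ~= \<zero>})"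
   proof
    fix n assume "n \<in> {n. U_proj n f ~= \<zero>\<^bsub>U X\<^esub>}"
    then obtain m where m: "U_proj n f m ~= \<zero>" by (auto simp: U_simps)
    hence "mdeg dg m \<le> n" "hcomp A (f m) (n - mdeg dg m) ~= \<zero>" "f m ~= \<zero>"
     by (auto simp: U_proj_def hcomp_zero split: if_splits)
    thus "n \<in> (\<Union>m\<in>{m. f m ~= \<zero>}. (%p. p + mdeg dg m) ` {p. hcomp A (f m) p ~= \<zero>})"
     by (auto intro!: bexI[of _ m] image_eqI[of _ _ "n - mdeg dg m"])
   qed
   moreover have "finite (\<Union>m\<in>{m. f m ~= \<zero>}. (%p. p + mdeg dg m) ` {p. hcomp A (f m) p ~= \<zero>})"
    using f fv hcomp_finite by (intro finite_UN_I finite_imageI) (auto simp: U_simps fin_funs_finite)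
   ultimately show "finite {n. U_proj n f ~= \<zero>\<^bsub>U X\<^esub>}" by (rule finite_subset)
  next
   fix f assume f: "f .: U X" and z: "!!n. U_proj n f = \<zero>\<^bsub>U X\<^esub>"
   have "f m = \<zero>" for m
   proof -
    have fv: "f m .: A" using f by (simp add: U_simps fin_funs_val)
    have "hcomp A (f m) p = \<zero>" for p
     using fun_cong[OF z[of "p + mdeg dg m"], of m] by (simp add: U_proj_def U_simps)
    thus ?thesis using hcomp_sum[OF fv] by simp
   qed
   thus "f = \<zero>\<^bsub>U X\<^esub>" by (auto simp: U_simps)
  qed (rule x)
 qed
qed

lemma U_mult_grade:
 assumes f: "f \<in> grade (U X) i" and g: "g \<in> grade (U X) j"
 shows "f \<otimes>\<^bsub>U X\<^esub> g \<in> grade (U X) (i + j)"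
proof (rule U_gradeI)
 interpret U: ring "U X" by (rule U_ring)
 show "f \<otimes>\<^bsub>U X\<^esub> g .: U X" using f g U_grade_carrier by auto
 fix m assume nz: "(f \<otimes>\<^bsub>U X\<^esub> g) m ~= \<zero>"
 let ?I = "{(u, v). f u ~= \<zero> \<and> g v ~= \<zero> \<and> u + v = m}"
 have eq: "(f \<otimes>\<^bsub>U X\<^esub> g) m = finsum A (%(u, v). ext_twist A dg u v (f u) (g v)) ?I"
  by (simp add: U_simps conv_def)
 have "?I ~= {}" using nz unfolding eq by (metis M.finsum_empty)
 then obtain u v where uv: "(u, v) \<in> ?I" by auto
 have le: "mdeg dg u + mdeg dg v \<le> i + j" if "(u, v) \<in> ?I" for u v
  using U_gradeD[OF f, of u] U_gradeD[OF g, of v] that by auto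
 have "finsum A (%(u, v). ext_twist A dg u v (f u) (g v)) ?I \<in> grade A (i + j - mdeg dg m)"
 proof (rule grade_finsum, clarify)
  fix u v assume h: "f u ~= \<zero>" "g v ~= \<zero>" "m = u + v"
  have fu: "mdeg dg u \<le> i" "f u \<in> grade A (i - mdeg dg u)"
   and gv: "mdeg dg v \<le> j" "g v \<in> grade A (j - mdeg dg v)"
   using U_gradeD[OF f h(1)] U_gradeD[OF g h(2)] by auto
  have "f u \<otimes> grade_inv A (mdeg dg u) (g v) \<in> grade A ((i - mdeg dg u) + (j - mdeg dg v))"
   using fu gv by (intro mult_grade grade_inv_grade)
  moreover have "(i - mdeg dg u) + (j - mdeg dg v) = i + j - mdeg dg (u + v)" using fu gv by simp
  ultimately show "ext_twist A dg u v (f u) (g v) \<in> grade A (i + j - mdeg dg (u + v))"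
   by (auto simp: ext_twist_def)
 qed
 thus "mdeg dg m \<le> i + j \<and> (f \<otimes>\<^bsub>U X\<^esub> g) m \<in> grade A (i + j - mdeg dg m)"
  using eq le[OF uv] uv by auto
qed

lemma ext_twist_swap:
 assumes a: "a \<in> grade A p" and b: "b \<in> grade A q"
 shows "ext_twist A dg u v a b =
  ksgn A ((p + mdeg dg u) * (q + mdeg dg v)) (ext_twist A dg v u b a)"
proof (cases "odd_clash dg (u + v)")
 case True
 thus ?thesis by (simp add: ext_twist_def add.commute)
next
 case False
 hence par: "even (inversions dg u v + inversions dg v u + mdeg dg u * mdeg dg v)"
  by (rule inversions_swap_parity)
 have c: "a .: A" "b .: A" using a b grade_carrier by auto
 let ?s = "(p + mdeg dg u) * (q + mdeg dg v)"
 have l: "ext_twist A dg u v a b = ksgn A (inversions dg u v + mdeg dg u * q + p * q) (b \<otimes> a)"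
  using False c b graded_comm[OF a b]
  by (simp add: ext_twist_def grade_inv_homogeneous A.ksgn_mult_right M.ksgn_ksgn add.assoc)
 have r: "ext_twist A dg v u b a = ksgn A (inversions dg v u + mdeg dg v * p) (b \<otimes> a)"
  using False c a by (simp add: ext_twist_def grade_inv_homogeneous A.ksgn_mult_right M.ksgn_ksgn add.commute)
 have e: "?s = p * q + p * mdeg dg v + mdeg dg u * q + mdeg dg u * mdeg dg v"
  by (simp add: algebra_simps)
 have "even (inversions dg u v + mdeg dg u * q + p * q) \<longleftrightarrow>
   even (?s + (inversions dg v u + mdeg dg v * p))"
  using par unfolding e even_add mult.commute[of "mdeg dg v" p] by argo
 hence "ksgn A (inversions dg u v + mdeg dg u * q + p * q) (b \<otimes> a) =
   ksgn A (?s + (inversions dg v u + mdeg dg v * p)) (b \<otimes> a)"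
  by (rule ksgn_cong)
 thus ?thesis
  using c unfolding l r by (simp only: M.ksgn_ksgn A.m_closed)
qed

lemma U_graded_comm:
 assumes f: "f \<in> grade (U X) i" and g: "g \<in> grade (U X) j"
 shows "f \<otimes>\<^bsub>U X\<^esub> g = ksgn (U X) (i * j) (g \<otimes>\<^bsub>U X\<^esub> f)"
proof
 fix m
 interpret U: ring "U X" by (rule U_ring)
 interpret tw: twisted_conv A "monomials dg X" "(+)" "ext_twist A dg" "U X" by (rule U_twisted)
 have fv: "f u .: A" and gv: "g u .: A" for u
  using f g by (auto simp: U_simps fin_funs_val)
 have tc: "ext_twist A dg u v a b .: A" if "a .: A" "b .: A" for u v a b
  using that by (simp add: ext_twist_def)
 let ?I = "{(u, v). f u ~= \<zero> \<and> g v ~= \<zero> \<and> u + v = m}"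
 let ?J = "{(v, u). g v ~= \<zero> \<and> f u ~= \<zero> \<and> v + u = m}"
 have J: "?J = prod.swap ` ?I" by (auto simp: add.commute image_iff)
 have "(f \<otimes>\<^bsub>U X\<^esub> g) m = finsum A (%(u, v). ext_twist A dg u v (f u) (g v)) ?I"
  by (simp add: U_simps conv_def)
 also have "\<dots> = finsum A (%(u, v). ksgn A (i * j) (ext_twist A dg v u (g v) (f u))) ?I"
 proof (rule M.finsum_cong', goal_cases)
  case 2
  show ?case using fv gv tc by auto
 next
  case (3 p)
  obtain u v where p: "p = (u, v)" by (cases p)
  have h: "f u ~= \<zero>" "g v ~= \<zero>" using 3 p by auto
  have "ext_twist A dg u v (f u) (g v) = ksgn A (i * j) (ext_twist A dg v u (g v) (f u))"
   using ext_twist_swap[of "f u" "i - mdeg dg u" "g v" "j - mdeg dg v" u v] U_gradeD[OF f h(1)] U_gradeD[OF g h(2)]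
   by auto
  thus ?case using p by simp
 qed simp
 also have "\<dots> = finsum A (%p. ksgn A (i * j) (case prod.swap p of (v, u) => ext_twist A dg v u (g v) (f u))) ?I"
  by (intro M.finsum_cong') (use fv gv tc in auto)
 also have "\<dots> = finsum A (%p. ksgn A (i * j) (case p of (v, u) => ext_twist A dg v u (g v) (f u))) (prod.swap ` ?I)"
  by (intro M.finsum_reindex[symmetric]) (use fv gv tc in auto)
 also have "\<dots> = ksgn A (i * j) (finsum A (%(v, u). ext_twist A dg v u (g v) (f u)) ?J)"
  unfolding J
  by (rule additive_finsum[OF M.ab M.ab, symmetric])
   (use fv gv tc in \<open>auto simp: additive_map_def M.ksgn_add\<close>)
 also have "\<dots> = ksgn A (i * j) ((g \<otimes>\<^bsub>U X\<^esub> f) m)"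
  by (simp add: U_simps conv_def)
 also have "\<dots> = ksgn (U X) (i * j) (g \<otimes>\<^bsub>U X\<^esub> f) m"
  using M.fun_group_minus[OF U_group, of "g \<otimes>\<^bsub>U X\<^esub> f" X m] U_grade_carrier[OF f] U_grade_carrier[OF g]
  by (simp add: ksgn_def)
 finally show "(f \<otimes>\<^bsub>U X\<^esub> g) m = ksgn (U X) (i * j) (g \<otimes>\<^bsub>U X\<^esub> f) m" .
qed

lemma U_single_carrier[simp, intro]: "m \<in> monomials dg X ==> a .: A ==> fs_single A m a .: U X"
 by (simp add: U_simps M.fs_single_fin_funs)

lemma U_smult_single: "r .: R ==> r \<odot>\<^bsub>U X\<^esub> fs_single A m a = fs_single A m (r \<odot> a)"
 by (auto simp: U_simps fs_single_def)

lemma U_single_mult: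
 assumes "m \<in> monomials dg X" "n \<in> monomials dg X" "a .: A" "b .: A"
 shows "fs_single A m a \<otimes>\<^bsub>U X\<^esub> fs_single A n b = fs_single A (m + n) (ext_twist A dg m n a b)"
 by (rule twisted_conv.Q_single_mult[OF U_twisted assms])

lemma U_single_grade:
 assumes "m \<in> monomials dg X" "a \<in> grade A p"
 shows "fs_single A m a \<in> grade (U X) (p + mdeg dg m)"
 using assms grade_carrier by (intro U_gradeI) (auto simp: fs_single_def U_simps fin_funs_def)

lemma U_comm_graded_algebra: "comm_graded_algebra R (U X)"
proof -
 interpret U: graded_module R "U X" by (rule U_graded_module)
 interpret Ur: ring "U X" by (rule U_ring)
 interpret tw: twisted_conv A "monomials dg X" "(+)" "ext_twist A dg" "U X" by (rule U_twisted)
 have ab: "abelian_group (U X)" using Ur.is_abelian_group .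
 have clos: "ext_twist A dg m n a b .: A" if "a .: A" "b .: A" for m n a b
  using that by (simp add: ext_twist_def)
 have tw_smult: "ext_twist A dg m n (r \<odot> a) b = r \<odot> ext_twist A dg m n a b"
  "ext_twist A dg m n a (r \<odot> b) = r \<odot> ext_twist A dg m n a b"
  if "r .: R" "a .: A" "b .: A" for r m n a b
  using that by (auto simp: ext_twist_def smult_mult_left smult_mult_right grade_inv_smult ksgn_smult)
 have left: "(r \<odot>\<^bsub>U X\<^esub> x) \<otimes>\<^bsub>U X\<^esub> y = r \<odot>\<^bsub>U X\<^esub> (x \<otimes>\<^bsub>U X\<^esub> y) \<and> x \<otimes>\<^bsub>U X\<^esub> (r \<odot>\<^bsub>U X\<^esub> y) = r \<odot>\<^bsub>U X\<^esub> (x \<otimes>\<^bsub>U X\<^esub> y)"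
  if r: "r .: R" and x: "x .: U X" and y: "y .: U X" for r x y
  using x
 proof (induction x rule: tw.Q_induct)
  case zero
  thus ?case using r y by simp
 next
  case (add f g)
  thus ?case using r y by (simp add: U.smult_r_distr Ur.l_distr)
 next
  case (single m a)
  note ma = this
  show ?case using y
  proof (induction y rule: tw.Q_induct)
   case zero
   thus ?case using r ma by simp
  next
   case (add f g)
   thus ?case using r ma by (simp add: U.smult_r_distr Ur.r_distr)
  next
   case (single n b)
   thus ?case using r ma clos by (simp add: U_smult_single U_single_mult tw_smult)
  qed
 qed
 have one: "\<one>\<^bsub>U X\<^esub> \<in> grade (U X) 0"
  using U_single_grade[of "{#}" X "\<one>" 0] one_grade by (simp add: U_simps(5) monomials_def odd_clash_def)
 show ?thesis
  by (intro comm_graded_algebra.intro U_graded_module U_ring comm_graded_algebra_axioms.intro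
    conjunct1[OF left] conjunct2[OF left] one U_mult_grade U_graded_comm)
qed

end

section \<open>Algebras obtained by adjoining one generator\<close>

context cdga
begin

lemma diff_closed[simp, intro]: "x .: A ==> d x .: A"
 by (induction x rule: graded_induct) (auto simp: diff_add intro: diff_grade grade_carrier)

lemma diff_additive: "additive_map A A d"
 by (rule additiveI) (auto simp: diff_add)

lemmas diff_zero[simp] = additive_zero[OF M.ab M.ab diff_additive]
lemmas diff_neg = additive_neg[OF M.ab M.ab diff_additive]
lemma diff_one[simp]: "d \<one>\<^bsub>A\<^esub> = \<zero>\<^bsub>A\<^esub>"
proof -
 have "d \<one>\<^bsub>A\<^esub> = d \<one>\<^bsub>A\<^esub> \<oplus>\<^bsub>A\<^esub> d \<one>\<^bsub>A\<^esub>"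
  using diff_mult[OF one_grade A.one_closed] by (simp add: ksgn_def)
 thus ?thesis by simp
qed

end

text \<open>\<open>E\<close> is \<open>K \<otimes> \<Lambda>(v)\<close>: every element is a polynomial in \<open>v\<close> with unique coefficients
 \<open>cf e\<close> in \<open>K\<close>, a linear polynomial if \<open>v\<close> is odd.\<close>

locale one_gen_ext = K: comm_graded_algebra R K + E: comm_graded_algebra R E
 for R :: "('r, 'e) ring_scheme" and K :: "('r, 'u) gmod" and E :: "('r, 'u) gmod" (structure) +
 fixes v :: 'u and k :: nat and cf :: "nat => 'u => 'u"
 assumes half: "\<one>\<^bsub>R\<^esub> \<oplus>\<^bsub>R\<^esub> \<one>\<^bsub>R\<^esub> \<in> Units R"
  and K_carrier: "carrier K \<subseteq> carrier E" and K_grade: "grade K n \<subseteq> grade E n"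
  and K_ops: "mult K = mult E" "add K = add E" "zero K = zero E" "one K = one E" "smult K = smult E"
  and v_grade: "v \<in> grade E k"
  and cf_additive: "additive_map E K (cf e)"
  and cf_power: "\<lbrakk>a .: K; even k \<or> f \<le> 1\<rbrakk> \<Longrightarrow>
    cf e (a \<otimes> v [^] f) = (if e = f then a else \<zero>)"
  and cf_finite: "u .: E ==> finite {e. cf e u ~= \<zero>}"
  and cf_odd: "\<lbrakk>u .: E; odd k; 2 \<le> e\<rbrakk> \<Longrightarrow> cf e u = \<zero>"
  and cf_grade: "\<lbrakk>u \<in> grade E n; e * k \<le> n\<rbrakk> \<Longrightarrow> cf e u \<in> grade K (n - e * k)"
  and cf_large: "\<lbrakk>u \<in> grade E n; n < e * k\<rbrakk> \<Longrightarrow> cf e u = \<zero>"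
  and cf_expand: "u .: E ==>
    u = finsum E (%e. cf e u \<otimes> v [^] e) {e. cf e u ~= \<zero>}"
begin

lemma KE[simp, intro]: "x .: K ==> x .: E"
 using K_carrier by blast

lemma KEg: "x \<in> grade K n ==> x \<in> grade E n"
 using K_grade by blast

lemma KgE[simp]: "x \<in> grade K n ==> x .: E"
 using K.grade_carrier by blast

lemma v_carrier[simp, intro]: "v .: E"
 using v_grade E.grade_carrier by blast

lemmas E_ab = E.M.ab
lemmas K_ab = K.M.ab

lemma incl_additive: "additive_map K E (%x. x)"
 by (rule additiveI) (auto simp: K_ops)

lemma K_neg: "x .: K ==> \<ominus>\<^bsub>K\<^esub> x = \<ominus> x"
 using additive_neg[OF K_ab E_ab incl_additive] by simp

lemma K_ksgn: "x .: K ==> ksgn K n x = ksgn E n x"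
 by (simp add: ksgn_def K_neg)

lemma K_add[simp]: "x .: K ==> y .: K ==> x \<oplus> y .: K"
 using K.M.a_closed by (simp add: K_ops)
lemma K_mult[simp]: "x .: K ==> y .: K ==> x \<otimes> y .: K"
 using K.A.m_closed by (simp add: K_ops)
lemma K_zero[simp]: "\<zero> .: K"
 using K.M.zero_closed by (simp add: K_ops)
lemma K_one[simp]: "\<one> .: K"
 using K.A.one_closed by (simp add: K_ops)
lemma K_smult[simp]: "r .: R ==> x .: K ==> r \<odot> x .: K"
 using K.smult_closed by (simp add: K_ops)
lemma K_ksgn_closed[simp]: "x .: K ==> ksgn E n x .: K"
 using K.M.ksgn_closed[of x n] K_ksgn by simp
lemma K_mult_grade: "x \<in> grade K i ==> y \<in> grade K j ==> x \<otimes> y \<in> grade K (i + j)"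
 using K.mult_grade by (simp add: K_ops)
lemma K_inv_homogeneous: "x \<in> grade K p ==> grade_inv K 1 x = ksgn E p x"
 using K.grade_inv_homogeneous[of x p 1] K_ksgn K.grade_carrier by simp

lemma pow_closed[simp, intro]: "v [^] (e::nat) .: E"
 by simp

lemma pow_grade: "v [^] e \<in> grade E (k * e)"
proof (induction e)
 case 0
 thus ?case using E.one_grade by simp
next
 case (Suc e)
 thus ?case using E.mult_grade[OF Suc v_grade] by (simp add: add.commute)
qed

lemma pow_odd: "odd k ==> 2 \<le> e ==> v [^] (e::nat) = \<zero>"
proof (induction e)
 case (Suc e)
 show ?case
 proof (cases "e = 1")
  case True
  thus ?thesis using E.odd_square_zero[OF half v_grade Suc(2)] by simp
 qed (use Suc in simp)
qed simp

lemma ext_induct [consumes 1, case_names power add]: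
 assumes u: "u .: E"
  and p: "!!a p (e::nat). a \<in> grade K p ==> even k \<or> e \<le> 1 ==> P (a \<otimes> v [^] e)"
  and a: "!!x y. x .: E ==> y .: E ==> P x ==> P y ==> P (x \<oplus> y)"
 shows "P u"
proof -
 have p': "P (a \<otimes> v [^] e)" if "a .: K" "even k \<or> e \<le> 1" for a and e :: nat
  using that(1)
 proof (induction a rule: K.graded_induct)
  case (homogeneous n x)
  thus ?case using p that(2) by blast
 next
  case (add x y)
  thus ?case using a[of "x \<otimes> v [^] e" "y \<otimes> v [^] e"]
   by (simp add: K_ops E.A.l_distr)
 qed
 have cfK: "cf e u .: K" for e using additive_closed[OF cf_additive u] .
 have "P (finsum E (%e. cf e u \<otimes> v [^] e) I)" if "finite I" "I \<subseteq> {e. cf e u ~= \<zero>}" for I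
  using that
 proof (induction I)
  case empty
  thus ?case using p'[of "\<zero>" 0] by simp
 next
  case (insert i I)
  have "even k \<or> i \<le> 1"
  proof (rule ccontr)
   assume "\<not> (even k \<or> i \<le> 1)"
   thus False using cf_odd[OF u, of i] insert by simp
  qed
  hence "P (cf i u \<otimes> v [^] i)" using p' cfK by simp
  thus ?case using insert cfK by (subst E.M.finsum_insert) (auto intro!: a)
 qed
 thus ?thesis using cf_expand[OF u] cf_finite[OF u] by (metis subset_refl)
qed

lemma ext_additive_eq:
 assumes "abelian_group G" "additive_map E G h" "additive_map E G g"
  and "!!a p (e::nat). a \<in> grade K p ==> even k \<or> e \<le> 1 ==> h (a \<otimes> v [^] e) = g (a \<otimes> v [^] e)"
  and "u .: E"
 shows "h u = g u"
 using assms(5)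
 by (induction u rule: ext_induct) (use assms additive_add[OF assms(2)] additive_add[OF assms(3)] in auto)

definition coeff_ext :: "('g, 'h) ring_scheme => (nat => 'u => 'g) => 'u => 'g" where
 "coeff_ext G h u = lin_ext K G h (%e. cf e u)"

lemma cf_fin_funs: "u .: E ==> (%e. cf e u) \<in> fin_funs UNIV K"
 using additive_closed[OF cf_additive] cf_finite by (auto simp: fin_funs_def K_ops)

lemma coeff_ext_additive:
 assumes "abelian_group G" "!!e. additive_map K G (h e)"
 shows "additive_map E G (coeff_ext G h)"
proof -
 define Q :: "(nat => 'u) ring" where
  "Q = \<lparr>carrier = fin_funs UNIV K, mult = undefined, one = undefined, zero = (%m. \<zero>\<^bsub>K\<^esub>),
    add = (%f g m. f m \<oplus>\<^bsub>K\<^esub> g m)\<rparr>"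
 have Q: "fun_group Q UNIV K" by (simp add: fun_group_def Q_def)
 have "additive_map E Q (%u e. cf e u)"
  using cf_fin_funs additive_add[OF cf_additive] by (auto simp: additive_map_def Q_def)
 moreover have "additive_map Q G (lin_ext K G h)"
  using lin_ext_additive[OF K_ab assms(1) _ Q] assms(2) by simp
 ultimately show ?thesis unfolding coeff_ext_def by (rule additive_comp)
qed

lemma coeff_ext_power:
 assumes "abelian_group G" "!!e. additive_map K G (h e)" "a .: K" "even k \<or> f \<le> 1"
 shows "coeff_ext G h (a \<otimes> v [^] f) = h f a"
proof -
 have "(%e. cf e (a \<otimes> v [^] f)) = fs_single K f a"
  using assms(3,4) by (auto simp: fs_single_def cf_power K_ops)
 thus ?thesis
  unfolding coeff_ext_def using lin_ext_single[OF K_ab assms(1,2,3)] by simp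
qed

lemma coeff_ext_grade:
 assumes G: "graded_module S G" and "u \<in> grade E n"
  and h: "!!e a. a \<in> grade K (n - e * k) ==> e * k \<le> n ==> h e a \<in> grade G l"
 shows "coeff_ext G h u \<in> grade G l"
proof -
 interpret G: graded_module S G by fact
 have "!!e. cf e u ~= \<zero> ==> e * k \<le> n" using cf_large[OF assms(2)] by (meson not_le_imp_less)
 thus ?thesis
  unfolding coeff_ext_def lin_ext_def
  by (intro G.grade_finsum h) (auto simp: K_ops intro: cf_grade[OF assms(2)])
qed

lemma cf_K: "a .: K ==> cf e a = (if e = 0 then a else \<zero>)"
 using cf_power[of a 0 e] by simp

lemma cf_zero: "cf e \<zero> = \<zero>"
 using cf_K[OF K_zero] by simp

lemma pow_comm:
 assumes "b \<in> grade E q"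
 shows "v [^] e \<otimes> b = ksgn E (k * e * q) (b \<otimes> v [^] e)"
 using E.graded_comm[OF pow_grade assms] by simp

lemma power_mult:
 assumes "a .: K" "b \<in> grade K q"
 shows "(a \<otimes> v [^] (e::nat)) \<otimes> (b \<otimes> v [^] (f::nat)) =
  ksgn E (k * e * q) ((a \<otimes> b) \<otimes> v [^] (e + f))"
proof -
 have bE: "b .: E" "a .: E" using assms by auto
 have "(a \<otimes> v [^] e) \<otimes> (b \<otimes> v [^] f) =
  a \<otimes> ((v [^] e \<otimes> b) \<otimes> v [^] f)"
  using bE by (simp add: E.A.m_assoc)
 also have "v [^] e \<otimes> b = ksgn E (k * e * q) (b \<otimes> v [^] e)"
  using pow_comm KEg assms(2) by blast
 finally show ?thesis
  using bE by (simp add: E.A.ksgn_mult_left E.A.ksgn_mult_right E.A.m_assoc E.A.nat_pow_mult[symmetric])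
qed

end

subsection \<open>Extending the differential\<close>

locale one_gen_diff = one_gen_ext R K E v k cf + Kd: cdga R K d
 for R :: "('r, 'e) ring_scheme" and K :: "('r, 'u) gmod" and E :: "('r, 'u) gmod" (structure) and v k cf and d +
 fixes z :: 'u
 assumes z_grade: "z \<in> grade K (Suc k)" and dz: "d z = \<zero>"
begin

lemma z_carrier[simp, intro]: "z .: E" "z .: K"
 using z_grade K.grade_carrier by auto

text \<open>\<open>pow_diff e\<close> is the differential of \<open>v\<^sup>e\<close>.\<close>

fun pow_diff :: "nat => 'u" where
 "pow_diff 0 = \<zero>"
| "pow_diff (Suc e) = pow_diff e \<otimes> v \<oplus> ksgn E (k * e) (v [^] e \<otimes> z)"

lemma pow_diff_closed[simp, intro]: "pow_diff e .: E"
 by (induction e) auto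

lemma pow_diff_grade: "pow_diff e \<in> grade E (Suc (k * e))"
proof (induction e)
 case 0
 thus ?case by simp
next
 case (Suc e)
 have "pow_diff e \<otimes> v \<in> grade E (Suc (k * e) + k)" using E.mult_grade[OF Suc v_grade] .
 moreover have "v [^] e \<otimes> z \<in> grade E (k * e + Suc k)"
  using E.mult_grade[OF pow_grade] KEg z_grade by blast
 ultimately show ?case by (auto simp: add.commute)
qed

lemma pow_diff_add:
 "pow_diff (e + f) = pow_diff e \<otimes> v [^] f \<oplus> ksgn E (k * e) (v [^] e \<otimes> pow_diff f)"
proof (induction f)
 case 0
 thus ?case by simp
next
 case (Suc f)
 have "pow_diff (e + Suc f) = (pow_diff e \<otimes> v [^] f \<oplus> ksgn E (k * e) (v [^] e \<otimes> pow_diff f)) \<otimes> v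
   \<oplus> ksgn E (k * (e + f)) (v [^] (e + f) \<otimes> z)"
  using Suc by simp
 thus ?case
  by (simp add: E.A.l_distr E.A.r_distr E.A.m_assoc E.A.ksgn_mult_left E.A.ksgn_mult_right E.M.ksgn_ksgn
    E.M.ksgn_add E.M.a_assoc E.A.nat_pow_mult[symmetric] add_mult_distrib2)
qed

lemma pow_diff_odd:
 assumes "odd k" "2 \<le> e"
 shows "pow_diff e = \<zero>"
 using assms(2)
proof (induction e)
 case (Suc e)
 show ?case
 proof (cases "e = 1")
  case True
  have "v \<otimes> z = z \<otimes> v"
   using E.graded_comm[OF v_grade KEg[OF z_grade]] assms(1) by (simp add: ksgn_def)
  thus ?thesis using True assms(1) by (simp add: ksgn_def E.M.r_neg)
 qed (use Suc pow_odd[OF assms(1), of e] in simp)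
qed simp

lemma pow_diff_coeff: "\<exists>c\<in>carrier K. pow_diff (Suc e) = c \<otimes> v [^] e"
proof (induction e)
 case 0
 show ?case by (rule bexI[of _ z]) (auto simp: ksgn_def)
next
 case (Suc e)
 then obtain c where c: "c .: K" "pow_diff (Suc e) = c \<otimes> v [^] e" by blast
 define w where "w = v [^] Suc e"
 have w: "w .: E" by (simp add: w_def)
 have "pow_diff (Suc (Suc e)) = c \<otimes> w \<oplus> ksgn E (k * Suc e) (w \<otimes> z)"
  unfolding pow_diff.simps(2)[of "Suc e"] c(2) w_def using c(1) by (simp add: E.A.m_assoc)
 moreover have "w \<otimes> z = ksgn E (k * Suc e * Suc k) (z \<otimes> w)"
  unfolding w_def using pow_comm[OF KEg[OF z_grade]] .
 ultimately have "pow_diff (Suc (Suc e)) =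
   (c \<oplus> ksgn E (k * Suc e) (ksgn E (k * Suc e * Suc k) z)) \<otimes> v [^] Suc e"
  using c(1) w unfolding w_def[symmetric] by (simp only: E.A.l_distr E.A.ksgn_mult_left KE z_carrier E.M.ksgn_closed)
 moreover have "c \<oplus> ksgn E (k * Suc e) (ksgn E (k * Suc e * Suc k) z) .: K"
  using c by simp
 ultimately show ?case by blast
qed

lemma dK[simp]: "x .: K ==> d x .: K"
 by (rule Kd.diff_closed)

lemma d_zero[simp]: "d \<zero> = \<zero>"
 using Kd.diff_zero by (simp add: K_ops)

text \<open>On a coefficient \<open>a\<close> of \<open>v\<^sup>e\<close> the extended differential is forced by the Leibniz rule.\<close>

definition diff_coeff :: "nat => 'u => 'u" where
 "diff_coeff e a = d a \<otimes> v [^] e \<oplus> grade_inv K 1 a \<otimes> pow_diff e"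

definition D :: "'u => 'u" where
 "D = coeff_ext E diff_coeff"

lemma diff_coeff_additive: "additive_map K E (diff_coeff e)"
 unfolding diff_coeff_def
 by (rule additiveI)
  (simp_all add: K_ops Kd.diff_add[unfolded K_ops] K.grade_inv_add[unfolded K_ops] E.A.l_distr E.M.a_ac)

lemma D_additive: "additive_map E E D"
 unfolding D_def using coeff_ext_additive[OF E_ab diff_coeff_additive] .

lemmas D_closed[simp, intro] = additive_closed[OF D_additive]
lemmas D_add = additive_add[OF D_additive]
lemmas D_ksgn = additive_ksgn[OF E_ab E_ab D_additive]
lemmas D_zero[simp] = additive_zero[OF E_ab E_ab D_additive]

lemma D_power:
 assumes "a .: K"
 shows "D (a \<otimes> v [^] (e::nat)) = d a \<otimes> v [^] e \<oplus> grade_inv K 1 a \<otimes> pow_diff e"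
proof (cases "even k \<or> e \<le> 1")
 case True
 thus ?thesis
  unfolding D_def using coeff_ext_power[OF E_ab diff_coeff_additive assms True] by (simp add: diff_coeff_def)
next
 case False
 thus ?thesis using pow_odd[of e] pow_diff_odd[of e] assms by simp
qed

lemma D_power_homogeneous:
 assumes "a \<in> grade K p"
 shows "D (a \<otimes> v [^] (e::nat)) = d a \<otimes> v [^] e \<oplus> ksgn E p (a \<otimes> pow_diff e)"
 using assms D_power[of a e] K_inv_homogeneous[OF assms] K.grade_carrier[OF assms]
 by (simp add: E.A.ksgn_mult_left)

lemma D_K: "a .: K ==> D a = d a"
 using D_power[of a 0] by simp

lemma D_pow: "D (v [^] (e::nat)) = pow_diff e"
proof -
 have "\<one> \<in> grade K 0" using K.one_grade by (simp add: K_ops)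
 thus ?thesis
  using D_power_homogeneous[of "\<one>" 0 e] Kd.diff_one by (simp add: K_ops ksgn_def)
qed

lemma D_grade:
 assumes "u \<in> grade E n"
 shows "D u \<in> grade E (Suc n)"
 unfolding D_def
proof (rule coeff_ext_grade[OF E.graded_module_axioms assms])
 fix e a assume a: "a \<in> grade K (n - e * k)" and le: "e * k \<le> n"
 have "d a \<otimes> v [^] e \<in> grade E (Suc (n - e * k) + k * e)"
  using E.mult_grade[OF KEg[OF Kd.diff_grade[OF a]] pow_grade] .
 moreover have "a \<otimes> pow_diff e \<in> grade E ((n - e * k) + Suc (k * e))"
  using E.mult_grade[OF KEg[OF a] pow_diff_grade] .
 moreover have "Suc (n - e * k) + k * e = Suc n" "(n - e * k) + Suc (k * e) = Suc n"
  using le by (simp_all add: mult.commute)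
 ultimately show "diff_coeff e a \<in> grade E (Suc n)"
  using K_inv_homogeneous[OF a] a by (auto simp: diff_coeff_def E.A.ksgn_mult_left)
qed

text \<open>On two powers with coefficients both sides are monomials with computable signs; additivity
 then gives the rule for all elements.\<close>

lemma Leibniz_power:
 assumes a: "a \<in> grade K p" and b: "b \<in> grade K q"
 shows "D ((a \<otimes> v [^] (e::nat)) \<otimes> (b \<otimes> v [^] (f::nat))) =
  D (a \<otimes> v [^] e) \<otimes> (b \<otimes> v [^] f) \<oplus>
  ksgn E (p + k * e) ((a \<otimes> v [^] e) \<otimes> D (b \<otimes> v [^] f))"
proof -
 have c: "a .: K" "b .: K" using a b K.grade_carrier by auto
 have dE: "d a .: E" "d b .: E" "a .: E" "b .: E" using c by auto
 let ?e = "v [^] e" and ?f = "v [^] f"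
 define t1 where "t1 = d a \<otimes> (b \<otimes> (?e \<otimes> ?f))"
 define t2 where "t2 = a \<otimes> (d b \<otimes> (?e \<otimes> ?f))"
 define t3 where "t3 = a \<otimes> (b \<otimes> (pow_diff e \<otimes> ?f))"
 define t4 where "t4 = a \<otimes> (b \<otimes> (?e \<otimes> pow_diff f))"
 have t: "t1 .: E" "t2 .: E" "t3 .: E" "t4 .: E"
  using dE by (auto simp: t1_def t2_def t3_def t4_def)
 have dab: "d (a \<otimes> b) = d a \<otimes> b \<oplus> ksgn E p (a \<otimes> d b)"
  using Kd.diff_mult[OF a c(2)] c K_ksgn[of "a \<otimes> d b" p] by (simp add: K_ops)
 note nf = E.A.l_distr E.A.r_distr E.A.ksgn_mult_left E.A.ksgn_mult_right E.M.ksgn_ksgn E.M.ksgn_add E.A.m_assoc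
 have L: "D ((a \<otimes> ?e) \<otimes> (b \<otimes> ?f)) =
   ksgn E (k * e * q) t1 \<oplus> ksgn E (k * e * q + p) t2 \<oplus>
   (ksgn E (k * e * q + (p + q)) t3 \<oplus> ksgn E (k * e * q + (p + q) + k * e) t4)"
 proof -
  have "D ((a \<otimes> ?e) \<otimes> (b \<otimes> ?f)) =
   ksgn E (k * e * q) (d (a \<otimes> b) \<otimes> v [^] (e + f) \<oplus>
    ksgn E (p + q) ((a \<otimes> b) \<otimes> pow_diff (e + f)))"
   using c D_power_homogeneous[OF K_mult_grade[OF a b], of "e + f"]
   by (simp add: power_mult[OF c(1) b] D_ksgn)
  thus ?thesis
   using dE unfolding dab pow_diff_add t1_def t2_def t3_def t4_def
   by (simp add: nf E.A.nat_pow_mult[symmetric] add.assoc)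
 qed
 have com1: "pow_diff e \<otimes> b = ksgn E (Suc (k * e) * q) (b \<otimes> pow_diff e)"
  using E.graded_comm[OF pow_diff_grade KEg[OF b]] .
 have com2: "?e \<otimes> d b = ksgn E (k * e * Suc q) (d b \<otimes> ?e)"
  using pow_comm[OF KEg[OF Kd.diff_grade[OF b]]] .
 have com3: "?e \<otimes> b = ksgn E (k * e * q) (b \<otimes> ?e)"
  using pow_comm[OF KEg[OF b]] .
 have sw: "x \<otimes> (y \<otimes> w) = ksgn E s (y \<otimes> (x \<otimes> w))"
  if "x \<otimes> y = ksgn E s (y \<otimes> x)" "x .: E" "y .: E" "w .: E" for x y w s
  using that by (metis E.A.ksgn_mult_left E.A.m_assoc E.A.m_closed)
 have R1: "D (a \<otimes> ?e) \<otimes> (b \<otimes> ?f) =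
   ksgn E (k * e * q) t1 \<oplus> ksgn E (p + Suc (k * e) * q) t3"
  using dE unfolding D_power_homogeneous[OF a] t1_def t3_def
  by (simp only: nf E.M.a_closed E.A.m_closed pow_closed pow_diff_closed E.M.ksgn_closed
    sw[OF com3] sw[OF com1])
 have R2: "ksgn E (p + k * e) ((a \<otimes> ?e) \<otimes> D (b \<otimes> ?f)) =
   ksgn E (p + k * e + k * e * Suc q) t2 \<oplus> ksgn E (p + k * e + (q + k * e * q)) t4"
  using dE unfolding D_power_homogeneous[OF b] t2_def t4_def
  by (simp only: nf E.M.a_closed E.A.m_closed pow_closed pow_diff_closed E.M.ksgn_closed
    sw[OF com3] sw[OF com2])
 have "p + k * e + k * e * Suc q = 2 * (k * e) + (k * e * q + p)" by simp
 hence s2: "ksgn E (p + k * e + k * e * Suc q) t2 = ksgn E (k * e * q + p) t2"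
  by (intro ksgn_cong) (simp only: even_add even_mult_iff even_numeral simp_thms)
 have s3: "ksgn E (p + Suc (k * e) * q) t3 = ksgn E (k * e * q + (p + q)) t3" by (rule ksgn_cong) auto
 have s4: "ksgn E (p + k * e + (q + k * e * q)) t4 = ksgn E (k * e * q + (p + q) + k * e) t4"
  by (rule arg_cong[where f = "%n. ksgn E n t4"]) simp
 show ?thesis unfolding L R1 R2 s2 s3 s4 using t by (simp add: E.M.a_ac)
qed

lemma Leibniz:
 assumes "x \<in> grade E i" "y .: E"
 shows "D (x \<otimes> y) = D x \<otimes> y \<oplus> ksgn E i (x \<otimes> D y)"
proof -
 have add1: "additive_map E E (%x. D x \<otimes> y \<oplus> grade_inv E 1 x \<otimes> D y)" if "y .: E" for y
  by (rule additiveI) (use that in \<open>simp_all add: D_add E.grade_inv_add E.A.l_distr E.M.a_ac\<close>)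
 have add2: "additive_map E E (%y. D x \<otimes> y \<oplus> grade_inv E 1 x \<otimes> D y)" if "x .: E" for x
  by (rule additiveI) (use that in \<open>simp_all add: D_add E.A.r_distr E.M.a_ac\<close>)
 have base: "D (x \<otimes> y) = D x \<otimes> y \<oplus> grade_inv E 1 x \<otimes> D y"
  if "x .: E" "y .: E" for x y
 proof (rule ext_additive_eq[OF E_ab _ add1[OF that(2)] _ that(1)])
  fix a p and e :: nat assume a: "a \<in> grade K p"
  let ?x = "a \<otimes> v [^] e"
  have x: "?x \<in> grade E (p + k * e)" using E.mult_grade[OF KEg[OF a] pow_grade] .
  hence xc: "?x .: E" using E.grade_carrier by blast
  show "D (?x \<otimes> y) = D ?x \<otimes> y \<oplus> grade_inv E 1 ?x \<otimes> D y"
  proof (rule ext_additive_eq[OF E_ab _ add2[OF xc] _ that(2)])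
   fix b q and f :: nat assume b: "b \<in> grade K q"
   have "grade_inv E 1 ?x = ksgn E (p + k * e) ?x"
    using E.grade_inv_homogeneous[OF x, of 1] by simp
   thus "D (?x \<otimes> (b \<otimes> v [^] f)) = D ?x \<otimes> (b \<otimes> v [^] f) \<oplus>
     grade_inv E 1 ?x \<otimes> D (b \<otimes> v [^] f)"
    using Leibniz_power[OF a b, of e f] xc b by (simp add: E.A.ksgn_mult_left)
  qed (rule additive_comp[OF E.mult_additive_right[OF xc] D_additive])
 qed (rule additive_comp[OF E.mult_additive_left[OF that(2)] D_additive])
 have xc: "x .: E" using assms(1) E.grade_carrier by blast
 show ?thesis
  using base[OF xc assms(2)] E.grade_inv_homogeneous[OF assms(1), of 1] xc assms(2)
  by (simp add: E.A.ksgn_mult_left)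
qed

lemma D_v: "D v = z"
 using D_pow[of 1] by (simp add: ksgn_def)

lemma D_pow_diff: "D (pow_diff e) = \<zero>"
proof (induction e)
 case 0
 thus ?case by simp
next
 case (Suc e)
 have "D (pow_diff e \<otimes> v) = ksgn E (Suc (k * e)) (pow_diff e \<otimes> z)"
  using Leibniz[OF pow_diff_grade v_carrier] Suc by (simp add: D_v)
 moreover have "D (v [^] e \<otimes> z) = pow_diff e \<otimes> z"
  using Leibniz[OF pow_grade z_carrier(1), of e] dz by (simp add: D_pow D_K)
 ultimately show ?case
  by (simp add: D_add D_ksgn) (simp add: ksgn_def E.M.r_neg E.M.l_neg)
qed

lemma D_D:
 assumes "u .: E"
 shows "D (D u) = \<zero>"
proof (rule ext_additive_eq[OF E_ab additive_comp[OF D_additive D_additive] _ _ assms])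
 show "additive_map E E (%u. \<zero>)" by (rule additiveI) auto
 fix a p and e :: nat assume a: "a \<in> grade K p"
 have c: "a .: K" using a K.grade_carrier by blast
 have "D (d a \<otimes> v [^] e) = ksgn E (Suc p) (d a \<otimes> pow_diff e)"
  using D_power_homogeneous[OF Kd.diff_grade[OF a], of e] Kd.diff_diff[OF c] c by (simp add: K_ops)
 moreover have "D (a \<otimes> pow_diff e) = d a \<otimes> pow_diff e"
  using Leibniz[OF KEg[OF a] pow_diff_closed, of e] c by (simp add: D_pow_diff D_K)
 ultimately show "D (D (a \<otimes> v [^] e)) = \<zero>"
  using c by (simp add: D_power_homogeneous[OF a] D_add D_ksgn) (simp add: ksgn_def E.M.r_neg E.M.l_neg)
qed

lemma D_smult:
 assumes "r .: R" "u .: E"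
 shows "D (r \<odot> u) = r \<odot> D u"
proof (rule ext_additive_eq[OF E_ab additive_comp[OF E.smult_additive D_additive] additive_comp[OF D_additive E.smult_additive] _ assms(2)])
 fix a p and e :: nat assume a: "a \<in> grade K p"
 have c: "a .: K" using a K.grade_carrier by blast
 have ra: "r \<odot> a \<in> grade K p" using K.grade_smult[OF assms(1) a] by (simp add: K_ops)
 have dra: "d (r \<odot> a) = r \<odot> d a" using Kd.diff_smult[OF assms(1) c] by (simp add: K_ops)
 have eq: "r \<odot> (a \<otimes> v [^] e) = (r \<odot> a) \<otimes> v [^] e"
  using c assms(1) by (simp add: E.smult_mult_left)
 show "D (r \<odot> (a \<otimes> v [^] e)) = r \<odot> D (a \<otimes> v [^] e)"
  using c assms(1) unfolding eq D_power_homogeneous[OF a] D_power_homogeneous[OF ra] dra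
  by (simp add: E.smult_mult_left E.smult_r_distr E.ksgn_smult)
qed (use assms in auto)

lemma D_cdga: "cdga R E D"
 by (intro cdga.intro E.comm_graded_algebra_axioms cdga_axioms.intro)
  (use D_add D_smult D_grade D_D Leibniz in auto)

text \<open>A morphism to \<open>B\<close> extends once the image \<open>b\<close> of \<open>v\<close> is chosen such that \<open>dB b\<close> is the
 image of \<open>d v\<close>; if \<open>v\<close> is odd, this uses \<open>b\<^sup>2 = 0\<close>.\<close>

context
 fixes B :: "('r, 'b) gmod" and dB :: "'b => 'b" and \<phi> :: "'u => 'b" and b :: 'b
 assumes B: "cdga R B dB" and phi: "cdga_hom R K d B dB \<phi>"
  and b_grade: "b \<in> grade B k" and db: "dB b = \<phi> z"
begin

interpretation B: cdga R B dB by (rule B)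

lemma phi_closed: "x .: K ==> \<phi> x .: B"
 and phi_mult: "x .: K ==> y .: K ==> \<phi> (x \<otimes> y) = \<phi> x \<otimes>\<^bsub>B\<^esub> \<phi> y"
 and phi_add: "x .: K ==> y .: K ==> \<phi> (x \<oplus> y) = \<phi> x \<oplus>\<^bsub>B\<^esub> \<phi> y"
 and phi_one: "\<phi> \<one> = \<one>\<^bsub>B\<^esub>"
 and phi_smult: "r .: R ==> x .: K ==> \<phi> (r \<odot> x) = r \<odot>\<^bsub>B\<^esub> \<phi> x"
 and phi_grade: "x \<in> grade K n ==> \<phi> x \<in> grade B n"
 and phi_diff: "x .: K ==> \<phi> (d x) = dB (\<phi> x)"
 using phi unfolding cdga_hom_def ring_hom_def by (auto simp: K_ops image_subset_iff)

lemma b_carrier[simp, intro]: "b .: B"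
 using b_grade B.grade_carrier by blast

lemma b_pow_odd: "odd k ==> 2 \<le> e ==> b [^]\<^bsub>B\<^esub> (e::nat) = \<zero>\<^bsub>B\<^esub>"
proof (induction e)
 case (Suc e)
 show ?case
 proof (cases "e = 1")
  case True
  thus ?thesis using B.odd_square_zero[OF half b_grade Suc(2)] by simp
 qed (use Suc in simp)
qed simp

lemma b_pow_grade: "b [^]\<^bsub>B\<^esub> e \<in> grade B (k * e)"
proof (induction e)
 case 0
 thus ?case using B.one_grade by simp
next
 case (Suc e)
 thus ?case using B.mult_grade[OF Suc b_grade] by (simp add: add.commute)
qed

definition Phi :: "'u => 'b" where
 "Phi = coeff_ext B (%e a. \<phi> a \<otimes>\<^bsub>B\<^esub> b [^]\<^bsub>B\<^esub> e)"

lemma Phi_coeff_additive: "additive_map K B (%a. \<phi> a \<otimes>\<^bsub>B\<^esub> b [^]\<^bsub>B\<^esub> (e::nat))"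
 by (rule additiveI) (simp_all add: K_ops phi_add phi_closed B.A.l_distr)

lemma Phi_additive: "additive_map E B Phi"
 unfolding Phi_def using coeff_ext_additive[OF B.M.ab Phi_coeff_additive] .

lemmas Phi_closed[simp] = additive_closed[OF Phi_additive]
lemmas Phi_add = additive_add[OF Phi_additive]
lemmas Phi_ksgn = additive_ksgn[OF E_ab B.M.ab Phi_additive]
lemmas Phi_zero[simp] = additive_zero[OF E_ab B.M.ab Phi_additive]

lemma Phi_power:
 assumes "a .: K"
 shows "Phi (a \<otimes> v [^] (e::nat)) = \<phi> a \<otimes>\<^bsub>B\<^esub> b [^]\<^bsub>B\<^esub> e"
proof (cases "even k \<or> e \<le> 1")
 case True
 thus ?thesis
  unfolding Phi_def using coeff_ext_power[OF B.M.ab Phi_coeff_additive assms True] by simp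
next
 case False
 thus ?thesis using pow_odd[of e] b_pow_odd[of e] assms by (simp add: phi_closed)
qed

lemma Phi_K: "a .: K ==> Phi a = \<phi> a"
 using Phi_power[of a 0] by (simp add: phi_closed)

lemma Phi_pow: "Phi (v [^] (e::nat)) = b [^]\<^bsub>B\<^esub> e"
 using Phi_power[OF K_one, of e] by (simp add: phi_one)

lemma Phi_v: "Phi v = b"
 using Phi_pow[of 1] by simp

lemma Phi_grade:
 assumes "u \<in> grade E n"
 shows "Phi u \<in> grade B n"
 unfolding Phi_def
proof (rule coeff_ext_grade[OF B.graded_module_axioms assms])
 fix e a assume a: "a \<in> grade K (n - e * k)" and le: "e * k \<le> n"
 show "\<phi> a \<otimes>\<^bsub>B\<^esub> b [^]\<^bsub>B\<^esub> e \<in> grade B n"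
  using B.mult_grade[OF phi_grade[OF a] b_pow_grade[of e]] le by (simp add: mult.commute)
qed

lemma Phi_mult_power:
 assumes a: "a .: K" and c: "c \<in> grade K q"
 shows "Phi ((a \<otimes> v [^] (e::nat)) \<otimes> (c \<otimes> v [^] (f::nat))) =
  Phi (a \<otimes> v [^] e) \<otimes>\<^bsub>B\<^esub> Phi (c \<otimes> v [^] f)"
proof -
 have cK: "c .: K" using c K.grade_carrier by blast
 let ?a = "\<phi> a" and ?c = "\<phi> c" and ?e = "b [^]\<^bsub>B\<^esub> e" and ?f = "b [^]\<^bsub>B\<^esub> f"
 have cl: "?a .: B" "?c .: B" "?e .: B" "?f .: B" using a cK phi_closed by auto
 have "?e \<otimes>\<^bsub>B\<^esub> ?c = ksgn B (k * e * q) (?c \<otimes>\<^bsub>B\<^esub> ?e)"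
  using B.graded_comm[OF b_pow_grade phi_grade[OF c]] .
 hence sw: "?e \<otimes>\<^bsub>B\<^esub> (?c \<otimes>\<^bsub>B\<^esub> ?f) = ksgn B (k * e * q) (?c \<otimes>\<^bsub>B\<^esub> (?e \<otimes>\<^bsub>B\<^esub> ?f))"
  using cl by (metis B.A.ksgn_mult_left B.A.m_assoc B.A.m_closed)
 show ?thesis
  using cl a cK
  by (simp add: power_mult[OF a c] Phi_ksgn Phi_power phi_mult B.A.m_assoc sw B.A.ksgn_mult_right B.A.nat_pow_mult[symmetric])
qed

lemma Phi_mult:
 assumes "x .: E" "y .: E"
 shows "Phi (x \<otimes> y) = Phi x \<otimes>\<^bsub>B\<^esub> Phi y"
proof (rule ext_additive_eq[OF B.M.ab _ _ _ assms(1)])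
 fix a p and e :: nat assume a: "a \<in> grade K p"
 have aK: "a .: K" using a K.grade_carrier by blast
 show "Phi ((a \<otimes> v [^] e) \<otimes> y) = Phi (a \<otimes> v [^] e) \<otimes>\<^bsub>B\<^esub> Phi y"
 proof (rule ext_additive_eq[OF B.M.ab _ _ _ assms(2)])
  fix c q and f :: nat assume c: "c \<in> grade K q"
  show "Phi ((a \<otimes> v [^] e) \<otimes> (c \<otimes> v [^] f)) =
    Phi (a \<otimes> v [^] e) \<otimes>\<^bsub>B\<^esub> Phi (c \<otimes> v [^] f)"
   by (rule Phi_mult_power[OF aK c])
 qed (use aK in \<open>auto intro!: additive_comp[OF E.mult_additive_right Phi_additive] additive_comp[OF Phi_additive B.mult_additive_right]\<close>)
qed (use assms in \<open>auto intro!: additive_comp[OF E.mult_additive_left Phi_additive] additive_comp[OF Phi_additive B.mult_additive_left]\<close>)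

lemma Phi_pow_diff: "Phi (pow_diff e) = dB (b [^]\<^bsub>B\<^esub> e)"
proof (induction e)
 case 0
 thus ?case by simp
next
 case (Suc e)
 have "dB (b [^]\<^bsub>B\<^esub> Suc e) = dB (b [^]\<^bsub>B\<^esub> e) \<otimes>\<^bsub>B\<^esub> b \<oplus>\<^bsub>B\<^esub> ksgn B (k * e) (b [^]\<^bsub>B\<^esub> e \<otimes>\<^bsub>B\<^esub> dB b)"
  using B.diff_mult[OF b_pow_grade b_carrier, of e] by simp
 thus ?case
  using Suc by (simp add: Phi_add Phi_ksgn Phi_mult Phi_v Phi_pow Phi_K db)
qed

lemma Phi_diff:
 assumes "u .: E"
 shows "Phi (D u) = dB (Phi u)"
proof (rule ext_additive_eq[OF B.M.ab additive_comp[OF D_additive Phi_additive]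
   additive_comp[OF Phi_additive B.diff_additive] _ assms])
 fix a p and e :: nat assume a: "a \<in> grade K p"
 have aK: "a .: K" using a K.grade_carrier by blast
 have "dB (\<phi> a \<otimes>\<^bsub>B\<^esub> b [^]\<^bsub>B\<^esub> e) = dB (\<phi> a) \<otimes>\<^bsub>B\<^esub> b [^]\<^bsub>B\<^esub> e \<oplus>\<^bsub>B\<^esub> ksgn B p (\<phi> a \<otimes>\<^bsub>B\<^esub> dB (b [^]\<^bsub>B\<^esub> e))"
  using B.diff_mult[OF phi_grade[OF a]] by simp
 thus "Phi (D (a \<otimes> v [^] e)) = dB (Phi (a \<otimes> v [^] e))"
  using aK phi_closed[OF aK]
  by (simp add: D_power_homogeneous[OF a] Phi_add Phi_ksgn Phi_power Phi_mult Phi_K Phi_pow Phi_pow_diff phi_diff)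
qed

lemma Phi_smult:
 assumes "r .: R" "u .: E"
 shows "Phi (r \<odot> u) = r \<odot>\<^bsub>B\<^esub> Phi u"
proof -
 have "r \<odot> u = (r \<odot> \<one>) \<otimes> u" using E.smult_as_mult assms by blast
 hence "Phi (r \<odot> u) = (r \<odot>\<^bsub>B\<^esub> \<one>\<^bsub>B\<^esub>) \<otimes>\<^bsub>B\<^esub> Phi u"
  using assms by (simp add: Phi_mult Phi_K phi_smult phi_one)
 thus ?thesis using B.smult_as_mult[OF assms(1) Phi_closed[OF assms(2)]] by simp
qed

lemma Phi_cdga_hom: "cdga_hom R E D B dB Phi"
 unfolding cdga_hom_def
proof (intro conjI ballI allI)
 show "Phi \<in> ring_hom E B"
  by (rule ring_hom_memI) (simp_all add: Phi_mult Phi_add Phi_K phi_one)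
 show "Phi ` grade E n \<subseteq> grade B n" for n
  using Phi_grade by blast
qed (simp_all add: Phi_smult Phi_diff)

end

theorem extend_morphism:
 fixes B :: "('r, 'b) gmod"
 assumes "cdga R B dB" "cdga_hom R K d B dB \<phi>" "b \<in> grade B k" "dB b = \<phi> z"
 obtains d' \<phi>' where "cdga R E d'" "cdga_hom R E d' B dB \<phi>'"
  "!!a. a .: K ==> d' a = d a" "!!a. a .: K ==> \<phi>' a = \<phi> a" "d' v = z" "\<phi>' v = b"
 by (rule that[OF D_cdga Phi_cdga_hom[OF assms]]) (simp_all add: D_K D_v Phi_K[OF assms] Phi_v[OF assms])

end

subsection \<open>The last generator of a free extension\<close>

context free_gens
begin

definition gen :: "nat => nat multiset => 'a" where
 "gen j = fs_single A {#j#} \<one>"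

definition gen_coeff :: "nat => nat => (nat multiset => 'a) => nat multiset => 'a" where
 "gen_coeff j e u = (%m. if j \<in># m then \<zero> else u (m + replicate_mset e j))"

lemma monomials_mono: "X \<subseteq> Y ==> monomials dg X \<subseteq> monomials dg Y"
 by (auto simp: monomials_def)

lemma U_carrier_mono: "X \<subseteq> Y ==> carrier (U X) \<subseteq> carrier (U Y)"
 using monomials_mono[of X Y] by (auto simp: U_simps fin_funs_def)

lemma U_grade_mono: "X \<subseteq> Y ==> grade (U X) n \<subseteq> grade (U Y) n"
 using U_carrier_mono[of X Y] by (auto simp: U_simps)

lemma U_grade_restrict: "u \<in> grade (U Y) n ==> u .: U X ==> u \<in> grade (U X) n"
 by (auto simp: U_simps)

lemma U_ops: "mult (U X) = mult (U Y)" "add (U X) = add (U Y)" "zero (U X) = zero (U Y)"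
 "one (U X) = one (U Y)" "smult (U X) = smult (U Y)"
 by (simp_all add: gen_ext_def)

lemma U_finitely_many_gens:
 assumes "u .: U X"
 obtains X' where "finite X'" "X' \<subseteq> X" "u .: U X'"
proof
 let ?X' = "\<Union>m\<in>{m. u m ~= \<zero>}. set_mset m"
 show "finite ?X'" using assms by (auto simp: U_simps fin_funs_finite)
 show "?X' \<subseteq> X" using assms by (auto simp: U_simps fin_funs_def monomials_def)
 show "u .: U ?X'"
  using assms by (auto simp: U_simps fin_funs_def monomials_def)
qed

lemma gen_monomial: "j \<in> X ==> {#j#} \<in> monomials dg X"
 by (auto simp: monomials_def odd_clash_def)

lemma gen_grade: "j \<in> X ==> gen j \<in> grade (U X) (dg j)"
 using U_single_grade[OF gen_monomial one_grade, of j X] by (simp add: gen_def)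

lemma odd_clash_add_replicate:
 assumes "j \<notin># m" "\<not> odd_clash dg m" "even (dg j) \<or> e \<le> 1"
 shows "\<not> odd_clash dg (m + replicate_mset e j)"
 unfolding odd_clash_def
proof safe
 fix i assume i: "odd (dg i)" "2 \<le> count (m + replicate_mset e j) i"
 show False
 proof (cases "i = j")
  case True
  thus ?thesis using assms i by (auto simp: not_in_iff)
 next
  case False
  thus ?thesis using assms(2) i by (auto simp: odd_clash_def)
 qed
qed

lemma gen_pow:
 assumes "j \<in> Y" "even (dg j) \<or> e \<le> 1"
 shows "gen j [^]\<^bsub>U Y\<^esub> e = fs_single A (replicate_mset e j) \<one>"
 using assms(2)
proof (induction e)
 case 0
 thus ?case by (simp add: U_simps)
next
 case (Suc e)
 have e: "replicate_mset i j \<in> monomials dg Y" if "even (dg j) \<or> i \<le> 1" for i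
  using odd_clash_add_replicate[of j "{#}" i] that assms(1) by (auto simp: monomials_def odd_clash_def split: if_splits)
 have *: "even (dg j) \<or> e \<le> 1" using Suc.prems by auto
 have inv: "inversions dg (replicate_mset e j) {#j#} = 0"
  by (induction e) (auto simp: inversions_def)
 have nc: "\<not> odd_clash dg (replicate_mset e j + {#j#})"
  using e[OF Suc.prems] by (simp add: monomials_def)
 have "gen j [^]\<^bsub>U Y\<^esub> Suc e = fs_single A (replicate_mset e j) \<one> \<otimes>\<^bsub>U Y\<^esub> fs_single A {#j#} \<one>"
  using Suc.IH[OF *] by (simp add: gen_def)
 also have "\<dots> = fs_single A (replicate_mset (Suc e) j) (ext_twist A dg (replicate_mset e j) {#j#} \<one> \<one>)"
  using U_single_mult[OF e[OF *] gen_monomial[OF assms(1)] A.one_closed A.one_closed] by simp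
 also have "ext_twist A dg (replicate_mset e j) {#j#} \<one> \<one> = \<one>"
  using nc by (simp add: ext_twist_def inv ksgn_def grade_inv_one)
 finally show ?case .
qed

lemma inversions_last:
 assumes "\<forall>i\<in>X. i < j" "set_mset m \<subseteq> X"
 shows "inversions dg m (replicate_mset e j) = 0"
 using assms(2)
proof (induction m)
 case (add i m)
 hence "i < j" using assms(1) by auto
 hence "{#j' \<in># replicate_mset e j. j' < i \<and> odd (dg j')#} = {#}"
  by (auto simp: filter_mset_eq_conv)
 hence "inversions dg {#i#} (replicate_mset e j) = 0"
  by (simp add: inversions_def)
 moreover have "inversions dg (add_mset i m) (replicate_mset e j) =
   inversions dg {#i#} (replicate_mset e j) + inversions dg m (replicate_mset e j)"
  using inversions_add_left[of dg "{#i#}" m] by simp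
 ultimately show ?case using add by simp
qed simp

lemma single_mult_pow:
 assumes j: "\<forall>i\<in>X. i < j" and m: "m \<in> monomials dg X" and a: "a .: A" and e: "even (dg j) \<or> e \<le> 1"
 shows "fs_single A m a \<otimes>\<^bsub>U (insert j X)\<^esub> gen j [^]\<^bsub>U (insert j X)\<^esub> e =
  fs_single A (m + replicate_mset e j) a"
proof -
 have jm: "j \<notin># m" using m j by (auto simp: monomials_def)
 have nc: "\<not> odd_clash dg (m + replicate_mset e j)"
  using odd_clash_add_replicate[OF jm _ e] m by (auto simp: monomials_def)
 have m': "m \<in> monomials dg (insert j X)" using m monomials_mono by blast
 have r: "replicate_mset e j \<in> monomials dg (insert j X)"
  using odd_clash_mono'[of dg "replicate_mset e j" m] nc by (auto simp: monomials_def split: if_splits)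
 have "ext_twist A dg m (replicate_mset e j) a \<one> = a"
  using nc a inversions_last[OF j, of m e] m by (simp add: ext_twist_def ksgn_def grade_inv_one monomials_def)
 thus ?thesis
  using U_single_mult[OF m' r a A.one_closed] gen_pow[OF insertI1 e] by simp
qed

lemma mult_pow_eval:
 assumes j: "\<forall>i\<in>X. i < j" and e: "even (dg j) \<or> e \<le> 1" and f: "f .: U X"
 shows "(f \<otimes>\<^bsub>U (insert j X)\<^esub> gen j [^]\<^bsub>U (insert j X)\<^esub> e) m =
  (if count m j = e then f (m - replicate_mset e j) else \<zero>)"
proof -
 interpret E: comm_graded_algebra R "U (insert j X)" by (rule U_comm_graded_algebra)
 interpret tw: twisted_conv A "monomials dg X" "(+)" "ext_twist A dg" "U X" by (rule U_twisted)
 have g: "gen j .: (U (insert j X))"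
  using gen_grade[of j "insert j X"] E.grade_carrier by blast
 have sub: "carrier (U X) \<subseteq> carrier (U (insert j X))" by (rule U_carrier_mono) auto
 have "additive_map (U X) (U (insert j X)) (%f. f)"
  using sub by (auto simp: additive_map_def U_simps)
 hence 1: "additive_map (U X) A (%f. (f \<otimes>\<^bsub>U (insert j X)\<^esub> gen j [^]\<^bsub>U (insert j X)\<^esub> e) m)"
  using additive_comp[OF _ additive_comp[OF E.mult_additive_left M.fun_group_eval[OF U_group]]] g by blast
 have 2: "additive_map (U X) A (%f. if count m j = e then f (m - replicate_mset e j) else \<zero>)"
  by (auto simp: additive_map_def U_simps fin_funs_val)
 show ?thesis
 proof (rule tw.additive_eq_on[OF M.ab 1 2 _ f])
  fix m0 a assume m0: "m0 \<in> monomials dg X" and a: "a .: A"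
  have "count m0 j = 0" using m0 j by (auto simp: monomials_def not_in_iff)
  hence "m = m0 + replicate_mset e j \<longleftrightarrow> count m j = e \<and> m - replicate_mset e j = m0"
   by (auto simp: multiset_eq_iff)
  thus "(fs_single A m0 a \<otimes>\<^bsub>U (insert j X)\<^esub> gen j [^]\<^bsub>U (insert j X)\<^esub> e) m =
    (if count m j = e then fs_single A m0 a (m - replicate_mset e j) else \<zero>)"
   unfolding single_mult_pow[OF j m0 a e] by (auto simp: fs_single_def)
 qed
qed

lemma gen_coeff_carrier:
 assumes j: "\<forall>i\<in>X. i < j" and u: "u .: (U (insert j X))"
 shows "gen_coeff j e u .: U X"
proof -
 have u': "u \<in> fin_funs (monomials dg (insert j X)) A" using u by (simp add: U_simps)
 have "{m. gen_coeff j e u m ~= \<zero>} \<subseteq> (%m. m - replicate_mset e j) ` {m. u m ~= \<zero>}"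
 proof
  fix m assume "m \<in> {m. gen_coeff j e u m ~= \<zero>}"
  hence "u (m + replicate_mset e j) ~= \<zero>" by (auto simp: gen_coeff_def split: if_splits)
  thus "m \<in> (%m. m - replicate_mset e j) ` {m. u m ~= \<zero>}"
   by (intro image_eqI[of _ _ "m + replicate_mset e j"]) auto
 qed
 hence "finite {m. gen_coeff j e u m ~= \<zero>}"
  using finite_subset fin_funs_finite[OF u'] by blast
 moreover have "m \<in> monomials dg X" if "gen_coeff j e u m ~= \<zero>" for m
 proof -
  have "j \<notin># m" "u (m + replicate_mset e j) ~= \<zero>" using that by (auto simp: gen_coeff_def split: if_splits)
  thus ?thesis
   using fin_funs_supp[OF u', of "m + replicate_mset e j"] odd_clash_mono[of dg m "replicate_mset e j"]
   by (auto simp: monomials_def)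
 qed
 ultimately show ?thesis
  using fin_funs_val[OF u'] by (auto simp: U_simps fin_funs_def gen_coeff_def)
qed

text \<open>If \<open>j\<close> comes after all elements of \<open>X\<close>, then \<open>v\<^sub>j\<close> is always the last factor of a sorted
 monomial and its coefficients are read off without a sign.\<close>

theorem U_one_gen_ext:
 assumes half: "\<one>\<^bsub>R\<^esub> \<oplus>\<^bsub>R\<^esub> \<one>\<^bsub>R\<^esub> \<in> Units R" and j: "\<forall>i\<in>X. i < j"
 shows "one_gen_ext R (U X) (U (insert j X)) (gen j) (dg j) (gen_coeff j)"
proof -
 interpret E: comm_graded_algebra R "U (insert j X)" by (rule U_comm_graded_algebra)
 have jX: "j \<notin> X" using j by auto
 have cfc: "u .: (U (insert j X)) ==> gen_coeff j e u .: U X" for u e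
  using gen_coeff_carrier[OF j] .
 show ?thesis
 proof (intro one_gen_ext.intro U_comm_graded_algebra one_gen_ext_axioms.intro half)
  show "carrier (U X) \<subseteq> carrier (U (insert j X))" by (rule U_carrier_mono) auto
  show "grade (U X) n \<subseteq> grade (U (insert j X)) n" for n by (rule U_grade_mono) auto
  show "gen j \<in> grade (U (insert j X)) (dg j)" by (rule gen_grade) simp
  show "additive_map (U (insert j X)) (U X) (gen_coeff j e)" for e
   by (rule additiveI[OF cfc]) (auto simp: U_simps gen_coeff_def fun_eq_iff)
 next
  fix a and f e :: nat assume a: "a .: U X" and f: "even (dg j) \<or> f \<le> 1"
  have a0: "a m = \<zero>" if "j \<in># m" for m
   using a that jX by (intro fin_funs_outside[of a "monomials dg X" A]) (auto simp: U_simps monomials_def)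
  show "gen_coeff j e (a \<otimes>\<^bsub>U (insert j X)\<^esub> gen j [^]\<^bsub>U (insert j X)\<^esub> f) =
    (if e = f then a else \<zero>\<^bsub>U (insert j X)\<^esub>)"
   using a0 by (auto simp: gen_coeff_def fun_eq_iff mult_pow_eval[OF j f a] U_simps(2) not_in_iff)
 next
  fix u assume u: "u .: (U (insert j X))"
  have "{e. gen_coeff j e u ~= \<zero>\<^bsub>U (insert j X)\<^esub>} \<subseteq> (%m. count m j) ` {m. u m ~= \<zero>}"
  proof
   fix e assume "e \<in> {e. gen_coeff j e u ~= \<zero>\<^bsub>U (insert j X)\<^esub>}"
   then obtain m where "j \<notin># m" "u (m + replicate_mset e j) ~= \<zero>"
    by (auto simp: gen_coeff_def U_simps(2) fun_eq_iff split: if_splits)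
   thus "e \<in> (%m. count m j) ` {m. u m ~= \<zero>}"
    by (intro image_eqI[of _ _ "m + replicate_mset e j"]) (auto simp: not_in_iff)
  qed
  thus fin: "finite {e. gen_coeff j e u ~= \<zero>\<^bsub>U (insert j X)\<^esub>}"
   using u fin_funs_finite[of u "monomials dg (insert j X)" A] finite_subset by (auto simp: U_simps(1))
  have odd0: "gen_coeff j e u = \<zero>\<^bsub>U (insert j X)\<^esub>" if "odd (dg j)" "2 \<le> e" for e
  proof -
   have "m + replicate_mset e j \<notin> monomials dg (insert j X)" for m
    using that by (auto simp: monomials_def odd_clash_def intro!: exI[of _ j])
   thus ?thesis
    using u fin_funs_outside[of u "monomials dg (insert j X)" A] by (auto simp: gen_coeff_def U_simps(1,2) fun_eq_iff)
  qed
  thus "odd (dg j) ==> 2 \<le> e ==> gen_coeff j e u = \<zero>\<^bsub>U (insert j X)\<^esub>" for e .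
  let ?t = "%e. gen_coeff j e u \<otimes>\<^bsub>U (insert j X)\<^esub> gen j [^]\<^bsub>U (insert j X)\<^esub> e"
  let ?I = "{e. gen_coeff j e u ~= \<zero>\<^bsub>U (insert j X)\<^esub>}"
  have g: "gen j .: (U (insert j X))"
   using gen_grade[of j "insert j X"] E.grade_carrier by blast
  have tc: "?t e .: (U (insert j X))" for e
   using cfc[OF u, of e] U_carrier_mono[of X "insert j X"] g by auto
  have uv: "u m .: A" for m using u by (simp add: U_simps fin_funs_val)
  show "u = finsum (U (insert j X)) ?t ?I"
  proof
   fix m
   have ev: "?t e m = (if count m j = e then u m else \<zero>)" if "e \<in> ?I" for e
   proof -
    have al: "even (dg j) \<or> e \<le> 1" using odd0[of e] that by (cases "e \<le> 1") auto
    have "gen_coeff j e u (m - replicate_mset e j) = u m" if "count m j = e"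
    proof -
     have "m - replicate_mset e j + replicate_mset e j = m"
      using that by (auto simp: multiset_eq_iff)
     moreover have "j \<notin># m - replicate_mset e j" using that by (simp add: not_in_iff)
     ultimately show ?thesis by (simp add: gen_coeff_def)
    qed
    thus ?thesis using mult_pow_eval[OF j al cfc[OF u, of e], of m] by simp
   qed
   have "finsum (U (insert j X)) ?t ?I m = finsum A (%e. ?t e m) ?I"
    by (rule M.fun_group_finsum[OF U_group]) (use tc in auto)
   also have "\<dots> = finsum A (%e. if count m j = e then u m else \<zero>) ?I"
    by (rule M.finsum_cong') (use ev uv in auto)
   also have "\<dots> = u m"
   proof (cases "count m j \<in> ?I")
    case True
    thus ?thesis using fin uv by (subst M.finsum_single[of _ "count m j"]) auto
   next
    case False
    define m0 where "m0 = m - replicate_mset (count m j) j"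
    have "m0 + replicate_mset (count m j) j = m" "j \<notin># m0"
     by (auto simp: multiset_eq_iff not_in_iff m0_def)
    hence "gen_coeff j (count m j) u m0 = u m" by (simp add: gen_coeff_def)
    hence "u m = \<zero>" using False by (auto simp: U_simps(2) fun_eq_iff)
    thus ?thesis using M.finsum_zero by (simp add: if_distrib cong: if_cong)
   qed
   finally show "u m = finsum (U (insert j X)) ?t ?I m" by simp
  qed
 next
  fix u and n e :: nat assume u: "u \<in> grade (U (insert j X)) n"
  have md: "mdeg dg (m + replicate_mset e j) = mdeg dg m + e * dg j" for m
   by (induction e) auto
  have deg: "mdeg dg m + e * dg j \<le> n \<and> gen_coeff j e u m \<in> grade A (n - (mdeg dg m + e * dg j))"
   if "gen_coeff j e u m ~= \<zero>" for m
   using U_gradeD[OF u, of "m + replicate_mset e j"] that unfolding md by (auto simp: gen_coeff_def split: if_splits)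
  show "gen_coeff j e u \<in> grade (U X) (n - e * dg j)" if "e * dg j \<le> n"
   using deg by (intro U_gradeI cfc[OF U_grade_carrier[OF u]]) (fastforce simp: diff_diff_left add.commute)
  show "gen_coeff j e u = \<zero>\<^bsub>U (insert j X)\<^esub>" if "n < e * dg j"
   using deg that by (fastforce simp: U_simps(2) fun_eq_iff)
 qed (rule U_ops)+
qed

end

section \<open>Generation of cohomology modules\<close>

text \<open>\<open>N\<close> plus the span of a list.  With \<open>N\<close> the coboundaries this expresses generation of
 cohomology without quotients, and a list loses one generator at a time.\<close>

fun mod_span :: "('r, 'e) ring_scheme => ('r, 'm, 'f) module_scheme => 'm set => 'm list => 'm set" where
 "mod_span R M N [] = N"
| "mod_span R M N (s # S) = {(r \<odot>\<^bsub>M\<^esub> s) \<oplus>\<^bsub>M\<^esub> m | r m. r .: R \<and> m \<in> mod_span R M N S}"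

lemma mod_span_trans:
 assumes "N' \<subseteq> mod_span R M N S'"
 shows "mod_span R M N' S \<subseteq> mod_span R M N (S @ S')"
 by (induction S) (use assms in auto)

context module
begin

lemma submodule_diff: "submodule N R M ==> x \<in> N ==> y \<in> N ==> x \<ominus>\<^bsub>M\<^esub> y \<in> N"
 unfolding a_minus_def by (metis submoduleE(3) submoduleE(5))

lemma mod_span_submodule:
 assumes N: "submodule N R M" and S: "set S \<subseteq> carrier M"
 shows "submodule (mod_span R M N S) R M"
 using S
proof (induction S)
 case Nil
 thus ?case using N by simp
next
 case (Cons s S)
 hence sub: "submodule (mod_span R M N S) R M" and s: "s .: M" by auto
 note E = submoduleE[OF sub]
 have c: "m \<in> mod_span R M N S ==> m .: M" for m using E(1) by blast
 show ?case
 proof (rule submoduleI)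
  show "mod_span R M N (s # S) \<subseteq> carrier M" using s c by auto
 next
  have "\<zero>\<^bsub>M\<^esub> \<in> mod_span R M N S"
   using subgroup.one_closed[OF submodule.axioms(1)[OF sub]] by simp
  hence "(\<zero>\<^bsub>R\<^esub> \<odot>\<^bsub>M\<^esub> s) \<oplus>\<^bsub>M\<^esub> \<zero>\<^bsub>M\<^esub> \<in> mod_span R M N (s # S)" by auto
  thus "\<zero>\<^bsub>M\<^esub> \<in> mod_span R M N (s # S)" using s by simp
 next
  fix x assume "x \<in> mod_span R M N (s # S)"
  then obtain r m where r: "r .: R" "m \<in> mod_span R M N S" "x = (r \<odot>\<^bsub>M\<^esub> s) \<oplus>\<^bsub>M\<^esub> m" by auto
  have "\<ominus>\<^bsub>M\<^esub> x = ((\<ominus>\<^bsub>R\<^esub> r) \<odot>\<^bsub>M\<^esub> s) \<oplus>\<^bsub>M\<^esub> (\<ominus>\<^bsub>M\<^esub> m)"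
   using r s c by (simp add: M.minus_add smult_l_minus)
  thus "\<ominus>\<^bsub>M\<^esub> x \<in> mod_span R M N (s # S)" using r E(3) R.a_inv_closed by auto
 next
  fix x y assume "x \<in> mod_span R M N (s # S)" "y \<in> mod_span R M N (s # S)"
  then obtain r m r' m' where r: "r .: R" "m \<in> mod_span R M N S" "x = (r \<odot>\<^bsub>M\<^esub> s) \<oplus>\<^bsub>M\<^esub> m"
   and r': "r' .: R" "m' \<in> mod_span R M N S" "y = (r' \<odot>\<^bsub>M\<^esub> s) \<oplus>\<^bsub>M\<^esub> m'" by auto
  have "x \<oplus>\<^bsub>M\<^esub> y = ((r \<oplus>\<^bsub>R\<^esub> r') \<odot>\<^bsub>M\<^esub> s) \<oplus>\<^bsub>M\<^esub> (m \<oplus>\<^bsub>M\<^esub> m')"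
   using r r' s c by (simp add: smult_l_distr M.a_ac)
  thus "x \<oplus>\<^bsub>M\<^esub> y \<in> mod_span R M N (s # S)" using r r' E(5) R.a_closed by auto
 next
  fix a x assume a: "a .: R" and "x \<in> mod_span R M N (s # S)"
  then obtain r m where r: "r .: R" "m \<in> mod_span R M N S" "x = (r \<odot>\<^bsub>M\<^esub> s) \<oplus>\<^bsub>M\<^esub> m" by auto
  have "a \<odot>\<^bsub>M\<^esub> x = ((a \<otimes>\<^bsub>R\<^esub> r) \<odot>\<^bsub>M\<^esub> s) \<oplus>\<^bsub>M\<^esub> (a \<odot>\<^bsub>M\<^esub> m)"
   using a r s c by (simp add: smult_r_distr smult_assoc1)
  thus "a \<odot>\<^bsub>M\<^esub> x \<in> mod_span R M N (s # S)" using a r E(4) R.m_closed by auto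
 qed
qed

lemma mod_span_base:
 assumes N: "submodule N R M" and S: "set S \<subseteq> carrier M"
 shows "N \<subseteq> mod_span R M N S"
 using S
proof (induction S)
 case (Cons s S)
 hence IH: "N \<subseteq> mod_span R M N S" and s: "s .: M" by auto
 show ?case
 proof
  fix n assume n: "n \<in> N"
  hence "n .: M" using submoduleE(1)[OF N] by blast
  hence "n = (\<zero>\<^bsub>R\<^esub> \<odot>\<^bsub>M\<^esub> s) \<oplus>\<^bsub>M\<^esub> n" using s by simp
  thus "n \<in> mod_span R M N (s # S)" using n IH R.zero_closed by auto
 qed
qed simp

text \<open>Over a principal ideal domain, a submodule of a finitely generated module is finitely
 generated: the coefficients of the first generator form a principal ideal.\<close>

theorem submodule_fin_gen:
 assumes R: "principal_domain R" and N: "submodule N R M"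
  and "set S \<subseteq> carrier M" "submodule P R M" "P \<subseteq> mod_span R M N S"
 obtains S' where "set S' \<subseteq> P" "P \<subseteq> mod_span R M N S'"
proof -
 have "\<exists>S'. set S' \<subseteq> P \<and> P \<subseteq> mod_span R M N S'"
  using assms(3-5)
 proof (induction S arbitrary: P)
  case Nil
  thus ?case by (intro exI[of _ "[]"]) simp
 next
  case (Cons s S)
  interpret R: principal_domain R by fact
  let ?L = "mod_span R M N S"
  have s: "s .: M" and S: "set S \<subseteq> carrier M" using Cons.prems by auto
  have sub: "submodule ?L R M" using mod_span_submodule[OF N S] .
  note LE = submoduleE[OF sub] and PE = submoduleE[OF Cons.prems(2)]
  have c: "m \<in> ?L ==> m .: M" and Pc: "p \<in> P ==> p .: M" for m p using LE(1) PE(1) by blast+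
  define I where "I = {r \<in> carrier R. \<exists>m\<in>?L. (r \<odot>\<^bsub>M\<^esub> s) \<oplus>\<^bsub>M\<^esub> m \<in> P}"
  have L0: "\<zero>\<^bsub>M\<^esub> \<in> ?L" and P0: "\<zero>\<^bsub>M\<^esub> \<in> P"
   using subgroup.one_closed[OF submodule.axioms(1)] sub Cons.prems(2) by fastforce+
  have I_add: "a \<oplus>\<^bsub>R\<^esub> b \<in> I" if "a \<in> I" "b \<in> I" for a b
  proof -
   obtain m m' where m: "m \<in> ?L" "(a \<odot>\<^bsub>M\<^esub> s) \<oplus>\<^bsub>M\<^esub> m \<in> P" "m' \<in> ?L" "(b \<odot>\<^bsub>M\<^esub> s) \<oplus>\<^bsub>M\<^esub> m' \<in> P" "a .: R" "b .: R"
    using \<open>a \<in> I\<close> \<open>b \<in> I\<close> by (auto simp: I_def)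
   have "((a \<odot>\<^bsub>M\<^esub> s) \<oplus>\<^bsub>M\<^esub> m) \<oplus>\<^bsub>M\<^esub> ((b \<odot>\<^bsub>M\<^esub> s) \<oplus>\<^bsub>M\<^esub> m') = ((a \<oplus>\<^bsub>R\<^esub> b) \<odot>\<^bsub>M\<^esub> s) \<oplus>\<^bsub>M\<^esub> (m \<oplus>\<^bsub>M\<^esub> m')"
    using m s c by (simp add: smult_l_distr M.a_ac)
   hence "((a \<oplus>\<^bsub>R\<^esub> b) \<odot>\<^bsub>M\<^esub> s) \<oplus>\<^bsub>M\<^esub> (m \<oplus>\<^bsub>M\<^esub> m') \<in> P" using PE(5) m by metis
   thus ?thesis using m LE(5) by (auto simp: I_def)
  qed
  have I_mult: "x \<otimes>\<^bsub>R\<^esub> a \<in> I" if "a \<in> I" "x .: R" for a x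
  proof -
   obtain m where m: "m \<in> ?L" "(a \<odot>\<^bsub>M\<^esub> s) \<oplus>\<^bsub>M\<^esub> m \<in> P" "a .: R"
    using \<open>a \<in> I\<close> by (auto simp: I_def)
   have "x \<odot>\<^bsub>M\<^esub> ((a \<odot>\<^bsub>M\<^esub> s) \<oplus>\<^bsub>M\<^esub> m) = ((x \<otimes>\<^bsub>R\<^esub> a) \<odot>\<^bsub>M\<^esub> s) \<oplus>\<^bsub>M\<^esub> (x \<odot>\<^bsub>M\<^esub> m)"
    using m s c that by (simp add: smult_r_distr smult_assoc1)
   hence "((x \<otimes>\<^bsub>R\<^esub> a) \<odot>\<^bsub>M\<^esub> s) \<oplus>\<^bsub>M\<^esub> (x \<odot>\<^bsub>M\<^esub> m) \<in> P" using PE(4) m that by metis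
   thus ?thesis using m LE(4) that by (auto simp: I_def)
  qed
  have zI: "\<zero>\<^bsub>R\<^esub> \<in> I" using L0 P0 s by (auto simp: I_def intro!: bexI[of _ "\<zero>\<^bsub>M\<^esub>"])
  have neg: "\<ominus>\<^bsub>R\<^esub> a = (\<ominus>\<^bsub>R\<^esub> \<one>\<^bsub>R\<^esub>) \<otimes>\<^bsub>R\<^esub> a" if "a .: R" for a using that by (simp add: R.l_minus)
  have "ideal I R"
  proof (rule idealI)
   show "ring R" by (rule R.ring_axioms)
   show "subgroup I (add_monoid R)"
   proof (rule subgroup.intro)
    show "I \<subseteq> carrier (add_monoid R)" by (auto simp: I_def)
    fix a assume a: "a \<in> I"
    hence "a .: R" by (auto simp: I_def)
    have "\<ominus>\<^bsub>R\<^esub> a \<in> I"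
     unfolding neg[OF \<open>a .: R\<close>] by (rule I_mult[OF a]) simp
    thus "inv\<^bsub>add_monoid R\<^esub> a \<in> I" by (simp add: a_inv_def)
   next
    show "\<one>\<^bsub>add_monoid R\<^esub> \<in> I" using zI by simp
    show "x \<otimes>\<^bsub>add_monoid R\<^esub> y \<in> I" if "x \<in> I" "y \<in> I" for x y
     using I_add[OF that] by simp
   qed
   fix a x assume a: "a \<in> I" and x: "x .: R"
   hence "a .: R" by (auto simp: I_def)
   show "x \<otimes>\<^bsub>R\<^esub> a \<in> I" using I_mult[OF a x] .
   thus "a \<otimes>\<^bsub>R\<^esub> x \<in> I" using R.m_comm x \<open>a .: R\<close> by simp
  qed
  then obtain q where q: "q .: R" "I = PIdl\<^bsub>R\<^esub> q" using R.exists_gen by blast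
  hence "q \<in> I" using R.cgenideal_self by blast
  then obtain m0 where m0: "m0 \<in> ?L" "(q \<odot>\<^bsub>M\<^esub> s) \<oplus>\<^bsub>M\<^esub> m0 \<in> P" by (auto simp: I_def)
  let ?p0 = "(q \<odot>\<^bsub>M\<^esub> s) \<oplus>\<^bsub>M\<^esub> m0"
  have "submodule (P \<inter> ?L) R M"
   using PE LE L0 P0 by (intro submoduleI) auto
  then obtain S' where S': "set S' \<subseteq> P \<inter> ?L" "P \<inter> ?L \<subseteq> mod_span R M N S'"
   using Cons.IH[OF S, of "P \<inter> ?L"] by auto
  have "P \<subseteq> mod_span R M N (?p0 # S')"
  proof
   fix p assume p: "p \<in> P"
   then obtain r m where r: "r .: R" "m \<in> ?L" "p = (r \<odot>\<^bsub>M\<^esub> s) \<oplus>\<^bsub>M\<^esub> m"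
    using Cons.prems(3) by auto
   hence "r \<in> I" using p by (auto simp: I_def)
   then obtain r' where r': "r' .: R" "r = r' \<otimes>\<^bsub>R\<^esub> q" using q by (auto simp: cgenideal_def)
   have e: "p \<oplus>\<^bsub>M\<^esub> (\<ominus>\<^bsub>M\<^esub> (r' \<odot>\<^bsub>M\<^esub> ?p0)) = m \<oplus>\<^bsub>M\<^esub> (\<ominus>\<^bsub>M\<^esub> (r' \<odot>\<^bsub>M\<^esub> m0))"
   proof -
    have "r' \<odot>\<^bsub>M\<^esub> ?p0 = (r \<odot>\<^bsub>M\<^esub> s) \<oplus>\<^bsub>M\<^esub> (r' \<odot>\<^bsub>M\<^esub> m0)"
     using r' q m0 s c by (simp add: smult_r_distr smult_assoc1)
    thus ?thesis
     using r r' q m0 s c Pc[OF p] by (simp add: M.minus_add M.a_ac M.r_neg M.r_neg1 M.r_neg2)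
   qed
   let ?t = "p \<oplus>\<^bsub>M\<^esub> (\<ominus>\<^bsub>M\<^esub> (r' \<odot>\<^bsub>M\<^esub> ?p0))"
   have "?t \<in> ?L" unfolding e using r r' m0 LE(3-5) by blast
   moreover have "?t \<in> P" using p r' m0 PE(3-5) by blast
   ultimately have "?t \<in> mod_span R M N S'" using S' by blast
   moreover have "p = (r' \<odot>\<^bsub>M\<^esub> ?p0) \<oplus>\<^bsub>M\<^esub> ?t"
    using Pc[OF p] Pc[OF m0(2)] r' by (simp add: M.a_lcomm[of _ p] M.r_neg)
   ultimately show "p \<in> mod_span R M N (?p0 # S')" using r' by auto
  qed
  thus ?case using S' m0 by (intro exI[of _ "?p0 # S'"]) auto
 qed
 thus thesis using that by blast
qed

end

text \<open>Generators pull back along a linear map: what their lifts miss lies in the preimage of \<open>N\<close>.\<close>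

lemma mod_span_lift:
 fixes M :: "('r, 'm, 'f) module_scheme" and M' :: "('r, 'n, 'g) module_scheme"
 assumes M: "module R M" and M': "module R M'" and Z: "submodule Z R M" and "set S \<subseteq> Z"
  and f: "!!x. x \<in> Z ==> f x .: M'"
   "!!x y. x \<in> Z ==> y \<in> Z ==> f (x \<oplus>\<^bsub>M\<^esub> y) = f x \<oplus>\<^bsub>M'\<^esub> f y"
   "!!r x. r .: R ==> x \<in> Z ==> f (r \<odot>\<^bsub>M\<^esub> x) = r \<odot>\<^bsub>M'\<^esub> f x"
  and "N \<subseteq> carrier M'" "x \<in> Z" "f x \<in> mod_span R M' N (map f S)"
 shows "x \<in> mod_span R M {y \<in> Z. f y \<in> N} S"
 using assms(4,9,10)
proof (induction S arbitrary: x)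
 case Nil
 thus ?case by simp
next
 case (Cons s S)
 interpret M: module R M by fact
 interpret M': module R M' by fact
 note ZE = M.submoduleE[OF Z]
 have Zc: "x \<in> Z ==> x .: M" for x using ZE(1) by blast
 have s: "s \<in> Z" using Cons.prems by simp
 obtain r m where r: "r .: R" "m \<in> mod_span R M' N (map f S)" "f x = (r \<odot>\<^bsub>M'\<^esub> f s) \<oplus>\<^bsub>M'\<^esub> m"
  using Cons.prems by auto
 have m: "m .: M'"
 proof -
  have "mod_span R M' N (map f S) \<subseteq> carrier M'" if "set S \<subseteq> Z" for S
   using that by (induction S) (use assms(8) f in auto)
  thus ?thesis using r Cons.prems by auto
 qed
 let ?y = "((\<ominus>\<^bsub>R\<^esub> r) \<odot>\<^bsub>M\<^esub> s) \<oplus>\<^bsub>M\<^esub> x"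
 have y: "?y \<in> Z" using ZE(4,5) s r Cons.prems by auto
 have "f ?y = m"
  using f s r m Cons.prems ZE(4)[OF _ s, of "\<ominus>\<^bsub>R\<^esub> r"]
  by (simp add: M'.smult_l_minus M'.M.r_neg1)
 hence "?y \<in> mod_span R M {y \<in> Z. f y \<in> N} S" using Cons y r by simp
 moreover have "x = (r \<odot>\<^bsub>M\<^esub> s) \<oplus>\<^bsub>M\<^esub> ?y"
  using r Zc s Cons.prems by (simp add: M.smult_l_minus M.M.r_neg2)
 ultimately show ?case using r by auto
qed

definition fin_gen_cohom :: "('r, 'e) ring_scheme => ('r, 'a, 'f) gmod_scheme => ('a => 'a) => nat => bool" where
 "fin_gen_cohom R A d i \<longleftrightarrow> (\<exists>S. set S \<subseteq> cocycles A d i \<and>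
   cocycles A d i \<subseteq> mod_span R A (coboundaries A d i) S)"

context cdga
begin

lemma cocycles_submodule: "submodule (cocycles A d n) R A"
 by (rule submoduleI) (auto simp: cocycles_def grade_carrier diff_add diff_smult diff_neg)

lemma coboundaries_submodule: "submodule (coboundaries A d n) R A"
proof (cases n)
 case 0
 thus ?thesis by (intro submoduleI) (auto simp: coboundaries_def)
next
 case (Suc k)
 show ?thesis
 proof (rule submoduleI)
  show "\<zero>\<^bsub>A\<^esub> \<in> coboundaries A d n"
   using Suc by (auto simp: coboundaries_def image_iff intro!: bexI[of _ "\<zero>\<^bsub>A\<^esub>"])
  show "\<ominus>\<^bsub>A\<^esub> x \<in> coboundaries A d n" if "x \<in> coboundaries A d n" for x
   using that Suc by (auto simp: coboundaries_def grade_carrier diff_neg[symmetric])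
  show "x \<oplus>\<^bsub>A\<^esub> y \<in> coboundaries A d n" if "x \<in> coboundaries A d n" "y \<in> coboundaries A d n" for x y
   using that Suc by (auto simp: coboundaries_def grade_carrier diff_add[symmetric])
  show "r \<odot>\<^bsub>A\<^esub> x \<in> coboundaries A d n" if "r .: R" "x \<in> coboundaries A d n" for r x
   using that Suc by (auto simp: coboundaries_def grade_carrier diff_smult[symmetric])
 qed (use Suc grade_carrier in \<open>auto simp: coboundaries_def\<close>)
qed

lemma coboundaries_grade: "x \<in> coboundaries A d n ==> x \<in> grade A n"
 by (cases n) (auto simp: coboundaries_def intro: diff_grade)

lemma coboundaries_cocycles: "coboundaries A d n \<subseteq> cocycles A d n"
 using coboundaries_grade[of _ n] by (cases n) (auto simp: cocycles_def coboundaries_def grade_carrier diff_diff)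

end

section \<open>Cohomology of an algebra with one more generator\<close>

locale one_gen_cdga = one_gen_diff R K E v k cf d z + Ed: cdga R E d'
 for R :: "('r, 'e) ring_scheme" and K :: "('r, 'u) gmod" and E :: "('r, 'u) gmod" (structure)
  and v k cf d z and d' +
 assumes d'_K: "a .: K ==> d' a = d a" and d'_v: "d' v = z"
begin

lemma d'_pow: "d' (v [^] (e::nat)) = pow_diff e"
proof (induction e)
 case 0
 thus ?case using Ed.diff_one by simp
next
 case (Suc e)
 thus ?case using Ed.diff_mult[OF pow_grade v_carrier, of e] by (simp add: d'_v)
qed

lemma d'_power:
 assumes "a \<in> grade K p"
 shows "d' (a \<otimes> v [^] (e::nat)) = d a \<otimes> v [^] e \<oplus> ksgn E p (a \<otimes> pow_diff e)"
 using Ed.diff_mult[OF KEg[OF assms] pow_closed, of e] d'_K[of a] K.grade_carrier[OF assms] by (simp add: d'_pow)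

lemma cf_smult:
 assumes "r .: R" "u .: E"
 shows "cf e (r \<odot> u) = r \<odot> cf e u"
proof (rule ext_additive_eq[OF K_ab additive_comp[OF E.smult_additive cf_additive] _ _ assms(2)])
 show "additive_map E K (%u. r \<odot> cf e u)"
  using additive_comp[OF cf_additive K.smult_additive[OF assms(1)]] by (simp add: K_ops)
 fix a p and f :: nat assume a: "a \<in> grade K p" and f: "even k \<or> f \<le> 1"
 have aK: "a .: K" using a K.grade_carrier by blast
 have "r \<odot> (a \<otimes> v [^] f) = (r \<odot> a) \<otimes> v [^] f"
  using aK assms(1) by (simp add: E.smult_mult_left)
 thus "cf e (r \<odot> (a \<otimes> v [^] f)) = r \<odot> cf e (a \<otimes> v [^] f)"
  using aK f assms(1) by (simp add: cf_power del: E.A.nat_pow_Suc)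
qed (rule assms(1))

lemma cf_closed[simp]: "u .: E ==> cf e u .: K"
 using additive_closed[OF cf_additive] .

lemma cf_diff_power:
 assumes "a .: K" "even k \<or> f \<le> 1" "f \<le> e"
 shows "cf e (d' (a \<otimes> v [^] f)) = (if e = f then d a else \<zero>)"
 using assms(1)
proof (induction a rule: K.graded_induct)
 case (add x y)
 have "cf e (d' ((x \<oplus>\<^bsub>K\<^esub> y) \<otimes> v [^] f)) =
   cf e (d' (x \<otimes> v [^] f)) \<oplus>\<^bsub>K\<^esub> cf e (d' (y \<otimes> v [^] f))"
  using add(1,2) by (simp add: K_ops E.A.l_distr Ed.diff_add additive_add[OF cf_additive, unfolded K_ops])
 thus ?case using add Kd.diff_add[OF add(1,2)] by (simp add: K_ops)
next
 case (homogeneous p a)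
 have aK: "a .: K" using homogeneous K.grade_carrier by blast
 have 1: "cf e (d a \<otimes> v [^] f) = (if e = f then d a else \<zero>)"
  using cf_power[OF dK[OF aK] assms(2)] by simp
 have 2: "cf e (ksgn E p (a \<otimes> pow_diff f)) = \<zero>"
 proof (cases f)
  case 0
  thus ?thesis using aK cf_zero by simp
 next
  case (Suc f')
  obtain c where c: "c .: K" "pow_diff (Suc f') = c \<otimes> v [^] f'" using pow_diff_coeff by blast
  have f': "even k \<or> f' \<le> 1" using assms(2) Suc by auto
  have "ksgn E p (a \<otimes> pow_diff f) = ksgn E p (a \<otimes> c) \<otimes> v [^] f'"
   using c aK unfolding Suc by (simp add: E.A.ksgn_mult_left E.A.m_assoc del: pow_diff.simps)
  thus ?thesis using cf_power[OF _ f', of "ksgn E p (a \<otimes> c)" e] c aK assms(3) Suc by simp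
 qed
 show ?case
  using additive_add[OF cf_additive, of "d a \<otimes> v [^] f" "ksgn E p (a \<otimes> pow_diff f)" e] aK 1 2
  by (simp add: d'_power[OF homogeneous] K_ops)
qed

text \<open>The differential lowers or keeps the power of \<open>v\<close>, and on the top coefficient it is \<open>d\<close>.\<close>

lemma cf_diff_top:
 assumes u: "u .: E" and top: "!!e. p < e ==> cf e u = \<zero>" and "p \<le> e"
 shows "cf e (d' u) = (if e = p then d (cf p u) else \<zero>)"
proof -
 let ?I = "{e. cf e u ~= \<zero>}"
 have I: "finite ?I" using cf_finite[OF u] .
 have summand: "cf e (d' (cf f u \<otimes> v [^] f)) = (if f = e then d (cf f u) else \<zero>)" if "f \<in> ?I" for f
 proof -
  have "f \<le> p" using top that by (meson mem_Collect_eq not_le_imp_less)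
  moreover have "even k \<or> f \<le> 1"
  proof (rule ccontr)
   assume "\<not> (even k \<or> f \<le> 1)"
   thus False using cf_odd[OF u, of f] that by simp
  qed
  ultimately show ?thesis using cf_diff_power[of "cf f u" f e] u assms(3) by simp
 qed
 have "cf e (d' u) = cf e (d' (finsum E (%f. cf f u \<otimes> v [^] f) ?I))"
  using cf_expand[OF u] by simp
 also have "\<dots> = finsum K (%f. cf e (d' (cf f u \<otimes> v [^] f))) ?I"
  by (rule additive_finsum[OF E_ab K_ab additive_comp[OF Ed.diff_additive cf_additive]]) (use u in auto)
 also have "\<dots> = finsum K (%f. if f = e then d (cf f u) else \<zero>\<^bsub>K\<^esub>) ?I"
  by (rule K.M.finsum_cong') (use summand u in \<open>auto simp: K_ops\<close>)
 also have "\<dots> = (if e = p then d (cf p u) else \<zero>)"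
 proof (cases "e \<in> ?I")
  case True
  hence "e = p" using top[of e] assms(3) by (cases "e = p") auto
  thus ?thesis using True I u by (subst K.M.finsum_single[of _ e]) auto
 next
  case False
  hence "(%f. if f = e then d (cf f u) else \<zero>\<^bsub>K\<^esub>) \<in> ?I \<rightarrow> carrier K" "!!f. f \<in> ?I ==> f ~= e" by auto
  hence "finsum K (%f. if f = e then d (cf f u) else \<zero>\<^bsub>K\<^esub>) ?I = finsum K (%f. \<zero>\<^bsub>K\<^esub>) ?I"
   by (intro K.M.finsum_cong') auto
  moreover have "e = p ==> d (cf p u) = \<zero>" using False by simp
  ultimately show ?thesis using K.M.finsum_zero by (simp add: K_ops)
 qed
 finally show ?thesis .
qed

text \<open>Filtering by the powers of \<open>v\<close>, the leading coefficients of cocycles are cocycles of \<open>K\<close>;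
 hence the cohomology stays finitely generated.\<close>

theorem fin_gen_cohom_ext:
 assumes R: "principal_domain R" and fg: "!!i. fin_gen_cohom R K d i" and k: "0 < k"
 shows "fin_gen_cohom R E d' i"
proof -
 define Z where "Z p = {u \<in> cocycles E d' i. \<forall>e\<ge>p. cf e u = \<zero>}" for p
 let ?B = "coboundaries E d' i"
 have cf_neg: "cf e (\<ominus> u) = \<ominus> cf e u" if "u .: E" for e u
  using additive_neg[OF E_ab K_ab cf_additive that] K_neg that by simp
 have cf_add: "cf e (u \<oplus> w) = cf e u \<oplus> cf e w" if "u .: E" "w .: E" for e u w
  using additive_add[OF cf_additive that] by (simp add: K_ops)
 have cyc: "u .: E" if "u \<in> cocycles E d' i" for u using that E.grade_carrier by (auto simp: cocycles_def)
 have Zsub: "submodule (Z p) R E" for p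
 proof (rule E.submoduleI)
  note CE = E.submoduleE[OF Ed.cocycles_submodule[of i]]
  show "Z p \<subseteq> carrier E" using cyc by (auto simp: Z_def)
  show "\<zero> \<in> Z p" by (auto simp: Z_def cocycles_def cf_zero)
  show "\<ominus> a \<in> Z p" if "a \<in> Z p" for a
   using that CE(3) cf_neg cyc by (auto simp: Z_def)
  show "a \<oplus> b \<in> Z p" if "a \<in> Z p" "b \<in> Z p" for a b
   using that CE(5) cf_add cyc by (auto simp: Z_def)
  show "r \<odot> a \<in> Z p" if "r .: R" "a \<in> Z p" for r a
   using that CE(4) cf_smult cyc by (auto simp: Z_def)
 qed
 have "\<exists>S. set S \<subseteq> Z p \<and> Z p \<subseteq> mod_span R E ?B S" for p
 proof (induction p)
  case 0
  have "u = \<zero>" if "u \<in> Z 0" for u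
   using that cf_expand[of u] cyc by (auto simp: Z_def)
  moreover have "\<zero> \<in> ?B"
   using subgroup.one_closed[OF submodule.axioms(1)[OF Ed.coboundaries_submodule]] by simp
  ultimately have "Z 0 \<subseteq> mod_span R E ?B []" by auto
  thus ?case by (intro exI[of _ "[]"]) simp
 next
  case (Suc p)
  then obtain S where S: "set S \<subseteq> Z p" "Z p \<subseteq> mod_span R E ?B S" by blast
  have ZZ: "Z p \<subseteq> Z (Suc p)" by (auto simp: Z_def)
  show ?case
  proof (cases "p * k \<le> i \<and> (even k \<or> p \<le> 1)")
   case False
   have "cf p u = \<zero>" if "u \<in> Z (Suc p)" for u
    using False cf_large[of u i p] cf_odd[OF cyc, of u p] that by (auto simp: Z_def cocycles_def)
   hence "Z (Suc p) \<subseteq> Z p" unfolding Z_def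
    by (auto simp: le_eq_less_or_eq) (metis Suc_leI le_eq_less_or_eq)
   thus ?thesis using S ZZ by (intro exI[of _ S]) auto
  next
   case True
   let ?l = "i - p * k"
   let ?N = "coboundaries K d ?l"
   have top: "d (cf p u) = \<zero>" if "u \<in> Z (Suc p)" for u
    using cf_diff_top[OF cyc, of u p p] that cf_zero by (auto simp: Z_def cocycles_def)
   define P where "P = cf p ` Z (Suc p)"
   have Pc: "P \<subseteq> cocycles K d ?l"
    using top cf_grade[of _ i p] True by (auto simp: P_def cocycles_def Z_def K_ops)
   have Psub: "submodule P R K"
   proof (rule K.submoduleI)
    note ZE = E.submoduleE[OF Zsub[of "Suc p"]]
    have zc: "u \<in> Z (Suc p) ==> u .: E" for u using ZE(1) by blast
    show "P \<subseteq> carrier K" using zc by (auto simp: P_def)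
    show "\<zero>\<^bsub>K\<^esub> \<in> P"
     using subgroup.one_closed[OF submodule.axioms(1)[OF Zsub[of "Suc p"]]] cf_zero
     by (auto simp: P_def K_ops image_iff intro!: bexI[of _ "\<zero>"])
    show "\<ominus>\<^bsub>K\<^esub> a \<in> P" if h: "a \<in> P" for a
    proof -
     obtain u where u: "u \<in> Z (Suc p)" "a = cf p u" using h by (auto simp: P_def)
     hence "\<ominus>\<^bsub>K\<^esub> a = cf p (\<ominus> u)" using cf_neg zc K_neg by simp
     thus ?thesis using ZE(3) u by (auto simp: P_def)
    qed
    show "a \<oplus>\<^bsub>K\<^esub> b \<in> P" if h: "a \<in> P" "b \<in> P" for a b
    proof -
     obtain u w where u: "u \<in> Z (Suc p)" "a = cf p u" "w \<in> Z (Suc p)" "b = cf p w"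
      using h by (auto simp: P_def)
     hence "a \<oplus>\<^bsub>K\<^esub> b = cf p (u \<oplus> w)" using cf_add zc by (simp add: K_ops)
     thus ?thesis using ZE(5) u by (auto simp: P_def)
    qed
    show "r \<odot>\<^bsub>K\<^esub> a \<in> P" if h: "r .: R" "a \<in> P" for r a
    proof -
     obtain u where u: "u \<in> Z (Suc p)" "a = cf p u" using h(2) by (auto simp: P_def)
     hence "r \<odot>\<^bsub>K\<^esub> a = cf p (r \<odot> u)" using cf_smult zc that(1) by (simp add: K_ops)
     thus ?thesis using ZE(4) u that(1) by (auto simp: P_def)
    qed
   qed
   obtain S0 where S0: "set S0 \<subseteq> cocycles K d ?l" "cocycles K d ?l \<subseteq> mod_span R K ?N S0"
    using fg[of ?l] unfolding fin_gen_cohom_def by blast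
   have S0c: "set S0 \<subseteq> carrier K" using S0(1) K.grade_carrier by (auto simp: cocycles_def)
   obtain S1 where S1: "set S1 \<subseteq> P" "P \<subseteq> mod_span R K ?N S1"
    by (rule K.submodule_fin_gen[OF R Kd.coboundaries_submodule S0c Psub subset_trans[OF Pc S0(2)]])
   obtain S2 where S2: "set S2 \<subseteq> Z (Suc p)" "map (cf p) S2 = S1"
   proof -
    have "\<exists>S2. map (cf p) S2 = S1 \<and> (\<forall>x\<in>set S2. x \<in> Z (Suc p))"
     using S1(1) unfolding P_def by (induction S1) (auto, metis list.simps(9) set_ConsD)
    thus thesis using that by blast
   qed
   let ?Y = "{y \<in> Z (Suc p). cf p y \<in> ?N}"
   have 1: "Z (Suc p) \<subseteq> mod_span R E ?Y S2"
   proof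
    fix u assume u: "u \<in> Z (Suc p)"
    show "u \<in> mod_span R E ?Y S2"
    proof (rule mod_span_lift[OF E.module_axioms K.module_axioms Zsub S2(1) _ _ _ _ u])
     show "?N \<subseteq> carrier K" using Kd.coboundaries_grade K.grade_carrier by blast
     show "cf p u \<in> mod_span R K ?N (map (cf p) S2)" using u S1 S2 by (auto simp: P_def)
    qed (use cyc cf_add cf_smult in \<open>auto simp: Z_def K_ops\<close>)
   qed
   have 2: "?Y \<subseteq> mod_span R E ?B S"
   proof
    fix y assume y: "y \<in> ?Y"
    have yZ: "y \<in> cocycles E d' i" "!!e. Suc p \<le> e ==> cf e y = \<zero>" using y by (auto simp: Z_def)
    have yE: "y .: E" using yZ cyc by blast
    have sp: "submodule (mod_span R E ?B S) R E"
     by (rule E.mod_span_submodule[OF Ed.coboundaries_submodule]) (use S Zsub E.submoduleE(1) in blast)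
    obtain w where w: "w \<in> ?B" "w .: E" "cf p w = cf p y" "!!e. Suc p \<le> e ==> cf e w = \<zero>"
    proof (cases ?l)
     case 0
     hence "cf p y = \<zero>" using y by (simp add: coboundaries_def K_ops)
     moreover have "\<zero> \<in> ?B"
      using subgroup.one_closed[OF submodule.axioms(1)[OF Ed.coboundaries_submodule]] by simp
     ultimately show thesis using that[of "\<zero>"] cf_zero by simp
    next
     case (Suc l)
     then obtain \<kappa> where \<kappa>: "\<kappa> \<in> grade K l" "cf p y = d \<kappa>" using y by (auto simp: coboundaries_def)
     let ?x = "\<kappa> \<otimes> v [^] p"
     have \<kappa>K: "\<kappa> .: K" using \<kappa> K.grade_carrier by blast
     have x: "?x .: E" using \<kappa>K by simp
     have "?x \<in> grade E (l + k * p)" using E.mult_grade[OF KEg[OF \<kappa>(1)] pow_grade] .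
     moreover have "Suc (l + k * p) = i" using Suc True by (simp add: mult.commute)
     ultimately have "d' ?x \<in> ?B" by (auto simp: coboundaries_def split: nat.split)
     moreover have "cf e (d' ?x) = (if e = p then d \<kappa> else \<zero>)" if "p \<le> e" for e
      using cf_diff_power[OF \<kappa>K _ that] True by blast
     ultimately show thesis using that[of "d' ?x"] \<kappa> x by simp
    qed
    have "cf e (y \<oplus> \<ominus> w) = \<zero>" if "p \<le> e" for e
    proof (cases "e = p")
     case True
     thus ?thesis using cf_add[OF yE, of "\<ominus> w"] w cf_neg[OF w(2)] yE K_neg by (simp add: E.M.r_neg)
    next
     case False
     thus ?thesis using cf_add[OF yE, of "\<ominus> w"] w yZ cf_neg[OF w(2)] that K_neg by simp
    qed
    moreover have "y \<oplus> \<ominus> w \<in> cocycles E d' i"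
     using yZ(1) w(1) Ed.coboundaries_cocycles E.submoduleE(3,5)[OF Ed.cocycles_submodule] by blast
    ultimately have "y \<oplus> \<ominus> w \<in> Z p" by (simp add: Z_def)
    hence "y \<oplus> \<ominus> w \<in> mod_span R E ?B S" using S by blast
    moreover have "w \<in> mod_span R E ?B S"
     using w(1) E.mod_span_base[OF Ed.coboundaries_submodule] S(1) Zsub[of p] E.submoduleE(1) by blast
    ultimately have "(y \<oplus> \<ominus> w) \<oplus> w \<in> mod_span R E ?B S"
     using E.submoduleE(5)[OF sp] by blast
    thus "y \<in> mod_span R E ?B S" using yE w(2) by (simp add: E.M.a_assoc E.M.l_neg)
   qed
   have "Z (Suc p) \<subseteq> mod_span R E ?B (S2 @ S)" using 1 mod_span_trans[OF 2] by blast
   thus ?thesis using S2(1) S(1) ZZ by (intro exI[of _ "S2 @ S"]) auto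
  qed
 qed
 then obtain S where S: "set S \<subseteq> Z (Suc i)" "Z (Suc i) \<subseteq> mod_span R E ?B S" by blast
 have "Z (Suc i) = cocycles E d' i"
 proof -
  have "cf e u = \<zero>" if "u \<in> cocycles E d' i" "Suc i \<le> e" for u e
  proof -
   have "e * 1 \<le> e * k" using k by (intro mult_le_mono2) simp
   hence "i < e * k" using that(2) by linarith
   thus ?thesis using cf_large that(1) by (auto simp: cocycles_def)
  qed
  thus ?thesis by (auto simp: Z_def)
 qed
 thus ?thesis using S by (auto simp: fin_gen_cohom_def)
qed

end

context one_gen_cdga
begin

lemma rep_low:
 assumes "u \<in> grade E i" "i < k"
 shows "u \<in> grade K i"
proof -
 have u: "u .: E" using assms E.grade_carrier by blast
 have z: "cf e u = \<zero>" if "e ~= 0" for e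
 proof -
  have "1 * k \<le> e * k" using that by (intro mult_le_mono1) simp
  hence "i < e * k" using assms(2) by linarith
  thus ?thesis using cf_large[OF assms(1)] by blast
 qed
 have "u = finsum E (%e. cf e u \<otimes> v [^] e) {e. cf e u ~= \<zero>}" by (rule cf_expand[OF u])
 also have "\<dots> = finsum E (%e. cf e u \<otimes> v [^] e) {0}"
  using u z by (intro E.M.finsum_supp) auto
 finally have "u = cf 0 u" using u by simp
 thus ?thesis using cf_grade[OF assms(1), of 0] by simp
qed

lemma rep_linear:
 assumes u: "u \<in> grade E i" and i: "k \<le> i" "odd k \<or> i < 2 * k"
 obtains a s where "a \<in> grade K i" "s \<in> grade K (i - k)" "u = a \<oplus> s \<otimes> v"
proof -
 have uc: "u .: E" using u E.grade_carrier by blast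
 have z: "cf e u = \<zero>" if "e \<notin> {0, 1}" for e
 proof -
  have e: "2 \<le> e" using that by auto
  hence "2 * k \<le> e * k" by (rule mult_le_mono1)
  thus ?thesis using cf_odd[OF uc _ e] cf_large[OF u, of e] i(2) by linarith
 qed
 have "u = finsum E (%e. cf e u \<otimes> v [^] e) {e. cf e u ~= \<zero>}" by (rule cf_expand[OF uc])
 also have "\<dots> = finsum E (%e. cf e u \<otimes> v [^] e) {0, 1}"
  using uc z by (intro E.M.finsum_supp) auto
 also have "\<dots> = cf 0 u \<oplus> cf 1 u \<otimes> v"
  using uc by (subst E.M.finsum_insert) auto
 finally show thesis using that cf_grade[OF u, of 0] cf_grade[OF u, of 1] i(1) by simp
qed

lemma rep_quadratic:
 assumes u: "u \<in> grade E i" and i: "even k" "2 * k \<le> i" "i < 3 * k"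
 obtains a s t where "a \<in> grade K i" "s \<in> grade K (i - k)" "t \<in> grade K (i - 2 * k)"
  "u = a \<oplus> s \<otimes> v \<oplus> t \<otimes> v [^] (2::nat)"
proof -
 have uc: "u .: E" using u E.grade_carrier by blast
 have z: "cf e u = \<zero>" if "e \<notin> {0, 1, 2}" for e
 proof -
  have e: "3 \<le> e" using that by auto
  hence "3 * k \<le> e * k" by (rule mult_le_mono1)
  thus ?thesis using cf_large[OF u, of e] i(3) by linarith
 qed
 have "u = finsum E (%e. cf e u \<otimes> v [^] e) {e. cf e u ~= \<zero>}" by (rule cf_expand[OF uc])
 also have "\<dots> = finsum E (%e. cf e u \<otimes> v [^] e) {0, 1, 2}"
  using uc z by (intro E.M.finsum_supp) auto
 also have "\<dots> = cf 0 u \<oplus> cf 1 u \<otimes> v \<oplus> cf 2 u \<otimes> v [^] (2::nat)"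
  using uc by (simp add: E.M.finsum_insert E.M.a_assoc)
 finally show thesis
  using that cf_grade[OF u, of 0] cf_grade[OF u, of 1] cf_grade[OF u, of 2] i by simp
qed

lemma cf_sum2:
 assumes "a .: K" "s .: K"
 shows "cf e (a \<oplus> s \<otimes> v) = (if e = 0 then a else if e = 1 then s else \<zero>)"
 using additive_add[OF cf_additive, of a "s \<otimes> v" e] cf_K[OF assms(1), of e] cf_power[OF assms(2), of 1 e] assms
 by (auto simp: K_ops)

lemma diff_linear:
 assumes "s \<in> grade K p"
 shows "d' (s \<otimes> v) = d s \<otimes> v \<oplus> ksgn E p (s \<otimes> z)"
 using Ed.diff_mult[OF KEg[OF assms] v_carrier] d'_K d'_v K.grade_carrier[OF assms] by simp

lemma closed_linear:
 assumes a: "a .: K" and s: "s \<in> grade K p" and cl: "d' (a \<oplus> s \<otimes> v) = \<zero>"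
 shows "d s = \<zero>" "d a \<oplus> ksgn E p (s \<otimes> z) = \<zero>"
proof -
 have sK: "s .: K" using s K.grade_carrier by blast
 have "d' (a \<oplus> s \<otimes> v) = (d a \<oplus> ksgn E p (s \<otimes> z)) \<oplus> d s \<otimes> v"
  using a sK d'_K[OF a] by (simp add: Ed.diff_add diff_linear[OF s] E.M.a_ac)
 hence "cf e ((d a \<oplus> ksgn E p (s \<otimes> z)) \<oplus> d s \<otimes> v) = \<zero>" for e
  using cl cf_zero by simp
 moreover have "d a \<oplus> ksgn E p (s \<otimes> z) .: K" "d s .: K" using a sK by simp_all
 ultimately have "(if e = 0 then d a \<oplus> ksgn E p (s \<otimes> z) else if e = 1 then d s else \<zero>) = \<zero>" for e :: nat
  using cf_sum2 by metis
 from this[of 0] this[of 1] show "d s = \<zero>" "d a \<oplus> ksgn E p (s \<otimes> z) = \<zero>"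
  by simp_all
qed

lemma closed_quadratic:
 assumes k: "even k" and a: "a .: K" and s: "s \<in> grade K p" and t: "t \<in> grade K p'"
  and cl: "d' (a \<oplus> s \<otimes> v \<oplus> t \<otimes> v [^] (2::nat)) = \<zero>"
 shows "d t = \<zero>" "d s \<oplus> ksgn E p' (t \<otimes> (z \<oplus> z)) = \<zero>"
proof -
 have c: "s .: K" "t .: K" using s t K.grade_carrier by auto
 have "v \<otimes> z = z \<otimes> v"
  using E.graded_comm[OF v_grade KEg[OF z_grade]] k by (simp add: ksgn_def)
 hence pd: "pow_diff (2::nat) = (z \<oplus> z) \<otimes> v"
  using k by (simp add: numeral_2_eq_2 ksgn_def E.A.l_distr)
 let ?A = "d a \<oplus> ksgn E p (s \<otimes> z)" and ?S = "d s \<oplus> ksgn E p' (t \<otimes> (z \<oplus> z))"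
 have "d' (a \<oplus> s \<otimes> v \<oplus> t \<otimes> v [^] (2::nat)) =
  ?A \<oplus> ?S \<otimes> v \<oplus> d t \<otimes> v [^] (2::nat)"
  using a c d'_K[OF a]
  by (simp add: Ed.diff_add diff_linear[OF s] d'_power[OF t] pd E.A.l_distr E.A.m_assoc E.A.ksgn_mult_left E.M.a_ac
    del: pow_diff.simps)
 hence eq: "cf e (?A \<oplus> ?S \<otimes> v \<oplus> d t \<otimes> v [^] (2::nat)) = \<zero>" for e
  using cl cf_zero by simp
 have "cf e (?A \<oplus> ?S \<otimes> v \<oplus> d t \<otimes> v [^] (2::nat)) =
  (if e = 0 then ?A else if e = 1 then ?S else if e = 2 then d t else \<zero>)" for e
  using additive_add[OF cf_additive, of "?A \<oplus> ?S \<otimes> v" "d t \<otimes> v [^] (2::nat)" e]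
   cf_power[of "d t" 2 e] cf_sum2[of ?A ?S e] a c k by (simp add: K_ops)
 from eq[unfolded this, of 2] eq[unfolded this, of 1]
 show "d t = \<zero>" "d s \<oplus> ksgn E p' (t \<otimes> (z \<oplus> z)) = \<zero>" by simp_all
qed

text \<open>In the degree of \<open>v\<close> a cocycle is linear in \<open>v\<close> with a scalar coefficient.  One degree
 higher the coefficient of \<open>v\<close> is a 1-cocycle, hence \<open>d t\<close>, and subtracting \<open>d (t v)\<close> removes it.\<close>

lemma closed_generator_degree:
 assumes H0: "!!a. a \<in> grade K 0 ==> d a = \<zero> ==> \<exists>r\<in>carrier R. a = r \<odot> \<one>"
  and u: "u \<in> grade E k" and cl: "d' u = \<zero>" and k: "0 < k"
 obtains a r where "a \<in> grade K k" "r .: R" "u = a \<oplus> r \<odot> v" "d a \<oplus> r \<odot> z = \<zero>"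
proof -
 obtain a s where a: "a \<in> grade K k" "s \<in> grade K 0" "u = a \<oplus> s \<otimes> v"
  using rep_linear[OF u] k by auto
 have c: "d s = \<zero>" "d a \<oplus> ksgn E 0 (s \<otimes> z) = \<zero>"
  using closed_linear[OF K.grade_carrier[OF a(1)] a(2)] cl a(3) by auto
 obtain r where r: "r .: R" "s = r \<odot> \<one>" using H0[OF a(2) c(1)] by blast
 have "s \<otimes> w = r \<odot> w" if "w .: E" for w
  unfolding r(2) using E.smult_as_mult[OF r(1) that] by simp
 thus thesis using that[OF a(1) r(1)] a(3) c(2) by (simp add: ksgn_def)
qed

lemma closed_next_degree:
 assumes H1: "!!a. a \<in> grade K 1 ==> d a = \<zero> ==> \<exists>t\<in>grade K 0. a = d t"
  and u: "u \<in> grade E (Suc k)" and cl: "d' u = \<zero>" and k: "odd k \<or> 2 \<le> k"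
 obtains a t where "a \<in> grade K (Suc k)" "t \<in> grade K 0" "u = a \<oplus> d' (t \<otimes> v)"
proof -
 have le: "k \<le> Suc k" "odd k \<or> Suc k < 2 * k" using k by auto
 obtain a s where a: "a \<in> grade K (Suc k)" "s \<in> grade K 1" "u = a \<oplus> s \<otimes> v"
  by (rule rep_linear[OF u le]) simp
 have "d s = \<zero>"
  using closed_linear(1)[OF K.grade_carrier[OF a(1)] a(2)] cl a(3) by auto
 then obtain t where t: "t \<in> grade K 0" "s = d t" using H1[OF a(2)] by blast
 have tK: "t .: K" using t K.grade_carrier by blast
 have aK: "a .: K" using a K.grade_carrier by blast
 have dt: "d' (t \<otimes> v) = s \<otimes> v \<oplus> t \<otimes> z"
  using diff_linear[OF t(1)] t(2) by (simp add: ksgn_def)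
 have tz: "t \<otimes> z \<in> grade K (Suc k)" using K_mult_grade[OF t(1) z_grade] by simp
 hence "a \<oplus> \<ominus>\<^bsub>K\<^esub> (t \<otimes> z) \<in> grade K (Suc k)"
  using K.grade_add[OF a(1) K.grade_neg[OF tz]] by (simp add: K_ops)
 moreover have "u = (a \<oplus> \<ominus>\<^bsub>K\<^esub> (t \<otimes> z)) \<oplus> d' (t \<otimes> v)"
 proof -
  have "\<ominus>\<^bsub>K\<^esub> (t \<otimes> z) = \<ominus> (t \<otimes> z)" using tK by (simp add: K_neg)
  moreover have "t \<otimes> z .: E" "s \<otimes> v .: E" using tK t by auto
  ultimately show ?thesis
   unfolding a(3) dt using aK by (simp add: E.M.a_ac E.M.r_neg E.M.r_neg1 E.M.r_neg2)
 qed
 ultimately show thesis using that t(1) by blast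
qed

end

section \<open>Killing a class of the mapping cone\<close>

text \<open>A cocycle of degree \<open>n\<close> of the mapping cone is \<open>(u, c)\<close> with \<open>d u = 0\<close> and \<open>\<phi> u = d c\<close>,
 and the coboundaries are \<open>(d a, \<phi> a + e)\<close> with \<open>e\<close> a coboundary of \<open>B\<close>.\<close>

definition cone_cocycle :: "('r, 'k) gmod => ('k => 'k) => ('r, 'b) gmod => ('b => 'b) => ('k => 'b) => nat => 'k => 'b => bool" where
 "cone_cocycle K d B dB \<phi> n u c \<longleftrightarrow>
   u \<in> grade K (Suc n) \<and> d u = \<zero>\<^bsub>K\<^esub> \<and> c \<in> grade B n \<and> \<phi> u = dB c"

fun cone_span :: "('r, 'e) ring_scheme => ('r, 'k) gmod => ('k => 'k) => ('r, 'b) gmod => ('b => 'b) => ('k => 'b) => nat =>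
  ('k \<times> 'b) list => ('k \<times> 'b) set" where
 "cone_span R K d B dB \<phi> n [] =
   {(d a, \<phi> a \<oplus>\<^bsub>B\<^esub> e) | a e. a \<in> grade K n \<and> e \<in> coboundaries B dB n}"
| "cone_span R K d B dB \<phi> n (g # G) =
   {((r \<odot>\<^bsub>K\<^esub> fst g) \<oplus>\<^bsub>K\<^esub> u, (r \<odot>\<^bsub>B\<^esub> snd g) \<oplus>\<^bsub>B\<^esub> c) | r u c. r .: R \<and> (u, c) \<in> cone_span R K d B dB \<phi> n G}"

text \<open>\<open>H\<^sup>n\<close> of the mapping cone of \<open>\<phi>\<close> is zero.\<close>

definition cone_acyclic where
 "cone_acyclic R K d B dB \<phi> n \<longleftrightarrow> (\<forall>u c. cone_cocycle K d B dB \<phi> n u c \<longrightarrow> (u, c) \<in> cone_span R K d B dB \<phi> n [])"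

definition model_extends where
 "model_extends K d \<phi> K' d' \<phi>' \<longleftrightarrow> carrier K \<subseteq> carrier K' \<and> (\<forall>n. grade K n \<subseteq> grade K' n) \<and>
   mult K = mult K' \<and> add K = add K' \<and> zero K = zero K' \<and> one K = one K' \<and> smult K = smult K' \<and>
   (\<forall>a\<in>carrier K. d' a = d a \<and> \<phi>' a = \<phi> a)"

text \<open>The hypotheses on \<open>B\<close> in terms of cocycles: \<open>H\<^sup>0\<close> consists of the scalars, \<open>H\<^sup>1\<close> is zero
 and \<open>H\<^sup>2\<close> is torsion free.\<close>

locale pid_target = B: cdga R B dB
 for R :: "('r, 'e) ring_scheme" and B :: "('r, 'b) gmod" (structure) and dB :: "'b => 'b" +
 assumes pid: "principal_domain R" and half: "\<one>\<^bsub>R\<^esub> \<oplus>\<^bsub>R\<^esub> \<one>\<^bsub>R\<^esub> \<in> Units R"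
  and B_H0: "\<lbrakk>c \<in> grade B 0; dB c = \<zero>\<rbrakk> \<Longrightarrow> \<exists>r\<in>carrier R. c = r \<odot> \<one>"
  and B_scalars: "\<lbrakk>r .: R; r \<odot> \<one> = \<zero>\<rbrakk> \<Longrightarrow> r = \<zero>\<^bsub>R\<^esub>"
  and B_H1: "\<lbrakk>c \<in> grade B 1; dB c = \<zero>\<rbrakk> \<Longrightarrow> \<exists>t\<in>grade B 0. c = dB t"
  and B_H2: "\<lbrakk>s \<in> grade B 2; dB s = \<zero>; q .: R; q ~= \<zero>\<^bsub>R\<^esub>; t \<in> grade B 1; q \<odot> s = dB t\<rbrakk> \<Longrightarrow>
   \<exists>t'\<in>grade B 1. s = dB t'"

locale cdga_model = pid_target R B dB + K: cdga R K d
 for R :: "('r, 'e) ring_scheme" and B :: "('r, 'b) gmod" (structure) and dB and K :: "('r, 'k) gmod" and d +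
 fixes \<phi> :: "'k => 'b"
 assumes phi: "cdga_hom R K d B dB \<phi>"
  and K_H0: "\<lbrakk>a \<in> grade K 0; d a = \<zero>\<^bsub>K\<^esub>\<rbrakk> \<Longrightarrow> \<exists>r\<in>carrier R. a = r \<odot>\<^bsub>K\<^esub> \<one>\<^bsub>K\<^esub>"
begin

lemma phi_closed[simp]: "x .: K ==> \<phi> x .: B"
 and phi_add: "x .: K ==> y .: K ==> \<phi> (x \<oplus>\<^bsub>K\<^esub> y) = \<phi> x \<oplus> \<phi> y"
 and phi_one: "\<phi> \<one>\<^bsub>K\<^esub> = \<one>"
 and phi_smult: "r .: R ==> x .: K ==> \<phi> (r \<odot>\<^bsub>K\<^esub> x) = r \<odot> \<phi> x"
 and phi_grade: "x \<in> grade K n ==> \<phi> x \<in> grade B n"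
 and phi_diff: "x .: K ==> \<phi> (d x) = dB (\<phi> x)"
 using phi unfolding cdga_hom_def ring_hom_def by (auto simp: image_subset_iff)

lemma phi_additive: "additive_map K B \<phi>"
 by (rule additiveI) (simp_all add: phi_add)

lemmas phi_zero[simp] = additive_zero[OF K.M.ab B.M.ab phi_additive]
lemmas phi_neg = additive_neg[OF K.M.ab B.M.ab phi_additive]

lemma K_scalars: "r .: R ==> r \<odot>\<^bsub>K\<^esub> \<one>\<^bsub>K\<^esub> = \<zero>\<^bsub>K\<^esub> ==> r = \<zero>\<^bsub>R\<^esub>"
 using B_scalars[of r] phi_smult[of r "\<one>\<^bsub>K\<^esub>"] phi_one by simp

lemma K_H1:
 assumes "cone_acyclic R K d B dB \<phi> 0" "a \<in> grade K 1" "d a = \<zero>\<^bsub>K\<^esub>"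
 shows "\<exists>t\<in>grade K 0. a = d t"
proof -
 have "dB (\<phi> a) = \<zero>" using phi_diff[of a] assms K.grade_carrier by simp
 then obtain c where c: "c \<in> grade B 0" "\<phi> a = dB c" using B_H1[OF phi_grade[OF assms(2)]] by blast
 hence "cone_cocycle K d B dB \<phi> 0 a c" using assms(2,3) by (simp add: cone_cocycle_def)
 thus ?thesis using assms(1) by (auto simp: cone_acyclic_def)
qed

text \<open>\<open>H\<^sup>2(K)\<close> embeds in \<open>H\<^sup>2(B)\<close>, so it is torsion free.\<close>

lemma K_H2:
 assumes ac: "cone_acyclic R K d B dB \<phi> 1" and s: "s \<in> grade K 2" "d s = \<zero>\<^bsub>K\<^esub>"
  and q: "q .: R" "q ~= \<zero>\<^bsub>R\<^esub>" and t: "t \<in> grade K 1" "q \<odot>\<^bsub>K\<^esub> s = d t"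
 shows "\<exists>t'\<in>grade K 1. s = d t'"
proof -
 have c: "s .: K" "t .: K" using s t K.grade_carrier by auto
 have "q \<odot> \<phi> s = dB (\<phi> t)" using phi_smult[OF q(1) c(1)] phi_diff[OF c(2)] t(2) by simp
 moreover have "dB (\<phi> s) = \<zero>" using phi_diff[OF c(1)] s(2) by simp
 ultimately obtain b where b: "b \<in> grade B 1" "\<phi> s = dB b"
  using B_H2[OF phi_grade[OF s(1)] _ q phi_grade[OF t(1)]] by blast
 hence "cone_cocycle K d B dB \<phi> 1 s b" using s by (simp add: cone_cocycle_def numeral_2_eq_2)
 thus ?thesis using ac by (auto simp: cone_acyclic_def)
qed

lemma cone_span_carrier:
 assumes "set G \<subseteq> carrier K \<times> carrier B" "(u, c) \<in> cone_span R K d B dB \<phi> n G"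
 shows "u .: K" "c .: B"
proof -
 have "u .: K \<and> c .: B"
  using assms
 proof (induction G arbitrary: u c)
  case Nil
  thus ?case using B.grade_carrier[OF B.coboundaries_grade] by (auto simp: K.grade_carrier)
 next
  case (Cons g G)
  thus ?case by fastforce
 qed
 thus "u .: K" "c .: B" by auto
qed

lemma cone_span_add_boundary:
 assumes "set G \<subseteq> carrier K \<times> carrier B" "(u, c) \<in> cone_span R K d B dB \<phi> n G" "a \<in> grade K n"
 shows "(u \<oplus>\<^bsub>K\<^esub> d a, c \<oplus> \<phi> a) \<in> cone_span R K d B dB \<phi> n G"
 using assms(1,2)
proof (induction G arbitrary: u c)
 case Nil
 then obtain a' e where h: "a' \<in> grade K n" "e \<in> coboundaries B dB n" "u = d a'" "c = \<phi> a' \<oplus> e" by auto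
 have cl: "a' .: K" "a .: K" "e .: B"
  using h assms(3) K.grade_carrier B.grade_carrier[OF B.coboundaries_grade] by auto
 have "u \<oplus>\<^bsub>K\<^esub> d a = d (a' \<oplus>\<^bsub>K\<^esub> a)" "c \<oplus> \<phi> a = \<phi> (a' \<oplus>\<^bsub>K\<^esub> a) \<oplus> e"
  using h cl by (simp_all add: K.diff_add phi_add B.M.a_ac)
 moreover have "a' \<oplus>\<^bsub>K\<^esub> a \<in> grade K n" using h assms(3) by blast
 ultimately show ?case using h(2) by auto
next
 case (Cons g G)
 then obtain r u' c' where h: "r .: R" "(u', c') \<in> cone_span R K d B dB \<phi> n G"
  "u = (r \<odot>\<^bsub>K\<^esub> fst g) \<oplus>\<^bsub>K\<^esub> u'" "c = (r \<odot> snd g) \<oplus> c'" by auto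
 have G: "set G \<subseteq> carrier K \<times> carrier B" "fst g .: K" "snd g .: B" using Cons.prems by auto
 have cl: "u' .: K" "c' .: B" "a .: K"
  using cone_span_carrier[OF G(1) h(2)] assms(3) K.grade_carrier by auto
 have "u \<oplus>\<^bsub>K\<^esub> d a = (r \<odot>\<^bsub>K\<^esub> fst g) \<oplus>\<^bsub>K\<^esub> (u' \<oplus>\<^bsub>K\<^esub> d a)"
  "c \<oplus> \<phi> a = (r \<odot> snd g) \<oplus> (c' \<oplus> \<phi> a)"
  using h G cl by (simp_all add: K.M.a_assoc B.M.a_assoc)
 thus ?case using Cons.IH[OF G(1) h(2)] h(1) by auto
qed

end

lemma cone_span_mono:
 fixes B :: "('r, 'b) gmod" (structure)
 assumes "model_extends K d \<phi> K' d' \<phi>'" and "graded_module R K"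
 shows "cone_span R K d B dB \<phi> n G \<subseteq> cone_span R K' d' B dB \<phi>' n G"
proof (induction G)
 case Nil
 show ?case
 proof
  fix p assume "p \<in> cone_span R K d B dB \<phi> n []"
  then obtain a e where h: "a \<in> grade K n" "e \<in> coboundaries B dB n" "p = (d a, \<phi> a \<oplus> e)" by auto
  have "a \<in> grade K' n" "d' a = d a" "\<phi>' a = \<phi> a"
   using assms(1) h(1) graded_module.grade_carrier[OF assms(2) h(1)] by (auto simp: model_extends_def)
  thus "p \<in> cone_span R K' d' B dB \<phi>' n []" using h(2,3) by force
 qed
next
 case (Cons g G)
 thus ?case using assms(1) unfolding model_extends_def by auto
qed

text \<open>Up to coboundaries, the cone cocycles of the extension come from \<open>K\<close>.\<close>

definition cone_reduces where
 "cone_reduces K K' d' B dB \<phi>' i \<longleftrightarrow> (\<forall>u c. cone_cocycle K' d' B dB \<phi>' i u c \<longrightarrow>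
   (\<exists>u0\<in>grade K (Suc i). \<exists>e\<in>grade K' i. u = u0 \<oplus>\<^bsub>K'\<^esub> d' e))"

context
 fixes R :: "('r, 'e) ring_scheme" and B :: "('r, 'b) gmod" (structure) and dB and K K' :: "('r, 'k) gmod" and d d' \<phi> \<phi>'
 assumes mK: "cdga_model R B dB K d \<phi>" and mK': "cdga_model R B dB K' d' \<phi>'"
  and ext: "model_extends K d \<phi> K' d' \<phi>'"
begin

interpretation K: cdga_model R B dB K d \<phi> by (rule mK)
interpretation K': cdga_model R B dB K' d' \<phi>' by (rule mK')

lemma cone_reduce:
 assumes red: "cone_reduces K K' d' B dB \<phi>' i" and cc: "cone_cocycle K' d' B dB \<phi>' i u c"
 obtains u0 c0 e where "cone_cocycle K d B dB \<phi> i u0 c0" "e \<in> grade K' i" "u = u0 \<oplus>\<^bsub>K'\<^esub> d' e"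
  "c = c0 \<oplus> \<phi>' e"
proof -
 obtain u0 e where h: "u0 \<in> grade K (Suc i)" "e \<in> grade K' i" "u = u0 \<oplus>\<^bsub>K'\<^esub> d' e"
  using red cc unfolding cone_reduces_def by blast
 have u0: "u0 .: K" using h K.K.grade_carrier by blast
 hence u0': "u0 .: K'" using ext by (auto simp: model_extends_def)
 have e: "e .: K'" using h K'.K.grade_carrier by blast
 have c: "c \<in> grade B i" "c .: B" "d' u = \<zero>\<^bsub>K'\<^esub>" "\<phi>' u = dB c"
  using cc K.B.grade_carrier by (auto simp: cone_cocycle_def)
 let ?c0 = "c \<oplus> \<ominus> \<phi>' e"
 have "d u0 = \<zero>\<^bsub>K\<^esub>"
 proof -
  have "d' u = d' u0" using h(3) u0' e by (simp add: K'.K.diff_add K'.K.diff_diff)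
  thus ?thesis using c(3) u0 ext by (simp add: model_extends_def)
 qed
 moreover have "\<phi> u0 = dB ?c0"
 proof -
  have "dB c = \<phi>' u0 \<oplus> dB (\<phi>' e)" using h(3) c(4) u0' e by (simp add: K'.phi_add K'.phi_diff)
  moreover have "\<phi>' u0 = \<phi> u0" using u0 ext by (simp add: model_extends_def)
  ultimately show ?thesis
   using c(2) u0 e by (simp add: K.B.diff_add K.B.diff_neg K.B.M.a_assoc K.B.M.r_neg)
 qed
 moreover have "?c0 \<in> grade B i" using c h K'.phi_grade by blast
 ultimately have "cone_cocycle K d B dB \<phi> i u0 ?c0" using h by (simp add: cone_cocycle_def)
 moreover have "c = ?c0 \<oplus> \<phi>' e" using c e by (simp add: K.B.M.a_assoc K.B.M.l_neg)
 ultimately show thesis using that h by blast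
qed

lemma cone_acyclic_extends:
 assumes red: "cone_reduces K K' d' B dB \<phi>' i" and ac: "cone_acyclic R K d B dB \<phi> i"
 shows "cone_acyclic R K' d' B dB \<phi>' i"
 unfolding cone_acyclic_def
proof (intro allI impI)
 fix u c assume "cone_cocycle K' d' B dB \<phi>' i u c"
 then obtain u0 c0 e where h: "cone_cocycle K d B dB \<phi> i u0 c0" "e \<in> grade K' i" "u = u0 \<oplus>\<^bsub>K'\<^esub> d' e"
  "c = c0 \<oplus> \<phi>' e" using cone_reduce[OF red] by blast
 hence "(u0, c0) \<in> cone_span R K' d' B dB \<phi>' i []"
  using ac cone_span_mono[OF ext K.K.graded_module_axioms] unfolding cone_acyclic_def by blast
 thus "(u, c) \<in> cone_span R K' d' B dB \<phi>' i []"
  unfolding h(3,4) using K'.cone_span_add_boundary[OF _ _ h(2), of "[]"] by simp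
qed

text \<open>In the extension the class of \<open>g\<close> is the boundary of the new generator, so the remaining
 classes generate.\<close>

lemma cone_span_extends:
 assumes red: "cone_reduces K K' d' B dB \<phi>' n"
  and G: "set (g # G) \<subseteq> carrier K \<times> carrier B"
  and span: "!!u c. cone_cocycle K d B dB \<phi> n u c ==> (u, c) \<in> cone_span R K d B dB \<phi> n (g # G)"
  and x: "x \<in> grade K' n" "d' x = fst g" "\<phi>' x = snd g"
  and cc: "cone_cocycle K' d' B dB \<phi>' n u c"
 shows "(u, c) \<in> cone_span R K' d' B dB \<phi>' n G"
proof -
 obtain u0 c0 e where h: "cone_cocycle K d B dB \<phi> n u0 c0" "e \<in> grade K' n" "u = u0 \<oplus>\<^bsub>K'\<^esub> d' e"
  "c = c0 \<oplus> \<phi>' e" using cone_reduce[OF red cc] by blast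
 obtain r u1 c1 where r: "r .: R" "(u1, c1) \<in> cone_span R K d B dB \<phi> n G"
  "u0 = (r \<odot>\<^bsub>K\<^esub> fst g) \<oplus>\<^bsub>K\<^esub> u1" "c0 = (r \<odot> snd g) \<oplus> c1"
  using span[OF h(1)] by auto
 have sub: "carrier K \<subseteq> carrier K'" and ops: "add K = add K'" "smult K = smult K'"
  using ext by (auto simp: model_extends_def)
 have G': "set G \<subseteq> carrier K' \<times> carrier B" using G sub by auto
 have u1: "(u1, c1) \<in> cone_span R K' d' B dB \<phi>' n G"
  using cone_span_mono[OF ext K.K.graded_module_axioms] r(2) by blast
 have cl: "u1 .: K'" "c1 .: B" using K'.cone_span_carrier[OF G' u1] by auto
 have xc: "x .: K'" "e .: K'" using x h K'.K.grade_carrier by auto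
 let ?a = "(r \<odot>\<^bsub>K'\<^esub> x) \<oplus>\<^bsub>K'\<^esub> e"
 have "?a \<in> grade K' n" using r x h by blast
 note K'.cone_span_add_boundary[OF G' u1 this]
 moreover have "u = u1 \<oplus>\<^bsub>K'\<^esub> d' ?a"
  unfolding h(3) r(3) ops using r xc cl
  by (simp add: K'.K.diff_add K'.K.diff_smult K'.K.M.a_ac flip: x(2))
 moreover have "c = c1 \<oplus> \<phi>' ?a"
  unfolding h(4) r(4) using r xc cl
  by (simp add: K'.phi_add K'.phi_smult K.B.M.a_ac flip: x(3))
 ultimately show ?thesis by simp
qed

end

lemma (in abelian_group) cancel_middle:
 assumes "a .: G" "w .: G" "x .: G" "t .: G"
 shows "(a \<oplus> \<ominus> w) \<oplus> ((x \<oplus> w) \<oplus> t) = (a \<oplus> x) \<oplus> t"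
proof -
 have "(a \<oplus> \<ominus> w) \<oplus> ((x \<oplus> w) \<oplus> t) = (a \<oplus> (x \<oplus> t)) \<oplus> (\<ominus> w \<oplus> w)"
  using assms by (simp add: a_ac)
 thus ?thesis using assms by (simp add: l_neg a_assoc)
qed

lemma (in module) smult_commute:
 "r .: R ==> q .: R ==> x .: M ==> r \<odot>\<^bsub>M\<^esub> (q \<odot>\<^bsub>M\<^esub> x) = q \<odot>\<^bsub>M\<^esub> (r \<odot>\<^bsub>M\<^esub> x)"
 by (simp add: smult_assoc1[symmetric] R.m_comm)

text \<open>One generator \<open>x\<close> suffices to kill the class of \<open>(z, b)\<close> if no nonzero multiple of it
 vanishes.\<close>

lemma kill_torsion_free_class:
 fixes E :: "('r, 'k) gmod" (structure)
 assumes m: "cdga_model R B dB K d \<phi>" and X: "one_gen_cdga R K E x n cf d z d'"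
  and hom: "cdga_hom R E d' B dB \<phi>'" and agree: "!!a. a .: K ==> \<phi>' a = \<phi> a"
  and b: "\<phi>' x = b" and n: "2 \<le> n" and ac: "!!i. i < n ==> cone_acyclic R K d B dB \<phi> i"
  and ann: "!!r a c. \<lbrakk>r .: R; a \<in> grade K n; c \<in> grade B (n - 1);
   d a \<oplus>\<^bsub>K\<^esub> r \<odot>\<^bsub>K\<^esub> z = \<zero>\<^bsub>K\<^esub>; \<phi> a \<oplus>\<^bsub>B\<^esub> r \<odot>\<^bsub>B\<^esub> b = dB c\<rbrakk> \<Longrightarrow> r = \<zero>\<^bsub>R\<^esub>"
 shows "cdga_model R B dB E d' \<phi>'" "i \<le> n ==> cone_reduces K E d' B dB \<phi>' i"
  "model_extends K d \<phi> E d' \<phi>'"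
proof -
 interpret M: cdga_model R B dB K d \<phi> by (rule m)
 interpret X: one_gen_cdga R K E x n cf d z d' by (rule X)
 have H0: "\<exists>r\<in>carrier R. a = r \<odot> \<one>" if "a \<in> grade K 0" "d a = \<zero>" for a
  using M.K_H0[OF that(1)] that(2) by (simp add: X.K_ops)
 have H1: "\<exists>t\<in>grade K 0. a = d t" if "a \<in> grade K 1" "d a = \<zero>" for a
  using M.K_H1[OF ac that(1)] that(2) n by (simp add: X.K_ops)
 show E: "cdga_model R B dB E d' \<phi>'"
 proof (intro cdga_model.intro M.pid_target_axioms X.Ed.cdga_axioms cdga_model_axioms.intro hom)
  fix a assume a: "a \<in> grade E 0" "d' a = \<zero>"
  hence "a \<in> grade K 0" using X.rep_low n by auto
  thus "\<exists>r\<in>carrier R. a = r \<odot> \<one>"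
   using H0 a(2) X.d'_K[OF M.K.grade_carrier] by simp
 qed
 interpret E: cdga_model R B dB E d' \<phi>' by (rule E)
 show "model_extends K d \<phi> E d' \<phi>'"
  using X.K_carrier X.K_grade X.K_ops X.d'_K agree by (auto simp: model_extends_def)
 show "cone_reduces K E d' B dB \<phi>' i" if le: "i \<le> n"
  unfolding cone_reduces_def
 proof (intro allI impI)
  fix u c assume cc: "cone_cocycle E d' B dB \<phi>' i u c"
  hence u: "u \<in> grade E (Suc i)" "d' u = \<zero>" "c \<in> grade B i" "\<phi>' u = dB c"
   by (auto simp: cone_cocycle_def)
  have uc: "u .: E" using u(1) X.E.grade_carrier by blast
  have zero: "\<exists>u0\<in>grade K (Suc i). \<exists>e\<in>grade E i. u = u0 \<oplus> d' e" if "u \<in> grade K (Suc i)"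
   using that uc X.Ed.diff_zero by (intro bexI[of _ u] bexI[of _ "\<zero>"]) auto
  consider "Suc i < n" | "Suc i = n" | "i = n" using le by linarith
  thus "\<exists>u0\<in>grade K (Suc i). \<exists>e\<in>grade E i. u = u0 \<oplus> d' e"
  proof cases
   case 1
   thus ?thesis using zero X.rep_low[OF u(1)] by blast
  next
   case 2
   obtain a r where a: "a \<in> grade K n" "r .: R" "u = a \<oplus> r \<odot> x"
    "d a \<oplus> r \<odot> z = \<zero>"
    using X.closed_generator_degree[OF H0 _ u(2)] u(1) 2 n by auto
   have aK: "a .: K" using a(1) M.K.grade_carrier by blast
   have "\<phi> a \<oplus>\<^bsub>B\<^esub> r \<odot>\<^bsub>B\<^esub> b = dB c"
    using u(4) a aK agree[OF aK] b E.phi_add[of a "r \<odot> x"] E.phi_smult[OF a(2) X.v_carrier] by simp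
   moreover have "c \<in> grade B (n - 1)" using u(3) 2 by auto
   ultimately have "r = \<zero>\<^bsub>R\<^esub>" using ann[OF a(2,1)] a(4) by (simp add: X.K_ops)
   hence "u = a" using a(3) aK by simp
   thus ?thesis using zero a(1) 2 by simp
  next
   case 3
   obtain a t where a: "a \<in> grade K (Suc n)" "t \<in> grade K 0" "u = a \<oplus> d' (t \<otimes> x)"
    using X.closed_next_degree[OF H1 _ u(2)] u(1) 3 n by auto
   have "t \<otimes> x \<in> grade E n" using X.E.mult_grade[OF X.KEg[OF a(2)] X.v_grade] by simp
   thus ?thesis using a 3 by blast
  qed
 qed
qed

text \<open>If the multiples of the class that vanish are those by multiples of \<open>q \<noteq> 0\<close>, a second generator
 \<open>y\<close> with \<open>d y = q x + w\<close> kills the class of \<open>q x + w\<close> that \<open>x\<close> has created one degree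
 below.  In degree \<open>n + 1\<close> a cocycle of the extension is \<open>a + s y\<close>; comparing the
 coefficients of \<open>x\<close> shows that \<open>q s\<close> is a boundary, so \<open>s\<close> is one by torsion freeness of
 \<open>H\<^sup>2\<close>, and \<open>s y\<close> can be removed.\<close>

lemma kill_torsion_class:
 fixes E :: "('r, 'k) gmod" (structure)
 assumes m: "cdga_model R B dB K d \<phi>" and X: "one_gen_cdga R K K1 x n cf1 d z d1"
  and Y: "one_gen_cdga R K1 E y (n - 1) cf2 d1 zy d2"
  and hom: "cdga_hom R E d2 B dB \<phi>2" and agree: "!!a. a .: K ==> \<phi>2 a = \<phi> a"
  and b: "\<phi>2 x = b" and n: "2 \<le> n" and ac: "!!i. i < n ==> cone_acyclic R K d B dB \<phi> i"
  and q: "q .: R" "q ~= \<zero>\<^bsub>R\<^esub>" and w: "w \<in> grade K n" and zy: "zy = q \<odot>\<^bsub>K\<^esub> x \<oplus>\<^bsub>K\<^esub> w"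
  and ann: "!!r a c. \<lbrakk>r .: R; a \<in> grade K n; c \<in> grade B (n - 1);
   d a \<oplus>\<^bsub>K\<^esub> r \<odot>\<^bsub>K\<^esub> z = \<zero>\<^bsub>K\<^esub>; \<phi> a \<oplus>\<^bsub>B\<^esub> r \<odot>\<^bsub>B\<^esub> b = dB c\<rbrakk> \<Longrightarrow> \<exists>r'\<in>carrier R. r = r' \<otimes>\<^bsub>R\<^esub> q"
 shows "cdga_model R B dB E d2 \<phi>2" "i \<le> n ==> cone_reduces K E d2 B dB \<phi>2 i"
  "model_extends K d \<phi> E d2 \<phi>2"
proof -
 interpret M: cdga_model R B dB K d \<phi> by (rule m)
 interpret X: one_gen_cdga R K K1 x n cf1 d z d1 by (rule X)
 interpret Y: one_gen_cdga R K1 E y "n - 1" cf2 d1 zy d2 by (rule Y)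
 interpret P: principal_domain R by (rule M.pid)
 note ops = X.K_ops Y.K_ops
 have KK1: "a .: K1" and KE: "a .: E" if "a .: K" for a using that by auto
 have K1E: "a .: E" if "a .: K1" for a using that by auto
 have gK: "a .: K" if "a \<in> grade K i" for a i using that M.K.grade_carrier by blast
 have gK1: "a .: K1" if "a \<in> grade K1 i" for a i using that X.E.grade_carrier by blast
 have gKE: "a \<in> grade E i" if "a \<in> grade K i" for a i using that X.KEg Y.KEg by blast
 have d1K: "d1 a = d a" if "a .: K" for a using X.d'_K that .
 have d2K1: "d2 a = d1 a" if "a .: K1" for a using Y.d'_K that .
 have d2K: "d2 a = d a" if "a .: K" for a using that d1K d2K1 KK1 by simp
 have xE: "x .: E" "x .: K1" "x \<in> grade E n" using X.v_grade Y.KEg gK1 by auto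
 have wE: "w .: E" "w .: K" "w .: K1" using w gK KE by auto
 have zE: "z .: E" "z .: K" using X.z_carrier by auto
 have zyE: "zy = q \<odot> x \<oplus> w" "zy .: E" using zy Y.z_carrier by (simp_all add: ops)
 have d2y: "d2 y = q \<odot> x \<oplus> w" using Y.d'_v zyE by simp
 have torsion: "r = \<zero>\<^bsub>R\<^esub>" if "r .: R" "(r \<otimes>\<^bsub>R\<^esub> q) \<odot> \<one> = \<zero>" for r
  using M.K_scalars[of "r \<otimes>\<^bsub>R\<^esub> q"] that q P.integral[of r q] by (auto simp: ops)
 have scal: "(r \<odot> \<one>) \<otimes> a = r \<odot> a" if "r .: R" "a .: E" for r a
  using Y.E.smult_as_mult[OF that] by simp
 have H0: "\<exists>r\<in>carrier R. a = r \<odot> \<one>" if "a \<in> grade K 0" "d a = \<zero>" for a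
  using M.K_H0[OF that(1)] that(2) by (simp add: ops)
 have H1: "\<exists>t\<in>grade K 0. a = d t" if "a \<in> grade K 1" "d a = \<zero>" for a
  using M.K_H1[OF ac that(1)] that(2) n by (simp add: ops)
 have low: "a \<in> grade K i" if "a \<in> grade K1 i" "i < n" for a i using X.rep_low that by blast
 have H0': "\<exists>r\<in>carrier R. a = r \<odot> \<one>" if "a \<in> grade K1 0" "d1 a = \<zero>" for a
  using H0[OF low[OF that(1)]] d1K[OF gK[OF low[OF that(1)]]] that(2) n by auto
 have H1': "\<exists>t\<in>grade K1 0. a = d1 t" if a: "a \<in> grade K1 1" "d1 a = \<zero>" for a
 proof -
  have aK: "a \<in> grade K 1" using low[OF a(1)] n by auto
  then obtain t where t: "t \<in> grade K 0" "a = d t" using H1 d1K[OF gK] a(2) by auto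
  thus ?thesis using d1K[OF gK[OF t(1)]] X.KEg by (intro bexI[of _ t]) auto
 qed
 have X_gen: "\<exists>a\<in>grade K n. \<exists>r\<in>carrier R. u = a \<oplus> r \<odot> x \<and> d a \<oplus> r \<odot> z = \<zero>"
  if "u \<in> grade K1 n" "d1 u = \<zero>" for u
  by (rule X.closed_generator_degree[of u]) (use H0 that n in \<open>auto simp: ops\<close>)
 have X_next: "\<exists>a\<in>grade K (Suc n). \<exists>t\<in>grade K 0. u = a \<oplus> d1 (t \<otimes> x)"
  if "u \<in> grade K1 (Suc n)" "d1 u = \<zero>" for u
  by (rule X.closed_next_degree[of u]) (use H1 that n in \<open>auto simp: ops\<close>)
 have Y_gen: "\<exists>a\<in>grade K1 (n - 1). \<exists>r\<in>carrier R. u = a \<oplus> r \<odot> y \<and> d1 a \<oplus> r \<odot> zy = \<zero>"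
  if "u \<in> grade E (n - 1)" "d2 u = \<zero>" for u
  by (rule Y.closed_generator_degree[of u]) (use H0' that n in auto)
 have Y_next: "\<exists>a\<in>grade K1 n. \<exists>t\<in>grade K1 0. u = a \<oplus> d2 (t \<otimes> y)"
  if "u \<in> grade E n" "d2 u = \<zero>" for u
 proof -
  have odd: "odd (n - 1) \<or> 2 \<le> n - 1" using n by (cases "n = 2") auto
  have suc: "Suc (n - 1) = n" using n by simp
  have u: "u \<in> grade E (Suc (n - 1))" unfolding suc by (rule that(1))
  show ?thesis
  proof (rule Y.closed_next_degree[OF _ u that(2) odd])
   fix a assume "a \<in> grade K1 1" "d1 a = \<zero>"
   thus "\<exists>t\<in>grade K1 0. a = d1 t" by (rule H1')
  next
   fix a t assume "a \<in> grade K1 (Suc (n - 1))" "t \<in> grade K1 0" "u = a \<oplus> d2 (t \<otimes> y)"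
   thus ?thesis unfolding suc by blast
  qed
 qed
 \<comment> \<open>coefficients of an equation in \<open>K1\<close> that is linear in \<open>x\<close>\<close>
 have X_coeff: "a = \<zero>" "s = \<zero>" if "a .: K" "s .: K" "a \<oplus> s \<otimes> x = \<zero>" for a s
 proof -
  have "cf1 e (a \<oplus> s \<otimes> x) = (if e = 0 then a else if e = 1 then s else \<zero>)" for e
   using X.cf_sum2[OF that(1,2), of e] by (simp add: ops)
  moreover have "cf1 e (a \<oplus> s \<otimes> x) = \<zero>" for e
   using X.cf_zero[of e] that(3) by (simp add: ops)
  ultimately have "(if e = 0 then a else if e = 1 then s else \<zero>) = \<zero>" for e :: nat by metis
  from this[of 0] this[of 1] show "a = \<zero>" "s = \<zero>" by simp_all
 qed
 have K_ops': "a \<oplus> a' .: K" "a \<otimes> a' .: K" if "a .: K" "a' .: K" for a a'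
  using X.K_add[OF that] X.K_mult[OF that] by (simp_all add: ops)
 have K_sm: "r \<odot> a .: K" if "r .: R" "a .: K" for r a
  using X.K_smult[OF that] by (simp add: ops)
 have K_sm_g: "r \<odot> a \<in> grade K i" if "r .: R" "a \<in> grade K i" for r a i
  using M.K.grade_smult[OF that] by (simp add: ops)
 have K_add_g: "a \<oplus> a' \<in> grade K i" if "a \<in> grade K i" "a' \<in> grade K i" for a a' i
  using M.K.grade_add[OF that] by (simp add: ops)
 have K_one: "\<one> .: K" using X.K_one by (simp add: ops)
 show E: "cdga_model R B dB E d2 \<phi>2"
 proof (intro cdga_model.intro M.pid_target_axioms Y.Ed.cdga_axioms cdga_model_axioms.intro hom)
  fix a assume a: "a \<in> grade E 0" "d2 a = \<zero>"
  hence "a \<in> grade K1 0" using Y.rep_low n by auto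
  thus "\<exists>r\<in>carrier R. a = r \<odot> \<one>"
   using H0' a(2) d2K1[OF gK1] by simp
 qed
 interpret E: cdga_model R B dB E d2 \<phi>2 by (rule E)
 show "model_extends K d \<phi> E d2 \<phi>2"
  using KE gKE d2K agree by (auto simp: model_extends_def ops)
 \<comment> \<open>a multiple of \<open>d y\<close> plus an element of \<open>K\<close>: both coefficients are controlled\<close>
 have no_multiple: "r = \<zero>\<^bsub>R\<^esub>" if "r .: R" "a .: K" "a \<oplus> r \<odot> zy = \<zero>" for a r
 proof -
  have "a \<oplus> r \<odot> zy = (a \<oplus> r \<odot> w) \<oplus> ((r \<otimes>\<^bsub>R\<^esub> q) \<odot> \<one>) \<otimes> x"
   unfolding scal[OF M.B.R.m_closed[OF that(1) q(1)] xE(1)]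
   using that(1,2) q xE wE by (simp add: zyE(1) Y.E.smult_r_distr Y.E.smult_assoc1 Y.E.M.a_ac)
  hence "(r \<otimes>\<^bsub>R\<^esub> q) \<odot> \<one> = \<zero>"
   using X_coeff(2)[of "a \<oplus> r \<odot> w" "(r \<otimes>\<^bsub>R\<^esub> q) \<odot> \<one>"] that q wE K_ops' K_sm K_one by simp
  thus ?thesis using torsion that(1) by blast
 qed
 show "cone_reduces K E d2 B dB \<phi>2 i" if le: "i \<le> n"
  unfolding cone_reduces_def
 proof (intro allI impI)
  fix u c assume cc: "cone_cocycle E d2 B dB \<phi>2 i u c"
  hence u: "u \<in> grade E (Suc i)" "d2 u = \<zero>" "c \<in> grade B i" "\<phi>2 u = dB c"
   by (auto simp: cone_cocycle_def)
  have uc: "u .: E" using u(1) Y.E.grade_carrier by blast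
  have zero: "\<exists>u0\<in>grade K (Suc i). \<exists>e\<in>grade E i. u = u0 \<oplus> d2 e" if "u \<in> grade K (Suc i)"
   using that uc Y.Ed.diff_zero by (intro bexI[of _ u] bexI[of _ "\<zero>"]) auto
  consider "Suc i < n - 1" | "Suc i = n - 1" | "Suc i = n" | "i = n" using le by linarith
  thus "\<exists>u0\<in>grade K (Suc i). \<exists>e\<in>grade E i. u = u0 \<oplus> d2 e"
  proof cases
   case 1
   thus ?thesis using zero low Y.rep_low[OF u(1)] by auto
  next
   case 2
   obtain a r where a: "a \<in> grade K1 (n - 1)" "r .: R" "u = a \<oplus> r \<odot> y"
    "d1 a \<oplus> r \<odot> zy = \<zero>"
    using Y_gen[OF _ u(2)] u(1) 2 by auto
   have aK: "a \<in> grade K (n - 1)" using low[OF a(1)] n by simp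
   hence "d1 a .: K" using d1K[OF gK] X.dK[OF gK] by simp
   hence "r = \<zero>\<^bsub>R\<^esub>" using no_multiple a by blast
   hence "u = a" using a(3) gK[OF aK] KE by simp
   thus ?thesis using zero aK 2 by simp
  next
   case 3
   obtain a t where a: "a \<in> grade K1 n" "t \<in> grade K1 0" "u = a \<oplus> d2 (t \<otimes> y)"
    using Y_next[OF _ u(2)] u(1) 3 by auto
   have ty: "t \<otimes> y \<in> grade E (n - 1)" using Y.E.mult_grade[OF Y.KEg[OF a(2)] Y.v_grade] by simp
   hence tyc: "t \<otimes> y .: E" using Y.E.grade_carrier by blast
   have ac1: "a .: K1" using gK1 a(1) .
   have "d1 a = \<zero>"
    using u(2) a(3) K1E[OF ac1] K1E[OF X.Ed.diff_closed[OF ac1]] tyc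
    by (simp add: Y.Ed.diff_add Y.Ed.diff_diff d2K1[OF ac1])
   then obtain a1 r where a1: "a1 \<in> grade K n" "r .: R" "a = a1 \<oplus> r \<odot> x"
    "d a1 \<oplus> r \<odot> z = \<zero>"
    using X_gen[OF a(1)] by auto
   have a1K: "a1 .: K" "a1 .: E" using gK a1(1) KE by auto
   let ?c = "c \<oplus>\<^bsub>B\<^esub> \<ominus>\<^bsub>B\<^esub> \<phi>2 (t \<otimes> y)"
   have cB: "c .: B" using u(3) M.B.grade_carrier by blast
   have "\<phi>2 u = \<phi> a1 \<oplus>\<^bsub>B\<^esub> r \<odot>\<^bsub>B\<^esub> b \<oplus>\<^bsub>B\<^esub> dB (\<phi>2 (t \<otimes> y))"
    using a1K a1(2) xE tyc unfolding a(3) a1(3)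
    by (simp add: E.phi_add E.phi_smult E.phi_diff agree b)
   hence "\<phi> a1 \<oplus>\<^bsub>B\<^esub> r \<odot>\<^bsub>B\<^esub> b = dB ?c"
    using u(4)[symmetric] cB tyc a1(2) M.phi_closed[OF a1K(1)] E.phi_closed[OF xE(1)] b
    by (simp add: M.B.diff_add M.B.diff_neg M.B.M.a_assoc M.B.M.r_neg)
   moreover have "?c \<in> grade B (n - 1)" using u(3) 3 E.phi_grade[OF ty] by auto
   ultimately obtain r' where r': "r' .: R" "r = r' \<otimes>\<^bsub>R\<^esub> q"
    using ann[OF a1(2,1)] a1(4) by (auto simp: ops)
   let ?u0 = "a1 \<oplus> (\<ominus>\<^bsub>R\<^esub> r') \<odot> w" and ?e = "r' \<odot> y \<oplus> t \<otimes> y"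
   have "?u0 \<in> grade K (Suc i)" using 3 a1(1) w r'(1) K_add_g K_sm_g by simp
   moreover have "?e \<in> grade E i"
    using 3 Y.E.grade_add[OF Y.E.grade_smult[OF r'(1) Y.v_grade] ty] by auto
   moreover have "u = ?u0 \<oplus> d2 ?e"
   proof -
    have "d2 ?e = (r \<odot> x \<oplus> r' \<odot> w) \<oplus> d2 (t \<otimes> y)"
     using r' q xE wE tyc
     by (simp add: Y.Ed.diff_add Y.Ed.diff_smult d2y Y.E.smult_r_distr Y.E.smult_assoc1)
    thus ?thesis
     unfolding a(3) a1(3) using a1K a1(2) r'(1) xE wE tyc
     by (simp add: Y.E.smult_l_minus Y.E.M.cancel_middle)
   qed
   ultimately show ?thesis by blast
  next
   case 4
   let ?m = "n - 1"
   have u': "u \<in> grade E (?m + 2)" using u(1) 4 n by simp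
   obtain a s where a: "a \<in> grade K1 (Suc n)" and s: "s \<in> grade K1 2" and ue: "u = a \<oplus> s \<otimes> y"
   proof (cases "n = 3")
    case False
    hence "odd ?m \<or> ?m + 2 < 2 * ?m" using n by (cases "n = 2"; cases "n = 4") auto
    then obtain a s where "a \<in> grade K1 (?m + 2)" "s \<in> grade K1 (?m + 2 - ?m)" "u = a \<oplus> s \<otimes> y"
     using Y.rep_linear[OF u'] by auto
    thus thesis using that n by simp
   next
    case True
    \<comment> \<open>here \<open>y\<close> has degree 2, and \<open>y\<^sup>2\<close> is ruled out since \<open>2 q ~= 0\<close>\<close>
    obtain a s t where h: "a \<in> grade K1 4" "s \<in> grade K1 2" "t \<in> grade K1 0"
     "u = a \<oplus> s \<otimes> y \<oplus> t \<otimes> y [^] (2::nat)"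
     using Y.rep_quadratic[OF u'] True by auto
    have ev: "even ?m" using True by simp
    have t: "d1 t = \<zero>" "d1 s \<oplus> ksgn E 0 (t \<otimes> (zy \<oplus> zy)) = \<zero>"
     using Y.closed_quadratic[OF ev gK1[OF h(1)] h(2,3)] u(2) h(4) by auto
    obtain r where r: "r .: R" "t = r \<odot> \<one>" using H0'[OF h(3) t(1)] by blast
    have sK: "s \<in> grade K 2" using low[OF h(2)] True by simp
    have dsK: "d1 s .: K" using X.dK[OF gK[OF sK]] d1K[OF gK[OF sK]] by simp
    have two: "\<one>\<^bsub>R\<^esub> \<oplus>\<^bsub>R\<^esub> \<one>\<^bsub>R\<^esub> ~= \<zero>\<^bsub>R\<^esub>"
     using M.half P.zero_not_one by (metis M.B.R.Units_r_inv M.B.R.Units_inv_closed M.B.R.l_null)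
    have "t \<otimes> (zy \<oplus> zy) = (r \<otimes>\<^bsub>R\<^esub> (\<one>\<^bsub>R\<^esub> \<oplus>\<^bsub>R\<^esub> \<one>\<^bsub>R\<^esub>)) \<odot> zy"
     using r zyE(2) by (simp add: scal Y.E.smult_assoc1 Y.E.smult_l_distr)
    hence "r \<otimes>\<^bsub>R\<^esub> (\<one>\<^bsub>R\<^esub> \<oplus>\<^bsub>R\<^esub> \<one>\<^bsub>R\<^esub>) = \<zero>\<^bsub>R\<^esub>"
     using no_multiple[OF _ dsK, of "r \<otimes>\<^bsub>R\<^esub> (\<one>\<^bsub>R\<^esub> \<oplus>\<^bsub>R\<^esub> \<one>\<^bsub>R\<^esub>)"] t(2) r(1) by (simp add: ksgn_def)
    hence "r = \<zero>\<^bsub>R\<^esub>" using P.integral[of r] two r(1) by auto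
    hence "t = \<zero>" using r(2) by simp
    hence "u = a \<oplus> s \<otimes> y" using h gK1[OF h(1)] gK1[OF h(2)] by simp
    thus thesis using that h True by simp
   qed
   have cl: "d1 s = \<zero>" "d1 a \<oplus> s \<otimes> zy = \<zero>"
    using Y.closed_linear[OF gK1[OF a] s] u(2) ue by (auto simp: ksgn_def)
   obtain a0 a1 where a01: "a0 \<in> grade K (Suc n)" "a1 \<in> grade K 1" "a = a0 \<oplus> a1 \<otimes> x"
   proof -
    have le: "n \<le> Suc n" "odd n \<or> Suc n < 2 * n" using n by auto
    show thesis by (rule X.rep_linear[OF a le]) (use that in \<open>simp add: ops\<close>)
   qed
   have a01c: "a0 .: K" "a1 .: K" using a01 gK by auto
   define a1z where "a1z = \<ominus> (a1 \<otimes> z)"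
   have K_neg: "\<ominus> g .: K" if "g .: K" for g
    using M.K.M.a_inv_closed[OF that] X.K_neg[OF that] Y.K_neg[OF KK1[OF that]] by simp
   have a1z: "a1z .: K" unfolding a1z_def using K_neg K_ops'(2) a01c zE by blast
   have d1a: "d1 a = d a0 \<oplus> (d a1 \<otimes> x \<oplus> a1z)"
   proof -
    have "a1 \<otimes> z .: K1" using K_ops'(2)[OF a01c(2) zE(2)] KK1 by blast
    hence "d1 (a1 \<otimes> x) = d a1 \<otimes> x \<oplus> a1z"
     using X.diff_linear[OF a01(2)] Y.K_neg by (simp add: ops ksgn_def a1z_def)
    moreover have "a1 \<otimes> x .: K1" using Y.K_mult[OF KK1[OF a01c(2)] xE(2)] .
    ultimately show ?thesis
     unfolding a01(3) using X.Ed.diff_add[OF KK1[OF a01c(1)], of "a1 \<otimes> x"] d1K[OF a01c(1)] by (simp add: ops)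
   qed
   have s0: "s \<in> grade K 2"
   proof (cases "n = 2")
    case False
    thus ?thesis using low[OF s] n by simp
   next
    case True
    \<comment> \<open>here \<open>x\<close> has degree 2 as well, and the coefficient of \<open>x\<^sup>2\<close> shows that \<open>s\<close> does not involve it\<close>
    obtain s0 r where s0: "s0 \<in> grade K n" "r .: R" "s = s0 \<oplus> r \<odot> x"
     using X_gen[of s] s cl(1) True by auto
    have s0c: "s0 .: K" using gK s0(1) .
    have evn: "even n" using True by simp
    have xw: "x \<otimes> w = w \<otimes> x"
     using Y.E.graded_comm[OF xE(3) gKE[OF w]] evn by (simp add: ksgn_def)
    let ?P = "d a0 \<oplus> a1z \<oplus> s0 \<otimes> w" and ?Q = "d a1 \<oplus> q \<odot> s0 \<oplus> r \<odot> w"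
     and ?T = "(r \<otimes>\<^bsub>R\<^esub> q) \<odot> \<one>"
    have PQ: "?P .: K" "?Q .: K" "?T .: K"
     using K_ops' K_sm K_one a01c a1z s0c wE X.dK q s0(2) by auto
    have dE: "d a0 .: E" "d a1 .: E" "a1z .: E" "s0 .: E"
     using a01c a1z s0c KE X.dK by auto
    have "s \<otimes> zy = s0 \<otimes> w \<oplus> (q \<odot> s0 \<oplus> r \<odot> w) \<otimes> x \<oplus> ?T \<otimes> (x \<otimes> x)"
     using dE wE xE q s0(2) unfolding s0(3) zyE(1)
     by (simp add: scal Y.E.A.l_distr Y.E.A.r_distr Y.E.smult_mult_left Y.E.smult_mult_right
       Y.E.smult_assoc1 Y.E.smult_r_distr Y.E.smult_commute[of q r] xw Y.E.M.a_ac)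
    hence "d1 a \<oplus> s \<otimes> zy = (?P \<oplus> ?Q \<otimes> x) \<oplus> ?T \<otimes> (x \<otimes> x)"
     unfolding d1a using dE wE xE q s0(2) by (simp add: Y.E.A.l_distr Y.E.M.a_ac)
    hence "cf1 2 ((?P \<oplus> ?Q \<otimes> x) \<oplus> ?T \<otimes> (x \<otimes> x)) = \<zero>"
     using cl(2) X.cf_zero[of 2] by (simp add: ops)
    moreover have "cf1 2 (?T \<otimes> (x \<otimes> x)) = ?T"
     using X.cf_power[OF PQ(3), of 2 2] evn xE(2) by (simp add: numeral_2_eq_2 X.E.A.nat_pow_Suc) (simp add: ops)
    moreover have "cf1 2 (?P \<oplus> ?Q \<otimes> x) = \<zero>"
     using X.cf_sum2[OF PQ(1,2), of 2] by (simp add: ops)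
    moreover have "?P \<oplus> ?Q \<otimes> x .: K1" "?T \<otimes> (x \<otimes> x) .: K1"
     using Y.K_add Y.K_mult PQ KK1 xE(2) by auto
    ultimately have "?T = \<zero>"
     using additive_add[OF X.cf_additive, of "?P \<oplus> ?Q \<otimes> x" "?T \<otimes> (x \<otimes> x)" 2] PQ(3)
     by (simp add: ops KE)
    hence "r = \<zero>\<^bsub>R\<^esub>" using torsion s0(2) by blast
    thus ?thesis using s0 s0c KE xE True by simp
   qed
   have sc: "s .: K" "s .: E" using gK[OF s0] KE by auto
   have ds: "d s = \<zero>" using cl(1) d1K[OF sc(1)] by simp
   have "q \<odot> s = d (\<ominus>\<^bsub>K\<^esub> a1)"
   proof -
    have dE: "d a0 .: E" "d a1 .: E" "a1z .: E"
     using a01c a1z KE X.dK by auto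
    have "d1 a \<oplus> s \<otimes> zy = (d a0 \<oplus> a1z \<oplus> s \<otimes> w) \<oplus> (d a1 \<oplus> q \<odot> s) \<otimes> x"
     unfolding d1a zyE(1) using dE sc wE xE q
     by (simp add: Y.E.A.l_distr Y.E.A.r_distr Y.E.smult_mult_left Y.E.smult_mult_right Y.E.M.a_ac)
    hence "d a1 \<oplus> q \<odot> s = \<zero>"
     using X_coeff(2)[of "d a0 \<oplus> a1z \<oplus> s \<otimes> w" "d a1 \<oplus> q \<odot> s"] cl(2)
      K_ops' K_sm a01c a1z sc wE X.dK q by simp
    hence "q \<odot> s = \<ominus> d a1"
     using dE sc q by (metis Y.E.M.a_comm Y.E.M.minus_equality Y.E.smult_closed)
    thus ?thesis using M.K.diff_neg[OF a01c(2)] X.K_neg[OF X.dK[OF a01c(2)]] Y.K_neg[OF KK1[OF X.dK[OF a01c(2)]]] by simp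
   qed
   then obtain t where t: "t \<in> grade K 1" "s = d t"
    using M.K_H2[OF ac s0 _ q M.K.grade_neg[OF a01(2)]] ds n by (auto simp: ops)
   have tc: "t .: K" "t .: E" using gK t(1) KE by auto
   have dty: "d2 (t \<otimes> y) = s \<otimes> y \<oplus> \<ominus> (t \<otimes> zy)"
    using Y.diff_linear[OF X.KEg[OF t(1)]] d1K[OF tc(1)] t(2) by (simp add: ksgn_def)
   have tz: "t \<otimes> zy \<in> grade K1 (Suc n)"
   proof -
    have "1 + Suc (n - 1) = Suc n" using n by simp
    thus ?thesis using Y.K_mult_grade[OF X.KEg[OF t(1)] Y.z_grade] by metis
   qed
   let ?a' = "a \<oplus> t \<otimes> zy"
   have a': "?a' \<in> grade K1 (Suc n)" using X.E.grade_add[OF a tz] by (simp add: ops)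
   have ty: "t \<otimes> y \<in> grade E n" using Y.E.mult_grade[OF gKE[OF t(1)] Y.v_grade] n by simp
   have tyc: "t \<otimes> y .: E" using ty Y.E.grade_carrier by blast
   have cE: "a .: E" "t \<otimes> zy .: E" "s \<otimes> y .: E"
    using gK1[OF a] gK1[OF tz] K1E sc by auto
   have ue': "u = ?a' \<oplus> d2 (t \<otimes> y)"
    unfolding dty ue using cE by (simp add: Y.E.M.a_ac Y.E.M.r_neg1 Y.E.M.r_neg2 Y.E.M.r_neg)
   have "d1 ?a' = \<zero>"
    using u(2) cE tyc d2K1[OF gK1[OF a']] K1E[OF X.Ed.diff_closed[OF gK1[OF a']]] unfolding ue' by (simp add: Y.Ed.diff_add[of ?a'] Y.Ed.diff_diff)
   then obtain a2 t' where a2: "a2 \<in> grade K (Suc n)" "t' \<in> grade K 0" "?a' = a2 \<oplus> d1 (t' \<otimes> x)"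
    using X_next[OF a'] by blast
   have t'x: "t' \<otimes> x .: K1" "t' \<otimes> x \<in> grade E n"
    using Y.K_mult[OF KK1[OF gK[OF a2(2)]] xE(2)] Y.E.mult_grade[OF gKE[OF a2(2)] xE(3)] by auto
   have "u = a2 \<oplus> d2 (t' \<otimes> x \<oplus> t \<otimes> y)"
    unfolding ue' a2(3) using d2K1[OF t'x(1)] tyc t'x(1) gK[OF a2(1)] KE K1E
    by (simp add: Y.Ed.diff_add Y.E.M.a_assoc flip: d2K1)
   moreover have "t' \<otimes> x \<oplus> t \<otimes> y \<in> grade E n" using t'x(2) ty by blast
   ultimately show ?thesis using a2(1) 4 by blast
  qed
 qed
qed

subsection \<open>Generators of the cohomology of the cone\<close>

lemma (in cdga_model) cone_span_from_target:
 assumes "a \<in> grade K n" "e \<in> mod_span R B (coboundaries B dB n) S" "set S \<subseteq> carrier B"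
 shows "(d a, \<phi> a \<oplus> e) \<in> cone_span R K d B dB \<phi> n (map (%t. (\<zero>\<^bsub>K\<^esub>, t)) S)"
 using assms(2,3)
proof (induction S arbitrary: e)
 case Nil
 thus ?case using assms(1) by auto
next
 case (Cons t S)
 then obtain r e' where h: "r .: R" "e' \<in> mod_span R B (coboundaries B dB n) S"
  "e = (r \<odot> t) \<oplus> e'" by auto
 have S: "set S \<subseteq> carrier B" "t .: B" using Cons.prems by auto
 have e': "e' .: B"
  using B.submoduleE(1)[OF B.mod_span_submodule[OF B.coboundaries_submodule S(1)]] h(2) by blast
 have a: "a .: K" using assms(1) K.grade_carrier by blast
 have "d a = (r \<odot>\<^bsub>K\<^esub> \<zero>\<^bsub>K\<^esub>) \<oplus>\<^bsub>K\<^esub> d a" "\<phi> a \<oplus> e = (r \<odot> t) \<oplus> (\<phi> a \<oplus> e')"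
  using a h S e' by (simp_all add: B.M.a_ac)
 thus ?case
  using Cons.IH[OF h(2) S(1)] h(1) unfolding list.map cone_span.simps mem_Collect_eq fst_conv snd_conv
  by (intro exI[of _ r] exI[of _ "d a"] exI[of _ "\<phi> a \<oplus> e'"]) simp
qed

text \<open>The cocycles \<open>z\<close> of \<open>K\<close> whose image in \<open>B\<close> bounds form a submodule of a finitely generated
 module.  Over each of its generators choose one cone cocycle; two choices differ by a cocycle of \<open>B\<close>.\<close>

lemma (in cdga_model) cone_fin_gen:
 assumes fK: "fin_gen_cohom R K d (Suc n)" and fB: "fin_gen_cohom R B dB n"
 obtains G where "!!g. g \<in> set G ==> cone_cocycle K d B dB \<phi> n (fst g) (snd g)"
  "!!u c. cone_cocycle K d B dB \<phi> n u c ==> (u, c) \<in> cone_span R K d B dB \<phi> n G"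
proof -
 obtain S where S: "set S \<subseteq> cocycles K d (Suc n)"
  "cocycles K d (Suc n) \<subseteq> mod_span R K (coboundaries K d (Suc n)) S"
  using fK unfolding fin_gen_cohom_def by blast
 obtain SB where SB: "set SB \<subseteq> cocycles B dB n"
  "cocycles B dB n \<subseteq> mod_span R B (coboundaries B dB n) SB"
  using fB unfolding fin_gen_cohom_def by blast
 have SBc: "set SB \<subseteq> carrier B" using SB(1) B.grade_carrier by (auto simp: cocycles_def)
 define P where "P = {z \<in> cocycles K d (Suc n). \<exists>b\<in>grade B n. \<phi> z = dB b}"
 have cyc: "z .: K" if "z \<in> cocycles K d (Suc n)" for z using that K.grade_carrier by (auto simp: cocycles_def)
 note CE = K.submoduleE[OF K.cocycles_submodule[of "Suc n"]]
 have Psub: "submodule P R K"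
 proof (rule K.submoduleI)
  show "P \<subseteq> carrier K" using cyc by (auto simp: P_def)
  show "\<zero>\<^bsub>K\<^esub> \<in> P"
   using B.diff_zero by (auto simp: P_def cocycles_def intro!: bexI[of _ "\<zero>"])
  show "\<ominus>\<^bsub>K\<^esub> x \<in> P" if x: "x \<in> P" for x
  proof -
   obtain b where b: "b \<in> grade B n" "\<phi> x = dB b" "x \<in> cocycles K d (Suc n)" using x by (auto simp: P_def)
   have "\<phi> (\<ominus>\<^bsub>K\<^esub> x) = dB (\<ominus> b)"
    using b cyc phi_neg B.diff_neg[OF B.grade_carrier[OF b(1)]] by simp
   thus ?thesis using b CE(3) B.grade_neg by (auto simp: P_def)
  qed
  show "x \<oplus>\<^bsub>K\<^esub> y \<in> P" if x: "x \<in> P" and y: "y \<in> P" for x y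
  proof -
   obtain b b' where b: "b \<in> grade B n" "\<phi> x = dB b" "x \<in> cocycles K d (Suc n)"
    "b' \<in> grade B n" "\<phi> y = dB b'" "y \<in> cocycles K d (Suc n)" using x y by (auto simp: P_def)
   have "\<phi> (x \<oplus>\<^bsub>K\<^esub> y) = dB (b \<oplus> b')"
    using b cyc phi_add B.diff_add B.grade_carrier by simp
   thus ?thesis using b CE(5) B.grade_add by (auto simp: P_def)
  qed
  show "r \<odot>\<^bsub>K\<^esub> x \<in> P" if r: "r .: R" and x: "x \<in> P" for r x
  proof -
   obtain b where b: "b \<in> grade B n" "\<phi> x = dB b" "x \<in> cocycles K d (Suc n)" using x by (auto simp: P_def)
   have "\<phi> (r \<odot>\<^bsub>K\<^esub> x) = dB (r \<odot> b)"
    using b cyc phi_smult[OF r] B.diff_smult[OF r] B.grade_carrier by simp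
   thus ?thesis using b r CE(4) B.grade_smult by (auto simp: P_def)
  qed
 qed
 have Sc: "set S \<subseteq> carrier K" using S(1) cyc by blast
 have "P \<subseteq> mod_span R K (coboundaries K d (Suc n)) S" using S(2) by (auto simp: P_def)
 then obtain S' where S': "set S' \<subseteq> P" "P \<subseteq> mod_span R K (coboundaries K d (Suc n)) S'"
  by (rule K.submodule_fin_gen[OF pid K.coboundaries_submodule Sc Psub])
 have "\<exists>G1. map fst G1 = S' \<and> (\<forall>g\<in>set G1. cone_cocycle K d B dB \<phi> n (fst g) (snd g))"
  using S'(1)
 proof (induction S')
  case (Cons z S')
  then obtain G1 where G1: "map fst G1 = S'" "\<forall>g\<in>set G1. cone_cocycle K d B dB \<phi> n (fst g) (snd g)" by auto
  obtain b where "cone_cocycle K d B dB \<phi> n z b"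
   using Cons.prems by (auto simp: P_def cone_cocycle_def cocycles_def)
  thus ?case using G1 by (intro exI[of _ "(z, b) # G1"]) auto
 qed simp
 then obtain G1 where G1: "map fst G1 = S'" "\<forall>g\<in>set G1. cone_cocycle K d B dB \<phi> n (fst g) (snd g)" by blast
 let ?G2 = "map (%t. (\<zero>\<^bsub>K\<^esub>, t)) SB"
 have span: "(u, c) \<in> cone_span R K d B dB \<phi> n (G @ ?G2)"
  if "\<forall>g\<in>set G. cone_cocycle K d B dB \<phi> n (fst g) (snd g)" "cone_cocycle K d B dB \<phi> n u c"
   "u \<in> mod_span R K (coboundaries K d (Suc n)) (map fst G)" for G u c
  using that
 proof (induction G arbitrary: u c)
  case Nil
  then obtain a where a: "a \<in> grade K n" "u = d a" by (auto simp: coboundaries_def)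
  have aK: "a .: K" using a K.grade_carrier by blast
  have c: "c \<in> grade B n" "\<phi> u = dB c" "c .: B"
   using Nil B.grade_carrier by (auto simp: cone_cocycle_def)
  let ?e = "c \<oplus> \<ominus> \<phi> a"
  have "dB ?e = \<zero>"
   using c a aK phi_diff[OF aK] by (simp add: B.diff_add B.diff_neg B.M.r_neg)
  hence "?e \<in> cocycles B dB n" using c a phi_grade by (auto simp: cocycles_def)
  hence "?e \<in> mod_span R B (coboundaries B dB n) SB" using SB(2) by blast
  hence "(d a, \<phi> a \<oplus> ?e) \<in> cone_span R K d B dB \<phi> n ?G2"
   by (rule cone_span_from_target[OF a(1) _ SBc])
  moreover have "\<phi> a \<oplus> ?e = c" using c aK by (simp add: B.M.a_lcomm[of _ c] B.M.r_neg)
  ultimately show ?case using a(2) by simp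
 next
  case (Cons g G)
  have g: "cone_cocycle K d B dB \<phi> n (fst g) (snd g)" using Cons.prems by simp
  obtain r m where r: "r .: R" "m \<in> mod_span R K (coboundaries K d (Suc n)) (map fst G)"
   "u = (r \<odot>\<^bsub>K\<^esub> fst g) \<oplus>\<^bsub>K\<^esub> m" using Cons.prems(3) by auto
  have gc: "fst g \<in> grade K (Suc n)" "d (fst g) = \<zero>\<^bsub>K\<^esub>" "snd g \<in> grade B n" "\<phi> (fst g) = dB (snd g)"
   "fst g .: K" "snd g .: B"
   using g K.grade_carrier B.grade_carrier by (auto simp: cone_cocycle_def)
  have uc: "u \<in> grade K (Suc n)" "d u = \<zero>\<^bsub>K\<^esub>" "c \<in> grade B n" "\<phi> u = dB c"
   "u .: K" "c .: B"
   using Cons.prems(2) K.grade_carrier B.grade_carrier by (auto simp: cone_cocycle_def)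
  have "set (map fst G) \<subseteq> carrier K" using Cons.prems(1) K.grade_carrier by (auto simp: cone_cocycle_def)
  hence mK: "m .: K"
   using K.submoduleE(1)[OF K.mod_span_submodule[OF K.coboundaries_submodule]] r(2) by blast
  let ?s = "\<ominus>\<^bsub>R\<^esub> r"
  let ?c = "(?s \<odot> snd g) \<oplus> c"
  have s: "?s .: R" using r(1) by simp
  have m: "m = (?s \<odot>\<^bsub>K\<^esub> fst g) \<oplus>\<^bsub>K\<^esub> u"
   unfolding r(3) using r(1) gc mK by (simp add: K.smult_l_minus K.M.r_neg1)
  have "cone_cocycle K d B dB \<phi> n m ?c"
   unfolding cone_cocycle_def
  proof (intro conjI)
   show "m \<in> grade K (Suc n)" unfolding m using s gc(1) uc(1) by blast
   show "d m = \<zero>\<^bsub>K\<^esub>" unfolding m using s gc uc by (simp add: K.diff_add K.diff_smult)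
   show "?c \<in> grade B n" using s gc(3) uc(3) by blast
   show "\<phi> m = dB ?c" unfolding m using s gc uc by (simp add: phi_add phi_smult B.diff_add B.diff_smult)
  qed
  hence "(m, ?c) \<in> cone_span R K d B dB \<phi> n (G @ ?G2)" using Cons.IH Cons.prems(1) r(2) by simp
  moreover have "c = (r \<odot> snd g) \<oplus> ?c"
   using r(1) gc uc by (simp add: B.smult_l_minus B.M.r_neg2)
  ultimately show ?case using r by (auto intro!: exI[of _ r])
 qed
 show thesis
 proof (rule that[of "G1 @ ?G2"])
  fix g assume "g \<in> set (G1 @ ?G2)"
  thus "cone_cocycle K d B dB \<phi> n (fst g) (snd g)"
   using G1(2) SB(1) by (auto simp: cone_cocycle_def cocycles_def)
 next
  fix u c assume uc: "cone_cocycle K d B dB \<phi> n u c"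
  hence "u \<in> P" by (auto simp: P_def cone_cocycle_def cocycles_def)
  hence "u \<in> mod_span R K (coboundaries K d (Suc n)) (map fst G1)" using S'(2) G1(1) by auto
  thus "(u, c) \<in> cone_span R K d B dB \<phi> n (G1 @ ?G2)" using span[OF G1(2) uc] by blast
 qed
qed

section \<open>Isomorphisms\<close>

definition cga_iso where
 "cga_iso R T S \<Theta> \<longleftrightarrow> bij_betw \<Theta> (carrier T) (carrier S) \<and> \<Theta> \<in> ring_hom T S \<and>
   (\<forall>r\<in>carrier R. \<forall>x\<in>carrier T. \<Theta> (r \<odot>\<^bsub>T\<^esub> x) = r \<odot>\<^bsub>S\<^esub> \<Theta> x) \<and> (\<forall>n. \<Theta> ` grade T n = grade S n)"

context
 fixes R :: "('r, 'e) ring_scheme" and T :: "('r, 't) gmod" (structure) and S :: "('r, 's) gmod" and \<Theta> and dS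
 assumes T: "comm_graded_algebra R T" and S: "cdga R S dS" and iso: "cga_iso R T S \<Theta>"
begin

interpretation T: comm_graded_algebra R T by (rule T)
interpretation S: cdga R S dS by (rule S)

definition iso_diff where "iso_diff = (%t. the_inv_into (carrier T) \<Theta> (dS (\<Theta> t)))"

lemma iso_closed: "t .: T ==> \<Theta> t .: S"
 and iso_add: "t .: T ==> t' .: T ==> \<Theta> (t \<oplus> t') = \<Theta> t \<oplus>\<^bsub>S\<^esub> \<Theta> t'"
 and iso_mult: "t .: T ==> t' .: T ==> \<Theta> (t \<otimes> t') = \<Theta> t \<otimes>\<^bsub>S\<^esub> \<Theta> t'"
 and iso_smult: "r .: R ==> t .: T ==> \<Theta> (r \<odot> t) = r \<odot>\<^bsub>S\<^esub> \<Theta> t"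
 and iso_one: "\<Theta> \<one> = \<one>\<^bsub>S\<^esub>"
 and iso_inj: "inj_on \<Theta> (carrier T)"
 and iso_image: "\<Theta> ` carrier T = carrier S"
 and iso_grade: "\<Theta> ` grade T n = grade S n"
 using iso unfolding cga_iso_def ring_hom_def by (auto simp: bij_betw_def)

lemma iso_additive: "additive_map T S \<Theta>"
 by (rule additiveI) (simp_all add: iso_closed iso_add)

lemma iso_grade_iff: "t .: T ==> \<Theta> t \<in> grade S n \<longleftrightarrow> t \<in> grade T n"
 using iso_grade[of n] iso_inj T.grade_carrier by (auto dest: inj_onD)

lemma iso_diff_closed: "t .: T ==> iso_diff t .: T"
 unfolding iso_diff_def using iso_image iso_inj iso_closed S.diff_closed
 by (metis subset_refl the_inv_into_into)

lemma iso_diff: "t .: T ==> \<Theta> (iso_diff t) = dS (\<Theta> t)"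
 unfolding iso_diff_def using iso_image iso_inj iso_closed S.diff_closed
 by (metis f_the_inv_into_f)

lemma iso_eqI: "t .: T ==> t' .: T ==> \<Theta> t = \<Theta> t' ==> t = t'"
 using iso_inj by (rule inj_onD)

lemma iso_zero: "\<Theta> \<zero> = \<zero>\<^bsub>S\<^esub>"
 using additive_zero[OF T.M.ab S.M.ab iso_additive] .

lemma iso_ksgn: "t .: T ==> \<Theta> (ksgn T n t) = ksgn S n (\<Theta> t)"
 using additive_ksgn[OF T.M.ab S.M.ab iso_additive] .

lemma iso_cdga: "cdga R T iso_diff"
proof (intro cdga.intro T cdga_axioms.intro)
 fix x y assume xy: "x .: T" "y .: T"
 show "iso_diff (x \<oplus> y) = iso_diff x \<oplus> iso_diff y"
  by (rule iso_eqI) (use xy in \<open>simp_all add: iso_diff_closed iso_diff iso_add iso_closed S.diff_add\<close>)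
next
 fix r x assume "r .: R" "x .: T"
 thus "iso_diff (r \<odot> x) = r \<odot> iso_diff x"
  by (intro iso_eqI) (simp_all add: iso_diff_closed iso_diff iso_smult iso_closed S.diff_smult)
next
 fix x i assume x: "x \<in> grade T i"
 hence xc: "x .: T" using T.grade_carrier by blast
 have "\<Theta> (iso_diff x) \<in> grade S (Suc i)"
  using x xc iso_diff iso_grade_iff S.diff_grade by simp
 thus "iso_diff x \<in> grade T (Suc i)" using iso_grade_iff iso_diff_closed[OF xc] by simp
next
 fix x assume "x .: T"
 thus "iso_diff (iso_diff x) = \<zero>"
  by (intro iso_eqI) (simp_all add: iso_diff_closed iso_diff iso_closed iso_zero S.diff_diff)
next
 fix x y i assume x: "x \<in> grade T i" and y: "y .: T"
 hence xc: "x .: T" using T.grade_carrier by blast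
 have "\<Theta> x \<in> grade S i" using x xc iso_grade_iff by simp
 thus "iso_diff (x \<otimes> y) = iso_diff x \<otimes> y \<oplus> ksgn T i (x \<otimes> iso_diff y)"
  using xc y by (intro iso_eqI) (simp_all add: iso_diff_closed iso_diff iso_mult iso_add iso_ksgn iso_closed S.diff_mult)
qed

lemma iso_cdga_hom: "cdga_hom R T iso_diff S dS \<Theta>"
 using iso iso_grade iso_diff unfolding cdga_hom_def cga_iso_def by auto

lemma iso_fin_gen:
 assumes "fin_gen_cohom R S dS i"
 shows "fin_gen_cohom R T iso_diff i"
proof -
 interpret Td: cdga R T iso_diff by (rule iso_cdga)
 obtain L where L: "set L \<subseteq> cocycles S dS i" "cocycles S dS i \<subseteq> mod_span R S (coboundaries S dS i) L"
  using assms unfolding fin_gen_cohom_def by blast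
 have cyc: "\<Theta> t \<in> cocycles S dS i \<longleftrightarrow> t \<in> cocycles T iso_diff i" if "t .: T" for t
 proof -
  have "iso_diff t = \<zero> \<longleftrightarrow> dS (\<Theta> t) = \<zero>\<^bsub>S\<^esub>"
   using iso_diff[OF that] iso_zero iso_eqI[OF iso_diff_closed[OF that] T.M.zero_closed] by auto
  thus ?thesis using iso_grade_iff[OF that] by (auto simp: cocycles_def)
 qed
 have "\<exists>L'. set L' \<subseteq> carrier T \<and> map \<Theta> L' = L"
 proof -
  have "set L \<subseteq> \<Theta> ` carrier T" using L(1) S.grade_carrier iso_image by (auto simp: cocycles_def)
  thus ?thesis by (induction L) (auto, metis insert_subset list.simps(15) list.simps(9))
 qed
 then obtain L' where L': "set L' \<subseteq> carrier T" "map \<Theta> L' = L" by blast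
 have L'c: "set L' \<subseteq> cocycles T iso_diff i"
 proof
  fix x assume x: "x \<in> set L'"
  hence "\<Theta> x \<in> cocycles S dS i" using L(1) L'(2) by auto
  thus "x \<in> cocycles T iso_diff i" using cyc x L'(1) by blast
 qed
 have cob: "y \<in> coboundaries T iso_diff i" if y: "y .: T" "\<Theta> y \<in> coboundaries S dS i" for y
 proof (cases i)
  case 0
  thus ?thesis using y iso_eqI[OF y(1) T.M.zero_closed] iso_zero by (simp add: coboundaries_def)
 next
  case (Suc k)
  then obtain s where s: "s \<in> grade S k" "\<Theta> y = dS s" using y by (auto simp: coboundaries_def)
  hence "s \<in> \<Theta> ` grade T k" using iso_grade[of k] by simp
  then obtain t where t: "t \<in> grade T k" "\<Theta> y = dS (\<Theta> t)" using s(2) by auto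
  hence "y = iso_diff t"
   using iso_eqI[OF y(1) iso_diff_closed] iso_diff T.grade_carrier by simp
  thus ?thesis using t Suc by (auto simp: coboundaries_def)
 qed
 have cT: "t .: T" if "t \<in> cocycles T iso_diff i" for t using that T.grade_carrier by (auto simp: cocycles_def)
 have "cocycles T iso_diff i \<subseteq> mod_span R T (coboundaries T iso_diff i) L'"
 proof
  fix t assume t: "t \<in> cocycles T iso_diff i"
  have "t \<in> mod_span R T {y \<in> cocycles T iso_diff i. \<Theta> y \<in> coboundaries S dS i} L'"
  proof (rule mod_span_lift[OF T.module_axioms S.module_axioms Td.cocycles_submodule L'c _ _ _ _ t])
   show "\<Theta> t \<in> mod_span R S (coboundaries S dS i) (map \<Theta> L')"
    using L L'(2) cyc[OF cT[OF t]] t by auto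
   show "coboundaries S dS i \<subseteq> carrier S" using S.coboundaries_grade S.grade_carrier by blast
  qed (use cT iso_closed iso_add iso_smult in auto)
  moreover have "{y \<in> cocycles T iso_diff i. \<Theta> y \<in> coboundaries S dS i} \<subseteq> mod_span R T (coboundaries T iso_diff i) []"
   using cob cT by auto
  ultimately show "t \<in> mod_span R T (coboundaries T iso_diff i) L'"
   using mod_span_trans[of "{y \<in> cocycles T iso_diff i. \<Theta> y \<in> coboundaries S dS i}" R T "coboundaries T iso_diff i" "[]" L'] by auto
 qed
 thus ?thesis using L'c by (auto simp: fin_gen_cohom_def)
qed

text \<open>A morphism on \<open>S\<close> and its composition with an isomorphism have the same cone.\<close>

lemma iso_comp_hom:
 fixes B :: "('r, 'b) gmod"
 assumes "cdga_hom R S dS B dB \<psi>"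
 shows "cdga_hom R T iso_diff B dB (%t. \<psi> (\<Theta> t))"
 using assms iso_cdga_hom unfolding cdga_hom_def ring_hom_def by (auto simp: image_subset_iff Pi_iff)

lemma iso_cone_acyclic:
 fixes B :: "('r, 'b) gmod"
 assumes "cone_acyclic R S dS B dB \<psi> n"
 shows "cone_acyclic R T iso_diff B dB (%t. \<psi> (\<Theta> t)) n"
 unfolding cone_acyclic_def
proof (intro allI impI)
 fix u c assume uc: "cone_cocycle T iso_diff B dB (%t. \<psi> (\<Theta> t)) n u c"
 hence u: "u \<in> grade T (Suc n)" "u .: T" using T.grade_carrier by (auto simp: cone_cocycle_def)
 have "dS (\<Theta> u) = \<zero>\<^bsub>S\<^esub>" using uc iso_diff[OF u(2)] iso_zero by (simp add: cone_cocycle_def)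
 hence "cone_cocycle S dS B dB \<psi> n (\<Theta> u) c" using uc iso_grade by (auto simp: cone_cocycle_def)
 hence "(\<Theta> u, c) \<in> cone_span R S dS B dB \<psi> n []" using assms by (auto simp: cone_acyclic_def)
 then obtain s e where s: "s \<in> grade S n" "e \<in> coboundaries B dB n" "\<Theta> u = dS s" "c = \<psi> s \<oplus>\<^bsub>B\<^esub> e" by auto
 then obtain a where a: "a \<in> grade T n" "s = \<Theta> a" using iso_grade[of n] by auto
 hence "u = iso_diff a" using s(3) iso_eqI[OF u(2) iso_diff_closed] iso_diff T.grade_carrier by simp
 thus "(u, c) \<in> cone_span R T iso_diff B dB (%t. \<psi> (\<Theta> t)) n []" using a s by auto
qed

end

section \<open>Construction of the relative model\<close>

context free_gens
begin

definition incl :: "'a => nat multiset => 'a" where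
 "incl a = fs_single A {#} a"

lemma U_empty: "u .: (U {}) ==> u = incl (u {#})"
 by (auto simp: incl_def fs_single_def fun_eq_iff U_simps monomials_def fin_funs_def)

lemma incl_U: "a .: A ==> incl a .: U X"
 unfolding incl_def by (rule U_single_carrier) (auto simp: monomials_def odd_clash_def)

lemma incl_mult: "a .: A ==> a' .: A ==> incl a \<otimes>\<^bsub>U X\<^esub> incl a' = incl (a \<otimes> a')"
 unfolding incl_def
 by (subst U_single_mult) (auto simp: monomials_def odd_clash_def ext_twist_def ksgn_def grade_inv_even)

lemma incl_simps: "incl a {#} = a" "a .: A ==> a' .: A ==> incl a \<oplus>\<^bsub>U X\<^esub> incl a' = incl (a \<oplus> a')"
 "r .: R ==> r \<odot>\<^bsub>U X\<^esub> incl a = incl (r \<odot> a)" "\<one>\<^bsub>U X\<^esub> = incl \<one>"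
 by (auto simp: incl_def fs_single_def U_simps fun_eq_iff)

lemma U_empty_iso: "cga_iso R (U {}) A (%u. u {#})"
 unfolding cga_iso_def
proof (intro conjI allI ballI)
 have val: "u {#} .: A" if "u .: (U {})" for u
  using that by (simp add: U_simps fin_funs_val)
 show "bij_betw (%u. u {#}) (carrier (U {})) (carrier A)"
 proof (rule bij_betw_byWitness[of _ incl])
  show "\<forall>u\<in>carrier (U {}). incl (u {#}) = u" using U_empty by simp
  show "\<forall>a\<in>carrier A. incl a {#} = a" by (simp add: incl_simps)
  show "(%u. u {#}) ` carrier (U {}) \<subseteq> carrier A" using val by blast
  show "incl ` carrier A \<subseteq> carrier (U {})" using incl_U by blast
 qed
 show "(%u. u {#}) \<in> ring_hom (U {}) A"
 proof (rule ring_hom_memI)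
  fix u u' assume u: "u .: (U {})" "u' .: (U {})"
  have "u \<otimes>\<^bsub>U {}\<^esub> u' = incl (u {#} \<otimes> u' {#})"
   using incl_mult[OF val val] U_empty u by metis
  thus "(u \<otimes>\<^bsub>U {}\<^esub> u') {#} = u {#} \<otimes> u' {#}" by (simp add: incl_simps)
 qed (auto simp: U_simps fin_funs_val)
 show "(r \<odot>\<^bsub>U {}\<^esub> x) {#} = r \<odot> x {#}" for r x by (simp add: U_simps)
 show "(%u. u {#}) ` grade (U {}) n = grade A n" for n
 proof
  show "(%u. u {#}) ` grade (U {}) n \<subseteq> grade A n"
   using U_gradeD[of _ "{}" n "{#}"] by (fastforce simp: grade_zero)
  show "grade A n \<subseteq> (%u. u {#}) ` grade (U {}) n"
  proof
   fix a assume a: "a \<in> grade A n"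
   have "incl a \<in> grade (U {}) n"
    using U_single_grade[of "{#}" "{}" a n] a by (simp add: incl_def monomials_def odd_clash_def)
   thus "a \<in> (%u. u {#}) ` grade (U {}) n" by (rule image_eqI[rotated]) (simp add: incl_simps)
  qed
 qed
qed

end

locale relative_model_data = free_gens R A dg + pid_target R B dB + A: cdga R A dA
 for R :: "('r, 'e) ring_scheme" and A :: "('r, 'a) gmod" and dg :: "nat => nat"
  and B :: "('r, 'b) gmod" (structure) and dB and dA +
 fixes f :: "'a => 'b"
 assumes f: "cdga_hom R A dA B dB f"
  and A_H0: "\<lbrakk>a \<in> grade A 0; dA a = \<zero>\<^bsub>A\<^esub>\<rbrakk> \<Longrightarrow> \<exists>r\<in>carrier R. a = r \<odot>\<^bsub>A\<^esub> \<one>\<^bsub>A\<^esub>"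
  and A_acyclic: "i < 2 ==> cone_acyclic R A dA B dB f i"
  and A_fin_gen: "fin_gen_cohom R A dA i" and B_fin_gen: "fin_gen_cohom R B dB i"
  and dg_fibres: "1 \<le> n ==> \<exists>j\<ge>N. dg j = n"
begin

text \<open>The cone is exact below degree \<open>n\<close>; a finite set of generators leaves room for a new last one.\<close>

definition partial_model where
 "partial_model n X d \<phi> \<longleftrightarrow> finite X \<and> cdga_model R B dB (U X) d \<phi> \<and>
   (\<forall>i<n. cone_acyclic R (U X) d B dB \<phi> i) \<and> (\<forall>i. fin_gen_cohom R (U X) d i)"

abbreviation ext_model where
 "ext_model X d \<phi> X' d' \<phi>' \<equiv> X \<subseteq> X' \<and> model_extends (U X) d \<phi> (U X') d' \<phi>'"

lemma ext_model_refl: "ext_model X d \<phi> X d \<phi>"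
 by (simp add: model_extends_def)

lemma ext_model_trans: "ext_model X d \<phi> X' d' \<phi>' ==> ext_model X' d' \<phi>' X'' d'' \<phi>'' ==> ext_model X d \<phi> X'' d'' \<phi>''"
 unfolding model_extends_def by (auto simp: subset_iff)

lemma fresh_generator:
 assumes "finite X" "1 \<le> n"
 obtains j where "\<forall>i\<in>X. i < j" "dg j = n"
proof -
 obtain j where "Suc (Max (insert 0 X)) \<le> j" "dg j = n" using dg_fibres[OF assms(2)] by blast
 moreover have "i < j" if "i \<in> X" for i
 proof -
  have "i \<le> Max (insert 0 X)" using assms(1) that by (intro Max_ge) auto
  thus ?thesis using \<open>Suc (Max (insert 0 X)) \<le> j\<close> by linarith
 qed
 ultimately show thesis using that by blast
qed

lemma adjoin_generator:
 assumes m: "cdga_model R B dB (U X) d \<phi>" and fin: "finite X" and n: "1 \<le> n"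
  and fg: "!!i. fin_gen_cohom R (U X) d i"
  and z: "z \<in> grade (U X) (Suc n)" "d z = \<zero>\<^bsub>U X\<^esub>" and b: "b \<in> grade B n" "dB b = \<phi> z"
 obtains j d' \<phi>' where "\<forall>i\<in>X. i < j" "one_gen_cdga R (U X) (U (insert j X)) (gen j) n (gen_coeff j) d z d'"
  "cdga_hom R (U (insert j X)) d' B dB \<phi>'" "\<forall>a\<in>carrier (U X). \<phi>' a = \<phi> a" "\<phi>' (gen j) = b"
  "\<forall>i. fin_gen_cohom R (U (insert j X)) d' i"
proof -
 interpret M: cdga_model R B dB "U X" d \<phi> by (rule m)
 obtain j where j: "\<forall>i\<in>X. i < j" "dg j = n" using fresh_generator[OF fin n] by blast
 interpret E: one_gen_ext R "U X" "U (insert j X)" "gen j" n "gen_coeff j"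
  using U_one_gen_ext[OF half j(1)] j(2) by simp
 interpret D: one_gen_diff R "U X" "U (insert j X)" "gen j" n "gen_coeff j" d z
 proof unfold_locales
  show "z \<in> grade (U X) (Suc n)" by (rule z(1))
  show "d z = \<zero>\<^bsub>U (insert j X)\<^esub>" using z(2) by (simp add: U_simps)
 qed
 obtain d' \<phi>' where h: "cdga R (U (insert j X)) d'" "cdga_hom R (U (insert j X)) d' B dB \<phi>'"
  "!!a. a .: U X ==> d' a = d a" "!!a. a .: U X ==> \<phi>' a = \<phi> a" "d' (gen j) = z" "\<phi>' (gen j) = b"
  using D.extend_morphism[OF B.cdga_axioms M.phi b] by blast
 interpret d': cdga R "U (insert j X)" d' by (rule h(1))
 have one: "one_gen_cdga R (U X) (U (insert j X)) (gen j) n (gen_coeff j) d z d'"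
  by unfold_locales (use h in auto)
 interpret O: one_gen_cdga R "U X" "U (insert j X)" "gen j" n "gen_coeff j" d z d' by (rule one)
 have "\<forall>i. fin_gen_cohom R (U (insert j X)) d' i" using O.fin_gen_cohom_ext[OF pid fg] n by auto
 thus thesis using that[OF j(1) one h(2) _ h(6)] h(4) by blast
qed

lemma extends_cone_cocycle:
 assumes "model_extends K d \<phi> K' d' \<phi>'" "cone_cocycle K d B dB \<phi> n u c" "graded_module R K"
 shows "cone_cocycle K' d' B dB \<phi>' n u c"
 using assms graded_module.grade_carrier[OF assms(3), of u] unfolding model_extends_def cone_cocycle_def
 by auto

text \<open>One class fewer generates the cohomology of the cone in degree \<open>n\<close>, while it stays zero
 below: one new generator is adjoined if the annihilator \<open>(q)\<close> of the class is zero, and a pair otherwise.\<close>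

lemma kill_class:
 assumes pm: "partial_model n X d \<phi>" and n: "2 \<le> n"
  and G: "!!g'. g' \<in> set (g # G) ==> cone_cocycle (U X) d B dB \<phi> n (fst g') (snd g')"
  and span: "!!u c. cone_cocycle (U X) d B dB \<phi> n u c ==> (u, c) \<in> cone_span R (U X) d B dB \<phi> n (g # G)"
 obtains X' d' \<phi>' where "partial_model n X' d' \<phi>'" "ext_model X d \<phi> X' d' \<phi>'"
  "!!u c. cone_cocycle (U X') d' B dB \<phi>' n u c ==> (u, c) \<in> cone_span R (U X') d' B dB \<phi>' n G"
proof -
 have m: "cdga_model R B dB (U X) d \<phi>" and fin: "finite X"
  and ac: "!!i. i < n ==> cone_acyclic R (U X) d B dB \<phi> i" and fg: "!!i. fin_gen_cohom R (U X) d i"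
  using pm by (auto simp: partial_model_def)
 interpret M: cdga_model R B dB "U X" d \<phi> by (rule m)
 interpret P: principal_domain R by (rule pid)
 note result = that
 obtain z b where g: "g = (z, b)" by (cases g)
 have zb: "z \<in> grade (U X) (Suc n)" "d z = \<zero>\<^bsub>U X\<^esub>" "b \<in> grade B n" "dB b = \<phi> z"
  using G[of g] g by (auto simp: cone_cocycle_def)
 have zc: "z .: U X" "b .: B" using zb M.K.grade_carrier B.grade_carrier by auto
 have Gc: "set (g # G) \<subseteq> carrier (U X) \<times> carrier B"
 proof
  fix g' assume "g' \<in> set (g # G)"
  from G[OF this] show "g' \<in> carrier (U X) \<times> carrier B"
   using M.K.grade_carrier B.grade_carrier by (cases g') (auto simp: cone_cocycle_def)
 qed
 \<comment> \<open>the scalars that annihilate the class form a principal ideal\<close>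
 define I where "I = {r \<in> carrier R. \<exists>a\<in>grade (U X) n. \<exists>c\<in>grade B (n - 1).
  d a \<oplus>\<^bsub>U X\<^esub> r \<odot>\<^bsub>U X\<^esub> z = \<zero>\<^bsub>U X\<^esub> \<and> \<phi> a \<oplus> r \<odot> b = dB c}"
 have I_add: "r \<oplus>\<^bsub>R\<^esub> s \<in> I" if rs: "r \<in> I" "s \<in> I" for r s
 proof -
  obtain a c a' c' where h: "r .: R" "a \<in> grade (U X) n" "c \<in> grade B (n - 1)"
   "d a \<oplus>\<^bsub>U X\<^esub> r \<odot>\<^bsub>U X\<^esub> z = \<zero>\<^bsub>U X\<^esub>" "\<phi> a \<oplus> r \<odot> b = dB c"
   "s .: R" "a' \<in> grade (U X) n" "c' \<in> grade B (n - 1)"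
   "d a' \<oplus>\<^bsub>U X\<^esub> s \<odot>\<^bsub>U X\<^esub> z = \<zero>\<^bsub>U X\<^esub>" "\<phi> a' \<oplus> s \<odot> b = dB c'"
   using rs by (auto simp: I_def)
  have cl: "a .: U X" "a' .: U X" "c .: B" "c' .: B"
   using h M.K.grade_carrier B.grade_carrier by auto
  have "d (a \<oplus>\<^bsub>U X\<^esub> a') \<oplus>\<^bsub>U X\<^esub> (r \<oplus>\<^bsub>R\<^esub> s) \<odot>\<^bsub>U X\<^esub> z =
    (d a \<oplus>\<^bsub>U X\<^esub> r \<odot>\<^bsub>U X\<^esub> z) \<oplus>\<^bsub>U X\<^esub> (d a' \<oplus>\<^bsub>U X\<^esub> s \<odot>\<^bsub>U X\<^esub> z)"
   using h(1,6) cl zc by (simp add: M.K.diff_add M.K.smult_l_distr M.K.M.a_ac)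
  moreover have "\<phi> (a \<oplus>\<^bsub>U X\<^esub> a') \<oplus> (r \<oplus>\<^bsub>R\<^esub> s) \<odot> b =
    (\<phi> a \<oplus> r \<odot> b) \<oplus> (\<phi> a' \<oplus> s \<odot> b)"
   using h(1,6) cl zc by (simp add: M.phi_add B.smult_l_distr B.M.a_ac)
  moreover have "dB (c \<oplus> c') = dB c \<oplus> dB c'" using cl by (simp add: B.diff_add)
  moreover have "a \<oplus>\<^bsub>U X\<^esub> a' \<in> grade (U X) n" "c \<oplus> c' \<in> grade B (n - 1)" using h by blast+
  ultimately show ?thesis using h by (auto simp: I_def intro!: bexI[of _ "a \<oplus>\<^bsub>U X\<^esub> a'"] bexI[of _ "c \<oplus> c'"])
 qed
 have I_mult: "s \<otimes>\<^bsub>R\<^esub> r \<in> I" if rs: "r \<in> I" "s .: R" for r s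
 proof -
  obtain a c where h: "r .: R" "a \<in> grade (U X) n" "c \<in> grade B (n - 1)"
   "d a \<oplus>\<^bsub>U X\<^esub> r \<odot>\<^bsub>U X\<^esub> z = \<zero>\<^bsub>U X\<^esub>" "\<phi> a \<oplus> r \<odot> b = dB c"
   using rs by (auto simp: I_def)
  have cl: "a .: U X" "c .: B"
   using h M.K.grade_carrier B.grade_carrier by auto
  have "d (s \<odot>\<^bsub>U X\<^esub> a) \<oplus>\<^bsub>U X\<^esub> (s \<otimes>\<^bsub>R\<^esub> r) \<odot>\<^bsub>U X\<^esub> z = s \<odot>\<^bsub>U X\<^esub> (d a \<oplus>\<^bsub>U X\<^esub> r \<odot>\<^bsub>U X\<^esub> z)"
   using h(1) rs(2) cl zc by (simp add: M.K.diff_smult M.K.smult_r_distr M.K.smult_assoc1)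
  moreover have "\<phi> (s \<odot>\<^bsub>U X\<^esub> a) \<oplus> (s \<otimes>\<^bsub>R\<^esub> r) \<odot> b = s \<odot> (\<phi> a \<oplus> r \<odot> b)"
   using h(1) rs(2) cl zc by (simp add: M.phi_smult B.smult_r_distr B.smult_assoc1)
  moreover have "dB (s \<odot> c) = s \<odot> dB c" using cl rs(2) by (simp add: B.diff_smult)
  moreover have "s \<odot>\<^bsub>U X\<^esub> a \<in> grade (U X) n" "s \<odot> c \<in> grade B (n - 1)" using h rs(2) by blast+
  ultimately show ?thesis using h rs(2) by (auto simp: I_def intro!: bexI[of _ "s \<odot>\<^bsub>U X\<^esub> a"] bexI[of _ "s \<odot> c"])
 qed
 have I_zero: "\<zero>\<^bsub>R\<^esub> \<in> I"
  using zc by (auto simp: I_def intro!: bexI[of _ "\<zero>\<^bsub>U X\<^esub>"] bexI[of _ "\<zero>"])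
 have "ideal I R"
 proof (rule idealI)
  show "ring R" by (rule R.ring_axioms)
  show "subgroup I (add_monoid R)"
  proof (rule subgroup.intro)
   show "I \<subseteq> carrier (add_monoid R)" by (auto simp: I_def)
   fix a assume a: "a \<in> I"
   hence "a .: R" by (auto simp: I_def)
   hence "\<ominus>\<^bsub>R\<^esub> a = (\<ominus>\<^bsub>R\<^esub> \<one>\<^bsub>R\<^esub>) \<otimes>\<^bsub>R\<^esub> a" by (simp add: R.l_minus)
   hence "\<ominus>\<^bsub>R\<^esub> a \<in> I" using I_mult[OF a, of "\<ominus>\<^bsub>R\<^esub> \<one>\<^bsub>R\<^esub>"] by simp
   thus "inv\<^bsub>add_monoid R\<^esub> a \<in> I" by (simp add: a_inv_def)
  next
   show "\<one>\<^bsub>add_monoid R\<^esub> \<in> I" using I_zero by simp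
   show "x \<otimes>\<^bsub>add_monoid R\<^esub> y \<in> I" if "x \<in> I" "y \<in> I" for x y
    using I_add[OF that] by simp
  qed
  fix a x assume a: "a \<in> I" and x: "x .: R"
  hence "a .: R" by (auto simp: I_def)
  show "x \<otimes>\<^bsub>R\<^esub> a \<in> I" using I_mult[OF a x] .
  thus "a \<otimes>\<^bsub>R\<^esub> x \<in> I" using R.m_comm x \<open>a .: R\<close> by simp
 qed
 then obtain q where q: "q .: R" "I = PIdl\<^bsub>R\<^esub> q" using P.exists_gen by blast
 have n1: "1 \<le> n" using n by simp
 obtain j d1 \<phi>1 where j: "\<forall>i\<in>X. i < j" and one: "one_gen_cdga R (U X) (U (insert j X)) (gen j) n (gen_coeff j) d z d1"
  and hom1: "cdga_hom R (U (insert j X)) d1 B dB \<phi>1" and ag1': "\<forall>a\<in>carrier (U X). \<phi>1 a = \<phi> a"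
  and x: "\<phi>1 (gen j) = b" and fg1': "\<forall>i. fin_gen_cohom R (U (insert j X)) d1 i"
  by (rule adjoin_generator[OF m fin n1 fg zb])
 have ag1: "\<phi>1 a = \<phi> a" if "a .: U X" for a using ag1' that by blast
 have fg1: "fin_gen_cohom R (U (insert j X)) d1 i" for i using fg1' by blast
 interpret O: one_gen_cdga R "U X" "U (insert j X)" "gen j" n "gen_coeff j" d z d1 by (rule one)
 have finish: thesis
  if fX: "finite X'" and sX: "insert j X \<subseteq> X'" and mX: "cdga_model R B dB (U X') d' \<phi>'"
   and red: "!!i. i \<le> n ==> cone_reduces (U X) (U X') d' B dB \<phi>' i"
   and ext: "model_extends (U X) d \<phi> (U X') d' \<phi>'" and fgX: "!!i. fin_gen_cohom R (U X') d' i"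
   and xX: "d' (gen j) = z" "\<phi>' (gen j) = b" for X' d' \<phi>'
 proof (rule result)
  have "cone_acyclic R (U X') d' B dB \<phi>' i" if "i < n" for i
   by (rule cone_acyclic_extends[OF m mX ext red[of i] ac]) (use that in auto)
  thus "partial_model n X' d' \<phi>'"
   unfolding partial_model_def by (intro conjI allI impI fX mX fgX)
  show "ext_model X d \<phi> X' d' \<phi>'" using sX ext by auto
  have gj: "gen j \<in> grade (U X') n" using O.v_grade U_grade_mono[OF sX] by blast
  show "(u, c) \<in> cone_span R (U X') d' B dB \<phi>' n G" if "cone_cocycle (U X') d' B dB \<phi>' n u c" for u c
   by (rule cone_span_extends[OF m mX ext red[OF le_refl] Gc span gj _ _ that]) (simp_all add: xX g)
 qed
 show thesis
 proof (cases "q = \<zero>\<^bsub>R\<^esub>")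
  case True
  have I0: "r = \<zero>\<^bsub>R\<^esub>" if "r \<in> I" for r using that q True by (auto simp: cgenideal_def)
  have ann: "r = \<zero>\<^bsub>R\<^esub>" if "r .: R" "a \<in> grade (U X) n" "c \<in> grade B (n - 1)"
   "d a \<oplus>\<^bsub>U X\<^esub> r \<odot>\<^bsub>U X\<^esub> z = \<zero>\<^bsub>U X\<^esub>" "\<phi> a \<oplus> r \<odot> b = dB c" for r a c
   using I0[of r] that by (auto simp: I_def)
  note k = kill_torsion_free_class[OF m one hom1 ag1 x n ac ann]
  show thesis by (rule finish[of "insert j X" d1 \<phi>1]) (use k fin fg1 O.d'_v x in auto)
 next
  case False
  have "q \<in> I" using q R.cgenideal_self by blast
  then obtain w \<beta> where w: "w \<in> grade (U X) n" "\<beta> \<in> grade B (n - 1)"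
   "d w \<oplus>\<^bsub>U X\<^esub> q \<odot>\<^bsub>U X\<^esub> z = \<zero>\<^bsub>U X\<^esub>" "\<phi> w \<oplus> q \<odot> b = dB \<beta>"
   by (auto simp: I_def)
  let ?X1 = "insert j X"
  have wc: "w .: U X" using w M.K.grade_carrier by blast
  let ?zy = "q \<odot>\<^bsub>U ?X1\<^esub> gen j \<oplus>\<^bsub>U ?X1\<^esub> w"
  have gj: "gen j .: U ?X1" using O.v_carrier .
  have m1: "cdga_model R B dB (U ?X1) d1 \<phi>1"
  proof (intro cdga_model.intro pid_target_axioms O.Ed.cdga_axioms cdga_model_axioms.intro hom1)
   fix a assume a: "a \<in> grade (U ?X1) 0" "d1 a = \<zero>\<^bsub>U ?X1\<^esub>"
   hence "a \<in> grade (U X) 0" using O.rep_low n by auto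
   thus "\<exists>r\<in>carrier R. a = r \<odot>\<^bsub>U ?X1\<^esub> \<one>\<^bsub>U ?X1\<^esub>"
    using M.K_H0[of a] a(2) O.d'_K[OF M.K.grade_carrier] by (simp add: O.K_ops)
  qed
  interpret M1: cdga_model R B dB "U ?X1" d1 \<phi>1 by (rule m1)
  have zy: "?zy \<in> grade (U ?X1) (Suc (n - 1))"
   using O.v_grade O.KEg[OF w(1)] q(1) n O.E.grade_add O.E.grade_smult by simp
  have dzy: "d1 ?zy = \<zero>\<^bsub>U ?X1\<^esub>"
  proof -
   have "d1 ?zy = q \<odot>\<^bsub>U ?X1\<^esub> z \<oplus>\<^bsub>U ?X1\<^esub> d w"
    using gj wc q(1) O.d'_K[OF wc] by (simp add: O.Ed.diff_add O.Ed.diff_smult O.d'_v)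
   also have "\<dots> = d w \<oplus>\<^bsub>U X\<^esub> q \<odot>\<^bsub>U X\<^esub> z"
    using wc zc q(1) by (simp add: O.E.M.a_comm O.K_ops)
   finally show ?thesis using w(3) by (simp add: O.K_ops)
  qed
  have b2: "dB \<beta> = \<phi>1 ?zy"
  proof -
   have "\<phi>1 ?zy = q \<odot> b \<oplus> \<phi> w"
    using gj wc q(1) by (simp add: M1.phi_add M1.phi_smult x ag1)
   thus ?thesis using w(4) wc zc q(1) by (simp add: B.M.a_comm)
  qed
  have fin1: "finite ?X1" using fin by simp
  have n2: "1 \<le> n - 1" using n by simp
  obtain j2 d2 \<phi>2 where j2: "\<forall>i\<in>?X1. i < j2"
   and two: "one_gen_cdga R (U ?X1) (U (insert j2 ?X1)) (gen j2) (n - 1) (gen_coeff j2) d1 ?zy d2"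
   and hom2: "cdga_hom R (U (insert j2 ?X1)) d2 B dB \<phi>2" and ag2': "\<forall>a\<in>carrier (U ?X1). \<phi>2 a = \<phi>1 a"
   and fg2': "\<forall>i. fin_gen_cohom R (U (insert j2 ?X1)) d2 i"
   by (rule adjoin_generator[OF m1 fin1 n2 fg1 zy dzy w(2) b2])
  have ag2: "\<phi>2 a = \<phi>1 a" if "a .: U ?X1" for a using ag2' that by blast
  have fg2: "fin_gen_cohom R (U (insert j2 ?X1)) d2 i" for i using fg2' by blast
  interpret W: one_gen_cdga R "U ?X1" "U (insert j2 ?X1)" "gen j2" "n - 1" "gen_coeff j2" d1 ?zy d2 by (rule two)
  have ann: "\<exists>r'\<in>carrier R. r = r' \<otimes>\<^bsub>R\<^esub> q" if "r .: R" "a \<in> grade (U X) n" "c \<in> grade B (n - 1)"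
   "d a \<oplus>\<^bsub>U X\<^esub> r \<odot>\<^bsub>U X\<^esub> z = \<zero>\<^bsub>U X\<^esub>" "\<phi> a \<oplus> r \<odot> b = dB c" for r a c
  proof -
   have "r \<in> PIdl\<^bsub>R\<^esub> q" using that q(2) by (auto simp: I_def)
   thus ?thesis by (auto simp: cgenideal_def)
  qed
  have ag: "\<phi>2 a = \<phi> a" if "a .: U X" for a using ag1 ag2 O.KE that by simp
  have x2: "\<phi>2 (gen j) = b" using ag2[OF gj] x by simp
  have zyK: "?zy = q \<odot>\<^bsub>U X\<^esub> gen j \<oplus>\<^bsub>U X\<^esub> w" by (simp add: O.K_ops)
  note k = kill_torsion_class[OF m one two hom2 ag x2 n ac q(1) False w(1) zyK ann]
  show thesis
   by (rule finish[of "insert j2 ?X1" d2 \<phi>2])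
    (use k fin fg2 O.d'_v W.d'_K[OF gj] x2 in auto)
 qed
qed

lemma next_level:
 assumes pm: "partial_model n X d \<phi>" and n: "2 \<le> n"
 obtains X' d' \<phi>' where "partial_model (Suc n) X' d' \<phi>'" "ext_model X d \<phi> X' d' \<phi>'"
proof -
 have ind: "\<exists>X' d' \<phi>'. partial_model (Suc n) X' d' \<phi>' \<and> ext_model X d \<phi> X' d' \<phi>'"
  if "partial_model n X d \<phi>" "!!g. g \<in> set G ==> cone_cocycle (U X) d B dB \<phi> n (fst g) (snd g)"
   "!!u c. cone_cocycle (U X) d B dB \<phi> n u c ==> (u, c) \<in> cone_span R (U X) d B dB \<phi> n G" for G X d \<phi>
  using that
 proof (induction G arbitrary: X d \<phi>)
  case Nil
  hence "cone_acyclic R (U X) d B dB \<phi> n" unfolding cone_acyclic_def by blast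
  hence "partial_model (Suc n) X d \<phi>" using Nil(1) by (auto simp: partial_model_def less_Suc_eq)
  thus ?case using ext_model_refl by blast
 next
  case (Cons g G)
  obtain X1 d1 \<phi>1 where h: "partial_model n X1 d1 \<phi>1" "ext_model X d \<phi> X1 d1 \<phi>1"
   "!!u c. cone_cocycle (U X1) d1 B dB \<phi>1 n u c ==> (u, c) \<in> cone_span R (U X1) d1 B dB \<phi>1 n G"
   using kill_class[OF Cons.prems(1) n Cons.prems(2,3)] by metis
  have "cone_cocycle (U X1) d1 B dB \<phi>1 n (fst g') (snd g')" if "g' \<in> set G" for g'
   using extends_cone_cocycle[OF conjunct2[OF h(2)] Cons.prems(2) U_graded_module] that by simp
  then obtain X' d' \<phi>' where "partial_model (Suc n) X' d' \<phi>'" "ext_model X1 d1 \<phi>1 X' d' \<phi>'"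
   using Cons.IH[OF h(1) _ h(3)] by metis
  thus ?case using ext_model_trans[OF h(2)] by blast
 qed
 interpret M: cdga_model R B dB "U X" d \<phi> using pm by (simp add: partial_model_def)
 have "fin_gen_cohom R (U X) d (Suc n)" using pm by (simp add: partial_model_def)
 then obtain G where "!!g. g \<in> set G ==> cone_cocycle (U X) d B dB \<phi> n (fst g) (snd g)"
  "!!u c. cone_cocycle (U X) d B dB \<phi> n u c ==> (u, c) \<in> cone_span R (U X) d B dB \<phi> n G"
  using M.cone_fin_gen[OF _ B_fin_gen] by metis
 thus thesis using ind[OF pm] that by metis
qed

lemma initial_model:
 "\<exists>d \<phi>. partial_model 2 {} d \<phi> \<and> (\<forall>a\<in>carrier A. d (incl a) = incl (dA a) \<and> \<phi> (incl a) = f a)"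
proof -
 let ?\<Theta> = "%u. u {#} :: 'a"
 let ?d = "iso_diff (U {}) ?\<Theta> dA" and ?f = "%u. f (?\<Theta> u)"
 note iso = U_comm_graded_algebra[of "{}"] A.cdga_axioms U_empty_iso
 interpret D: cdga R "U {}" ?d by (rule iso_cdga[OF iso])
 have "cdga_model R B dB (U {}) ?d ?f"
 proof (intro cdga_model.intro pid_target_axioms D.cdga_axioms cdga_model_axioms.intro iso_comp_hom[OF iso f])
  fix a assume a: "a \<in> grade (U {}) 0" "?d a = \<zero>\<^bsub>U {}\<^esub>"
  have ac: "a .: (U {})" using a U_grade_carrier by blast
  have "dA (?\<Theta> a) = \<zero>\<^bsub>A\<^esub>" using iso_diff[OF iso ac] a(2) by (simp add: U_simps)
  then obtain r where r: "r .: R" "?\<Theta> a = r \<odot>\<^bsub>A\<^esub> \<one>\<^bsub>A\<^esub>"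
   using A_H0[of "?\<Theta> a"] iso_grade[OF iso, of 0] a(1) by blast
  hence "a = r \<odot>\<^bsub>U {}\<^esub> \<one>\<^bsub>U {}\<^esub>" using U_empty[OF ac] by (simp add: incl_simps)
  thus "\<exists>r\<in>carrier R. a = r \<odot>\<^bsub>U {}\<^esub> \<one>\<^bsub>U {}\<^esub>" using r(1) by blast
 qed
 hence "partial_model 2 {} ?d ?f"
  unfolding partial_model_def
  by (intro conjI allI impI iso_fin_gen[OF iso A_fin_gen] iso_cone_acyclic[OF iso A_acyclic]) simp
 moreover have "?d (incl a) = incl (dA a) \<and> ?f (incl a) = f a" if a: "a .: A" for a
 proof -
  have "?\<Theta> (?d (incl a)) = dA a" using iso_diff[OF iso incl_U[OF a]] by (simp add: incl_simps)
  thus ?thesis using U_empty[OF iso_diff_closed[OF iso incl_U[OF a]]] by (simp add: incl_simps)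
 qed
 ultimately show ?thesis by blast
qed

subsection \<open>The union of the stages\<close>

text \<open>Each element of the union lies in a stage, where all identities to be checked hold; a cone
 cocycle of degree \<open>n\<close> is bounded in every stage that is exact in degree \<open>n\<close>.\<close>

theorem full_model:
 obtains X d \<phi> where "cdga_model R B dB (U X) d \<phi>" "!!i. cone_acyclic R (U X) d B dB \<phi> i"
  "!!a. a .: A ==> d (incl a) = incl (dA a)" "!!a. a .: A ==> \<phi> (incl a) = f a"
proof -
 obtain d0 \<phi>0 where init: "partial_model 2 {} d0 \<phi>0" "\<forall>a\<in>carrier A. d0 (incl a) = incl (dA a) \<and> \<phi>0 (incl a) = f a"
  using initial_model by blast
 let ?Q = "%k (X, d, \<phi>). partial_model (k + 2) X d \<phi> \<and> ext_model {} d0 \<phi>0 X d \<phi>"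
 let ?E = "%k (X, d, \<phi>) (X', d', \<phi>'). ext_model X d \<phi> X' d' \<phi>'"
 have "\<exists>F. \<forall>k. ?Q k (F k) \<and> ?E k (F k) (F (Suc k))"
 proof (rule dependent_nat_choice)
  show "\<exists>x. ?Q 0 x" using init(1) ext_model_refl by (intro exI[of _ "({}, d0, \<phi>0)"]) (simp add: numeral_2_eq_2)
  fix x k assume "?Q k x"
  then obtain X d \<phi> where x: "x = (X, d, \<phi>)" "partial_model (k + 2) X d \<phi>" "ext_model {} d0 \<phi>0 X d \<phi>"
   by (cases x) auto
  obtain X' d' \<phi>' where h: "partial_model (Suc (k + 2)) X' d' \<phi>'" "ext_model X d \<phi> X' d' \<phi>'"
   using next_level[OF x(2)] by auto
  thus "\<exists>y. ?Q (Suc k) y \<and> ?E k x y"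
   using x ext_model_trans[OF x(3) h(2)] by (intro exI[of _ "(X', d', \<phi>')"]) simp
 qed
 then obtain F where "\<forall>k. ?Q k (F k) \<and> ?E k (F k) (F (Suc k))" ..
 hence F: "!!k. ?Q k (F k)" "!!k. ?E k (F k) (F (Suc k))" by simp_all
 define X where "X k = fst (F k)" for k
 define d where "d k = fst (snd (F k))" for k
 define \<phi> where "\<phi> k = snd (snd (F k))" for k
 have Fk: "F k = (X k, d k, \<phi> k)" for k by (simp add: X_def d_def \<phi>_def)
 have pm: "partial_model (k + 2) (X k) (d k) (\<phi> k)" and ext0: "ext_model {} d0 \<phi>0 (X k) (d k) (\<phi> k)" for k
  using F(1)[of k] by (auto simp: Fk)
 have ext1: "ext_model (X k) (d k) (\<phi> k) (X (Suc k)) (d (Suc k)) (\<phi> (Suc k))" for k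
  using F(2)[of k] by (auto simp: Fk)
 have ext: "ext_model (X k) (d k) (\<phi> k) (X l) (d l) (\<phi> l)" if "k \<le> l" for k l
  using that
 proof (induction l rule: dec_induct)
  case base
  show ?case by (rule ext_model_refl)
 next
  case (step l)
  show ?case by (rule ext_model_trans[OF step.IH ext1])
 qed
 have mod: "cdga_model R B dB (U (X k)) (d k) (\<phi> k)" for k using pm by (simp add: partial_model_def)
 define Y where "Y = (\<Union>k. X k)"
 have XY: "X k \<subseteq> Y" for k by (auto simp: Y_def)
 have stage: "\<exists>k. u .: (U (X k))" if u: "u .: U Y" for u
 proof -
  obtain X' where X': "finite X'" "X' \<subseteq> Y" "u .: U X'" using U_finitely_many_gens[OF u] by blast
  have "\<exists>k. X' \<subseteq> X k" using X'(1,2)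
  proof (induction X')
   case (insert j X')
   then obtain k l where "X' \<subseteq> X k" "j \<in> X l" by (auto simp: Y_def)
   moreover have "X k \<subseteq> X (max k l)" "X l \<subseteq> X (max k l)" using ext[of k "max k l"] ext[of l "max k l"] by auto
   ultimately show ?case by (intro exI[of _ "max k l"]) auto
  qed simp
  thus ?thesis using X'(3) U_carrier_mono by blast
 qed
 have stage2: "\<exists>k. u .: (U (X k)) \<and> w .: (U (X k))"
  if uw: "u .: U Y" "w .: U Y" for u w
 proof -
  obtain k l where "u .: (U (X k))" "w .: (U (X l))" using stage uw by blast
  moreover have "carrier (U (X k)) \<subseteq> carrier (U (X (max k l)))" "carrier (U (X l)) \<subseteq> carrier (U (X (max k l)))"
   using ext[of k "max k l"] ext[of l "max k l"] U_carrier_mono by auto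
  ultimately show ?thesis by blast
 qed
 define D where "D u = d (LEAST k. u .: (U (X k))) u" for u
 define P where "P u = \<phi> (LEAST k. u .: (U (X k))) u" for u
 have DP: "D u = d k u" "P u = \<phi> k u" if u: "u .: (U (X k))" for u k
 proof -
  let ?l = "LEAST k. u .: (U (X k))"
  have l: "u .: (U (X ?l))" "?l \<le> k" using u by (rule LeastI, rule Least_le)
  thus "D u = d k u" "P u = \<phi> k u"
   using ext[OF l(2)] l(1) unfolding D_def P_def model_extends_def by auto
 qed
 have gr: "u \<in> grade (U (X k)) n" if "u \<in> grade (U Y) n" "u .: (U (X k))" for u k n
  using U_grade_restrict that .
 have up: "u .: U Y" if "u .: (U (X k))" for u k
  using that U_carrier_mono[OF XY] by blast
 have upg: "u \<in> grade (U Y) n" if "u \<in> grade (U (X k)) n" for u k n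
  using that U_grade_mono[OF XY] by blast
 have ops: "mult (U Y) = mult (U (X k))" "add (U Y) = add (U (X k))" "zero (U Y) = zero (U (X k))"
  "one (U Y) = one (U (X k))" "smult (U Y) = smult (U (X k))" for k by (rule U_ops)+
 have ks: "ksgn (U Y) i u = ksgn (U (X k)) i u" if "u .: (U (X k))" for u i k
  using that up[OF that] M.fun_group_minus[OF U_group, of u] by (auto simp: ksgn_def fun_eq_iff)
 have cd: "cdga R (U Y) D"
 proof (intro cdga.intro U_comm_graded_algebra cdga_axioms.intro)
  fix x y assume xy: "x .: U Y" "y .: U Y"
  obtain k where k: "x .: (U (X k))" "y .: (U (X k))" using stage2[OF xy] by blast
  interpret k: cdga_model R B dB "U (X k)" "d k" "\<phi> k" by (rule mod)
  show "D (x \<oplus>\<^bsub>U Y\<^esub> y) = D x \<oplus>\<^bsub>U Y\<^esub> D y"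
   using k by (simp add: ops[of k] DP[of _ k] k.K.diff_add)
 next
  fix r x assume r: "r .: R" and x: "x .: U Y"
  obtain k where k: "x .: (U (X k))" using stage[OF x] by blast
  interpret k: cdga_model R B dB "U (X k)" "d k" "\<phi> k" by (rule mod)
  show "D (r \<odot>\<^bsub>U Y\<^esub> x) = r \<odot>\<^bsub>U Y\<^esub> D x"
   using k r by (simp add: ops[of k] DP[of _ k] k.K.diff_smult)
 next
  fix x i assume x: "x \<in> grade (U Y) i"
  obtain k where k: "x .: (U (X k))" using stage[OF U_grade_carrier[OF x]] by blast
  interpret k: cdga_model R B dB "U (X k)" "d k" "\<phi> k" by (rule mod)
  show "D x \<in> grade (U Y) (Suc i)"
   unfolding DP(1)[OF k] using upg k.K.diff_grade[OF gr[OF x k]] by blast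
 next
  fix x assume x: "x .: U Y"
  obtain k where k: "x .: (U (X k))" using stage[OF x] by blast
  interpret k: cdga_model R B dB "U (X k)" "d k" "\<phi> k" by (rule mod)
  show "D (D x) = \<zero>\<^bsub>U Y\<^esub>"
   using k by (simp add: ops[of k] DP[of _ k] k.K.diff_diff)
 next
  fix x y i assume x: "x \<in> grade (U Y) i" and y: "y .: U Y"
  obtain k where k: "x .: (U (X k))" "y .: (U (X k))"
   using stage2[OF U_grade_carrier[OF x] y] by blast
  interpret k: cdga_model R B dB "U (X k)" "d k" "\<phi> k" by (rule mod)
  have "D (x \<otimes>\<^bsub>U Y\<^esub> y) = d k x \<otimes>\<^bsub>U (X k)\<^esub> y \<oplus>\<^bsub>U (X k)\<^esub> ksgn (U (X k)) i (x \<otimes>\<^bsub>U (X k)\<^esub> d k y)"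
   using k.K.diff_mult[OF gr[OF x k(1)] k(2)] k by (simp add: ops[of k] DP[of _ k])
  thus "D (x \<otimes>\<^bsub>U Y\<^esub> y) = D x \<otimes>\<^bsub>U Y\<^esub> y \<oplus>\<^bsub>U Y\<^esub> ksgn (U Y) i (x \<otimes>\<^bsub>U Y\<^esub> D y)"
   using k ks[of "x \<otimes>\<^bsub>U (X k)\<^esub> d k y" k i] by (simp add: ops[of k] DP[of _ k])
 qed
 interpret Y: cdga R "U Y" D by (rule cd)
 have hom: "cdga_hom R (U Y) D B dB P"
  unfolding cdga_hom_def
 proof (intro conjI ballI allI)
  show "P \<in> ring_hom (U Y) B"
  proof (rule ring_hom_memI)
   fix x assume x: "x .: U Y"
   obtain k where k: "x .: (U (X k))" using stage[OF x] by blast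
   interpret k: cdga_model R B dB "U (X k)" "d k" "\<phi> k" by (rule mod)
   show "P x .: B" using k by (simp add: DP[of _ k])
  next
   fix x y assume xy: "x .: U Y" "y .: U Y"
   obtain k where k: "x .: (U (X k))" "y .: (U (X k))" using stage2[OF xy] by blast
   interpret k: cdga_model R B dB "U (X k)" "d k" "\<phi> k" by (rule mod)
   have "\<phi> k \<in> ring_hom (U (X k)) B" using k.phi by (simp add: cdga_hom_def)
   thus "P (x \<otimes>\<^bsub>U Y\<^esub> y) = P x \<otimes> P y" "P (x \<oplus>\<^bsub>U Y\<^esub> y) = P x \<oplus> P y"
    using k by (simp_all add: ops[of k] DP[of _ k] ring_hom_mult ring_hom_add)
  next
   interpret k: cdga_model R B dB "U (X 0)" "d 0" "\<phi> 0" by (rule mod)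
   show "P \<one>\<^bsub>U Y\<^esub> = \<one>" using k.phi_one by (simp add: ops[of 0] DP[of _ 0])
  qed
  fix r x assume r: "r .: R" and x: "x .: U Y"
  obtain k where k: "x .: (U (X k))" using stage[OF x] by blast
  interpret k: cdga_model R B dB "U (X k)" "d k" "\<phi> k" by (rule mod)
  show "P (r \<odot>\<^bsub>U Y\<^esub> x) = r \<odot> P x"
   using k r by (simp add: ops[of k] DP[of _ k] k.phi_smult)
 next
  fix n show "P ` grade (U Y) n \<subseteq> grade B n"
  proof clarify
   fix x assume x: "x \<in> grade (U Y) n"
   obtain k where k: "x .: (U (X k))" using stage[OF U_grade_carrier[OF x]] by blast
   interpret k: cdga_model R B dB "U (X k)" "d k" "\<phi> k" by (rule mod)
   show "P x \<in> grade B n" unfolding DP(2)[OF k] using k.phi_grade[OF gr[OF x k]] .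
  qed
 next
  fix x assume x: "x .: U Y"
  obtain k where k: "x .: (U (X k))" using stage[OF x] by blast
  interpret k: cdga_model R B dB "U (X k)" "d k" "\<phi> k" by (rule mod)
  show "P (D x) = dB (P x)" using k by (simp add: DP[of _ k] k.phi_diff)
 qed
 have model: "cdga_model R B dB (U Y) D P"
 proof (intro cdga_model.intro pid_target_axioms cd cdga_model_axioms.intro hom)
  fix a assume a: "a \<in> grade (U Y) 0" "D a = \<zero>\<^bsub>U Y\<^esub>"
  obtain k where k: "a .: (U (X k))" using stage[OF U_grade_carrier[OF a(1)]] by blast
  interpret k: cdga_model R B dB "U (X k)" "d k" "\<phi> k" by (rule mod)
  show "\<exists>r\<in>carrier R. a = r \<odot>\<^bsub>U Y\<^esub> \<one>\<^bsub>U Y\<^esub>"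
   using k.K_H0[OF gr[OF a(1) k]] a(2) DP(1)[OF k] by (simp add: ops[of k])
 qed
 have acyc: "cone_acyclic R (U Y) D B dB P i" for i
  unfolding cone_acyclic_def
 proof (intro allI impI)
  fix u c assume uc: "cone_cocycle (U Y) D B dB P i u c"
  have u: "u \<in> grade (U Y) (Suc i)" using uc by (simp add: cone_cocycle_def)
  obtain k where k: "u .: (U (X k))" using stage[OF U_grade_carrier[OF u]] by blast
  let ?l = "max k i"
  have kl: "u .: (U (X ?l))" using k ext[of k ?l] U_carrier_mono by auto
  have "cone_cocycle (U (X ?l)) (d ?l) B dB (\<phi> ?l) i u c"
   using uc gr[OF u kl] DP[OF kl] by (simp add: cone_cocycle_def ops[of ?l])
  moreover have "cone_acyclic R (U (X ?l)) (d ?l) B dB (\<phi> ?l) i"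
   using pm[of ?l] by (simp add: partial_model_def)
  ultimately have "(u, c) \<in> cone_span R (U (X ?l)) (d ?l) B dB (\<phi> ?l) i []" by (simp add: cone_acyclic_def)
  moreover have "model_extends (U (X ?l)) (d ?l) (\<phi> ?l) (U Y) D P"
   unfolding model_extends_def using up upg ops[of ?l] DP[of _ ?l] by auto
  ultimately show "(u, c) \<in> cone_span R (U Y) D B dB P i []"
   using cone_span_mono[OF _ U_graded_module] by blast
 qed
 show thesis
 proof (rule that[OF model acyc])
  fix a assume a: "a .: A"
  have i: "incl a .: (U {})" "incl a .: (U (X 0))" using incl_U[OF a] by auto
  have "d 0 (incl a) = d0 (incl a)" "\<phi> 0 (incl a) = \<phi>0 (incl a)"
   using ext0[of 0] i(1) by (auto simp: model_extends_def)
  thus "D (incl a) = incl (dA a)" "P (incl a) = f a"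
   using DP[OF i(2)] init(2) a by simp_all
 qed
qed

end

section \<open>Algebras presented by generators and relations\<close>

subsection \<open>Monoid algebras\<close>

text \<open>Both the algebra of words and the algebra of pure tensors are monoid algebras twisted by a sign.\<close>

locale monoid_algebra = R?: cring R + Mn: monoid Mn
 for R :: "('r, 'e) ring_scheme" (structure) and Mn :: "('m, 'x) monoid_scheme" +
 fixes wt :: "'m => nat" and \<sigma> :: "'m => 'm => nat"
 assumes sigma_assoc: "\<lbrakk>u .: Mn; v .: Mn; w .: Mn\<rbrakk> \<Longrightarrow>
   \<sigma> u v + \<sigma> (u \<otimes>\<^bsub>Mn\<^esub> v) w = \<sigma> v w + \<sigma> u (v \<otimes>\<^bsub>Mn\<^esub> w)"
  and sigma_one: "u .: Mn ==> \<sigma> \<one>\<^bsub>Mn\<^esub> u = 0" "u .: Mn ==> \<sigma> u \<one>\<^bsub>Mn\<^esub> = 0"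
  and wt_mult: "\<lbrakk>u .: Mn; v .: Mn\<rbrakk> \<Longrightarrow> wt (u \<otimes>\<^bsub>Mn\<^esub> v) = wt u + wt v"
begin

abbreviation F where "F \<equiv> monoid_alg R Mn wt \<sigma>"

lemma F_simps:
 "carrier F = fin_funs (carrier Mn) R" "\<zero>\<^bsub>F\<^esub> = (%m. \<zero>)" "f \<oplus>\<^bsub>F\<^esub> g = (%m. f m \<oplus> g m)"
 "r \<odot>\<^bsub>F\<^esub> f = (%m. r \<otimes> f m)" "\<one>\<^bsub>F\<^esub> = fs_single R \<one>\<^bsub>Mn\<^esub> \<one>"
 "mult F = conv R (mult Mn) (%u v a b. ksgn R (\<sigma> u v) (a \<otimes> b))"
 "grade F n = fin_funs {m \<in> carrier Mn. wt m = n} R"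
 by (auto simp: monoid_alg_def Let_def fin_funs_def fs_single_def conv_def[abs_def])

lemma single_eq: "single R m = fs_single R m \<one>"
 by (simp add: single_def fs_single_def)

lemma F_group: "fun_group F (carrier Mn) R"
 by (simp add: fun_group_def monoid_alg_def Let_def fin_funs_def)

lemma F_twisted: "twisted_conv R (carrier Mn) (mult Mn) (%u v a b. ksgn R (\<sigma> u v) (a \<otimes> b)) F"
 by unfold_locales
  (auto simp: F_group F_simps(6) l_distr r_distr ksgn_add)

lemma F_ring: "ring F"
proof -
 interpret tw: twisted_conv R "carrier Mn" "mult Mn" "%u v a b. ksgn R (\<sigma> u v) (a \<otimes> b)" F by (rule F_twisted)
 show ?thesis
 proof (rule tw.ring_conv[where e = "\<one>\<^bsub>Mn\<^esub>" and ?k1.0 = \<one>])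
  fix u v w a b c
  assume h: "u .: Mn" "v .: Mn" "w .: Mn" "a .: R" "b .: R" "c .: R"
  show "ksgn R (\<sigma> (u \<otimes>\<^bsub>Mn\<^esub> v) w) (ksgn R (\<sigma> u v) (a \<otimes> b) \<otimes> c) =
     ksgn R (\<sigma> u (v \<otimes>\<^bsub>Mn\<^esub> w)) (a \<otimes> ksgn R (\<sigma> v w) (b \<otimes> c))"
   using h sigma_assoc[OF h(1-3)]
   by (simp add: ksgn_mult_left ksgn_mult_right ksgn_ksgn m_assoc add.commute)
 qed (use sigma_one Mn.m_assoc in \<open>auto simp: F_simps(5) ksgn_def\<close>)
qed

lemma F_single_closed: "m .: Mn ==> r .: R ==> fs_single R m r .: F"
 by (simp add: F_simps(1) fs_single_fin_funs)

lemma F_single_mult: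
 assumes "u .: Mn" "v .: Mn" "a .: R" "b .: R"
 shows "fs_single R u a \<otimes>\<^bsub>F\<^esub> fs_single R v b = fs_single R (u \<otimes>\<^bsub>Mn\<^esub> v) (ksgn R (\<sigma> u v) (a \<otimes> b))"
 using twisted_conv.Q_single_mult[OF F_twisted assms] .

lemma F_smult_closed: "r .: R ==> f .: F ==> r \<odot>\<^bsub>F\<^esub> f .: F"
proof -
 assume r: "r .: R" and f: "f .: F"
 have "{m. r \<otimes> f m ~= \<zero>} \<subseteq> {m. f m ~= \<zero>}" using r by auto
 thus ?thesis using r f by (auto simp: F_simps(1,4) fin_funs_def elim: finite_subset)
qed

lemma F_smult_single: "r .: R ==> a .: R ==> r \<odot>\<^bsub>F\<^esub> fs_single R m a = fs_single R m (r \<otimes> a)"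
 by (auto simp: F_simps(4) fs_single_def)

lemma F_smult_additive: "r .: R ==> additive_map F F (%f. r \<odot>\<^bsub>F\<^esub> f)"
 by (rule additiveI[OF F_smult_closed]) (auto simp: F_simps(1,3,4) r_distr fin_funs_val)

lemma F_smult_as_mult:
 assumes "r .: R" "f .: F"
 shows "r \<odot>\<^bsub>F\<^esub> f = (r \<odot>\<^bsub>F\<^esub> \<one>\<^bsub>F\<^esub>) \<otimes>\<^bsub>F\<^esub> f"
proof -
 interpret tw: twisted_conv R "carrier Mn" "mult Mn" "%u v a b. ksgn R (\<sigma> u v) (a \<otimes> b)" F by (rule F_twisted)
 interpret F: ring F by (rule F_ring)
 have "r \<odot>\<^bsub>F\<^esub> \<one>\<^bsub>F\<^esub> .: F" using assms F_smult_closed by simp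
 thus ?thesis
  using assms sigma_one
  by (intro tw.additive_eq_on[OF F.ab F_smult_additive tw.Q_additive_right _ assms(2)])
   (auto simp: F_smult_single F_simps(5) F_single_mult ksgn_def)
qed

lemma F_grade_carrier: "f \<in> grade F n ==> f .: F"
 by (auto simp: F_simps(1,7) fin_funs_def)

lemma F_grade_add: "f \<in> grade F n ==> g \<in> grade F n ==> f \<oplus>\<^bsub>F\<^esub> g \<in> grade F n"
 using fin_funs_add by (simp add: F_simps(3,7))

lemma F_grade_zero: "\<zero>\<^bsub>F\<^esub> \<in> grade F n"
 by (simp add: F_simps(2,7) fin_funs_zero)

lemma F_single_grade: "m .: Mn ==> r .: R ==> fs_single R m r \<in> grade F (wt m)"
 by (simp add: F_simps(7) fs_single_fin_funs)

lemma F_grade_induct [consumes 1, case_names zero add single]: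
 assumes "f \<in> grade F n" "P \<zero>\<^bsub>F\<^esub>"
  and "!!f g. f \<in> grade F n ==> g \<in> grade F n ==> P f ==> P g ==> P (f \<oplus>\<^bsub>F\<^esub> g)"
  and "!!m a. m .: Mn ==> wt m = n ==> a .: R ==> P (fs_single R m a)"
 shows "P f"
 by (rule fin_funs_induct[of f "{m \<in> carrier Mn. wt m = n}"]) (use assms in \<open>auto simp: F_simps(2,3,7)\<close>)

lemma F_induct [consumes 1, case_names zero add single]:
 assumes "f .: F" "P \<zero>\<^bsub>F\<^esub>"
  and "!!f g. f .: F ==> g .: F ==> P f ==> P g ==> P (f \<oplus>\<^bsub>F\<^esub> g)"
  and "!!m a. m .: Mn ==> a .: R ==> P (fs_single R m a)"
 shows "P f"
 by (rule fin_funs_induct[of f "carrier Mn"]) (use assms in \<open>auto simp: F_simps(1,2,3)\<close>)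

lemma F_mult_grade:
 assumes "f \<in> grade F i" "g \<in> grade F j"
 shows "f \<otimes>\<^bsub>F\<^esub> g \<in> grade F (i + j)"
proof -
 interpret F: ring F by (rule F_ring)
 show ?thesis using assms(1)
 proof (induction f rule: F_grade_induct)
  case zero
  thus ?case using assms(2) F_grade_carrier F_grade_zero by simp
 next
  case (add f f')
  thus ?case using assms(2) F_grade_carrier F_grade_add by (simp add: F.l_distr)
 next
  case (single u a)
  note u = this
  show ?case using assms(2)
  proof (induction g rule: F_grade_induct)
   case zero
   thus ?case using u F_single_closed F_grade_zero by simp
  next
   case (add g g')
   thus ?case using u F_single_closed F_grade_carrier F_grade_add by (simp add: F.r_distr)
  next
   case (single v b)
   thus ?case
    using u F_single_grade[of "u \<otimes>\<^bsub>Mn\<^esub> v" "ksgn R (\<sigma> u v) (a \<otimes> b)"] by (simp add: F_single_mult wt_mult)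
  qed
 qed
qed

text \<open>A homogeneous map \<open>\<theta>\<close> on the monoid that is multiplicative up to the sign \<open>\<sigma>\<close> extends to the
 algebra.\<close>

context
 fixes S :: "('r, 's) gmod" and \<theta> :: "'m => 's"
 assumes S: "comm_graded_algebra R S" and theta_grade: "!!u. u .: Mn ==> \<theta> u \<in> grade S (wt u)"
  and theta_one: "\<theta> \<one>\<^bsub>Mn\<^esub> = \<one>\<^bsub>S\<^esub>"
  and theta_mult: "!!u v. u .: Mn ==> v .: Mn ==>
    \<theta> u \<otimes>\<^bsub>S\<^esub> \<theta> v = ksgn S (\<sigma> u v) (\<theta> (u \<otimes>\<^bsub>Mn\<^esub> v))"
begin

interpretation S: comm_graded_algebra R S by (rule S)
interpretation F: ring F by (rule F_ring)
interpretation tw: twisted_conv R "carrier Mn" "mult Mn" "%u v a b. ksgn R (\<sigma> u v) (a \<otimes> b)" F by (rule F_twisted)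

definition alg_ext :: "('m => 'r) => 's" where
 "alg_ext = lin_ext R S (%m r. r \<odot>\<^bsub>S\<^esub> \<theta> m)"

lemma theta_carrier: "u .: Mn ==> \<theta> u .: S"
 using theta_grade S.grade_carrier by blast

lemma coeff_additive: "u .: Mn ==> additive_map R S (%r. r \<odot>\<^bsub>S\<^esub> \<theta> u)"
 by (rule additiveI) (auto simp: theta_carrier S.smult_l_distr)

lemma alg_ext_additive: "additive_map F S alg_ext"
 unfolding alg_ext_def
 by (rule lin_ext_additive[OF ab S.M.ab coeff_additive F_group])

lemmas alg_ext_closed = additive_closed[OF alg_ext_additive]

lemma alg_ext_single: "m .: Mn ==> r .: R ==> alg_ext (fs_single R m r) = r \<odot>\<^bsub>S\<^esub> \<theta> m"
 unfolding alg_ext_def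
 by (rule lin_ext_single[where h = "%m r. r \<odot>\<^bsub>S\<^esub> \<theta> m",
    OF ab S.M.ab coeff_additive])

lemma alg_ext_smult:
 assumes "r .: R" "f .: F"
 shows "alg_ext (r \<odot>\<^bsub>F\<^esub> f) = r \<odot>\<^bsub>S\<^esub> alg_ext f"
 by (rule tw.additive_eq_on[OF S.M.ab additive_comp[OF F_smult_additive alg_ext_additive]
    additive_comp[OF alg_ext_additive S.smult_additive] _ assms(2)])
  (use assms(1) in \<open>auto simp: F_smult_single alg_ext_single theta_carrier S.smult_assoc1\<close>)

lemma alg_ext_mult:
 assumes "f .: F" "g .: F"
 shows "alg_ext (f \<otimes>\<^bsub>F\<^esub> g) = alg_ext f \<otimes>\<^bsub>S\<^esub> alg_ext g"
proof (rule tw.additive_eq_on[OF S.M.ab _ _ _ assms(1)])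
 fix u a assume u: "u .: Mn" "a .: R"
 have ua: "fs_single R u a .: F" using u F_single_closed by blast
 show "alg_ext (fs_single R u a \<otimes>\<^bsub>F\<^esub> g) = alg_ext (fs_single R u a) \<otimes>\<^bsub>S\<^esub> alg_ext g"
 proof (rule tw.additive_eq_on[OF S.M.ab _ _ _ assms(2)])
  fix v b assume v: "v .: Mn" "b .: R"
  have uv: "\<theta> (u \<otimes>\<^bsub>Mn\<^esub> v) .: S" using u v theta_carrier by simp
  have neg: "ksgn R n r \<odot>\<^bsub>S\<^esub> s = r \<odot>\<^bsub>S\<^esub> ksgn S n s" if "r .: R" "s .: S" for n r s
   using that by (simp add: ksgn_def S.smult_l_minus S.smult_r_minus)
  have "alg_ext (fs_single R u a \<otimes>\<^bsub>F\<^esub> fs_single R v b) = (a \<otimes> b) \<odot>\<^bsub>S\<^esub> ksgn S (\<sigma> u v) (\<theta> (u \<otimes>\<^bsub>Mn\<^esub> v))"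
   using u v uv neg by (simp add: F_single_mult alg_ext_single)
  also have "\<dots> = (a \<odot>\<^bsub>S\<^esub> \<theta> u) \<otimes>\<^bsub>S\<^esub> (b \<odot>\<^bsub>S\<^esub> \<theta> v)"
   using u v theta_carrier theta_mult[OF u(1) v(1)]
   by (simp add: S.smult_mult_left S.smult_mult_right S.smult_assoc1 S.smult_commute[of a b])
  finally show "alg_ext (fs_single R u a \<otimes>\<^bsub>F\<^esub> fs_single R v b) =
    alg_ext (fs_single R u a) \<otimes>\<^bsub>S\<^esub> alg_ext (fs_single R v b)"
   using u v by (simp add: alg_ext_single)
 qed (rule additive_comp[OF tw.Q_additive_right[OF ua] alg_ext_additive]
   additive_comp[OF alg_ext_additive S.mult_additive_right[OF alg_ext_closed[OF ua]]])+
qed (rule additive_comp[OF tw.Q_additive_left[OF assms(2)] alg_ext_additive]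
   additive_comp[OF alg_ext_additive S.mult_additive_left[OF alg_ext_closed[OF assms(2)]]])+

lemma alg_ext_one: "alg_ext \<one>\<^bsub>F\<^esub> = \<one>\<^bsub>S\<^esub>"
 by (simp add: F_simps(5) alg_ext_single theta_one)

lemma alg_ext_hom: "alg_ext \<in> ring_hom F S"
 by (rule ring_hom_memI) (auto simp: alg_ext_closed alg_ext_mult alg_ext_one additive_add[OF alg_ext_additive])

lemma alg_ext_grade:
 assumes "f \<in> grade F n"
 shows "alg_ext f \<in> grade S n"
 using assms
proof (induction f rule: F_grade_induct)
 case zero
 thus ?case using additive_zero[OF F.ab S.M.ab alg_ext_additive] by simp
next
 case (add f g)
 thus ?case using additive_add[OF alg_ext_additive] F_grade_carrier by auto
next
 case (single m a)
 thus ?case using theta_grade[of m] by (auto simp: alg_ext_single)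
qed

end

end

subsection \<open>Quotients\<close>

locale graded_quotient = R: cring R + G: ring G
 for R :: "('r, 'e) ring_scheme" and G :: "('r, 'g) gmod" (structure) +
 fixes rels :: "'g set"
 assumes rels: "rels \<subseteq> carrier G"
  and G_smult: "\<lbrakk>r .: R; x .: G\<rbrakk> \<Longrightarrow> r \<odot> x .: G"
  and G_smult_as_mult: "\<lbrakk>r .: R; x .: G\<rbrakk> \<Longrightarrow> r \<odot> x = (r \<odot> \<one>) \<otimes> x"
begin

abbreviation I where "I \<equiv> genideal G rels"
abbreviation Q where "Q \<equiv> graded_quot G rels"

definition proj :: "'g => 'g set" where "proj x = I +> x"

sublocale I: ideal I G
 by (rule G.genideal_ideal[OF rels])

lemma Q_ops: "carrier Q = carrier (G Quot I)" "mult Q = mult (G Quot I)" "one Q = one (G Quot I)"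
 "zero Q = zero (G Quot I)" "add Q = add (G Quot I)"
 by (simp_all add: graded_quot_def Let_def)

lemma Q_ring: "ring Q"
proof -
 interpret QI: ring "G Quot I" by (rule I.quotient_is_ring)
 show ?thesis
 proof (rule ringI)
  show "abelian_group Q"
  proof (rule abelian_groupI)
   fix x assume "x .: Q"
   hence "\<ominus>\<^bsub>G Quot I\<^esub> x \<oplus>\<^bsub>Q\<^esub> x = \<zero>\<^bsub>Q\<^esub>" "\<ominus>\<^bsub>G Quot I\<^esub> x .: Q"
    by (simp_all add: Q_ops QI.l_neg)
   thus "\<exists>y\<in>carrier Q. y \<oplus>\<^bsub>Q\<^esub> x = \<zero>\<^bsub>Q\<^esub>" by (rule bexI)
  next
   fix x y assume "x .: Q" "y .: Q"
   thus "x \<oplus>\<^bsub>Q\<^esub> y = y \<oplus>\<^bsub>Q\<^esub> x" unfolding Q_ops by (rule QI.a_comm)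
  qed (simp_all add: Q_ops QI.a_assoc)
  show "monoid Q" by (rule monoidI) (simp_all add: Q_ops QI.m_assoc)
 qed (simp_all add: Q_ops QI.l_distr QI.r_distr)
qed

lemma Q_carrier: "carrier Q = proj ` carrier G"
 by (auto simp: Q_ops FactRing_def A_RCOSETS_def' proj_def)

lemma proj_hom: "proj \<in> ring_hom G Q"
proof -
 have "(+>) I \<in> ring_hom G (G Quot I)" by (rule I.rcos_ring_hom)
 thus ?thesis by (simp add: ring_hom_def Q_ops proj_def[abs_def])
qed

lemma proj_closed: "x .: G ==> proj x .: Q"
 using Q_carrier by blast

lemma proj_add: "x .: G ==> y .: G ==> proj (x \<oplus> y) = proj x \<oplus>\<^bsub>Q\<^esub> proj y"
 using ring_hom_add[OF proj_hom] .

lemma proj_mult: "x .: G ==> y .: G ==> proj (x \<otimes> y) = proj x \<otimes>\<^bsub>Q\<^esub> proj y"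
 using ring_hom_mult[OF proj_hom] .

lemma proj_one: "proj \<one> = \<one>\<^bsub>Q\<^esub>"
 using ring_hom_one[OF proj_hom] .

lemma proj_additive: "additive_map G Q proj"
 by (rule additiveI) (auto simp: proj_closed proj_add)

lemma proj_zero: "proj \<zero> = \<zero>\<^bsub>Q\<^esub>"
 using additive_zero[OF G.ab ring.is_abelian_group[OF Q_ring] proj_additive] .

lemma proj_ksgn: "x .: G ==> proj (ksgn G n x) = ksgn Q n (proj x)"
 using additive_ksgn[OF G.ab ring.is_abelian_group[OF Q_ring] proj_additive] .

lemma proj_rel:
 assumes "x .: G" "y .: G" "x \<ominus> y \<in> rels"
 shows "proj x = proj y"
proof -
 have "x \<ominus> y \<in> I" using G.genideal_self[OF rels] assms(3) by blast
 hence "x \<in> I +> y"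
  using assms by (intro I.a_rcos_module_rev) (auto simp: a_minus_def)
 thus ?thesis unfolding proj_def using I.a_repr_independence'[OF _ assms(2)] by simp
qed

lemma smult_proj:
 assumes r: "r .: R" and x: "x .: G"
 shows "r \<odot>\<^bsub>Q\<^esub> proj x = proj (r \<odot> x)"
proof -
 have add: "r \<odot> (i \<oplus> x) = r \<odot> i \<oplus> r \<odot> x" if "i .: G" for i
  using that r x G_smult[OF r G.one_closed]
  by (simp add: G_smult_as_mult[of r "i \<oplus> x"] G_smult_as_mult[of r i] G_smult_as_mult[of r x] G.r_distr)
 have rI: "r \<odot> i \<in> I" if "i \<in> I" for i
  using that r G_smult[OF r G.one_closed] I.I_l_closed G_smult_as_mult[OF r I.a_Hcarr[OF that]] by simp
 have IC: "i .: G" if "i \<in> I" for i using I.a_Hcarr[OF that] .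
 have rx: "r \<odot> x .: G" using G_smult r x .
 have "r \<odot>\<^bsub>Q\<^esub> proj x = I <+>\<^bsub>G\<^esub> ((%y. r \<odot> y) ` (I +> x))"
  by (simp add: graded_quot_def Let_def proj_def)
 also have "\<dots> = I +> (r \<odot> x)"
 proof
  show "I <+>\<^bsub>G\<^esub> ((%y. r \<odot> y) ` (I +> x)) \<subseteq> I +> (r \<odot> x)"
  proof
   fix s assume "s \<in> I <+>\<^bsub>G\<^esub> ((%y. r \<odot> y) ` (I +> x))"
   then obtain i i' where i: "i \<in> I" "i' \<in> I" "s = i \<oplus> r \<odot> (i' \<oplus> x)"
    by (auto simp: set_add_def' a_r_coset_def')
   hence "s = (i \<oplus> r \<odot> i') \<oplus> r \<odot> x"
    using IC rx rI by (simp add: add G.a_assoc)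
   moreover have "i \<oplus> r \<odot> i' \<in> I" using i rI I.a_closed by blast
   ultimately show "s \<in> I +> (r \<odot> x)" by (auto simp: a_r_coset_def')
  qed
  show "I +> (r \<odot> x) \<subseteq> I <+>\<^bsub>G\<^esub> ((%y. r \<odot> y) ` (I +> x))"
  proof
   fix s assume "s \<in> I +> (r \<odot> x)"
   then obtain i where i: "i \<in> I" "s = i \<oplus> r \<odot> x" by (auto simp: a_r_coset_def')
   have "x \<in> I +> x" using I.a_rcos_self x by simp
   thus "s \<in> I <+>\<^bsub>G\<^esub> ((%y. r \<odot> y) ` (I +> x))"
    using i by (auto simp: set_add_def')
  qed
 qed
 finally show ?thesis by (simp add: proj_def)
qed

lemma Q_grade: "grade Q n = proj ` grade G n"
 by (simp add: graded_quot_def Let_def proj_def)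

text \<open>On a coset of the ideal, a map that kills the relations has a single value.\<close>

definition quot_map :: "('g => 's) => 'g set => 's" where
 "quot_map h X = the_elem (h ` X)"

lemma quot_map_proj:
 assumes S: "ring S" and h: "h \<in> ring_hom G S" and kill: "!!s. s \<in> rels ==> h s = \<zero>\<^bsub>S\<^esub>"
  and x: "x .: G"
 shows "quot_map h (proj x) = h x"
proof -
 interpret S: ring S by fact
 interpret h: ring_hom_ring G S h
  by (rule ring_hom_ringI2[OF G.ring_axioms S h])
 have "rels \<subseteq> a_kernel G S h"
 proof
  fix s assume "s \<in> rels"
  thus "s \<in> a_kernel G S h" unfolding a_kernel_def' using rels kill[of s] by blast
 qed
 hence sub: "I \<subseteq> a_kernel G S h" using G.genideal_minimal[OF h.kernel_is_ideal] by blast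
 have hI: "h i = \<zero>\<^bsub>S\<^esub>" "i .: G" if "i \<in> I" for i
 proof -
  have "i \<in> a_kernel G S h" using sub that by blast
  thus "h i = \<zero>\<^bsub>S\<^esub>" "i .: G" unfolding a_kernel_def' by blast+
 qed
 have "h ` (I +> x) = {h x}"
 proof (intro subset_antisym subsetI)
  fix s assume "s \<in> h ` (I +> x)"
  then obtain i where i: "i \<in> I" "s = h (i \<oplus> x)" unfolding a_r_coset_def' by blast
  have "s = h i \<oplus>\<^bsub>S\<^esub> h x" unfolding i(2) by (rule ring_hom_add[OF h hI(2)[OF i(1)] x])
  thus "s \<in> {h x}" using hI(1)[OF i(1)] S.l_zero[OF ring_hom_closed[OF h x]] by simp
 next
  fix s assume "s \<in> {h x}"
  thus "s \<in> h ` (I +> x)" using I.a_rcos_self[OF x] by blast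
 qed
 thus ?thesis by (simp add: quot_map_def proj_def)
qed

lemma quot_map_hom:
 assumes S: "ring S" and h: "h \<in> ring_hom G S" and kill: "!!s. s \<in> rels ==> h s = \<zero>\<^bsub>S\<^esub>"
 shows "quot_map h \<in> ring_hom Q S"
proof (rule ring_hom_memI)
 note qp = quot_map_proj[OF assms]
 fix X assume "X .: Q"
 then obtain x where x: "x .: G" "X = proj x" using Q_carrier by auto
 thus "quot_map h X .: S" using qp ring_hom_closed[OF h] by simp
 fix Y assume "Y .: Q"
 then obtain y where y: "y .: G" "Y = proj y" using Q_carrier by auto
 show "quot_map h (X \<otimes>\<^bsub>Q\<^esub> Y) = quot_map h X \<otimes>\<^bsub>S\<^esub> quot_map h Y"
  unfolding x(2) y(2) using x(1) y(1) qp ring_hom_mult[OF h] by (simp add: proj_mult[symmetric])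
 show "quot_map h (X \<oplus>\<^bsub>Q\<^esub> Y) = quot_map h X \<oplus>\<^bsub>S\<^esub> quot_map h Y"
  unfolding x(2) y(2) using x(1) y(1) qp ring_hom_add[OF h] by (simp add: proj_add[symmetric])
next
 show "quot_map h \<one>\<^bsub>Q\<^esub> = \<one>\<^bsub>S\<^esub>"
  using quot_map_proj[OF assms G.one_closed] ring_hom_one[OF h] by (simp add: proj_one)
qed

lemma Q_smult_closed: "r .: R ==> x .: Q ==> r \<odot>\<^bsub>Q\<^esub> x .: Q"
 unfolding Q_carrier by (elim imageE) (simp add: smult_proj G_smult)

lemma Q_smult_as_mult:
 assumes r: "r .: R" and x: "x .: Q"
 shows "r \<odot>\<^bsub>Q\<^esub> x = (r \<odot>\<^bsub>Q\<^esub> \<one>\<^bsub>Q\<^esub>) \<otimes>\<^bsub>Q\<^esub> x"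
proof -
 obtain f where f: "x = proj f" "f .: G" using x unfolding Q_carrier by (rule imageE)
 have r1: "r \<odot> \<one> .: G" using G_smult[OF r] by simp
 have "r \<odot>\<^bsub>Q\<^esub> x = proj ((r \<odot> \<one>) \<otimes> f)"
  unfolding f(1) smult_proj[OF r f(2)] using G_smult_as_mult[OF r f(2)] by simp
 also have "\<dots> = (r \<odot>\<^bsub>Q\<^esub> \<one>\<^bsub>Q\<^esub>) \<otimes>\<^bsub>Q\<^esub> x"
  unfolding f(1) proj_one[symmetric] smult_proj[OF r G.one_closed] by (rule proj_mult[OF r1 f(2)])
 finally show ?thesis .
qed

lemma Q_smult_additive: "r .: R ==> additive_map Q Q (%x. r \<odot>\<^bsub>Q\<^esub> x)"
proof (rule additiveI)
 interpret Q: ring Q by (rule Q_ring)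
 fix x y assume r: "r .: R" and xy: "x .: Q" "y .: Q"
 show "r \<odot>\<^bsub>Q\<^esub> (x \<oplus>\<^bsub>Q\<^esub> y) = r \<odot>\<^bsub>Q\<^esub> x \<oplus>\<^bsub>Q\<^esub> r \<odot>\<^bsub>Q\<^esub> y"
  unfolding Q_smult_as_mult[OF r xy(1)] Q_smult_as_mult[OF r xy(2)] Q_smult_as_mult[OF r Q.a_closed[OF xy]]
  by (rule Q.r_distr[OF xy Q_smult_closed[OF r Q.one_closed]])
qed (rule Q_smult_closed)

end

section \<open>The free graded module on the generators\<close>

definition gen_module :: "('r, 'e) ring_scheme => (nat => nat) => nat set => ('r, nat => 'r) gmod" where
 "gen_module R dg X = \<lparr>carrier = fin_funs X R, mult = undefined, one = undefined, zero = (%j. \<zero>\<^bsub>R\<^esub>),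
   add = (%f g j. f j \<oplus>\<^bsub>R\<^esub> g j), smult = (%r f j. r \<otimes>\<^bsub>R\<^esub> f j), grade = (%n. fin_funs {j \<in> X. dg j = n} R)\<rparr>"

locale generated_module = R?: cring R for R :: "('r, 'e) ring_scheme" (structure) +
 fixes dg :: "nat => nat" and X :: "nat set"
begin

abbreviation V where "V \<equiv> gen_module R dg X"

lemma V_simps: "carrier V = fin_funs X R" "\<zero>\<^bsub>V\<^esub> = (%j. \<zero>)" "f \<oplus>\<^bsub>V\<^esub> g = (%j. f j \<oplus> g j)"
 "r \<odot>\<^bsub>V\<^esub> f = (%j. r \<otimes> f j)" "grade V n = fin_funs {j \<in> X. dg j = n} R"
 by (simp_all add: gen_module_def)

lemma V_group: "fun_group V X R"
 by (simp add: fun_group_def gen_module_def)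

lemma fin_funs_smult:
 assumes "r .: R" "f \<in> fin_funs S R"
 shows "(%j. r \<otimes> f j) \<in> fin_funs S R"
proof -
 have "{j. r \<otimes> f j ~= \<zero>} \<subseteq> {j. f j ~= \<zero>}" using assms(1) by auto
 thus ?thesis using assms by (auto simp: fin_funs_def elim: finite_subset)
qed

lemma V_module: "module R V"
 by (rule moduleI)
  (auto simp: V_simps fin_funs_smult fin_funs_val l_distr r_distr m_assoc is_cring
   intro: fun_group_abelian_group[OF V_group])

lemma V_grade_carrier: "f \<in> grade V n ==> f .: V"
 by (auto simp: V_simps fin_funs_def)

lemma V_graded_module: "graded_module R V"
proof -
 interpret V: module R V by (rule V_module)
 define \<pi> where "\<pi> n f = (%j. if dg j = n then f j else \<zero>)" for n and f :: "nat => 'r"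
 have proj: "\<pi> n f \<in> grade V n" if "f .: V" for n f
 proof -
  have "{j. \<pi> n f j ~= \<zero>} \<subseteq> {j. f j ~= \<zero>}" by (auto simp: \<pi>_def)
  thus ?thesis
   using that finite_subset[of "{j. \<pi> n f j ~= \<zero>}" "{j. f j ~= \<zero>}"] fin_funs_val[of f X R]
   by (auto simp: V_simps(1,5) fin_funs_def) (auto simp: \<pi>_def split: if_splits)
 qed
 show ?thesis
 proof (intro graded_module.intro V_module graded_module_axioms.intro)
  fix n
  show "submodule (grade V n) R V"
  proof (rule V.submoduleI)
   show "grade V n \<subseteq> carrier V" using V_grade_carrier by blast
   show "\<ominus>\<^bsub>V\<^esub> f \<in> grade V n" if f: "f \<in> grade V n" for f
   proof -
    have "\<ominus>\<^bsub>V\<^esub> f = (\<ominus>\<^bsub>R\<^esub> \<one>) \<odot>\<^bsub>V\<^esub> f"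
     using V.smult_l_minus[of \<one> f] V_grade_carrier[OF f] by simp
    moreover have "(\<ominus>\<^bsub>R\<^esub> \<one>) \<odot>\<^bsub>V\<^esub> f \<in> grade V n"
     using fin_funs_smult[of "\<ominus> \<one>" f] f by (simp add: V_simps)
    ultimately show ?thesis by simp
   qed
  qed (auto simp: V_simps fin_funs_zero fin_funs_add fin_funs_smult)
 next
  fix f assume f: "f .: V"
  show "\<exists>!c. is_decomp V f c"
  proof (rule direct_sum_from_projections[where \<pi> = \<pi>])
   show "abelian_group V" by (rule V.ab)
   show "grade V n \<subseteq> carrier V" for n using V_grade_carrier by blast
   show "additive_map V V (\<pi> n)" for n
    by (rule additiveI) (use proj V_grade_carrier in \<open>auto simp: V_simps(3) \<pi>_def\<close>)
   show "\<pi> n x \<in> grade V n" if "x .: V" for n x using proj that .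
   show "\<pi> n x = x" if x: "x \<in> grade V n" for n x
   proof
    fix j show "\<pi> n x j = x j"
     using x by (cases "x j = \<zero>") (auto simp: \<pi>_def V_simps fin_funs_def)
   qed
   show "\<pi> n x = \<zero>\<^bsub>V\<^esub>" if x: "x \<in> grade V k" and "k ~= n" for n k x
    using that by (auto simp: \<pi>_def V_simps fin_funs_def fun_eq_iff)
   show "x = \<zero>\<^bsub>V\<^esub>" if "x .: V" "!!n. \<pi> n x = \<zero>\<^bsub>V\<^esub>" for x
   proof -
    have "x j = \<zero>" for j using fun_cong[OF that(2)[of "dg j"], of j] by (simp add: \<pi>_def V_simps)
    thus ?thesis by (auto simp: V_simps)
   qed
   show "finite {n. \<pi> n x ~= \<zero>\<^bsub>V\<^esub>}" if "x .: V" for x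
   proof -
    have "{n. \<pi> n x ~= \<zero>\<^bsub>V\<^esub>} \<subseteq> dg ` {j. x j ~= \<zero>}"
     by (auto simp: \<pi>_def V_simps fun_eq_iff split: if_splits)
    thus ?thesis using that finite_subset[of _ "dg ` {j. x j ~= \<zero>}"] by (simp add: V_simps fin_funs_finite)
   qed
  qed (rule f)
 qed
qed

lemma V_free:
 assumes "\<one> ~= \<zero>"
 shows "free_graded_module R V"
proof -
 interpret V: module R V by (rule V_module)
 let ?e = "%j::nat. fs_single R j \<one>"
 have inj: "?e i = ?e j \<longleftrightarrow> i = j" for i j
  using assms by (auto simp: fs_single_def fun_eq_iff)
 have e: "?e j .: V" if "j \<in> X" for j using that by (simp add: V_simps fs_single_fin_funs)
 let ?ok = "%c. c ` (?e ` X) \<subseteq> carrier R \<and> (\<forall>b. b \<notin> ?e ` X \<longrightarrow> c b = \<zero>) \<and> finite {b. c b ~= \<zero>}"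
 have eval: "finsum V (%b. c b \<odot>\<^bsub>V\<^esub> b) {b. c b ~= \<zero>} j = (if j \<in> X then c (?e j) else \<zero>)" if c: "?ok c" for c j
 proof -
  let ?S = "{b. c b ~= \<zero>}"
  have S: "?S \<subseteq> ?e ` X" "finite ?S" using c by auto
  have cR: "c b .: R" for b using c by (cases "b \<in> ?e ` X") auto
  have "finsum V (%b. c b \<odot>\<^bsub>V\<^esub> b) ?S j = finsum R (%b. (c b \<odot>\<^bsub>V\<^esub> b) j) ?S"
   by (rule fun_group_finsum[OF V_group]) (use S cR e in blast)
  also have "\<dots> = finsum R (%b. (c b \<odot>\<^bsub>V\<^esub> b) j) (insert (?e j) ?S)"
  proof (rule finsum_supp)
   fix b assume "b \<in> insert (?e j) ?S - ?S"
   thus "(c b \<odot>\<^bsub>V\<^esub> b) j = \<zero>" by (auto simp: V_simps)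
  qed (use S cR e in \<open>auto simp: V_simps fin_funs_val\<close>, auto simp: fs_single_def)
  also have "\<dots> = (c (?e j) \<odot>\<^bsub>V\<^esub> ?e j) j"
  proof (rule finsum_single)
   fix b assume "b \<in> insert (?e j) ?S" "b ~= ?e j"
   then obtain i where "b = ?e i" "i ~= j" using S by auto
   thus "(c b \<odot>\<^bsub>V\<^esub> b) j = \<zero>" using cR by (simp add: V_simps fs_single_def)
  qed (use S cR in \<open>auto simp: V_simps\<close>)
  also have "\<dots> = c (?e j)" using cR by (simp add: V_simps)
  also have "\<dots> = (if j \<in> X then c (?e j) else \<zero>)"
  proof (cases "j \<in> X")
   case False
   have "?e j \<notin> ?e ` X"
   proof
    assume "?e j \<in> ?e ` X"
    then obtain i where i: "i \<in> X" "?e j = ?e i" by (rule imageE)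
    show False using i inj[of j i] False by simp
   qed
   thus ?thesis using c False by simp
  qed simp
  finally show ?thesis .
 qed
 have "is_basis R V (?e ` X)"
  unfolding is_basis_def
 proof (intro conjI ballI)
  show "?e ` X \<subseteq> carrier V" using e by blast
  fix x assume x: "x .: V"
  hence xv: "x \<in> fin_funs X R" by (simp add: V_simps)
  define c where "c b = (if b \<in> ?e ` X then x (inv_into X ?e b) else \<zero>)" for b
  have inje: "inj_on ?e X" using inj by (intro inj_onI) simp
  have ce: "c (?e j) = x j" if "j \<in> X" for j
   unfolding c_def using inv_into_f_f[OF inje that] that by simp
  have "{b. c b ~= \<zero>} \<subseteq> ?e ` {j. x j ~= \<zero>}"
  proof
   fix b assume b: "b \<in> {b. c b ~= \<zero>}"
   hence "b \<in> ?e ` X" by (simp add: c_def split: if_splits)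
   then obtain j where j: "j \<in> X" "b = ?e j" by (rule imageE)
   hence "x j ~= \<zero>" using b ce[OF j(1)] by simp
   thus "b \<in> ?e ` {j. x j ~= \<zero>}" using j(2) by blast
  qed
  hence fin: "finite {b. c b ~= \<zero>}" using fin_funs_finite[OF xv] finite_subset by blast
  have cR: "c b .: R" for b using fin_funs_val[OF xv] by (simp add: c_def)
  have c0: "c b = \<zero>" if "b \<notin> ?e ` X" for b using that unfolding c_def by (rule if_not_P)
  have ok: "?ok c" using cR c0 fin by (intro conjI allI impI image_subsetI)
  show "\<exists>!c. c ` (?e ` X) \<subseteq> carrier R \<and> (\<forall>b. b \<notin> ?e ` X \<longrightarrow> c b = \<zero>) \<and> finite {b. c b ~= \<zero>} \<and>
    x = finsum V (%b. c b \<odot>\<^bsub>V\<^esub> b) {b. c b ~= \<zero>}" (is "\<exists>!c. ?P c")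
  proof (rule ex1I)
   have "x = finsum V (%b. c b \<odot>\<^bsub>V\<^esub> b) {b. c b ~= \<zero>}"
   proof
    fix j
    have "x j = (if j \<in> X then c (?e j) else \<zero>)"
    proof (cases "j \<in> X")
     case True
     thus ?thesis using ce[OF True] by simp
    next
     case False
     thus ?thesis using fin_funs_outside[OF xv False] by simp
    qed
    also have "\<dots> = finsum V (%b. c b \<odot>\<^bsub>V\<^esub> b) {b. c b ~= \<zero>} j" by (rule eval[OF ok, symmetric])
    finally show "x j = finsum V (%b. c b \<odot>\<^bsub>V\<^esub> b) {b. c b ~= \<zero>} j" .
   qed
   thus "?P c" using ok by blast
  next
   fix c' assume P: "?P c'"
   hence ok': "?ok c'" by blast
   from P have x': "x = finsum V (%b. c' b \<odot>\<^bsub>V\<^esub> b) {b. c' b ~= \<zero>}" by blast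
   show "c' = c"
   proof
    fix b
    show "c' b = c b"
    proof (cases "b \<in> ?e ` X")
     case True
     then obtain j where j: "j \<in> X" "b = ?e j" by (rule imageE)
     have "x j = c' (?e j)" using trans[OF fun_cong[OF x', of j] eval[OF ok', of j]] j(1) by simp
     thus ?thesis using ce[OF j(1)] unfolding j(2) by (rule trans[OF sym sym])
    next
     case False
     hence "c' b = \<zero>" using ok' by blast
     thus ?thesis using c0[OF False] by (rule trans[OF _ sym])
    qed
   qed
  qed
 qed
 moreover have "?e ` X \<subseteq> (\<Union>n. grade V n)"
 proof clarify
  fix j assume "j \<in> X"
  hence "?e j \<in> grade V (dg j)" by (simp add: V_simps fs_single_fin_funs)
  thus "?e j \<in> (\<Union>n. grade V n)" by blast
 qed
 ultimately show ?thesis unfolding free_graded_module_def using V_graded_module by blast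
qed

end

section \<open>The tensor product with a free graded commutative algebra\<close>

locale tensor_model = free_gens R A dg + GM: generated_module R dg X
 for R :: "('r, 'e) ring_scheme" and A :: "('r, 'a) gmod" (structure) and dg and X +
 assumes half: "\<one>\<^bsub>R\<^esub> \<oplus>\<^bsub>R\<^esub> \<one>\<^bsub>R\<^esub> \<in> Units R"
begin

abbreviation V where "V \<equiv> gen_module R dg X"
abbreviation L where "L \<equiv> Lambda R V"
abbreviation T where "T \<equiv> tensor_alg R A L"

interpretation V: graded_module R V by (rule GM.V_graded_module)
interpretation U: comm_graded_algebra R "U X" by (rule U_comm_graded_algebra)

subsection \<open>The free graded commutative algebra maps to the model\<close>

sublocale W: monoid_algebra R "words V" "%w. sum_list (map fst w)" "%_ _. 0"
proof -
 have "monoid (words V)" by (rule monoidI) (auto simp: words_def)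
 then interpret M: monoid "words V" .
 show "monoid_algebra R (words V) (%w. sum_list (map fst w)) (%_ _. 0)"
  by unfold_locales (auto simp: words_def)
qed

abbreviation word where "word w \<equiv> fs_single R w \<one>\<^bsub>R\<^esub>"

lemma word_alg_eq: "word_alg R V = W.F"
 by (simp add: word_alg_def)

lemma words_carrier: "w .: words V \<longleftrightarrow> (\<forall>(n, v)\<in>set w. v \<in> grade V n)"
 by (auto simp: words_def)

lemma words_mult: "w \<otimes>\<^bsub>words V\<^esub> w' = w @ w'" "\<one>\<^bsub>words V\<^esub> = []"
 by (simp_all add: words_def)

lemma word_closed: "w .: words V ==> word w .: W.F"
 using W.F_single_closed by simp

lemma word_mult: "w .: words V ==> w' .: words V ==> word w \<otimes>\<^bsub>W.F\<^esub> word w' = word (w @ w')"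
 by (simp add: W.F_single_mult words_mult ksgn_def)

lemma Lambda_rels_carrier: "Lambda_rels R V \<subseteq> carrier W.F"
proof
 interpret F: ring W.F by (rule W.F_ring)
 fix s assume "s \<in> Lambda_rels R V"
 thus "s .: W.F"
  unfolding Lambda_rels_def Let_def word_alg_eq W.single_eq
  by (elim UnE CollectE exE conjE)
   (simp_all add: words_carrier V.grade_add V.grade_smult word_closed W.F_smult_closed F.ksgn_closed)
qed

sublocale LQ: graded_quotient R W.F "Lambda_rels R V"
proof -
 interpret F: ring W.F by (rule W.F_ring)
 show "graded_quotient R W.F (Lambda_rels R V)"
 proof unfold_locales
  show "Lambda_rels R V \<subseteq> carrier W.F" by (rule Lambda_rels_carrier)
 qed (assumption | rule W.F_smult_closed W.F_smult_as_mult subsetI W.F_grade_carrier)+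
qed

lemma L_eq: "L = LQ.Q"
 by (simp add: Lambda_def word_alg_eq)

interpretation L: ring L unfolding L_eq by (rule LQ.Q_ring)

definition lword :: "(nat \<times> (nat => 'r)) list => ((nat \<times> (nat => 'r)) list => 'r) set" where
 "lword w = LQ.proj (word w)"

lemma lword_closed[simp]: "w .: words V ==> lword w .: L"
 unfolding L_eq lword_def using LQ.proj_closed word_closed by blast

lemma lword_mult: "w .: words V ==> w' .: words V ==> lword w \<otimes>\<^bsub>L\<^esub> lword w' = lword (w @ w')"
 unfolding L_eq lword_def using LQ.proj_mult[OF word_closed word_closed, of w w'] by (simp add: word_mult)

lemma lword_Nil: "lword [] = \<one>\<^bsub>L\<^esub>"
 unfolding L_eq lword_def using LQ.proj_one by (simp add: W.F_simps(5) words_mult)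

lemma lword_add:
 assumes "v \<in> grade V n" "w \<in> grade V n"
 shows "lword [(n, v \<oplus>\<^bsub>V\<^esub> w)] = lword [(n, v)] \<oplus>\<^bsub>L\<^esub> lword [(n, w)]"
proof -
 have c: "word [(n, v)] .: W.F" "word [(n, w)] .: W.F" "word [(n, v \<oplus>\<^bsub>V\<^esub> w)] .: W.F"
  using assms by (simp_all add: word_closed words_carrier V.grade_add)
 have "word [(n, v \<oplus>\<^bsub>V\<^esub> w)] \<ominus>\<^bsub>W.F\<^esub> (word [(n, v)] \<oplus>\<^bsub>W.F\<^esub> word [(n, w)]) \<in> Lambda_rels R V"
  unfolding Lambda_rels_def Let_def word_alg_eq W.single_eq by (rule UnI1, rule UnI1, rule CollectI, intro exI conjI, rule refl, rule assms(1), rule assms(2))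
 hence "LQ.proj (word [(n, v \<oplus>\<^bsub>V\<^esub> w)]) = LQ.proj (word [(n, v)] \<oplus>\<^bsub>W.F\<^esub> word [(n, w)])"
  by (rule LQ.proj_rel[rotated 2]) (use c in simp_all)
 thus ?thesis unfolding L_eq lword_def using LQ.proj_add[OF c(1,2)] by simp
qed

lemma lword_smult:
 assumes "v \<in> grade V n" "r .: R"
 shows "lword [(n, r \<odot>\<^bsub>V\<^esub> v)] = r \<odot>\<^bsub>L\<^esub> lword [(n, v)]"
proof -
 have c: "word [(n, v)] .: W.F" "word [(n, r \<odot>\<^bsub>V\<^esub> v)] .: W.F"
  using assms by (simp_all add: word_closed words_carrier V.grade_smult)
 have "word [(n, r \<odot>\<^bsub>V\<^esub> v)] \<ominus>\<^bsub>W.F\<^esub> (r \<odot>\<^bsub>W.F\<^esub> word [(n, v)]) \<in> Lambda_rels R V"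
  unfolding Lambda_rels_def Let_def word_alg_eq W.single_eq by (rule UnI1, rule UnI2, rule CollectI, intro exI conjI, rule refl, rule assms(2), rule assms(1))
 hence "LQ.proj (word [(n, r \<odot>\<^bsub>V\<^esub> v)]) = LQ.proj (r \<odot>\<^bsub>W.F\<^esub> word [(n, v)])"
  by (rule LQ.proj_rel[rotated 2]) (use c W.F_smult_closed assms(2) in simp_all)
 thus ?thesis unfolding L_eq lword_def using LQ.smult_proj[OF assms(2) c(1)] by simp
qed

lemma lword_comm:
 assumes "v \<in> grade V i" "w \<in> grade V j"
 shows "lword [(i, v), (j, w)] = ksgn L (i * j) (lword [(j, w), (i, v)])"
proof -
 have c: "word [(i, v), (j, w)] .: W.F" "word [(j, w), (i, v)] .: W.F"
  using assms by (simp_all add: word_closed words_carrier)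
 have "word [(i, v), (j, w)] \<ominus>\<^bsub>W.F\<^esub> ksgn W.F (i * j) (word [(j, w), (i, v)]) \<in> Lambda_rels R V"
  unfolding Lambda_rels_def Let_def word_alg_eq W.single_eq by (rule UnI2, rule CollectI, intro exI conjI, rule refl, rule assms(1), rule assms(2))
 hence "LQ.proj (word [(i, v), (j, w)]) = LQ.proj (ksgn W.F (i * j) (word [(j, w), (i, v)]))"
  by (rule LQ.proj_rel[rotated 2]) (use c LQ.G.ksgn_closed in simp_all)
 thus ?thesis unfolding L_eq lword_def using LQ.proj_ksgn[OF c(2)] by simp
qed

lemma L_smult_closed: "r .: R ==> x .: L ==> r \<odot>\<^bsub>L\<^esub> x .: L"
 unfolding L_eq by (rule LQ.Q_smult_closed)

lemma L_smult_as_mult: "r .: R ==> x .: L ==> r \<odot>\<^bsub>L\<^esub> x = (r \<odot>\<^bsub>L\<^esub> \<one>\<^bsub>L\<^esub>) \<otimes>\<^bsub>L\<^esub> x"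
 unfolding L_eq by (rule LQ.Q_smult_as_mult)

lemma L_smult_mult:
 assumes "r .: R" "x .: L" "y .: L"
 shows "(r \<odot>\<^bsub>L\<^esub> x) \<otimes>\<^bsub>L\<^esub> y = r \<odot>\<^bsub>L\<^esub> (x \<otimes>\<^bsub>L\<^esub> y)"
 using assms L_smult_closed[OF assms(1) L.one_closed]
 by (simp add: L_smult_as_mult[of r x] L_smult_as_mult[of r "x \<otimes>\<^bsub>L\<^esub> y"] L.m_assoc)

lemma L_mult_smult:
 assumes "r .: R" "x .: L" "y .: L"
 shows "x \<otimes>\<^bsub>L\<^esub> (r \<odot>\<^bsub>L\<^esub> y) = r \<odot>\<^bsub>L\<^esub> (x \<otimes>\<^bsub>L\<^esub> y)"
proof -
 interpret tw: twisted_conv R "carrier (words V)" "mult (words V)" "%u v a b. ksgn R 0 (a \<otimes>\<^bsub>R\<^esub> b)" W.F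
  by (rule W.F_twisted)
 obtain f where f: "f .: W.F" "x = LQ.proj f" using assms(2) unfolding L_eq LQ.Q_carrier by auto
 obtain g where g: "g .: W.F" "y = LQ.proj g" using assms(3) unfolding L_eq LQ.Q_carrier by auto
 let ?r1 = "fs_single R [] r"
 have r1: "r \<odot>\<^bsub>W.F\<^esub> \<one>\<^bsub>W.F\<^esub> = ?r1" using assms(1) by (simp add: W.F_simps(5) W.F_smult_single words_mult)
 have r1c: "?r1 .: W.F" using W.F_single_closed[of "[]" r] assms(1) by (simp add: words_carrier)
 have "f \<otimes>\<^bsub>W.F\<^esub> ?r1 = ?r1 \<otimes>\<^bsub>W.F\<^esub> f"
 proof (rule tw.additive_eq_on[OF LQ.G.ab tw.Q_additive_left[OF r1c] tw.Q_additive_right[OF r1c] _ f(1)])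
  fix m a assume m: "m .: words V" "a .: R"
  thus "fs_single R m a \<otimes>\<^bsub>W.F\<^esub> ?r1 = ?r1 \<otimes>\<^bsub>W.F\<^esub> fs_single R m a"
   using W.F_single_mult[OF m(1) _ m(2) assms(1), of "[]"] W.F_single_mult[OF _ m(1) assms(1) m(2), of "[]"] R.m_comm[OF assms(1) m(2)]
   by (simp add: words_carrier words_mult)
 qed
 hence eq: "f \<otimes>\<^bsub>W.F\<^esub> (r \<odot>\<^bsub>W.F\<^esub> g) = r \<odot>\<^bsub>W.F\<^esub> (f \<otimes>\<^bsub>W.F\<^esub> g)"
  using f(1) g(1) r1c LQ.G.m_assoc[OF f(1) r1c g(1)] LQ.G.m_assoc[OF r1c f(1) g(1)]
  unfolding W.F_smult_as_mult[OF assms(1) g(1)] W.F_smult_as_mult[OF assms(1) LQ.G.m_closed[OF f(1) g(1)]] r1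
  by simp
 have "x \<otimes>\<^bsub>L\<^esub> (r \<odot>\<^bsub>L\<^esub> y) = LQ.proj (f \<otimes>\<^bsub>W.F\<^esub> (r \<odot>\<^bsub>W.F\<^esub> g))"
  unfolding f g L_eq using LQ.smult_proj[OF assms(1) g(1)] LQ.proj_mult[OF f(1) W.F_smult_closed[OF assms(1) g(1)]] by simp
 also have "\<dots> = r \<odot>\<^bsub>L\<^esub> (x \<otimes>\<^bsub>L\<^esub> y)"
  unfolding f g L_eq eq using LQ.smult_proj[OF assms(1), of "f \<otimes>\<^bsub>W.F\<^esub> g"] LQ.proj_mult[OF f(1) g(1)] f(1) g(1) by simp
 finally show ?thesis .
qed

lemma L_grade: "grade L n = LQ.proj ` grade W.F n"
 unfolding L_eq by (rule LQ.Q_grade)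

lemma L_grade_carrier: "x \<in> grade L n ==> x .: L"
 unfolding L_eq LQ.Q_grade LQ.Q_carrier using W.F_grade_carrier by blast

lemma L_grade_add: "x \<in> grade L n ==> y \<in> grade L n ==> x \<oplus>\<^bsub>L\<^esub> y \<in> grade L n"
 unfolding L_eq LQ.Q_grade
 by (elim imageE) (simp add: LQ.proj_add[symmetric] W.F_grade_carrier W.F_grade_add)

lemma L_grade_mult: "x \<in> grade L i ==> y \<in> grade L j ==> x \<otimes>\<^bsub>L\<^esub> y \<in> grade L (i + j)"
 unfolding L_eq LQ.Q_grade
 by (elim imageE) (simp add: LQ.proj_mult[symmetric] W.F_grade_carrier W.F_mult_grade)

lemma L_grade_zero: "\<zero>\<^bsub>L\<^esub> \<in> grade L n"
 unfolding L_eq LQ.Q_grade by (rule image_eqI[where f = LQ.proj, OF LQ.proj_zero[symmetric] W.F_grade_zero])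

lemma L_grade_smult:
 assumes r: "r .: R" and x: "x \<in> grade L n"
 shows "r \<odot>\<^bsub>L\<^esub> x \<in> grade L n"
proof -
 obtain f where f: "f \<in> grade W.F n" "x = LQ.proj f" using x unfolding L_grade by (rule imageE)
 have "r \<odot>\<^bsub>W.F\<^esub> f \<in> grade W.F n"
  using f(1) r unfolding W.F_simps(4,7) by (intro GM.fin_funs_smult)
 thus ?thesis
  unfolding f(2) L_eq LQ.smult_proj[OF r W.F_grade_carrier[OF f(1)]] LQ.Q_grade by (rule imageI)
qed

lemma lword_grade: "w .: words V ==> lword w \<in> grade L (sum_list (map fst w))"
 unfolding L_grade lword_def using W.F_single_grade[of w "\<one>\<^bsub>R\<^esub>"] by blast

lemma L_one_grade: "\<one>\<^bsub>L\<^esub> \<in> grade L 0"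
 using lword_grade[of "[]"] by (simp add: words_carrier lword_Nil)

definition vgen :: "(nat => 'r) => nat multiset => 'a" where
 "vgen = lin_ext R (U X) (%j r. r \<odot>\<^bsub>U X\<^esub> gen j)"

lemma gen_U[simp]: "j \<in> X ==> gen j .: U X"
 using gen_grade U_grade_carrier by blast

lemma vgen_coeff: "j \<in> X ==> additive_map R (U X) (%r. r \<odot>\<^bsub>U X\<^esub> gen j)"
 by (rule additiveI) (auto simp: U.smult_l_distr)

lemma vgen_additive: "additive_map V (U X) vgen"
 unfolding vgen_def
 by (rule lin_ext_additive[OF R.ab U.M.ab vgen_coeff GM.V_group])

lemma vgen_single: "j \<in> X ==> r .: R ==> vgen (fs_single R j r) = r \<odot>\<^bsub>U X\<^esub> gen j"
 unfolding vgen_def by (rule lin_ext_single[where h = "%j r. r \<odot>\<^bsub>U X\<^esub> gen j", OF R.ab U.M.ab vgen_coeff])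

lemma V_grade_induct [consumes 1, case_names zero add single]:
 assumes "v \<in> grade V n" "P \<zero>\<^bsub>V\<^esub>"
  and "!!f g. f \<in> grade V n ==> g \<in> grade V n ==> P f ==> P g ==> P (f \<oplus>\<^bsub>V\<^esub> g)"
  and "!!j a. j \<in> X ==> dg j = n ==> a .: R ==> P (fs_single R j a)"
 shows "P v"
 by (rule R.fin_funs_induct[of v "{j \<in> X. dg j = n}"]) (use assms in \<open>auto simp: GM.V_simps\<close>)

lemma vgen_grade: "v \<in> grade V n ==> vgen v \<in> grade (U X) n"
proof (induction v rule: V_grade_induct)
 case zero
 thus ?case using additive_zero[OF V.M.ab U.M.ab vgen_additive] by simp
next
 case (add f g)
 thus ?case using additive_add[OF vgen_additive] V.grade_carrier by auto
next
 case (single j a)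
 thus ?case using gen_grade[of j X] by (auto simp: vgen_single)
qed

lemma vgen_smult:
 assumes "r .: R" "v \<in> grade V n"
 shows "vgen (r \<odot>\<^bsub>V\<^esub> v) = r \<odot>\<^bsub>U X\<^esub> vgen v"
 using assms(2)
proof (induction v rule: V_grade_induct)
 case zero
 thus ?case using assms(1) additive_zero[OF V.M.ab U.M.ab vgen_additive] by simp
next
 case (add f g)
 hence "f .: V" "g .: V" using V.grade_carrier by auto
 thus ?case
  using add assms(1) additive_add[OF vgen_additive] additive_closed[OF vgen_additive]
  by (simp add: V.smult_r_distr U.smult_r_distr)
next
 case (single j a)
 have "r \<odot>\<^bsub>V\<^esub> fs_single R j a = fs_single R j (r \<otimes>\<^bsub>R\<^esub> a)" using assms(1) by (auto simp: GM.V_simps fs_single_def)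
 thus ?case using single assms(1) by (simp add: vgen_single U.smult_assoc1)
qed

definition word_val :: "(nat \<times> (nat => 'r)) list => nat multiset => 'a" where
 "word_val w = foldr (%(n, v) y. vgen v \<otimes>\<^bsub>U X\<^esub> y) w \<one>\<^bsub>U X\<^esub>"

lemma word_val_grade: "w .: words V ==> word_val w \<in> grade (U X) (sum_list (map fst w))"
 unfolding word_val_def
proof (induction w)
 case Nil
 thus ?case using U.one_grade by simp
next
 case (Cons l w)
 thus ?case using U.mult_grade[OF vgen_grade] by (cases l) (auto simp: words_carrier)
qed

lemma word_val_closed[simp]: "w .: words V ==> word_val w .: U X"
 using word_val_grade U.grade_carrier by blast

lemma word_val_append:
 "w .: words V ==> w' .: words V ==> word_val (w @ w') = word_val w \<otimes>\<^bsub>U X\<^esub> word_val w'"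
proof (induction w)
 case Nil
 thus ?case using U.A.l_one[OF word_val_closed[of w']] by (simp add: word_val_def)
next
 case (Cons l w)
 obtain n v where l: "l = (n, v)" by (cases l)
 have "vgen v .: U X" "w .: words V"
  using Cons.prems(1) vgen_grade U.grade_carrier by (auto simp: l words_carrier)
 thus ?case using Cons word_val_closed by (simp add: word_val_def l U.A.m_assoc)
qed

lemma word_val_conditions:
 "u .: words V ==> word_val u \<in> grade (U X) (sum_list (map fst u))"
 "word_val \<one>\<^bsub>words V\<^esub> = \<one>\<^bsub>U X\<^esub>"
 "u .: words V ==> v .: words V ==>
   word_val u \<otimes>\<^bsub>U X\<^esub> word_val v = ksgn (U X) 0 (word_val (u \<otimes>\<^bsub>words V\<^esub> v))"
 using word_val_grade word_val_append by (auto simp: words_mult ksgn_def) (simp add: word_val_def)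

abbreviation "free_val \<equiv> W.alg_ext (U X) word_val"
lemmas free_val_hom = W.alg_ext_hom[OF U_comm_graded_algebra word_val_conditions]
lemmas free_val_additive = W.alg_ext_additive[OF U_comm_graded_algebra word_val_conditions]
lemmas free_val_smult = W.alg_ext_smult[OF U_comm_graded_algebra word_val_conditions]
lemmas free_val_grade = W.alg_ext_grade[OF U_comm_graded_algebra word_val_conditions]

lemma free_val_word: "w .: words V ==> free_val (word w) = word_val w"
 using W.alg_ext_single[OF U_comm_graded_algebra word_val_conditions, of w "\<one>\<^bsub>R\<^esub>"] by simp

lemma free_val_diff: "x .: W.F ==> y .: W.F ==> free_val x = free_val y ==>
 free_val (x \<ominus>\<^bsub>W.F\<^esub> y) = \<zero>\<^bsub>U X\<^esub>"
 using additive_diff[OF LQ.G.ab U.M.ab free_val_additive, of x y]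
  additive_closed[OF free_val_additive, of y] by (simp add: a_minus_def U.M.r_neg)

lemma free_val_rels:
 assumes "s \<in> Lambda_rels R V"
 shows "free_val s = \<zero>\<^bsub>U X\<^esub>"
proof -
 have one: "word_val [(n, v)] = vgen v" "vgen v .: U X" "[(n, v)] .: words V" if "v \<in> grade V n" for n v
 proof -
  show "vgen v .: U X" using vgen_grade[OF that] U.grade_carrier by blast
  thus "word_val [(n, v)] = vgen v" by (simp add: word_val_def)
  show "[(n, v)] .: words V" using that by (simp add: words_carrier)
 qed
 have add: "free_val (word [(n, v \<oplus>\<^bsub>V\<^esub> w)] \<ominus>\<^bsub>W.F\<^esub> (word [(n, v)] \<oplus>\<^bsub>W.F\<^esub> word [(n, w)])) = \<zero>\<^bsub>U X\<^esub>"
  if v: "v \<in> grade V n" and w: "w \<in> grade V n" for n v w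
 proof -
  have vw: "v \<oplus>\<^bsub>V\<^esub> w \<in> grade V n" using v w V.grade_add by blast
  have c: "v .: V" "w .: V" using v w V.grade_carrier by auto
  have "free_val (word [(n, v \<oplus>\<^bsub>V\<^esub> w)]) = free_val (word [(n, v)] \<oplus>\<^bsub>W.F\<^esub> word [(n, w)])"
   using one[OF v] one[OF w] one[OF vw] additive_add[OF vgen_additive c]
   by (simp add: free_val_word word_closed additive_add[OF free_val_additive])
  thus ?thesis
   by (rule free_val_diff[rotated 2]) (use one(3)[OF v] one(3)[OF w] one(3)[OF vw] word_closed in simp_all)
 qed
 have smult: "free_val (word [(n, r \<odot>\<^bsub>V\<^esub> v)] \<ominus>\<^bsub>W.F\<^esub> (r \<odot>\<^bsub>W.F\<^esub> word [(n, v)])) = \<zero>\<^bsub>U X\<^esub>"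
  if r: "r .: R" and v: "v \<in> grade V n" for n r v
 proof -
  have rv: "r \<odot>\<^bsub>V\<^esub> v \<in> grade V n" using r v V.grade_smult by blast
  have "free_val (word [(n, r \<odot>\<^bsub>V\<^esub> v)]) = free_val (r \<odot>\<^bsub>W.F\<^esub> word [(n, v)])"
   using one[OF v] one[OF rv] r vgen_smult[OF r v]
   by (simp add: free_val_word word_closed free_val_smult)
  thus ?thesis
   by (rule free_val_diff[rotated 2]) (use one(3)[OF v] one(3)[OF rv] word_closed W.F_smult_closed r in simp_all)
 qed
 have comm: "free_val (word [(i, v), (j, w)] \<ominus>\<^bsub>W.F\<^esub> ksgn W.F (i * j) (word [(j, w), (i, v)])) = \<zero>\<^bsub>U X\<^esub>"
  if v: "v \<in> grade V i" and w: "w \<in> grade V j" for i j v w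
 proof -
  have two: "[(i, v), (j, w)] .: words V" "[(j, w), (i, v)] .: words V"
   using v w by (simp_all add: words_carrier)
  have val: "word_val [(i, v), (j, w)] = vgen v \<otimes>\<^bsub>U X\<^esub> vgen w" "word_val [(j, w), (i, v)] = vgen w \<otimes>\<^bsub>U X\<^esub> vgen v"
   using one[OF v] one[OF w] by (simp_all add: word_val_def)
  have k: "free_val (ksgn W.F (i * j) (word [(j, w), (i, v)])) = ksgn (U X) (i * j) (free_val (word [(j, w), (i, v)]))"
   by (rule additive_ksgn[OF LQ.G.ab U.M.ab free_val_additive word_closed[OF two(2)]])
  have "free_val (word [(i, v), (j, w)]) = free_val (ksgn W.F (i * j) (word [(j, w), (i, v)]))"
   unfolding k free_val_word[OF two(1)] free_val_word[OF two(2)] val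
   by (rule U.graded_comm[OF vgen_grade[OF v] vgen_grade[OF w]])
  thus ?thesis
   by (rule free_val_diff[rotated 2]) (use word_closed[OF two(1)] word_closed[OF two(2)] LQ.G.ksgn_closed in simp_all)
 qed
 show ?thesis
  using assms unfolding Lambda_rels_def Let_def word_alg_eq W.single_eq
  by (elim UnE CollectE exE conjE) (simp_all only: add smult comm)
qed

definition Lval where "Lval = LQ.quot_map free_val"

lemmas Lval_proj = LQ.quot_map_proj[OF U_ring[of X] free_val_hom free_val_rels, folded Lval_def]
lemmas Lval_hom = LQ.quot_map_hom[OF U_ring[of X] free_val_hom free_val_rels, folded Lval_def L_eq]

lemma Lval_lword: "w .: words V ==> Lval (lword w) = word_val w"
 unfolding lword_def using Lval_proj word_closed free_val_word by simp

lemma Lval_grade: "x \<in> grade L n ==> Lval x \<in> grade (U X) n"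
 unfolding L_grade using Lval_proj W.F_grade_carrier free_val_grade by auto

lemma Lval_smult: "r .: R ==> x .: L ==> Lval (r \<odot>\<^bsub>L\<^esub> x) = r \<odot>\<^bsub>U X\<^esub> Lval x"
 unfolding L_eq LQ.Q_carrier using LQ.smult_proj Lval_proj W.F_smult_closed free_val_smult by auto

lemma Lval_closed: "x .: L ==> Lval x .: U X"
 using ring_hom_closed[OF Lval_hom] .

end

subsection \<open>Transport of the algebra structure\<close>

lemma iso_comm_graded_algebra:
 fixes R :: "('r, 'e) ring_scheme" and T :: "('r, 't) gmod" (structure) and S :: "('r, 's) gmod"
 assumes S: "comm_graded_algebra R S" and T: "ring T" and iso: "cga_iso R T S \<Theta>"
  and smult: "!!r t. r .: R ==> t .: T ==> r \<odot> t .: T"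
  and grade: "!!n t. t \<in> grade T n ==> t .: T"
 shows "comm_graded_algebra R T"
proof -
 interpret S: comm_graded_algebra R S by (rule S)
 interpret T: ring T by (rule T)
 have bij: "bij_betw \<Theta> (carrier T) (carrier S)" and hom: "\<Theta> \<in> ring_hom T S"
  and sm: "r .: R ==> t .: T ==> \<Theta> (r \<odot> t) = r \<odot>\<^bsub>S\<^esub> \<Theta> t"
  and gr: "\<Theta> ` grade T n = grade S n" for r t n
  using iso unfolding cga_iso_def by blast+
 note inj = bij_betw_imp_inj_on[OF bij]
 have eqI: "t = t'" if "\<Theta> t = \<Theta> t'" "t .: T" "t' .: T" for t t'
  using inj_onD[OF inj that] .
 note cl = ring_hom_closed[OF hom] and ad = ring_hom_add[OF hom] and mu = ring_hom_mult[OF hom] and on = ring_hom_one[OF hom]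
 have add: "additive_map T S \<Theta>" by (rule additiveI) (simp_all add: cl ad)
 note ze = additive_zero[OF T.ab S.M.ab add]
  and ks = additive_ksgn[OF T.ab S.M.ab add]
  and ne = additive_neg[OF T.ab S.M.ab add]
 have gr_iff: "\<Theta> t \<in> grade S n \<longleftrightarrow> t \<in> grade T n" if "t .: T" for t n
 proof
  assume "\<Theta> t \<in> grade S n"
  then obtain t' where t': "t' \<in> grade T n" "\<Theta> t = \<Theta> t'" unfolding gr[symmetric] by blast
  hence "t = t'" using eqI that grade by blast
  thus "t \<in> grade T n" using t'(1) by simp
 qed (use gr in blast)
 define g where "g = the_inv_into (carrier T) \<Theta>"
 have g: "g s .: T" "\<Theta> (g s) = s" if "s .: S" for s
  unfolding g_def using that bij_betw_imp_surj_on[OF bij] inj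
  by (auto intro: the_inv_into_into f_the_inv_into_f)
 have module: "module R T"
  by (rule moduleI) (auto intro!: eqI T.ab
    simp: S.R.is_cring smult sm cl ad S.smult_l_distr S.smult_r_distr S.smult_assoc1)
 interpret TM: module R T by (rule module)
 have graded: "graded_module R T"
 proof (intro graded_module.intro module graded_module_axioms.intro)
  fix n
  show "submodule (grade T n) R T"
  proof (rule TM.submoduleI)
   show "grade T n \<subseteq> carrier T" using grade by blast
   show "\<zero> \<in> grade T n" using gr_iff[of "\<zero>" n] S.grade_zero ze by simp
   show "\<ominus> x \<in> grade T n" if x: "x \<in> grade T n" for x
    using gr_iff[of "\<ominus> x" n] gr_iff[OF grade[OF x], of n] grade[OF x] x ne S.grade_neg by simp
   show "x \<oplus> y \<in> grade T n" if x: "x \<in> grade T n" and y: "y \<in> grade T n" for x y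
    using gr_iff[of "x \<oplus> y" n] gr_iff[OF grade[OF x], of n] gr_iff[OF grade[OF y], of n]
     grade[OF x] grade[OF y] x y ad S.grade_add by simp
   show "r \<odot> x \<in> grade T n" if r: "r .: R" and x: "x \<in> grade T n" for r x
    using gr_iff[of "r \<odot> x" n] gr_iff[OF grade[OF x], of n] grade[OF x] r x sm smult S.grade_smult by simp
  qed
 next
  fix x assume x: "x .: T"
  show "\<exists>!c. is_decomp T x c"
  proof (rule direct_sum_from_projections[where \<pi> = "%n t. g (hcomp S (\<Theta> t) n)"])
   show "abelian_group T" by (rule T.ab)
   show "grade T n \<subseteq> carrier T" for n using grade by blast
   have h: "hcomp S (\<Theta> t) n .: S" if "t .: T" for t n using S.hcomp_carrier cl that by blast
   show "additive_map T T (%t. g (hcomp S (\<Theta> t) n))" for n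
   proof (rule additiveI)
    fix t t' assume t: "t .: T" "t' .: T"
    show "g (hcomp S (\<Theta> (t \<oplus> t')) n) = g (hcomp S (\<Theta> t) n) \<oplus> g (hcomp S (\<Theta> t') n)"
     using t h by (intro eqI) (simp_all add: g ad cl S.hcomp_add)
   qed (use g h in blast)
   show "g (hcomp S (\<Theta> t) n) \<in> grade T n" if t: "t .: T" for n t
    using gr_iff[OF g(1)[OF h[OF t]]] g(2)[OF h[OF t]] S.hcomp_grade[OF cl[OF t]] by simp
   show "g (hcomp S (\<Theta> t) n) = t" if t: "t \<in> grade T n" for n t
   proof -
    have "\<Theta> t \<in> grade S n" using gr_iff[OF grade[OF t]] t by simp
    hence "hcomp S (\<Theta> t) n = \<Theta> t" using S.hcomp_homogeneous by simp
    thus ?thesis using grade[OF t] g[OF cl[OF grade[OF t]]] by (intro eqI) simp_all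
   qed
   show "g (hcomp S (\<Theta> t) n) = \<zero>" if t: "t \<in> grade T k" and k: "k ~= n" for n k t
   proof -
    have "\<Theta> t \<in> grade S k" using gr_iff[OF grade[OF t]] t by simp
    hence "hcomp S (\<Theta> t) n = \<zero>\<^bsub>S\<^esub>" using S.hcomp_homogeneous k by simp
    thus ?thesis using g[of "\<zero>\<^bsub>S\<^esub>"] ze by (intro eqI) simp_all
   qed
   show "finite {n. g (hcomp S (\<Theta> t) n) ~= \<zero>}" if t: "t .: T" for t
   proof (rule finite_subset[OF _ S.hcomp_finite[OF cl[OF t]]], rule subsetI)
    fix n assume n: "n \<in> {n. g (hcomp S (\<Theta> t) n) ~= \<zero>}"
    have "hcomp S (\<Theta> t) n ~= \<zero>\<^bsub>S\<^esub>"
    proof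
     assume z: "hcomp S (\<Theta> t) n = \<zero>\<^bsub>S\<^esub>"
     have "g \<zero>\<^bsub>S\<^esub> = \<zero>" using g[of "\<zero>\<^bsub>S\<^esub>"] ze by (intro eqI) simp_all
     thus False using n z by simp
    qed
    thus "n \<in> {n. hcomp S (\<Theta> t) n ~= \<zero>\<^bsub>S\<^esub>}" by simp
   qed
   show "t = \<zero>" if t: "t .: T" and z: "!!n. g (hcomp S (\<Theta> t) n) = \<zero>" for t
   proof -
    have "hcomp S (\<Theta> t) n = \<zero>\<^bsub>S\<^esub>" for n using g(2)[OF h[OF t], of n] z[of n] ze by simp
    hence "\<Theta> t = \<zero>\<^bsub>S\<^esub>" using S.hcomp_sum[OF cl[OF t]] by simp
    thus ?thesis using t ze by (intro eqI) simp_all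
   qed
  qed (rule x)
 qed
 show ?thesis
 proof (intro comm_graded_algebra.intro graded T comm_graded_algebra_axioms.intro)
  fix r x y assume "r .: R" "x .: T" "y .: T"
  thus "(r \<odot> x) \<otimes> y = r \<odot> (x \<otimes> y)" "x \<otimes> (r \<odot> y) = r \<odot> (x \<otimes> y)"
   by (auto intro!: eqI simp: smult sm mu cl S.smult_mult_left S.smult_mult_right)
 next
  show "\<one> \<in> grade T 0" using gr_iff[OF T.one_closed, of 0] on S.one_grade by simp
 next
  fix x y i j assume x: "x \<in> grade T i" and y: "y \<in> grade T j"
  have c: "x .: T" "y .: T" using x y grade by auto
  have gx: "\<Theta> x \<in> grade S i" and gy: "\<Theta> y \<in> grade S j" using gr_iff c x y by auto
  show "x \<otimes> y \<in> grade T (i + j)"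
   using gr_iff[of "x \<otimes> y" "i + j"] S.mult_grade[OF gx gy] c mu by simp
  show "x \<otimes> y = ksgn T (i * j) (y \<otimes> x)"
   by (rule eqI) (use S.graded_comm[OF gx gy] c mu ks in simp_all)
 qed
qed

section \<open>Sorted words span the free graded commutative algebra\<close>

context tensor_model
begin

interpretation V: graded_module R V by (rule GM.V_graded_module)
interpretation U: comm_graded_algebra R "U X" by (rule U_comm_graded_algebra)
interpretation L: ring L unfolding L_eq by (rule LQ.Q_ring)

lemma L_smult_additive: "r .: R ==> additive_map L L (%x. r \<odot>\<^bsub>L\<^esub> x)"
 unfolding L_eq by (rule LQ.Q_smult_additive)

lemmas L_smult_add = additive_add[OF L_smult_additive]
lemmas L_smult_zero = additive_zero[OF L.ab L.ab L_smult_additive]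
lemma L_smult_smult:
 assumes "r .: R" "s .: R" "x .: L"
 shows "r \<odot>\<^bsub>L\<^esub> (s \<odot>\<^bsub>L\<^esub> x) = (r \<otimes>\<^bsub>R\<^esub> s) \<odot>\<^bsub>L\<^esub> x"
proof -
 obtain f where f: "x = LQ.proj f" "f .: W.F" using assms(3) unfolding L_eq LQ.Q_carrier by (rule imageE)
 have "r \<odot>\<^bsub>W.F\<^esub> (s \<odot>\<^bsub>W.F\<^esub> f) = (r \<otimes>\<^bsub>R\<^esub> s) \<odot>\<^bsub>W.F\<^esub> f"
  using assms f(2) by (simp add: W.F_simps(1,4) fin_funs_val R.m_assoc fun_eq_iff)
 thus ?thesis
  unfolding f(1) L_eq using assms f(2) by (simp add: LQ.smult_proj W.F_smult_closed)
qed

lemma L_smult_one: "x .: L ==> \<one>\<^bsub>R\<^esub> \<odot>\<^bsub>L\<^esub> x = x"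
proof -
 assume "x .: L"
 then obtain f where f: "x = LQ.proj f" "f .: W.F" unfolding L_eq LQ.Q_carrier by (rule imageE)
 have "\<one>\<^bsub>R\<^esub> \<odot>\<^bsub>W.F\<^esub> f = f"
  using f(2) by (simp add: W.F_simps(1,4) fin_funs_val fun_eq_iff)
 thus ?thesis unfolding f(1) L_eq using f(2) by (simp add: LQ.smult_proj)
qed

lemma L_double_zero:
 assumes x: "x .: L" and z: "x \<oplus>\<^bsub>L\<^esub> x = \<zero>\<^bsub>L\<^esub>"
 shows "x = \<zero>\<^bsub>L\<^esub>"
proof -
 let ?h = "inv\<^bsub>R\<^esub> (\<one>\<^bsub>R\<^esub> \<oplus>\<^bsub>R\<^esub> \<one>\<^bsub>R\<^esub>)"
 have h: "?h .: R" "?h \<otimes>\<^bsub>R\<^esub> (\<one>\<^bsub>R\<^esub> \<oplus>\<^bsub>R\<^esub> \<one>\<^bsub>R\<^esub>) = \<one>\<^bsub>R\<^esub>"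
  using half by (simp_all add: R.Units_inv_closed R.Units_l_inv)
 obtain f where f: "x = LQ.proj f" "f .: W.F" using x unfolding L_eq LQ.Q_carrier by (rule imageE)
 have val: "f m .: R" for m using f(2) by (simp add: W.F_simps(1) fin_funs_val)
 have "?h \<otimes>\<^bsub>R\<^esub> (f m \<oplus>\<^bsub>R\<^esub> f m) = f m" for m
 proof -
  have "f m \<oplus>\<^bsub>R\<^esub> f m = (\<one>\<^bsub>R\<^esub> \<oplus>\<^bsub>R\<^esub> \<one>\<^bsub>R\<^esub>) \<otimes>\<^bsub>R\<^esub> f m" using val by (simp add: R.l_distr)
  thus ?thesis using h val by (simp add: R.m_assoc[symmetric])
 qed
 hence "?h \<odot>\<^bsub>W.F\<^esub> (f \<oplus>\<^bsub>W.F\<^esub> f) = f" by (simp add: W.F_simps(3,4))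
 hence "x = ?h \<odot>\<^bsub>L\<^esub> (x \<oplus>\<^bsub>L\<^esub> x)"
  unfolding f(1) L_eq using h(1) f(2) by (simp add: LQ.smult_proj LQ.proj_add[symmetric])
 thus ?thesis using z L_smult_zero[OF h(1)] by simp
qed

definition e :: "nat => nat \<times> (nat => 'r)" where
 "e j = (dg j, fs_single R j \<one>\<^bsub>R\<^esub>)"

abbreviation E :: "nat list => ((nat \<times> (nat => 'r)) list => 'r) set" where
 "E l \<equiv> lword (map e l)"

lemma e_grade: "j \<in> X ==> fs_single R j \<one>\<^bsub>R\<^esub> \<in> grade V (dg j)"
 by (simp add: GM.V_simps R.fs_single_fin_funs)

lemma E_words: "set l \<subseteq> X ==> map e l .: words V"
 using e_grade by (auto simp: words_carrier e_def)

lemma E_closed[simp]: "set l \<subseteq> X ==> E l .: L"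
 using E_words lword_closed by blast

lemma E_Cons: "j \<in> X ==> set l \<subseteq> X ==> E (j # l) = E [j] \<otimes>\<^bsub>L\<^esub> E l"
 using lword_mult[OF E_words[of "[j]"] E_words[of l]] by simp

lemma E_swap:
 assumes "i \<in> X" "j \<in> X"
 shows "E [j] \<otimes>\<^bsub>L\<^esub> E [i] = ksgn L (dg j * dg i) (E [i] \<otimes>\<^bsub>L\<^esub> E [j])"
 using lword_comm[OF e_grade[OF assms(2)] e_grade[OF assms(1)]]
  lword_mult[OF E_words[of "[j]"] E_words[of "[i]"]] lword_mult[OF E_words[of "[i]"] E_words[of "[j]"]] assms
 by (simp add: e_def)

lemma E_square:
 assumes "j \<in> X" "odd (dg j)"
 shows "E [j] \<otimes>\<^bsub>L\<^esub> E [j] = \<zero>\<^bsub>L\<^esub>"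
proof -
 have c: "E [j] \<otimes>\<^bsub>L\<^esub> E [j] .: L" using E_closed[of "[j]"] assms(1) by simp
 have "E [j] \<otimes>\<^bsub>L\<^esub> E [j] = \<ominus>\<^bsub>L\<^esub> (E [j] \<otimes>\<^bsub>L\<^esub> E [j])"
  using E_swap[OF assms(1,1)] assms(2) by (simp add: ksgn_def)
 hence "E [j] \<otimes>\<^bsub>L\<^esub> E [j] \<oplus>\<^bsub>L\<^esub> E [j] \<otimes>\<^bsub>L\<^esub> E [j] = \<zero>\<^bsub>L\<^esub>" using L.r_neg[OF c] by simp
 thus ?thesis by (rule L_double_zero[OF c])
qed

text \<open>Move \<open>e\<^sub>j\<close> to its place by transpositions; if \<open>e\<^sub>j\<close> is odd and occurs already, it meets its own
 copy, and the product vanishes.\<close>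

lemma gen_times_sorted:
 assumes "sorted l" "set l \<subseteq> X" "j \<in> X"
 shows "\<exists>n. E [j] \<otimes>\<^bsub>L\<^esub> E l = (if odd (dg j) \<and> j \<in> set l then \<zero>\<^bsub>L\<^esub> else ksgn L n (E (insort j l)))"
 using assms(1,2)
proof (induction l)
 case Nil
 thus ?case using lword_mult[OF E_words[of "[j]"] E_words[of "[]"]] assms(3)
  by (intro exI[of _ 0]) (simp add: ksgn_def)
next
 case (Cons i l)
 have i: "i \<in> X" and l: "set l \<subseteq> X" "sorted l" using Cons.prems by auto
 have c: "E [j] .: L" "E [i] .: L" "E l .: L" "E (insort j l) .: L"
  using E_closed[of "[j]"] E_closed[of "[i]"] E_closed[of l] E_closed[of "insort j l"] i l assms(3)
  by (simp_all add: set_insort_key)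
 show ?case
 proof (cases "j \<le> i")
  case True
  show ?thesis
  proof (cases "odd (dg j) \<and> j \<in> set (i # l)")
   case clash: True
   have "j = i"
   proof (rule ccontr)
    assume "j ~= i"
    hence "j \<in> set l" "j < i" using clash True by auto
    thus False using Cons.prems(1) by force
   qed
   hence "E [j] \<otimes>\<^bsub>L\<^esub> E (i # l) = (E [j] \<otimes>\<^bsub>L\<^esub> E [j]) \<otimes>\<^bsub>L\<^esub> E l"
    using E_Cons[OF i l(1)] L.m_assoc[OF c(1) c(1) c(3)] by simp
   also have "\<dots> = \<zero>\<^bsub>L\<^esub>" using E_square[OF assms(3)] clash c(3) by simp
   finally show ?thesis using clash by simp
  next
   case False
   have "E [j] \<otimes>\<^bsub>L\<^esub> E (i # l) = E (insort j (i # l))"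
    using E_Cons[of j "i # l"] assms(3) Cons.prems(2) True by simp
   thus ?thesis unfolding if_not_P[OF False] by (intro exI[of _ 0]) (simp add: ksgn_def)
  qed
 next
  case False
  obtain n where n: "E [j] \<otimes>\<^bsub>L\<^esub> E l = (if odd (dg j) \<and> j \<in> set l then \<zero>\<^bsub>L\<^esub> else ksgn L n (E (insort j l)))"
   using Cons.IH[OF l(2,1)] by blast
  have ji: "j \<in> set (i # l) \<longleftrightarrow> j \<in> set l" using False by auto
  have "E [j] \<otimes>\<^bsub>L\<^esub> E (i # l) = (E [j] \<otimes>\<^bsub>L\<^esub> E [i]) \<otimes>\<^bsub>L\<^esub> E l"
   using E_Cons[OF i l(1)] L.m_assoc[OF c(1,2,3)] by simp
  also have "\<dots> = ksgn L (dg j * dg i) (E [i] \<otimes>\<^bsub>L\<^esub> (E [j] \<otimes>\<^bsub>L\<^esub> E l))"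
   unfolding E_swap[OF i assms(3)] using c by (simp add: L.ksgn_mult_left L.m_assoc)
  also have "\<dots> = (if odd (dg j) \<and> j \<in> set (i # l) then \<zero>\<^bsub>L\<^esub> else ksgn L (dg j * dg i + n) (E (insort j (i # l))))"
  proof (cases "odd (dg j) \<and> j \<in> set l")
   case True
   thus ?thesis unfolding n ji using c by simp
  next
   case nc: False
   have h: "E (insort j (i # l)) = E [i] \<otimes>\<^bsub>L\<^esub> E (insort j l)"
    using False E_Cons[of i "insort j l"] i l assms(3) by (simp add: set_insort_key)
   show ?thesis unfolding n ji if_not_P[OF nc] h using c by (simp add: L.ksgn_mult_right L.ksgn_ksgn)
  qed
  finally show ?thesis by blast
 qed
qed

text \<open>The degree \<open>q\<close> part of the span of the sorted words without repeated odd letters.\<close>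

inductive Lsp :: "nat => ((nat \<times> (nat => 'r)) list => 'r) set => bool" where
 Lsp_zero: "Lsp q \<zero>\<^bsub>L\<^esub>"
| Lsp_step: "\<lbrakk>r .: R; m \<in> monomials dg X; mdeg dg m = q; Lsp q x\<rbrakk> \<Longrightarrow>
  Lsp q (r \<odot>\<^bsub>L\<^esub> E (sorted_list_of_multiset m) \<oplus>\<^bsub>L\<^esub> x)"

abbreviation Em where "Em m \<equiv> E (sorted_list_of_multiset m)"

lemma Em_closed[simp]: "m \<in> monomials dg X ==> Em m .: L"
 by (rule E_closed) (simp add: monomials_def)

lemma Em_grade:
 assumes "m \<in> monomials dg X"
 shows "Em m \<in> grade L (mdeg dg m)"
proof -
 have "sum_list (map fst (map e (sorted_list_of_multiset m))) = sum_mset (image_mset dg (mset (sorted_list_of_multiset m)))"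
  unfolding mset_map[symmetric] sum_mset_sum_list by (simp add: e_def comp_def)
 hence "sum_list (map fst (map e (sorted_list_of_multiset m))) = mdeg dg m"
  by (simp add: mdeg_def)
 thus ?thesis using lword_grade[OF E_words[of "sorted_list_of_multiset m"]] assms by (simp add: monomials_def)
qed

lemma Lsp_grade: "Lsp q x ==> x \<in> grade L q"
 by (induction rule: Lsp.induct) (auto intro: L_grade_zero L_grade_add L_grade_smult Em_grade)

lemma Lsp_closed: "Lsp q x ==> x .: L"
 using Lsp_grade L_grade_carrier by blast

lemma Lsp_add: "Lsp q x ==> Lsp q y ==> Lsp q (x \<oplus>\<^bsub>L\<^esub> y)"
proof (induction rule: Lsp.induct)
 case (Lsp_zero q)
 thus ?case using Lsp_closed by simp
next
 case (Lsp_step r m q x)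
 thus ?case using Lsp.Lsp_step[of r m q "x \<oplus>\<^bsub>L\<^esub> y"] Lsp_closed L_smult_closed by (simp add: L.a_assoc)
qed

lemma Lsp_smult: "Lsp q x ==> s .: R ==> Lsp q (s \<odot>\<^bsub>L\<^esub> x)"
proof (induction rule: Lsp.induct)
 case (Lsp_zero q)
 thus ?case using L_smult_zero Lsp.Lsp_zero by simp
next
 case (Lsp_step r m q x)
 thus ?case using Lsp.Lsp_step[of "s \<otimes>\<^bsub>R\<^esub> r" m q "s \<odot>\<^bsub>L\<^esub> x"] Lsp_closed L_smult_closed
  by (simp add: L_smult_add L_smult_smult)
qed

lemma Lsp_ksgn: "Lsp q x ==> Lsp q (ksgn L n x)"
proof (cases "even n")
 case False
 assume x: "Lsp q x"
 have xc: "x .: L" using Lsp_closed x by blast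
 have "\<ominus>\<^bsub>L\<^esub> x = (\<ominus>\<^bsub>R\<^esub> \<one>\<^bsub>R\<^esub>) \<odot>\<^bsub>L\<^esub> x"
 proof (rule L.minus_equality)
  obtain f where f: "x = LQ.proj f" "f .: W.F" using xc unfolding L_eq LQ.Q_carrier by (rule imageE)
  have "(\<ominus>\<^bsub>R\<^esub> \<one>\<^bsub>R\<^esub>) \<odot>\<^bsub>W.F\<^esub> f \<oplus>\<^bsub>W.F\<^esub> f = \<zero>\<^bsub>W.F\<^esub>"
   using f(2) by (simp add: W.F_simps(1,2,3,4) fin_funs_val R.l_minus R.l_neg)
  thus "(\<ominus>\<^bsub>R\<^esub> \<one>\<^bsub>R\<^esub>) \<odot>\<^bsub>L\<^esub> x \<oplus>\<^bsub>L\<^esub> x = \<zero>\<^bsub>L\<^esub>"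
   unfolding f(1) L_eq LQ.smult_proj[OF R.a_inv_closed[OF R.one_closed] f(2)]
   using LQ.proj_add[OF W.F_smult_closed[OF R.a_inv_closed[OF R.one_closed] f(2)] f(2)] LQ.proj_zero by simp
 qed (use xc L_smult_closed in simp_all)
 thus ?thesis using Lsp_smult[OF x, of "\<ominus>\<^bsub>R\<^esub> \<one>\<^bsub>R\<^esub>"] False by (simp add: ksgn_def)
qed (simp add: ksgn_def)

lemma Lsp_monomial: "m \<in> monomials dg X ==> Lsp (mdeg dg m) (Em m)"
 using Lsp_step[OF R.one_closed, of m "mdeg dg m" "\<zero>\<^bsub>L\<^esub>"] Lsp_zero by (simp add: L_smult_one)

lemma Lsp_gen_monomial:
 assumes "j \<in> X" and m: "m \<in> monomials dg X"
 shows "Lsp (dg j + mdeg dg m) (E [j] \<otimes>\<^bsub>L\<^esub> Em m)"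
proof -
 have "\<exists>n. E [j] \<otimes>\<^bsub>L\<^esub> Em m = (if odd (dg j) \<and> j \<in># m then \<zero>\<^bsub>L\<^esub> else ksgn L n (Em (add_mset j m)))"
  using gen_times_sorted[OF _ _ assms(1), of "sorted_list_of_multiset m"] m
  unfolding sorted_list_of_multiset_insert by (simp add: monomials_def split del: if_split)
 then obtain n where n: "E [j] \<otimes>\<^bsub>L\<^esub> Em m = (if odd (dg j) \<and> j \<in># m then \<zero>\<^bsub>L\<^esub> else ksgn L n (Em (add_mset j m)))" ..
 show ?thesis
 proof (cases "odd (dg j) \<and> j \<in># m")
  case True
  show ?thesis unfolding n if_P[OF True] by (rule Lsp_zero)
 next
  case False
  have "\<not> odd_clash dg (add_mset j m)"
  proof
   assume "odd_clash dg (add_mset j m)"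
   then obtain i where i: "odd (dg i)" "2 \<le> count (add_mset j m) i" by (auto simp: odd_clash_def)
   show False
   proof (cases "i = j")
    case True
    hence "1 \<le> count m j" using i(2) by simp
    hence "j \<in># m" by (simp add: count_greater_eq_one_iff)
    thus False using False i(1) True by simp
   next
    case False
    thus False using i m by (auto simp: monomials_def odd_clash_def)
   qed
  qed
  hence "add_mset j m \<in> monomials dg X" using assms by (simp add: monomials_def)
  hence "Lsp (dg j + mdeg dg m) (ksgn L n (Em (add_mset j m)))"
   using Lsp_ksgn[OF Lsp_monomial, of "add_mset j m" n] by simp
  thus ?thesis unfolding n if_not_P[OF False] .
 qed
qed

lemma Lsp_gen:
 assumes "Lsp q x" "j \<in> X"
 shows "Lsp (dg j + q) (E [j] \<otimes>\<^bsub>L\<^esub> x)"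
 using assms(1)
proof (induction rule: Lsp.induct)
 case (Lsp_zero q)
 thus ?case using E_closed[of "[j]"] assms(2) Lsp.Lsp_zero by simp
next
 case (Lsp_step r m q x)
 have c: "E [j] .: L" "Em m .: L" "x .: L"
  using E_closed[of "[j]"] assms(2) Lsp_step Lsp_closed by auto
 have "Lsp (dg j + q) (r \<odot>\<^bsub>L\<^esub> (E [j] \<otimes>\<^bsub>L\<^esub> Em m) \<oplus>\<^bsub>L\<^esub> E [j] \<otimes>\<^bsub>L\<^esub> x)"
  using Lsp_add[OF Lsp_smult[OF Lsp_gen_monomial[OF assms(2) Lsp_step(2)] Lsp_step(1)]] Lsp_step by simp
 thus ?case using c Lsp_step(1) L_smult_closed by (simp add: L.r_distr L_mult_smult)
qed

lemma lword_zero_letter: "lword [(n, \<zero>\<^bsub>V\<^esub>)] = \<zero>\<^bsub>L\<^esub>"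
proof -
 have c: "lword [(n, \<zero>\<^bsub>V\<^esub>)] .: L" by (rule lword_closed) (simp add: words_carrier V.grade_zero)
 have "lword [(n, \<zero>\<^bsub>V\<^esub>)] = lword [(n, \<zero>\<^bsub>V\<^esub>)] \<oplus>\<^bsub>L\<^esub> lword [(n, \<zero>\<^bsub>V\<^esub>)]"
  using lword_add[OF V.grade_zero V.grade_zero, of n] by simp
 thus ?thesis using c by simp
qed

lemma Lsp_letter:
 assumes "v \<in> grade V n" "Lsp q x"
 shows "Lsp (n + q) (lword [(n, v)] \<otimes>\<^bsub>L\<^esub> x)"
 using assms(1)
proof (induction v rule: V_grade_induct)
 case zero
 thus ?case using lword_zero_letter Lsp_closed[OF assms(2)] Lsp_zero by simp
next
 case (add f g)
 have "lword [(n, f)] .: L" "lword [(n, g)] .: L"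
  using add lword_closed by (auto simp: words_carrier)
 thus ?case using Lsp_add[OF add(3,4)] Lsp_closed[OF assms(2)] lword_add[OF add(1,2)] by (simp add: L.l_distr)
next
 case (single j a)
 have "a \<odot>\<^bsub>V\<^esub> fs_single R j \<one>\<^bsub>R\<^esub> = fs_single R j a"
  using single(3) by (auto simp: GM.V_simps fs_single_def)
 hence "lword [(n, fs_single R j a)] = a \<odot>\<^bsub>L\<^esub> E [j]"
  using lword_smult[OF e_grade[OF single(1)] single(3)] single(2) by (simp add: e_def)
 thus ?case
  using Lsp_smult[OF Lsp_gen[OF assms(2) single(1)] single(3)] single E_closed[of "[j]"] Lsp_closed[OF assms(2)]
  by (simp add: L_smult_mult)
qed

lemma Lsp_word: "w .: words V ==> Lsp (sum_list (map fst w)) (lword w)"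
proof (induction w)
 case Nil
 have "{#} \<in> monomials dg X" by (simp add: monomials_def odd_clash_def)
 thus ?case using Lsp_monomial[of "{#}"] by simp
next
 case (Cons l w)
 obtain n v where l: "l = (n, v)" by (cases l)
 have w: "w .: words V" and v: "v \<in> grade V n" "[(n, v)] .: words V"
  using Cons.prems by (simp_all add: l words_carrier)
 thus ?case using Lsp_letter[OF v(1) Cons.IH[OF w]] lword_mult[OF v(2) w] by (simp add: l)
qed

lemma Lsp_all:
 assumes "x \<in> grade L q"
 shows "Lsp q x"
proof -
 obtain f where f: "x = LQ.proj f" "f \<in> grade W.F q" using assms unfolding L_grade by (rule imageE)
 have "Lsp q (LQ.proj f)" using f(2)
 proof (induction f rule: W.F_grade_induct)
  case zero
  thus ?case using LQ.proj_zero Lsp_zero L_eq by simp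
 next
  case (add f g)
  thus ?case using LQ.proj_add[OF W.F_grade_carrier W.F_grade_carrier] Lsp_add[folded L_eq] L_eq by metis
 next
  case (single w a)
  have "LQ.proj (fs_single R w a) = a \<odot>\<^bsub>L\<^esub> lword w"
   unfolding lword_def L_eq LQ.smult_proj[OF single(3) word_closed[OF single(1)]]
   using single(3) by (simp add: W.F_smult_single)
  thus ?case using Lsp_smult[OF Lsp_word[OF single(1)] single(3)] single(2) by simp
 qed
 thus ?thesis using f(1) by simp
qed

end

section \<open>The tensor product is the model\<close>

context tensor_model
begin

interpretation V: graded_module R V by (rule GM.V_graded_module)
interpretation U: comm_graded_algebra R "U X" by (rule U_comm_graded_algebra)
interpretation L: ring L unfolding L_eq by (rule LQ.Q_ring)

lemma pure_pairs_monoid: "monoid (pure_pairs A L)"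
proof (rule monoidI)
 fix u v assume "u .: pure_pairs A L" "v .: pure_pairs A L"
 thus "u \<otimes>\<^bsub>pure_pairs A L\<^esub> v .: pure_pairs A L"
  using mult_grade L_grade_mult by (auto simp: pure_pairs_def)
next
 show "\<one>\<^bsub>pure_pairs A L\<^esub> .: pure_pairs A L"
  using one_grade L_one_grade by (simp add: pure_pairs_def)
next
 fix u v w assume "u .: pure_pairs A L" "v .: pure_pairs A L" "w .: pure_pairs A L"
 thus "u \<otimes>\<^bsub>pure_pairs A L\<^esub> v \<otimes>\<^bsub>pure_pairs A L\<^esub> w = u \<otimes>\<^bsub>pure_pairs A L\<^esub> (v \<otimes>\<^bsub>pure_pairs A L\<^esub> w)"
  using grade_carrier L_grade_carrier by (auto simp: pure_pairs_def A.m_assoc L.m_assoc)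
next
 fix u assume "u .: pure_pairs A L"
 thus "\<one>\<^bsub>pure_pairs A L\<^esub> \<otimes>\<^bsub>pure_pairs A L\<^esub> u = u" "u \<otimes>\<^bsub>pure_pairs A L\<^esub> \<one>\<^bsub>pure_pairs A L\<^esub> = u"
  using grade_carrier L_grade_carrier by (auto simp: pure_pairs_def)
qed

sublocale P: monoid_algebra R "pure_pairs A L" "%(p, a, q, x). p + q" "%(p, a, q, x) (p', b, q', y). q * p'"
proof -
 interpret M: monoid "pure_pairs A L" by (rule pure_pairs_monoid)
 show "monoid_algebra R (pure_pairs A L) (%(p, a, q, x). p + q) (%(p, a, q, x) (p', b, q', y). q * p')"
  by unfold_locales (auto simp: pure_pairs_def algebra_simps)
qed

abbreviation sym where "sym p a q x \<equiv> fs_single R (p, a, q, x) \<one>\<^bsub>R\<^esub>"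

lemma pair_alg_eq: "pair_alg R A L = P.F"
 by (simp add: pair_alg_def)

lemma pairs_carrier: "(p, a, q, x) .: pure_pairs A L \<longleftrightarrow> a \<in> grade A p \<and> x \<in> grade L q"
 by (simp add: pure_pairs_def)

lemma sym_closed: "a \<in> grade A p ==> x \<in> grade L q ==> sym p a q x .: P.F"
 by (rule P.F_single_closed) (simp_all add: pairs_carrier)

lemma bilinear_rels_carrier: "bilinear_rels R A L \<subseteq> carrier P.F"
proof
 interpret F: ring P.F by (rule P.F_ring)
 fix s assume "s \<in> bilinear_rels R A L"
 thus "s .: P.F"
  unfolding bilinear_rels_def Let_def pair_alg_eq P.single_eq
  by (elim UnE CollectE exE conjE)
   (simp_all add: grade_add grade_smult L_grade_add L_grade_smult sym_closed P.F_smult_closed)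
qed

sublocale TQ: graded_quotient R P.F "bilinear_rels R A L"
proof -
 interpret F: ring P.F by (rule P.F_ring)
 show "graded_quotient R P.F (bilinear_rels R A L)"
 proof unfold_locales
  show "bilinear_rels R A L \<subseteq> carrier P.F" by (rule bilinear_rels_carrier)
 qed (assumption | rule P.F_smult_closed P.F_smult_as_mult subsetI P.F_grade_carrier)+
qed

lemma T_eq: "T = TQ.Q"
 by (simp add: tensor_alg_def pair_alg_eq)

interpretation T: ring T unfolding T_eq by (rule TQ.Q_ring)

abbreviation pt where "pt \<equiv> pure_tensor R A L"

lemma pt_eq: "pt p a q x = TQ.proj (sym p a q x)"
 by (simp add: pure_tensor_def pair_alg_eq P.single_eq TQ.proj_def)

lemma pt_closed: "a \<in> grade A p ==> x \<in> grade L q ==> pt p a q x .: T"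
 unfolding pt_eq T_eq by (rule TQ.proj_closed[OF sym_closed])

lemma pt_grade: "a \<in> grade A p ==> x \<in> grade L q ==> pt p a q x \<in> grade T (p + q)"
 unfolding pt_eq T_eq TQ.Q_grade
 using P.F_single_grade[of "(p, a, q, x)" "\<one>\<^bsub>R\<^esub>"] by (simp add: pairs_carrier)

lemma T_smult_closed: "r .: R ==> t .: T ==> r \<odot>\<^bsub>T\<^esub> t .: T"
 unfolding T_eq by (rule TQ.Q_smult_closed)

lemma T_grade: "grade T n = TQ.proj ` grade P.F n"
 unfolding T_eq by (rule TQ.Q_grade)

lemma T_carrier: "carrier T = TQ.proj ` carrier P.F"
 unfolding T_eq by (rule TQ.Q_carrier)

lemma T_grade_carrier: "t \<in> grade T n ==> t .: T"
 unfolding T_grade T_carrier using P.F_grade_carrier by blast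

lemma T_grade_add: "t \<in> grade T n ==> t' \<in> grade T n ==> t \<oplus>\<^bsub>T\<^esub> t' \<in> grade T n"
 unfolding T_eq TQ.Q_grade
 by (elim imageE) (simp add: TQ.proj_add[symmetric] P.F_grade_carrier P.F_grade_add)

lemma T_grade_zero: "\<zero>\<^bsub>T\<^esub> \<in> grade T n"
 unfolding T_eq TQ.Q_grade by (rule image_eqI[where f = TQ.proj, OF TQ.proj_zero[symmetric] P.F_grade_zero])

lemma pt_add_left:
 assumes "a \<in> grade A p" "b \<in> grade A p" "x \<in> grade L q"
 shows "pt p (a \<oplus> b) q x = pt p a q x \<oplus>\<^bsub>T\<^esub> pt p b q x"
proof -
 have c: "sym p a q x .: P.F" "sym p b q x .: P.F" "sym p (a \<oplus> b) q x .: P.F"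
  using assms by (simp_all add: sym_closed grade_add)
 have "sym p (a \<oplus> b) q x \<ominus>\<^bsub>P.F\<^esub> (sym p a q x \<oplus>\<^bsub>P.F\<^esub> sym p b q x) \<in> bilinear_rels R A L"
  unfolding bilinear_rels_def Let_def pair_alg_eq P.single_eq
  by (rule UnI1, rule UnI1, rule UnI1, rule CollectI, intro exI conjI, rule refl) (rule assms)+
 hence "TQ.proj (sym p (a \<oplus> b) q x) = TQ.proj (sym p a q x \<oplus>\<^bsub>P.F\<^esub> sym p b q x)"
  by (rule TQ.proj_rel[rotated 2]) (use c in simp_all)
 thus ?thesis unfolding pt_eq T_eq using TQ.proj_add[OF c(1,2)] by simp
qed

lemma pt_add_right:
 assumes "a \<in> grade A p" "x \<in> grade L q" "y \<in> grade L q"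
 shows "pt p a q (x \<oplus>\<^bsub>L\<^esub> y) = pt p a q x \<oplus>\<^bsub>T\<^esub> pt p a q y"
proof -
 have c: "sym p a q x .: P.F" "sym p a q y .: P.F" "sym p a q (x \<oplus>\<^bsub>L\<^esub> y) .: P.F"
  using assms by (simp_all add: sym_closed L_grade_add)
 have "sym p a q (x \<oplus>\<^bsub>L\<^esub> y) \<ominus>\<^bsub>P.F\<^esub> (sym p a q x \<oplus>\<^bsub>P.F\<^esub> sym p a q y) \<in> bilinear_rels R A L"
  unfolding bilinear_rels_def Let_def pair_alg_eq P.single_eq
  by (rule UnI1, rule UnI1, rule UnI2, rule CollectI, intro exI conjI, rule refl) (rule assms)+
 hence "TQ.proj (sym p a q (x \<oplus>\<^bsub>L\<^esub> y)) = TQ.proj (sym p a q x \<oplus>\<^bsub>P.F\<^esub> sym p a q y)"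
  by (rule TQ.proj_rel[rotated 2]) (use c in simp_all)
 thus ?thesis unfolding pt_eq T_eq using TQ.proj_add[OF c(1,2)] by simp
qed

lemma pt_smult_left:
 assumes "r .: R" "a \<in> grade A p" "x \<in> grade L q"
 shows "pt p (r \<odot> a) q x = r \<odot>\<^bsub>T\<^esub> pt p a q x"
proof -
 have c: "sym p a q x .: P.F" "sym p (r \<odot> a) q x .: P.F"
  using assms by (simp_all add: sym_closed grade_smult)
 have "sym p (r \<odot> a) q x \<ominus>\<^bsub>P.F\<^esub> (r \<odot>\<^bsub>P.F\<^esub> sym p a q x) \<in> bilinear_rels R A L"
  unfolding bilinear_rels_def Let_def pair_alg_eq P.single_eq
  by (rule UnI1, rule UnI2, rule CollectI, intro exI conjI, rule refl) (rule assms)+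
 hence "TQ.proj (sym p (r \<odot> a) q x) = TQ.proj (r \<odot>\<^bsub>P.F\<^esub> sym p a q x)"
  by (rule TQ.proj_rel[rotated 2]) (use c P.F_smult_closed assms(1) in simp_all)
 thus ?thesis unfolding pt_eq T_eq using TQ.smult_proj[OF assms(1) c(1)] by simp
qed

lemma pt_smult_right:
 assumes "r .: R" "a \<in> grade A p" "x \<in> grade L q"
 shows "pt p a q (r \<odot>\<^bsub>L\<^esub> x) = r \<odot>\<^bsub>T\<^esub> pt p a q x"
proof -
 have c: "sym p a q x .: P.F" "sym p a q (r \<odot>\<^bsub>L\<^esub> x) .: P.F"
  using assms by (simp_all add: sym_closed L_grade_smult)
 have "sym p a q (r \<odot>\<^bsub>L\<^esub> x) \<ominus>\<^bsub>P.F\<^esub> (r \<odot>\<^bsub>P.F\<^esub> sym p a q x) \<in> bilinear_rels R A L"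
  unfolding bilinear_rels_def Let_def pair_alg_eq P.single_eq
  by (rule UnI2, rule CollectI, intro exI conjI, rule refl) (rule assms)+
 hence "TQ.proj (sym p a q (r \<odot>\<^bsub>L\<^esub> x)) = TQ.proj (r \<odot>\<^bsub>P.F\<^esub> sym p a q x)"
  by (rule TQ.proj_rel[rotated 2]) (use c P.F_smult_closed assms(1) in simp_all)
 thus ?thesis unfolding pt_eq T_eq using TQ.smult_proj[OF assms(1) c(1)] by simp
qed

lemma pt_zero_right: "a \<in> grade A p ==> pt p a q \<zero>\<^bsub>L\<^esub> = \<zero>\<^bsub>T\<^esub>"
 using pt_add_right[OF _ L_grade_zero L_grade_zero, of a p q] pt_closed[OF _ L_grade_zero, of a p q]
 by simp

text \<open>The sign of the product disappears when the left factor is \<open>a \<otimes> 1\<close>.\<close>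

lemma pt_mult:
 assumes "a \<in> grade A p" "x \<in> grade L q"
 shows "pt p a 0 \<one>\<^bsub>L\<^esub> \<otimes>\<^bsub>T\<^esub> pt 0 \<one> q x = pt p a q x"
proof -
 have c: "sym p a 0 \<one>\<^bsub>L\<^esub> .: P.F" "sym 0 \<one> q x .: P.F"
  using assms one_grade L_one_grade by (simp_all add: sym_closed)
 have "sym p a 0 \<one>\<^bsub>L\<^esub> \<otimes>\<^bsub>P.F\<^esub> sym 0 \<one> q x = sym p a q x"
  using assms one_grade L_one_grade grade_carrier[OF assms(1)] L_grade_carrier[OF assms(2)]
   P.F_single_mult[of "(p, a, 0, \<one>\<^bsub>L\<^esub>)" "(0, \<one>, q, x)" "\<one>\<^bsub>R\<^esub>" "\<one>\<^bsub>R\<^esub>"]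
  by (simp add: pairs_carrier ksgn_def) (simp add: pure_pairs_def)
 thus ?thesis unfolding pt_eq T_eq using TQ.proj_mult[OF c] by simp
qed

subsection \<open>The map to the model\<close>

lemma incl_grade: "a \<in> grade A p ==> incl a \<in> grade (U X) p"
 using U_single_grade[of "{#}" X a p] by (simp add: incl_def monomials_def odd_clash_def)

lemma incl_one: "incl \<one> = \<one>\<^bsub>U X\<^esub>"
 by (simp add: incl_def U_simps(5))

lemma incl_smult: "r .: R ==> incl (r \<odot> a) = r \<odot>\<^bsub>U X\<^esub> incl a"
 by (simp add: incl_def U_smult_single)

definition pair_val :: "nat \<times> 'a \<times> nat \<times> ((nat \<times> (nat => 'r)) list => 'r) set => nat multiset => 'a" where
 "pair_val = (%(p, a, q, x). incl a \<otimes>\<^bsub>U X\<^esub> Lval x)"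

lemma Lval_one: "Lval \<one>\<^bsub>L\<^esub> = \<one>\<^bsub>U X\<^esub>"
 using ring_hom_one[OF Lval_hom] .

lemma Lval_add: "x .: L ==> y .: L ==> Lval (x \<oplus>\<^bsub>L\<^esub> y) = Lval x \<oplus>\<^bsub>U X\<^esub> Lval y"
 using ring_hom_add[OF Lval_hom] .

lemma pair_val_grade: "u .: pure_pairs A L ==> pair_val u \<in> grade (U X) ((%(p, a, q, x). p + q) u)"
 unfolding pair_val_def pure_pairs_def using U.mult_grade[OF incl_grade Lval_grade] by auto

lemma pair_val_one: "pair_val \<one>\<^bsub>pure_pairs A L\<^esub> = \<one>\<^bsub>U X\<^esub>"
 by (simp add: pair_val_def pure_pairs_def incl_one Lval_one)

lemma pair_val_mult:
 assumes "u .: pure_pairs A L" "v .: pure_pairs A L"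
 shows "pair_val u \<otimes>\<^bsub>U X\<^esub> pair_val v =
  ksgn (U X) ((%(p, a, q, x) (p', b, q', y). q * p') u v) (pair_val (u \<otimes>\<^bsub>pure_pairs A L\<^esub> v))"
proof -
 obtain p a q x where u: "u = (p, a, q, x)" by (cases u)
 obtain p' b q' y where v: "v = (p', b, q', y)" by (cases v)
 have g: "a \<in> grade A p" "x \<in> grade L q" "b \<in> grade A p'" "y \<in> grade L q'"
  using assms unfolding u v pairs_carrier by auto
 have c: "a .: A" "b .: A" "x .: L" "y .: L"
  using g grade_carrier L_grade_carrier by auto
 have c': "incl a .: U X" "incl b .: U X" "Lval x .: U X" "Lval y .: U X"
  using c incl_U Lval_closed by auto
 have "(incl a \<otimes>\<^bsub>U X\<^esub> Lval x) \<otimes>\<^bsub>U X\<^esub> (incl b \<otimes>\<^bsub>U X\<^esub> Lval y) =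
   incl a \<otimes>\<^bsub>U X\<^esub> ((Lval x \<otimes>\<^bsub>U X\<^esub> incl b) \<otimes>\<^bsub>U X\<^esub> Lval y)"
  using c' by (simp add: U.A.m_assoc)
 also have "\<dots> = ksgn (U X) (q * p') (incl a \<otimes>\<^bsub>U X\<^esub> ((incl b \<otimes>\<^bsub>U X\<^esub> Lval x) \<otimes>\<^bsub>U X\<^esub> Lval y))"
  unfolding U.graded_comm[OF Lval_grade[OF g(2)] incl_grade[OF g(3)]]
  using c' by (simp add: U.A.ksgn_mult_left U.A.ksgn_mult_right)
 also have "incl a \<otimes>\<^bsub>U X\<^esub> ((incl b \<otimes>\<^bsub>U X\<^esub> Lval x) \<otimes>\<^bsub>U X\<^esub> Lval y) =
   incl (a \<otimes> b) \<otimes>\<^bsub>U X\<^esub> Lval (x \<otimes>\<^bsub>L\<^esub> y)"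
 proof -
  have m: "Lval (x \<otimes>\<^bsub>L\<^esub> y) = Lval x \<otimes>\<^bsub>U X\<^esub> Lval y" by (rule ring_hom_mult[OF Lval_hom c(3,4)])
  show ?thesis unfolding incl_mult[OF c(1,2), of X, symmetric] m using c' by (simp add: U.A.m_assoc)
 qed
 finally show ?thesis by (simp add: u v pair_val_def pure_pairs_def)
qed

abbreviation pairs_map where "pairs_map \<equiv> P.alg_ext (U X) pair_val"

lemma pairs_map_hom: "pairs_map \<in> ring_hom P.F (U X)"
 and pairs_map_additive: "additive_map P.F (U X) pairs_map"
 and pairs_map_smult: "r .: R ==> f .: P.F ==> pairs_map (r \<odot>\<^bsub>P.F\<^esub> f) = r \<odot>\<^bsub>U X\<^esub> pairs_map f"
 by (rule P.alg_ext_hom[OF U_comm_graded_algebra pair_val_grade pair_val_one pair_val_mult]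
   P.alg_ext_additive[OF U_comm_graded_algebra pair_val_grade pair_val_one pair_val_mult]
   P.alg_ext_smult[OF U_comm_graded_algebra pair_val_grade pair_val_one pair_val_mult]; assumption)+

lemma pairs_map_sym:
 "a \<in> grade A p ==> x \<in> grade L q ==> pairs_map (sym p a q x) = incl a \<otimes>\<^bsub>U X\<^esub> Lval x"
 using P.alg_ext_single[OF U_comm_graded_algebra pair_val_grade pair_val_one pair_val_mult, of "(p, a, q, x)" "\<one>\<^bsub>R\<^esub>"]
  U.A.m_closed[OF incl_U[OF grade_carrier] Lval_closed[OF L_grade_carrier], of a p x q]
 by (simp add: pairs_carrier pair_val_def)

lemma pairs_map_diff: "x .: P.F ==> y .: P.F ==> pairs_map x = pairs_map y ==>
 pairs_map (x \<ominus>\<^bsub>P.F\<^esub> y) = \<zero>\<^bsub>U X\<^esub>"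
 using additive_diff[OF TQ.G.ab U.M.ab pairs_map_additive, of x y]
  additive_closed[OF pairs_map_additive, of y] by (simp add: a_minus_def U.M.r_neg)

lemma pairs_map_rels:
 assumes "s \<in> bilinear_rels R A L"
 shows "pairs_map s = \<zero>\<^bsub>U X\<^esub>"
proof -
 have cl: "incl a .: U X" "Lval x .: U X" "a .: A" "x .: L"
  if "a \<in> grade A p" "x \<in> grade L q" for a p x q
  using that grade_carrier L_grade_carrier incl_U Lval_closed by auto
 have 1: "pairs_map (sym p (a \<oplus> b) q x \<ominus>\<^bsub>P.F\<^esub> (sym p a q x \<oplus>\<^bsub>P.F\<^esub> sym p b q x)) = \<zero>\<^bsub>U X\<^esub>"
  if h: "a \<in> grade A p" "b \<in> grade A p" "x \<in> grade L q" for p a b q x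
 proof (rule pairs_map_diff)
  show "pairs_map (sym p (a \<oplus> b) q x) = pairs_map (sym p a q x \<oplus>\<^bsub>P.F\<^esub> sym p b q x)"
   using h cl[OF h(1,3)] cl[OF h(2,3)] incl_simps(2)[of a b X]
   by (simp add: pairs_map_sym grade_add additive_add[OF pairs_map_additive] sym_closed U.A.l_distr[symmetric])
 qed (use h in \<open>simp_all add: sym_closed grade_add\<close>)
 have 2: "pairs_map (sym p a q (x \<oplus>\<^bsub>L\<^esub> y) \<ominus>\<^bsub>P.F\<^esub> (sym p a q x \<oplus>\<^bsub>P.F\<^esub> sym p a q y)) = \<zero>\<^bsub>U X\<^esub>"
  if h: "a \<in> grade A p" "x \<in> grade L q" "y \<in> grade L q" for p a q x y
 proof (rule pairs_map_diff)
  show "pairs_map (sym p a q (x \<oplus>\<^bsub>L\<^esub> y)) = pairs_map (sym p a q x \<oplus>\<^bsub>P.F\<^esub> sym p a q y)"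
   using h cl[OF h(1,2)] cl[OF h(1,3)]
   by (simp add: pairs_map_sym L_grade_add additive_add[OF pairs_map_additive] sym_closed Lval_add U.A.r_distr)
 qed (use h in \<open>simp_all add: sym_closed L_grade_add\<close>)
 have 3: "pairs_map (sym p (r \<odot> a) q x \<ominus>\<^bsub>P.F\<^esub> (r \<odot>\<^bsub>P.F\<^esub> sym p a q x)) = \<zero>\<^bsub>U X\<^esub>"
  if h: "r .: R" "a \<in> grade A p" "x \<in> grade L q" for p r a q x
 proof (rule pairs_map_diff)
  show "pairs_map (sym p (r \<odot> a) q x) = pairs_map (r \<odot>\<^bsub>P.F\<^esub> sym p a q x)"
   using h cl[OF h(2,3)]
   by (simp add: pairs_map_sym grade_smult pairs_map_smult sym_closed incl_smult U.smult_mult_left)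
 qed (use h in \<open>simp_all add: sym_closed grade_smult P.F_smult_closed\<close>)
 have 4: "pairs_map (sym p a q (r \<odot>\<^bsub>L\<^esub> x) \<ominus>\<^bsub>P.F\<^esub> (r \<odot>\<^bsub>P.F\<^esub> sym p a q x)) = \<zero>\<^bsub>U X\<^esub>"
  if h: "r .: R" "a \<in> grade A p" "x \<in> grade L q" for p r a q x
 proof (rule pairs_map_diff)
  show "pairs_map (sym p a q (r \<odot>\<^bsub>L\<^esub> x)) = pairs_map (r \<odot>\<^bsub>P.F\<^esub> sym p a q x)"
   using h cl[OF h(2,3)]
   by (simp add: pairs_map_sym L_grade_smult pairs_map_smult sym_closed Lval_smult U.smult_mult_right)
 qed (use h in \<open>simp_all add: sym_closed L_grade_smult P.F_smult_closed\<close>)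
 show ?thesis
  using assms unfolding bilinear_rels_def Let_def pair_alg_eq P.single_eq
  by (elim UnE CollectE exE conjE) (simp_all only: 1 2 3 4)
qed

definition to_model where "to_model = TQ.quot_map pairs_map"

lemma to_model_proj: "f .: P.F ==> to_model (TQ.proj f) = pairs_map f"
 unfolding to_model_def by (rule TQ.quot_map_proj[OF U_ring[of X] pairs_map_hom pairs_map_rels])

lemma to_model_hom: "to_model \<in> ring_hom T (U X)"
 unfolding to_model_def T_eq by (rule TQ.quot_map_hom[OF U_ring[of X] pairs_map_hom pairs_map_rels])

lemma to_model_pt: "a \<in> grade A p ==> x \<in> grade L q ==> to_model (pt p a q x) = incl a \<otimes>\<^bsub>U X\<^esub> Lval x"
 by (simp add: pt_eq to_model_proj sym_closed pairs_map_sym)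

lemma to_model_smult: "r .: R ==> t .: T ==> to_model (r \<odot>\<^bsub>T\<^esub> t) = r \<odot>\<^bsub>U X\<^esub> to_model t"
 unfolding T_carrier unfolding T_eq
 by (elim imageE) (simp add: TQ.smult_proj to_model_proj P.F_smult_closed pairs_map_smult)

lemma to_model_additive: "additive_map T (U X) to_model"
 by (rule additiveI) (simp_all add: ring_hom_closed[OF to_model_hom] ring_hom_add[OF to_model_hom])

subsection \<open>The inverse map\<close>

abbreviation ti where "ti \<equiv> tensor_incl R A L"

lemma ti_eq: "ti = graded_ext A T (%p a. pt p a 0 \<one>\<^bsub>L\<^esub>)"
 by (simp add: tensor_incl_def[abs_def] graded_ext_def[abs_def])

lemma ti_additive: "additive_map A T ti"
 unfolding ti_eq
 by (rule graded_ext_additive[OF T.ab pt_closed[OF _ L_one_grade] pt_add_left[OF _ _ L_one_grade]])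

lemma ti_homogeneous: "a \<in> grade A p ==> ti a = pt p a 0 \<one>\<^bsub>L\<^esub>"
 unfolding ti_eq
 by (rule graded_ext_homogeneous[OF T.ab pt_closed[OF _ L_one_grade] pt_add_left[OF _ _ L_one_grade]])

lemma ti_closed: "a .: A ==> ti a .: T"
 using additive_closed[OF ti_additive] .

lemma incl_additive: "additive_map A (U X) incl"
 by (rule additiveI) (simp_all add: incl_U incl_simps)

lemma to_model_ti:
 assumes "a .: A"
 shows "to_model (ti a) = incl a"
proof (rule additive_eq_on_homogeneous[OF U.M.ab
   additive_comp[OF ti_additive to_model_additive] incl_additive _ assms])
 fix n x assume x: "x \<in> grade A n"
 thus "to_model (ti x) = incl x"
  using incl_U[OF grade_carrier[OF x], of X] by (simp add: ti_homogeneous to_model_pt[OF x L_one_grade] Lval_one)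
qed

text \<open>\<open>1 \<otimes> m\<close> for a monomial \<open>m\<close>.\<close>

definition kap :: "nat multiset => (nat \<times> 'a \<times> nat \<times> ((nat \<times> (nat => 'r)) list => 'r) set => 'r) set" where
 "kap m = pt 0 \<one> (mdeg dg m) (Em m)"

lemma kap_closed: "m \<in> monomials dg X ==> kap m .: T"
 unfolding kap_def by (rule pt_closed[OF one_grade Em_grade])

lemma ti_kap: "a \<in> grade A p ==> m \<in> monomials dg X ==> ti a \<otimes>\<^bsub>T\<^esub> kap m = pt p a (mdeg dg m) (Em m)"
 unfolding kap_def by (simp add: ti_homogeneous pt_mult[OF _ Em_grade])

lemma monomials_mono_sub: "add_mset j m \<in> monomials dg X ==> m \<in> monomials dg X"
 using odd_clash_mono[of dg m "{#j#}"] by (auto simp: monomials_def)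

lemma word_val_sorted:
 "sorted l ==> mset l \<in> monomials dg X ==> word_val (map e l) = fs_single A (mset l) \<one>"
proof (induction l)
 case Nil
 thus ?case by (simp add: word_val_def U_simps(5))
next
 case (Cons j l)
 have m: "mset l \<in> monomials dg X" using Cons.prems(2) monomials_mono_sub by simp
 have j: "j \<in> X" "{#j#} \<in> monomials dg X" using Cons.prems(2) gen_monomial by (auto simp: monomials_def)
 have le: "\<forall>i\<in>#mset l. j \<le> i" using Cons.prems(1) by simp
 have "{#i \<in># mset l. i < j \<and> odd (dg i)#} = {#}"
 proof (rule ccontr)
  assume "{#i \<in># mset l. i < j \<and> odd (dg i)#} ~= {#}"
  then obtain i where "i \<in># {#i \<in># mset l. i < j \<and> odd (dg i)#}" by (rule multiset_nonemptyE)
  hence "i \<in># mset l" "i < j" by simp_all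
  thus False using le by fastforce
 qed
 hence inv: "inversions dg {#j#} (mset l) = 0" by (simp add: inversions_def)
 have nc: "\<not> odd_clash dg ({#j#} + mset l)" using Cons.prems(2) by (simp add: monomials_def)
 have "word_val (map e (j # l)) = vgen (fs_single R j \<one>\<^bsub>R\<^esub>) \<otimes>\<^bsub>U X\<^esub> word_val (map e l)"
  by (simp add: word_val_def e_def)
 also have "vgen (fs_single R j \<one>\<^bsub>R\<^esub>) = gen j"
  using vgen_single[OF j(1) R.one_closed] gen_U[OF j(1)] by simp
 also have "gen j \<otimes>\<^bsub>U X\<^esub> word_val (map e l) = fs_single A ({#j#} + mset l) (ext_twist A dg {#j#} (mset l) \<one> \<one>)"
  using Cons.IH[OF _ m] Cons.prems(1) U_single_mult[OF j(2) m, of "\<one>" "\<one>"] by (simp add: gen_def)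
 also have "ext_twist A dg {#j#} (mset l) \<one> \<one> = \<one>"
  unfolding ext_twist_def if_not_P[OF nc] inv by (simp add: ksgn_def grade_inv_one)
 finally show ?case by simp
qed

lemma to_model_kap:
 assumes "m \<in> monomials dg X"
 shows "to_model (kap m) = fs_single A m \<one>"
proof -
 have "Lval (Em m) = fs_single A m \<one>"
  using Lval_lword[OF E_words[of "sorted_list_of_multiset m"]] word_val_sorted[of "sorted_list_of_multiset m"] assms
  by (simp add: monomials_def)
 moreover have "fs_single A m \<one> .: U X" using assms by (rule U_single_carrier) simp
 ultimately show ?thesis unfolding kap_def to_model_pt[OF one_grade Em_grade[OF assms]] by (simp add: incl_one)
qed

definition from_model where "from_model = lin_ext A T (%m a. ti a \<otimes>\<^bsub>T\<^esub> kap m)"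

lemma from_coeff_additive: "m \<in> monomials dg X ==> additive_map A T (%a. ti a \<otimes>\<^bsub>T\<^esub> kap m)"
 by (rule additiveI) (simp_all add: ti_closed kap_closed additive_add[OF ti_additive] T.l_distr)

lemma from_model_additive: "additive_map (U X) T from_model"
 unfolding from_model_def
 by (rule lin_ext_additive[OF M.ab T.ab from_coeff_additive U_group])

lemma from_model_single:
 "m \<in> monomials dg X ==> a .: A ==> from_model (fs_single A m a) = ti a \<otimes>\<^bsub>T\<^esub> kap m"
 unfolding from_model_def
 by (rule lin_ext_single[where h = "%m a. ti a \<otimes>\<^bsub>T\<^esub> kap m",
    OF M.ab T.ab from_coeff_additive])

lemma to_from_model:
 assumes "u .: U X"
 shows "to_model (from_model u) = u"
proof -
 interpret tw: twisted_conv A "monomials dg X" "(+)" "ext_twist A dg" "U X" by (rule U_twisted)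
 have id: "additive_map (U X) (U X) (%u. u)" by (rule additiveI) simp_all
 show ?thesis
 proof (rule tw.additive_eq_on[OF U.M.ab additive_comp[OF from_model_additive to_model_additive] id _ assms])
  fix m a assume m: "m \<in> monomials dg X" and a: "a .: A"
  have e: "{#} \<in> monomials dg X" "\<not> odd_clash dg m" using m by (simp_all add: monomials_def odd_clash_def)
  have "to_model (from_model (fs_single A m a)) = to_model (ti a \<otimes>\<^bsub>T\<^esub> kap m)"
   by (rule arg_cong[OF from_model_single[OF m a]])
  also have "\<dots> = to_model (ti a) \<otimes>\<^bsub>U X\<^esub> to_model (kap m)"
   by (rule ring_hom_mult[OF to_model_hom ti_closed[OF a] kap_closed[OF m]])
  also have "\<dots> = fs_single A {#} a \<otimes>\<^bsub>U X\<^esub> fs_single A m \<one>"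
   unfolding to_model_ti[OF a] to_model_kap[OF m] incl_def ..
  also have "\<dots> = fs_single A ({#} + m) (ext_twist A dg {#} m a \<one>)"
   by (rule U_single_mult[OF e(1) m a A.one_closed])
  also have "{#} + m = m" by simp
  also have "ext_twist A dg {#} m a \<one> = a"
   using e(2) a by (simp add: ext_twist_def ksgn_def grade_inv_one)
  finally show "to_model (from_model (fs_single A m a)) = fs_single A m a" .
 qed
qed

lemma from_model_grade:
 assumes "u \<in> grade (U X) n"
 shows "from_model u \<in> grade T n"
proof -
 have uf: "u \<in> fin_funs (monomials dg X) A" using U_grade_carrier[OF assms] by (simp add: U_simps)
 have sum: "finsum T h I \<in> grade T n" if "finite I" "!!i. i \<in> I ==> h i \<in> grade T n" for h :: "nat multiset => _" and I
  using that
 proof (induction I)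
  case empty
  thus ?case using T_grade_zero by simp
 next
  case (insert i I)
  hence "h \<in> I \<rightarrow> carrier T" "h i .: T" using T_grade_carrier by auto
  thus ?case using insert T_grade_add by (simp add: T.finsum_insert)
 qed
 show ?thesis
  unfolding from_model_def lin_ext_def
 proof (rule sum)
  fix m assume "m \<in> {m. u m ~= \<zero>}"
  hence m: "m \<in> monomials dg X" "mdeg dg m \<le> n" "u m \<in> grade A (n - mdeg dg m)"
   using U_gradeD[OF assms, of m] fin_funs_supp[OF uf, of m] by auto
  thus "ti (u m) \<otimes>\<^bsub>T\<^esub> kap m \<in> grade T n"
   using ti_kap[OF m(3,1)] pt_grade[OF m(3) Em_grade[OF m(1)]] by simp
 qed (rule fin_funs_finite[OF uf])
qed

text \<open>The inverse map is onto since sorted words span: \<open>a \<otimes> r m\<close> is the image of \<open>r a\<close> at \<open>m\<close>.\<close>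

lemma pure_tensor_from_model:
 assumes "Lsp q x" "a \<in> grade A p"
 shows "pt p a q x \<in> from_model ` grade (U X) (p + q)"
 using assms
proof (induction arbitrary: a rule: Lsp.induct)
 case (Lsp_zero q)
 have "from_model \<zero>\<^bsub>U X\<^esub> = \<zero>\<^bsub>T\<^esub>"
  using additive_zero[OF U.M.ab T.ab from_model_additive] .
 thus ?case using pt_zero_right[OF Lsp_zero] U.grade_zero[of "p + q"] by (metis image_eqI)
next
 case (Lsp_step r m q x)
 have ra: "r \<odot> a \<in> grade A p" using Lsp_step grade_smult by blast
 have xg: "x \<in> grade L q" using Lsp_step(4) Lsp_grade by blast
 have mg: "Em m \<in> grade L q" using Em_grade[OF Lsp_step(2)] Lsp_step(3) by simp
 obtain u where u: "u \<in> grade (U X) (p + q)" "pt p a q x = from_model u"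
  using Lsp_step.IH[OF Lsp_step.prems] by blast
 let ?v = "fs_single A m (r \<odot> a)"
 have v: "?v \<in> grade (U X) (p + q)" using U_single_grade[OF Lsp_step(2) ra] Lsp_step(3) by simp
 have "pt p a q (r \<odot>\<^bsub>L\<^esub> Em m \<oplus>\<^bsub>L\<^esub> x) = pt p a q (r \<odot>\<^bsub>L\<^esub> Em m) \<oplus>\<^bsub>T\<^esub> pt p a q x"
  by (rule pt_add_right[OF Lsp_step.prems L_grade_smult[OF Lsp_step(1) mg] xg])
 also have "pt p a q (r \<odot>\<^bsub>L\<^esub> Em m) = pt p (r \<odot> a) q (Em m)"
  unfolding pt_smult_right[OF Lsp_step(1) Lsp_step.prems mg] pt_smult_left[OF Lsp_step(1) Lsp_step.prems mg] ..
 also have "\<dots> = from_model ?v"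
  using from_model_single[OF Lsp_step(2) grade_carrier[OF ra]] ti_kap[OF ra Lsp_step(2)] Lsp_step(3) by simp
 also have "from_model ?v \<oplus>\<^bsub>T\<^esub> pt p a q x = from_model (?v \<oplus>\<^bsub>U X\<^esub> u)"
  unfolding u(2) using additive_add[OF from_model_additive U_grade_carrier[OF v] U_grade_carrier[OF u(1)]] by simp
 finally show ?case using U.grade_add[OF v u(1)] by (metis image_eqI)
qed

lemma T_grade_from_model: "grade T n \<subseteq> from_model ` grade (U X) n"
proof
 fix t assume "t \<in> grade T n"
 then obtain f where f: "t = TQ.proj f" "f \<in> grade P.F n" unfolding T_grade by (rule imageE)
 have "TQ.proj f \<in> from_model ` grade (U X) n" using f(2)
 proof (induction f rule: P.F_grade_induct)
  case zero
  have "from_model \<zero>\<^bsub>U X\<^esub> = TQ.proj \<zero>\<^bsub>P.F\<^esub>"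
   unfolding TQ.proj_zero T_eq[symmetric]
   by (rule additive_zero[OF U.M.ab T.ab from_model_additive])
  thus ?case using U.grade_zero[of n] by (metis image_eqI)
 next
  case (add f g)
  obtain u where u: "u \<in> grade (U X) n" "TQ.proj f = from_model u" using add(3) by blast
  obtain v where v: "v \<in> grade (U X) n" "TQ.proj g = from_model v" using add(4) by blast
  have "TQ.proj (f \<oplus>\<^bsub>P.F\<^esub> g) = from_model (u \<oplus>\<^bsub>U X\<^esub> v)"
   unfolding TQ.proj_add[OF P.F_grade_carrier[OF add(1)] P.F_grade_carrier[OF add(2)]] u(2) v(2) T_eq[symmetric]
   by (rule additive_add[OF from_model_additive U_grade_carrier[OF u(1)] U_grade_carrier[OF v(1)], symmetric])
  thus ?case using U.grade_add[OF u(1) v(1)] by (metis image_eqI)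
 next
  case (single w r)
  obtain p a q x where w: "w = (p, a, q, x)" by (cases w)
  have g: "a \<in> grade A p" "x \<in> grade L q" "p + q = n" using single by (auto simp: w pairs_carrier)
  have "TQ.proj (fs_single R w r) = r \<odot>\<^bsub>T\<^esub> pt p a q x"
   unfolding pt_eq T_eq TQ.smult_proj[OF single(3) sym_closed[OF g(1,2)]]
   using single(3) by (simp add: w P.F_smult_single)
  hence eq: "TQ.proj (fs_single R w r) = pt p (r \<odot> a) q x"
   by (rule trans[OF _ pt_smult_left[OF single(3) g(1,2), symmetric]])
  show ?case
   unfolding eq g(3)[symmetric] by (rule pure_tensor_from_model[OF Lsp_all[OF g(2)] grade_smult[OF single(3) g(1)]])
 qed
 thus "t \<in> from_model ` grade (U X) n" using f(1) by simp
qed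

lemma T_carrier_from_model: "carrier T \<subseteq> from_model ` carrier (U X)"
proof
 fix t assume "t .: T"
 then obtain f where f: "t = TQ.proj f" "f .: P.F" unfolding T_carrier by (rule imageE)
 have "TQ.proj f \<in> from_model ` carrier (U X)" using f(2)
 proof (induction f rule: P.F_induct)
  case zero
  have "TQ.proj \<zero>\<^bsub>P.F\<^esub> \<in> grade T 0" unfolding TQ.proj_zero T_eq[symmetric] by (rule T_grade_zero)
  thus ?case using T_grade_from_model[of 0] U_grade_carrier by blast
 next
  case (add f g)
  obtain u where u: "u .: U X" "TQ.proj f = from_model u" using add(3) by blast
  obtain v where v: "v .: U X" "TQ.proj g = from_model v" using add(4) by blast
  have "TQ.proj (f \<oplus>\<^bsub>P.F\<^esub> g) = from_model (u \<oplus>\<^bsub>U X\<^esub> v)"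
   unfolding TQ.proj_add[OF add(1,2)] u(2) v(2) T_eq[symmetric]
   by (rule additive_add[OF from_model_additive u(1) v(1), symmetric])
  thus ?case using U.M.a_closed[OF u(1) v(1)] by (metis image_eqI)
 next
  case (single w r)
  hence "TQ.proj (fs_single R w r) \<in> grade T ((%(p, a, q, x). p + q) w)"
   unfolding T_grade using P.F_single_grade by blast
  thus ?case using T_grade_from_model U_grade_carrier by blast
 qed
 thus "t \<in> from_model ` carrier (U X)" using f(1) by simp
qed

lemma to_model_iso: "cga_iso R T (U X) to_model"
 unfolding cga_iso_def
proof (intro conjI ballI allI)
 show "bij_betw to_model (carrier T) (carrier (U X))"
  unfolding bij_betw_def
 proof
  show "inj_on to_model (carrier T)"
  proof (rule inj_onI)
   fix t t' assume t: "t .: T" "t' .: T" and eq: "to_model t = to_model t'"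
   obtain u where u: "u .: U X" "t = from_model u" using t(1) T_carrier_from_model by blast
   obtain u' where u': "u' .: U X" "t' = from_model u'" using t(2) T_carrier_from_model by blast
   show "t = t'" using eq to_from_model[OF u(1)] to_from_model[OF u'(1)] unfolding u(2) u'(2) by simp
  qed
  show "to_model ` carrier T = carrier (U X)"
  proof
   show "to_model ` carrier T \<subseteq> carrier (U X)" using ring_hom_closed[OF to_model_hom] by blast
   show "carrier (U X) \<subseteq> to_model ` carrier T"
   proof
    fix u assume u: "u .: U X"
    show "u \<in> to_model ` carrier T"
     using to_from_model[OF u, symmetric] additive_closed[OF from_model_additive u] by (rule image_eqI)
   qed
  qed
 qed
 show "to_model \<in> ring_hom T (U X)" by (rule to_model_hom)
 show "to_model (r \<odot>\<^bsub>T\<^esub> t) = r \<odot>\<^bsub>U X\<^esub> to_model t" if "r .: R" "t .: T" for r t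
  using that by (rule to_model_smult)
 show "to_model ` grade T n = grade (U X) n" for n
 proof
  show "to_model ` grade T n \<subseteq> grade (U X) n"
  proof
   fix s assume "s \<in> to_model ` grade T n"
   then obtain t where t: "s = to_model t" "t \<in> grade T n" by (rule imageE)
   then obtain u where u: "t = from_model u" "u \<in> grade (U X) n" using T_grade_from_model[of n] by blast
   show "s \<in> grade (U X) n"
    unfolding t(1) u(1) to_from_model[OF U_grade_carrier[OF u(2)]] by (rule u(2))
  qed
  show "grade (U X) n \<subseteq> to_model ` grade T n"
  proof
   fix u assume u: "u \<in> grade (U X) n"
   show "u \<in> to_model ` grade T n"
    using to_from_model[OF U_grade_carrier[OF u], symmetric] from_model_grade[OF u] by (rule image_eqI)
  qed
 qed
qed

lemma T_comm_graded_algebra: "comm_graded_algebra R T"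
 by (rule iso_comm_graded_algebra[OF U_comm_graded_algebra T.ring_axioms to_model_iso T_smult_closed T_grade_carrier])

end

section \<open>Cohomology classes\<close>

context cdga
begin

definition cls :: "nat => 'a => 'a set" where
 "cls n z = coboundaries A d n +>\<^bsub>A\<^esub> z"

lemma coboundaries_subgroup: "abelian_subgroup (coboundaries A d n) A"
 by (rule abelian_subgroupI3)
  (auto simp: additive_subgroup_def M.ab intro: submodule.axioms(1)[OF coboundaries_submodule])

lemma coboundary_closed: "x \<in> coboundaries A d n ==> x .: A"
 using coboundaries_grade grade_carrier by blast

lemma cocycle_closed: "x \<in> cocycles A d n ==> x .: A"
 unfolding cocycles_def using grade_carrier by blast

lemma cohom_carrier: "carrier (cohom A d n) = cls n ` cocycles A d n"
 by (simp add: cohom_def cls_def)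

lemma cls_self: "z .: A ==> z \<in> cls n z"
proof -
 interpret C: abelian_subgroup "coboundaries A d n" A by (rule coboundaries_subgroup)
 assume "z .: A"
 thus ?thesis unfolding cls_def by (rule C.a_rcos_self)
qed

lemma cls_memI: "i \<in> coboundaries A d n ==> i \<oplus>\<^bsub>A\<^esub> z \<in> cls n z"
 unfolding cls_def a_r_coset_def' by blast

lemma cls_memE:
 assumes "s \<in> cls n z"
 obtains i where "i \<in> coboundaries A d n" "s = i \<oplus>\<^bsub>A\<^esub> z"
 using assms unfolding cls_def a_r_coset_def' by blast

lemma cls_eqI:
 assumes "i \<in> coboundaries A d n" "z .: A"
 shows "cls n (i \<oplus>\<^bsub>A\<^esub> z) = cls n z"
proof -
 interpret C: abelian_subgroup "coboundaries A d n" A by (rule coboundaries_subgroup)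
 show ?thesis
  using C.a_repr_independence'[of "i \<oplus>\<^bsub>A\<^esub> z" z] cls_memI[OF assms(1), of z] assms(2) by (simp add: cls_def)
qed

lemma cls_eqD:
 assumes "cls n z = cls n z'" "z .: A"
 obtains i where "i \<in> coboundaries A d n" "z = i \<oplus>\<^bsub>A\<^esub> z'"
 using cls_memE[of z n z'] cls_self[OF assms(2), of n] assms(1) by blast

lemma cohom_zero: "\<zero>\<^bsub>cohom A d n\<^esub> = cls n \<zero>\<^bsub>A\<^esub>"
proof -
 interpret C: abelian_subgroup "coboundaries A d n" A by (rule coboundaries_subgroup)
 have "coboundaries A d n +>\<^bsub>A\<^esub> \<zero>\<^bsub>A\<^esub> = coboundaries A d n"
  using coboundary_closed unfolding a_r_coset_def' by (auto intro!: bexI)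
 thus ?thesis by (simp add: cohom_def cls_def)
qed

lemma cls_zeroD:
 assumes "cls n z = \<zero>\<^bsub>cohom A d n\<^esub>" "z .: A"
 shows "z \<in> coboundaries A d n"
proof -
 obtain i where "i \<in> coboundaries A d n" "z = i \<oplus>\<^bsub>A\<^esub> \<zero>\<^bsub>A\<^esub>"
  using cls_eqD[OF assms(1)[unfolded cohom_zero] assms(2)] .
 thus ?thesis using coboundary_closed by simp
qed

lemma cls_zeroI:
 assumes "z \<in> coboundaries A d n"
 shows "cls n z = \<zero>\<^bsub>cohom A d n\<^esub>"
 using cls_eqI[OF assms M.zero_closed] coboundary_closed[OF assms] by (simp add: cohom_zero)

lemma cls_add:
 assumes "x .: A" "y .: A"
 shows "cls n x \<oplus>\<^bsub>cohom A d n\<^esub> cls n y = cls n (x \<oplus>\<^bsub>A\<^esub> y)"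
proof -
 interpret C: abelian_subgroup "coboundaries A d n" A by (rule coboundaries_subgroup)
 show ?thesis using C.a_rcos_sum[OF assms] by (simp add: cohom_def cls_def)
qed

text \<open>A morphism acts on classes through representatives; scalars are a special case.\<close>

lemma coset_image:
 fixes B :: "('r, 'b) gmod"
 assumes B: "cdga R B dB" and h: "additive_map A B h"
  and cob: "!!i. i \<in> coboundaries A d n ==> h i \<in> coboundaries B dB n" and z: "z .: A"
 shows "set_add B (coboundaries B dB n) (h ` (coboundaries A d n +>\<^bsub>A\<^esub> z)) = coboundaries B dB n +>\<^bsub>B\<^esub> h z"
proof -
 interpret B: cdga R B dB by (rule B)
 note CE = B.submoduleE[OF B.coboundaries_submodule[of n]]
 have hz: "h z .: B" using additive_closed[OF h z] .
 have zero: "\<zero>\<^bsub>B\<^esub> \<in> coboundaries B dB n"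
  using subgroup.one_closed[OF submodule.axioms(1)[OF B.coboundaries_submodule[of n]]] by simp
 show ?thesis
 proof (intro subset_antisym subsetI)
  fix s assume "s \<in> set_add B (coboundaries B dB n) (h ` (coboundaries A d n +>\<^bsub>A\<^esub> z))"
  then obtain i j where ij: "i \<in> coboundaries B dB n" "j \<in> coboundaries A d n" "s = i \<oplus>\<^bsub>B\<^esub> h (j \<oplus>\<^bsub>A\<^esub> z)"
   unfolding set_add_def' a_r_coset_def' by blast
  have "s = (i \<oplus>\<^bsub>B\<^esub> h j) \<oplus>\<^bsub>B\<^esub> h z"
   using ij cob[OF ij(2)] B.coboundary_closed hz additive_add[OF h coboundary_closed[OF ij(2)] z]
   by (simp add: B.M.a_assoc)
  thus "s \<in> coboundaries B dB n +>\<^bsub>B\<^esub> h z"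
   unfolding a_r_coset_def' using CE(5)[OF ij(1) cob[OF ij(2)]] by blast
 next
  fix s assume "s \<in> coboundaries B dB n +>\<^bsub>B\<^esub> h z"
  then obtain i where "i \<in> coboundaries B dB n" "s = i \<oplus>\<^bsub>B\<^esub> h z" unfolding a_r_coset_def' by blast
  thus "s \<in> set_add B (coboundaries B dB n) (h ` (coboundaries A d n +>\<^bsub>A\<^esub> z))"
   using cls_self[OF z, of n] unfolding set_add_def' cls_def by blast
 qed
qed

lemma coboundary_smult: "r .: R ==> i \<in> coboundaries A d n ==> r \<odot>\<^bsub>A\<^esub> i \<in> coboundaries A d n"
 using submoduleE(4)[OF coboundaries_submodule] by blast

end

context
 fixes R :: "('r, 'e) ring_scheme" and A :: "('r, 'a) gmod" and d
 assumes A: "cdga R A d"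
begin

interpretation cdga R A d by (rule A)

lemma cls_smult:
 assumes r: "r .: R" and z: "z .: A"
 shows "r \<odot>\<^bsub>cohom A d n\<^esub> cls n z = cls n (r \<odot>\<^bsub>A\<^esub> z)"
 using coset_image[OF A smult_additive[OF r] coboundary_smult[OF r] z]
 by (simp add: cohom_def cls_def)

lemma cls_map:
 fixes B :: "('r, 'b) gmod"
 assumes B: "cdga R B dB" and h: "cdga_hom R A d B dB h" and z: "z .: A"
 shows "cohom_map B dB n h (cls n z) = cdga.cls B dB n (h z)"
proof -
 interpret B: cdga R B dB by (rule B)
 have H: "h x .: B" "h (x \<oplus>\<^bsub>A\<^esub> y) = h x \<oplus>\<^bsub>B\<^esub> h y" "h (d x) = dB (h x)"
  if "x .: A" "y .: A" for x y
  using h that unfolding cdga_hom_def ring_hom_def by auto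
 have add: "additive_map A B h" by (rule additiveI) (use H in auto)
 have gr: "h x \<in> grade B k" if "x \<in> grade A k" for x k
  using h that unfolding cdga_hom_def by blast
 have cob: "h i \<in> coboundaries B dB n" if i: "i \<in> coboundaries A d n" for i
 proof (cases n)
  case 0
  thus ?thesis using i additive_zero[OF M.ab B.M.ab add]
   by (simp add: coboundaries_def)
 next
  case (Suc k)
  then obtain t where t: "t \<in> grade A k" "i = d t" using i by (auto simp: coboundaries_def)
  hence "h i = dB (h t)" using H(3)[OF grade_carrier grade_carrier] by blast
  thus ?thesis using gr[OF t(1)] Suc by (simp add: coboundaries_def)
 qed
 show ?thesis
  unfolding cohom_map_def cls_def B.cls_def by (rule coset_image[OF B add cob z])
qed

lemma fin_gen_module_cohom:
 assumes "fin_gen_module R (cohom A d n)"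
 shows "fin_gen_cohom R A d n"
proof -
 let ?H = "cohom A d n"
 interpret H: module R ?H using assms by (simp add: fin_gen_module_def)
 obtain S where S: "finite S" "S \<subseteq> carrier ?H"
  "\<forall>x\<in>carrier ?H. \<exists>c. c ` S \<subseteq> carrier R \<and> x = finsum ?H (%s. c s \<odot>\<^bsub>?H\<^esub> s) S"
  using assms unfolding fin_gen_module_def by blast
 obtain ss where ss: "set ss = S" "distinct ss" using finite_distinct_list[OF S(1)] by blast
 define rep where "rep Y = (SOME z. z \<in> cocycles A d n \<and> Y = cls n z)" for Y
 have rep: "rep Y \<in> cocycles A d n \<and> Y = cls n (rep Y)" if "Y \<in> S" for Y
 proof -
  have "\<exists>z. z \<in> cocycles A d n \<and> Y = cls n z" using S(2) that unfolding cohom_carrier by blast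
  thus ?thesis unfolding rep_def by (rule someI_ex)
 qed
 let ?span = "%l. mod_span R A (coboundaries A d n) (map rep l)"
 have sub: "submodule (?span l) R A" if "set l \<subseteq> S" for l
  by (rule mod_span_submodule[OF coboundaries_submodule]) (use that rep cocycle_closed in fastforce)
 have comb: "\<exists>u\<in>?span l. finsum ?H (%s. c s \<odot>\<^bsub>?H\<^esub> s) (set l) = cls n u"
  if "set l \<subseteq> S" "distinct l" "c ` S \<subseteq> carrier R" for l c
  using that(1,2)
 proof (induction l)
  case Nil
  have "\<zero>\<^bsub>A\<^esub> \<in> coboundaries A d n"
   using subgroup.one_closed[OF submodule.axioms(1)[OF coboundaries_submodule[of n]]] by simp
  thus ?case by (auto simp: cohom_zero)
 next
  case (Cons s l)
  then obtain u where u: "u \<in> ?span l" "finsum ?H (%s. c s \<odot>\<^bsub>?H\<^esub> s) (set l) = cls n u" by auto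
  have s: "s \<in> S" "s \<notin> set l" "c s .: R" using Cons.prems that(3) by auto
  have uA: "u .: A" using submoduleE(1)[OF sub] u(1) Cons.prems(1) by auto
  have rA: "rep s .: A" using rep[OF s(1)] cocycle_closed by blast
  have cl: "c t \<odot>\<^bsub>?H\<^esub> t .: ?H" if "t \<in> S" for t
   using that \<open>c ` S \<subseteq> carrier R\<close> S(2) by (intro H.smult_closed) auto
  have "finsum ?H (%s. c s \<odot>\<^bsub>?H\<^esub> s) (set (s # l)) = c s \<odot>\<^bsub>?H\<^esub> s \<oplus>\<^bsub>?H\<^esub> finsum ?H (%s. c s \<odot>\<^bsub>?H\<^esub> s) (set l)"
   using s(2) cl Cons.prems(1) by (simp add: H.M.finsum_insert Pi_def subset_iff)
  also have "\<dots> = c s \<odot>\<^bsub>?H\<^esub> cls n (rep s) \<oplus>\<^bsub>?H\<^esub> cls n u"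
   unfolding u(2) using conjunct2[OF rep[OF s(1)]] by simp
  also have "\<dots> = cls n (c s \<odot>\<^bsub>A\<^esub> rep s \<oplus>\<^bsub>A\<^esub> u)"
   unfolding cls_smult[OF s(3) rA] by (rule cls_add[OF smult_closed[OF s(3) rA] uA])
  finally show ?case using u(1) s(3) by auto
 qed
 have "cocycles A d n \<subseteq> ?span ss"
 proof
  fix z assume z: "z \<in> cocycles A d n"
  hence "cls n z .: ?H" unfolding cohom_carrier by blast
  then obtain c where c: "c ` S \<subseteq> carrier R" "cls n z = finsum ?H (%s. c s \<odot>\<^bsub>?H\<^esub> s) S" using S(3) by blast
  obtain u where u: "u \<in> ?span ss" "cls n z = cls n u" using comb[of ss c] ss c by auto
  obtain i where i: "i \<in> coboundaries A d n" "z = i \<oplus>\<^bsub>A\<^esub> u"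
   using cls_eqD[OF u(2) cocycle_closed[OF z]] .
  have "set (map rep ss) \<subseteq> carrier A" using rep cocycle_closed ss(1) by fastforce
  hence "i \<in> ?span ss" using mod_span_base[OF coboundaries_submodule] i(1) by blast
  thus "z \<in> ?span ss" unfolding i(2) using submoduleE(5)[OF sub] ss(1) u(1) by blast
 qed
 moreover have "set (map rep ss) \<subseteq> cocycles A d n" using rep ss(1) by auto
 ultimately show ?thesis unfolding fin_gen_cohom_def by blast
qed

end

text \<open>The coefficients of \<open>q x\<close> in a basis are those of \<open>x\<close> times \<open>q\<close>, and \<open>R\<close> is a domain.\<close>

lemma free_module_torsion_free:
 assumes dom: "domain R" and free: "free_module R N"
  and x: "x .: N" and q: "q .: R" "q ~= \<zero>\<^bsub>R\<^esub>" "q \<odot>\<^bsub>N\<^esub> x = \<zero>\<^bsub>N\<^esub>"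
 shows "x = \<zero>\<^bsub>N\<^esub>"
proof -
 interpret R: domain R by (rule dom)
 interpret N: module R N using free by (simp add: free_module_def)
 obtain Y where Y: "is_basis R N Y" using free by (auto simp: free_module_def)
 let ?ok = "%x c. c ` Y \<subseteq> carrier R \<and> (\<forall>b. b \<notin> Y \<longrightarrow> c b = \<zero>\<^bsub>R\<^esub>) \<and> finite {b. c b ~= \<zero>\<^bsub>R\<^esub>} \<and>
    x = finsum N (%b. c b \<odot>\<^bsub>N\<^esub> b) {b. c b ~= \<zero>\<^bsub>R\<^esub>}"
 have YN: "Y \<subseteq> carrier N" and ex: "!!x. x .: N ==> \<exists>!c. ?ok x c"
  using Y unfolding is_basis_def by auto
 obtain c where c: "?ok x c" using ex[OF x] by blast
 have cR: "c b .: R" for b using c by (cases "b \<in> Y") auto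
 let ?S = "{b. c b ~= \<zero>\<^bsub>R\<^esub>}"
 have supp: "{b. q \<otimes>\<^bsub>R\<^esub> c b ~= \<zero>\<^bsub>R\<^esub>} = ?S" using q(1,2) cR R.integral_iff by auto
 have SY: "?S \<subseteq> Y" using c by auto
 have "\<zero>\<^bsub>N\<^esub> = q \<odot>\<^bsub>N\<^esub> finsum N (%b. c b \<odot>\<^bsub>N\<^esub> b) ?S" using c q(3) by simp
 also have "\<dots> = finsum N (%b. q \<odot>\<^bsub>N\<^esub> (c b \<odot>\<^bsub>N\<^esub> b)) ?S"
  using c q(1) cR SY YN by (intro N.finsum_smult_ldistr) auto
 also have "\<dots> = finsum N (%b. (q \<otimes>\<^bsub>R\<^esub> c b) \<odot>\<^bsub>N\<^esub> b) ?S"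
  using q(1) cR SY YN by (intro N.M.finsum_cong') (auto simp: N.smult_assoc1)
 finally have z: "\<zero>\<^bsub>N\<^esub> = finsum N (%b. (q \<otimes>\<^bsub>R\<^esub> c b) \<odot>\<^bsub>N\<^esub> b) {b. q \<otimes>\<^bsub>R\<^esub> c b ~= \<zero>\<^bsub>R\<^esub>}" unfolding supp .
 have ok1: "?ok \<zero>\<^bsub>N\<^esub> (%b. q \<otimes>\<^bsub>R\<^esub> c b)"
 proof (intro conjI)
  show "(%b. q \<otimes>\<^bsub>R\<^esub> c b) ` Y \<subseteq> carrier R" using q(1) cR by auto
  show "\<forall>b. b \<notin> Y \<longrightarrow> q \<otimes>\<^bsub>R\<^esub> c b = \<zero>\<^bsub>R\<^esub>" using c q(1) by simp
  show "finite {b. q \<otimes>\<^bsub>R\<^esub> c b ~= \<zero>\<^bsub>R\<^esub>}" unfolding supp using c by blast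
 qed (rule z)
 have ok0: "?ok \<zero>\<^bsub>N\<^esub> (%b. \<zero>\<^bsub>R\<^esub>)" by auto
 have "(%b. q \<otimes>\<^bsub>R\<^esub> c b) = (%b. \<zero>\<^bsub>R\<^esub>)" 
  by (rule trans[OF the1_equality[where P = "?ok \<zero>\<^bsub>N\<^esub>", OF ex[OF N.M.zero_closed] ok1, symmetric]
    the1_equality[where P = "?ok \<zero>\<^bsub>N\<^esub>", OF ex[OF N.M.zero_closed] ok0]])
 hence "q \<otimes>\<^bsub>R\<^esub> c b = \<zero>\<^bsub>R\<^esub>" for b by (rule fun_cong)
 hence "?S = {}" unfolding supp[symmetric] by simp
 thus ?thesis using c by simp
qed

text \<open>By the long exact sequence, exactness of the cone in all degrees leaves only the injectivity
 in degree \<open>0\<close> open.\<close>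

lemma quasi_iso_from_cone:
 fixes R :: "('r, 'e) ring_scheme" and K :: "('r, 'k) gmod" and B :: "('r, 'b) gmod"
 assumes K: "cdga R K d" and B: "cdga R B dB" and h: "cdga_hom R K d B dB h"
  and ac: "!!n. cone_acyclic R K d B dB h n"
  and inj0: "!!a. a \<in> grade K 0 ==> d a = \<zero>\<^bsub>K\<^esub> ==> h a = \<zero>\<^bsub>B\<^esub> ==> a = \<zero>\<^bsub>K\<^esub>"
 shows "quasi_iso R K d B dB h"
proof -
 interpret K: cdga R K d by (rule K)
 interpret B: cdga R B dB by (rule B)
 have H: "h x .: B" "h (x \<oplus>\<^bsub>K\<^esub> y) = h x \<oplus>\<^bsub>B\<^esub> h y" "h (d x) = dB (h x)"
  if "x .: K" "y .: K" for x y
  using h that unfolding cdga_hom_def ring_hom_def by auto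
 have gr: "h x \<in> grade B k" if "x \<in> grade K k" for x k
  using h that unfolding cdga_hom_def by blast
 have add: "additive_map K B h" by (rule additiveI) (use H in auto)
 note h0 = additive_zero[OF K.M.ab B.M.ab add]
  and hd = additive_diff[OF K.M.ab B.M.ab add]
 have cyc: "h z \<in> cocycles B dB n" if "z \<in> cocycles K d n" for z n
  using that gr H(3)[of z z] K.cocycle_closed[OF that] h0 by (auto simp: cocycles_def)
 have kill: "z \<in> coboundaries K d n" if z: "z \<in> cocycles K d n" "h z \<in> coboundaries B dB n" for z n
 proof (cases n)
  case 0
  hence "h z = \<zero>\<^bsub>B\<^esub>" using z(2) by (simp add: coboundaries_def)
  thus ?thesis using inj0[of z] z(1) 0 by (simp add: cocycles_def coboundaries_def)
 next
  case (Suc k)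
  then obtain c where "c \<in> grade B k" "h z = dB c" using z(2) by (auto simp: coboundaries_def)
  hence "cone_cocycle K d B dB h k z c" using z(1) Suc by (simp add: cone_cocycle_def cocycles_def)
  hence "(z, c) \<in> cone_span R K d B dB h k []" using ac[of k] unfolding cone_acyclic_def by blast
  thus ?thesis using Suc by (auto simp: coboundaries_def)
 qed
 have "bij_betw (cohom_map B dB n h) (carrier (cohom K d n)) (carrier (cohom B dB n))" for n
  unfolding bij_betw_def
 proof
  show "inj_on (cohom_map B dB n h) (carrier (cohom K d n))"
  proof (rule inj_onI)
   fix X Y assume X: "X .: cohom K d n" and Y: "Y .: cohom K d n"
    and eq: "cohom_map B dB n h X = cohom_map B dB n h Y"
   obtain x where x: "x \<in> cocycles K d n" "X = K.cls n x" using X unfolding K.cohom_carrier by blast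
   obtain y where y: "y \<in> cocycles K d n" "Y = K.cls n y" using Y unfolding K.cohom_carrier by blast
   have xc: "x .: K" and yc: "y .: K" using x y K.cocycle_closed by auto
   have "B.cls n (h x) = B.cls n (h y)"
    using eq unfolding x(2) y(2) cls_map[OF K B h xc] cls_map[OF K B h yc] .
   then obtain i where i: "i \<in> coboundaries B dB n" "h x = i \<oplus>\<^bsub>B\<^esub> h y"
    by (rule B.cls_eqD[OF _ H(1)[OF xc xc]])
   have "h (x \<ominus>\<^bsub>K\<^esub> y) = i"
    using hd[OF xc yc] i H(1)[OF yc yc] B.coboundary_closed[OF i(1)]
    by (simp add: a_minus_def B.M.a_assoc B.M.r_neg)
   moreover have "x \<ominus>\<^bsub>K\<^esub> y \<in> cocycles K d n"
    by (rule K.submodule_diff[OF K.cocycles_submodule x(1) y(1)])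
   ultimately have j: "x \<ominus>\<^bsub>K\<^esub> y \<in> coboundaries K d n" using kill i(1) by simp
   have "x = (x \<ominus>\<^bsub>K\<^esub> y) \<oplus>\<^bsub>K\<^esub> y" using xc yc by (simp add: a_minus_def K.M.a_assoc K.M.l_neg)
   thus "X = Y" unfolding x(2) y(2) using K.cls_eqI[OF j yc] by simp
  qed
  show "cohom_map B dB n h ` carrier (cohom K d n) = carrier (cohom B dB n)"
  proof (intro subset_antisym subsetI)
   fix Y assume "Y \<in> cohom_map B dB n h ` carrier (cohom K d n)"
   then obtain z where z: "z \<in> cocycles K d n" "Y = cohom_map B dB n h (K.cls n z)"
    unfolding K.cohom_carrier by blast
   show "Y .: cohom B dB n"
    unfolding z(2) cls_map[OF K B h K.cocycle_closed[OF z(1)]] B.cohom_carrier using cyc[OF z(1)] by (rule imageI)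
  next
   fix Y assume "Y .: cohom B dB n"
   then obtain c where c: "c \<in> cocycles B dB n" "Y = B.cls n c" unfolding B.cohom_carrier by blast
   have "cone_cocycle K d B dB h n \<zero>\<^bsub>K\<^esub> c" using c(1) h0 by (simp add: cone_cocycle_def cocycles_def K.grade_zero)
   hence "(\<zero>\<^bsub>K\<^esub>, c) \<in> cone_span R K d B dB h n []" using ac[of n] unfolding cone_acyclic_def by blast
   then obtain a e where a: "a \<in> grade K n" "d a = \<zero>\<^bsub>K\<^esub>" "e \<in> coboundaries B dB n" "c = h a \<oplus>\<^bsub>B\<^esub> e" by auto
   have ac: "a .: K" using a(1) K.grade_carrier by blast
   have "c = e \<oplus>\<^bsub>B\<^esub> h a" using a(4) H(1)[OF ac ac] B.coboundary_closed[OF a(3)] by (simp add: B.M.a_comm)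
   hence "Y = B.cls n (h a)" unfolding c(2) using B.cls_eqI[OF a(3) H(1)[OF ac ac]] by simp
   hence "Y = cohom_map B dB n h (K.cls n a)" using cls_map[OF K B h ac] by simp
   moreover have "K.cls n a .: cohom K d n"
    unfolding K.cohom_carrier using a(1,2) by (simp add: cocycles_def)
   ultimately show "Y \<in> cohom_map B dB n h ` carrier (cohom K d n)" by (rule image_eqI)
  qed
 qed
 thus ?thesis using h by (simp add: quasi_iso_def)
qed

lemma H0_is_baseD:
 fixes A :: "('r, 'a) gmod"
 assumes "cdga R A d" "H0_is_base R A d"
 shows "\<lbrakk>a \<in> grade A 0; d a = \<zero>\<^bsub>A\<^esub>\<rbrakk> \<Longrightarrow> \<exists>r\<in>carrier R. a = r \<odot>\<^bsub>A\<^esub> \<one>\<^bsub>A\<^esub>"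
  and "\<lbrakk>r .: R; r \<odot>\<^bsub>A\<^esub> \<one>\<^bsub>A\<^esub> = \<zero>\<^bsub>A\<^esub>\<rbrakk> \<Longrightarrow> r = \<zero>\<^bsub>R\<^esub>"
proof -
 interpret cdga R A d by (rule assms(1))
 have bij: "bij_betw (%r. cls 0 (r \<odot>\<^bsub>A\<^esub> \<one>\<^bsub>A\<^esub>)) (carrier R) (carrier (cohom A d 0))"
  using assms(2) by (simp add: H0_is_base_def cls_def)
 show "\<exists>r\<in>carrier R. a = r \<odot>\<^bsub>A\<^esub> \<one>\<^bsub>A\<^esub>" if a: "a \<in> grade A 0" "d a = \<zero>\<^bsub>A\<^esub>"
 proof -
  have ac: "a .: A" using a(1) grade_carrier by blast
  have "cls 0 a .: cohom A d 0" unfolding cohom_carrier using a by (simp add: cocycles_def)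
  hence "cls 0 a \<in> (%r. cls 0 (r \<odot>\<^bsub>A\<^esub> \<one>\<^bsub>A\<^esub>)) ` carrier R"
   using bij_betw_imp_surj_on[OF bij] by simp
  then obtain r where r: "cls 0 a = cls 0 (r \<odot>\<^bsub>A\<^esub> \<one>\<^bsub>A\<^esub>)" "r .: R" by (rule imageE)
  obtain i where "i \<in> coboundaries A d 0" "a = i \<oplus>\<^bsub>A\<^esub> r \<odot>\<^bsub>A\<^esub> \<one>\<^bsub>A\<^esub>" using cls_eqD[OF r(1) ac] .
  hence "a = r \<odot>\<^bsub>A\<^esub> \<one>\<^bsub>A\<^esub>" using r(2) by (simp add: coboundaries_def)
  thus ?thesis using r(2) by blast
 qed
 show "r = \<zero>\<^bsub>R\<^esub>" if r: "r .: R" "r \<odot>\<^bsub>A\<^esub> \<one>\<^bsub>A\<^esub> = \<zero>\<^bsub>A\<^esub>"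
  by (rule inj_onD[OF bij_betw_imp_inj_on[OF bij]]) (use r in simp_all)
qed

section \<open>The relative model theorem\<close>

theorem proposition3p3:
  fixes R :: "'r ring"
    and A :: "('r, 'a) gmod" and dA :: "'a \<Rightarrow> 'a"
    and B :: "('r, 'b) gmod" and dB :: "'b \<Rightarrow> 'b"
    and f :: "'a \<Rightarrow> 'b"
  assumes "principal_domain R"
    and "\<one>\<^bsub>R\<^esub> \<oplus>\<^bsub>R\<^esub> \<one>\<^bsub>R\<^esub> \<in> Units R"
    and "cdga R A dA" and "cdga R B dB"
    and "H0_is_base R A dA" and "H0_is_base R B dB"
    and "carrier (cohom A dA 1) = {\<zero>\<^bsub>cohom A dA 1\<^esub>}"
    and "carrier (cohom B dB 1) = {\<zero>\<^bsub>cohom B dB 1\<^esub>}"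
    and "\<And>i. fin_gen_module R (cohom A dA i)" and "\<And>i. fin_gen_module R (cohom B dB i)"
    and "free_module R (cohom B dB 2)"
    and "free_module R A"
    and "cdga_hom R A dA B dB f"
    and "inj_on (cohom_map B dB 2 f) (carrier (cohom A dA 2))"
  shows "\<exists>(V :: ('r, nat \<Rightarrow> 'r) gmod) d \<phi>.
           free_graded_module R V \<and>
           cdga R (tensor_alg R A (Lambda R V)) d \<and>
           cdga_hom R A dA (tensor_alg R A (Lambda R V)) d (tensor_incl R A (Lambda R V)) \<and>
           inj_on (tensor_incl R A (Lambda R V)) (carrier A) \<and>
           quasi_iso R (tensor_alg R A (Lambda R V)) d B dB \<phi> \<and>
           (\<forall>a\<in>carrier A. \<phi> (tensor_incl R A (Lambda R V) a) = f a)"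
proof -
 interpret R: principal_domain R by (rule assms(1))
 interpret A: cdga R A dA by (rule assms(3))
 interpret B: cdga R B dB by (rule assms(4))
 note f = assms(13)
 have F: "f x .: B" "f (x \<oplus>\<^bsub>A\<^esub> y) = f x \<oplus>\<^bsub>B\<^esub> f y" "f (dA x) = dB (f x)"
  if "x .: A" "y .: A" for x y
  using f that unfolding cdga_hom_def ring_hom_def by auto
 have f_closed: "f x .: B" if "x .: A" for x using F(1)[OF that that] .
 have f_smult: "f (r \<odot>\<^bsub>A\<^esub> x) = r \<odot>\<^bsub>B\<^esub> f x" if "r .: R" "x .: A" for r x
  using f that unfolding cdga_hom_def by blast
 have f_one: "f \<one>\<^bsub>A\<^esub> = \<one>\<^bsub>B\<^esub>" using f unfolding cdga_hom_def ring_hom_def by simp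
 have f_grade: "f x \<in> grade B k" if "x \<in> grade A k" for x k
  using f that unfolding cdga_hom_def by blast
 have f_add: "additive_map A B f" by (rule additiveI) (use F in auto)
 have H1: "\<exists>t\<in>grade C 0. c = d t"
  if C: "cdga R C d" and triv: "carrier (cohom C d 1) = {\<zero>\<^bsub>cohom C d 1\<^esub>}" and c: "c \<in> grade C 1" "d c = \<zero>\<^bsub>C\<^esub>"
  for C :: "('r, 'c) gmod" and d c
 proof -
  interpret C: cdga R C d by (rule C)
  have "C.cls 1 c .: cohom C d 1" unfolding C.cohom_carrier using c by (simp add: cocycles_def)
  hence "C.cls 1 c = \<zero>\<^bsub>cohom C d 1\<^esub>" using triv by simp
  hence "c \<in> coboundaries C d 1" using C.cls_zeroD C.grade_carrier[OF c(1)] by blast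
  thus ?thesis by (auto simp: coboundaries_def)
 qed
 have B_H2: "\<exists>t'\<in>grade B 1. s = dB t'"
  if s: "s \<in> grade B 2" "dB s = \<zero>\<^bsub>B\<^esub>" and q: "q .: R" "q ~= \<zero>\<^bsub>R\<^esub>"
   and t: "t \<in> grade B 1" "q \<odot>\<^bsub>B\<^esub> s = dB t" for s q t
 proof -
  have sc: "s .: B" using s(1) B.grade_carrier by blast
  have cl: "B.cls 2 s .: cohom B dB 2" unfolding B.cohom_carrier using s by (simp add: cocycles_def)
  have "q \<odot>\<^bsub>B\<^esub> s \<in> coboundaries B dB 2" using t by (simp add: coboundaries_def numeral_2_eq_2)
  hence "q \<odot>\<^bsub>cohom B dB 2\<^esub> B.cls 2 s = \<zero>\<^bsub>cohom B dB 2\<^esub>"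
   unfolding cls_smult[OF assms(4) q(1) sc] by (rule B.cls_zeroI)
  hence "B.cls 2 s = \<zero>\<^bsub>cohom B dB 2\<^esub>"
   by (rule free_module_torsion_free[OF R.domain_axioms assms(11) cl q])
  hence "s \<in> coboundaries B dB 2" using B.cls_zeroD sc by blast
  thus ?thesis by (auto simp: coboundaries_def numeral_2_eq_2)
 qed
 interpret P: pid_target R B dB
  by (intro pid_target.intro pid_target_axioms.intro assms(1,2,4) H0_is_baseD[OF assms(4,6)] H1[OF assms(4,8)] B_H2)
 have diff_cocycle: "dB (c \<ominus>\<^bsub>B\<^esub> f a) = \<zero>\<^bsub>B\<^esub> \<and> c \<ominus>\<^bsub>B\<^esub> f a \<in> grade B k"
  if "c \<in> grade B k" "a \<in> grade A k" "f (dA a) = dB c" for a c k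
 proof -
  have cl: "c .: B" "a .: A" "f a .: B"
   using that A.grade_carrier B.grade_carrier f_closed by auto
  show ?thesis
   using that cl F(3)[OF cl(2,2)] f_grade[OF that(2)]
   by (auto simp: a_minus_def B.diff_add B.diff_neg B.M.r_neg intro!: B.grade_add B.grade_neg)
 qed
 have ac0: "cone_acyclic R A dA B dB f 0"
  unfolding cone_acyclic_def
 proof (intro allI impI)
  fix u c assume "cone_cocycle A dA B dB f 0 u c"
  hence u: "u \<in> grade A 1" "dA u = \<zero>\<^bsub>A\<^esub>" and c: "c \<in> grade B 0" "f u = dB c" by (auto simp: cone_cocycle_def)
  obtain a where a: "a \<in> grade A 0" "u = dA a" using H1[OF assms(3,7) u] by blast
  have "f (dA a) = dB c" using c(2) a(2) by simp
  then obtain r where r: "r .: R" "c \<ominus>\<^bsub>B\<^esub> f a = r \<odot>\<^bsub>B\<^esub> \<one>\<^bsub>B\<^esub>"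
   using P.B_H0 diff_cocycle[OF c(1) a(1)] by blast
  let ?a = "a \<oplus>\<^bsub>A\<^esub> r \<odot>\<^bsub>A\<^esub> \<one>\<^bsub>A\<^esub>"
  have cl: "a .: A" "c .: B" "f a .: B" using a(1) c(1) A.grade_carrier B.grade_carrier f_closed by auto
  have "u = dA ?a" using a(2) cl r(1) by (simp add: A.diff_add A.diff_smult)
  moreover have "?a \<in> grade A 0" using a(1) r(1) A.one_grade A.grade_add A.grade_smult by simp
  moreover have "c = f ?a \<oplus>\<^bsub>B\<^esub> \<zero>\<^bsub>B\<^esub>"
  proof -
   have "f ?a = f a \<oplus>\<^bsub>B\<^esub> (c \<ominus>\<^bsub>B\<^esub> f a)" using F(2)[of a "r \<odot>\<^bsub>A\<^esub> \<one>\<^bsub>A\<^esub>"] cl(1) r f_smult f_one by simp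
   also have "\<dots> = c" using cl by (simp add: a_minus_def B.M.a_lcomm[of _ c] B.M.r_neg)
   finally show ?thesis using cl(2) by simp
  qed
  ultimately show "(u, c) \<in> cone_span R A dA B dB f 0 []" by (auto simp: coboundaries_def)
 qed
 have ac1: "cone_acyclic R A dA B dB f 1"
  unfolding cone_acyclic_def
 proof (intro allI impI)
  fix u c assume "cone_cocycle A dA B dB f 1 u c"
  hence u: "u \<in> grade A 2" "dA u = \<zero>\<^bsub>A\<^esub>" and c: "c \<in> grade B 1" "f u = dB c"
   by (auto simp: cone_cocycle_def numeral_2_eq_2)
  have uc: "u .: A" using u(1) A.grade_carrier by blast
  have "f u \<in> coboundaries B dB 2" using c by (simp add: coboundaries_def numeral_2_eq_2)
  hence "cohom_map B dB 2 f (A.cls 2 u) = \<zero>\<^bsub>cohom B dB 2\<^esub>"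
   unfolding cls_map[OF assms(3,4) f uc] by (rule B.cls_zeroI)
  moreover have "cohom_map B dB 2 f (A.cls 2 \<zero>\<^bsub>A\<^esub>) = \<zero>\<^bsub>cohom B dB 2\<^esub>"
   unfolding cls_map[OF assms(3,4) f A.M.zero_closed] B.cohom_zero
   using additive_zero[OF A.M.ab B.M.ab f_add] by simp
  moreover have "A.cls 2 u .: cohom A dA 2" "A.cls 2 \<zero>\<^bsub>A\<^esub> .: cohom A dA 2"
   unfolding A.cohom_carrier using u A.grade_zero by (simp_all add: cocycles_def)
  ultimately have "A.cls 2 u = A.cls 2 \<zero>\<^bsub>A\<^esub>" using assms(14) by (simp add: inj_on_def)
  hence "u \<in> coboundaries A dA 2" using A.cls_zeroD[OF _ uc] by (simp add: A.cohom_zero)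
  then obtain a where a: "a \<in> grade A 1" "u = dA a" by (auto simp: coboundaries_def numeral_2_eq_2)
  have "f (dA a) = dB c" using c(2) a(2) by simp
  then obtain t where t: "t \<in> grade B 0" "c \<ominus>\<^bsub>B\<^esub> f a = dB t"
   using P.B_H1 diff_cocycle[OF c(1) a(1)] by blast
  have cl: "a .: A" "c .: B" "f a .: B" using a(1) c(1) A.grade_carrier B.grade_carrier f_closed by auto
  have "c = f a \<oplus>\<^bsub>B\<^esub> dB t" unfolding t(2)[symmetric] using cl by (simp add: a_minus_def B.M.a_lcomm[of _ c] B.M.r_neg)
  moreover have "dB t \<in> coboundaries B dB 1" using t(1) by (simp add: coboundaries_def)
  ultimately show "(u, c) \<in> cone_span R A dA B dB f 1 []" using a by auto
 qed
 define dg where "dg j = fst (prod_decode j)" for j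
 interpret D: relative_model_data R A dg B dB dA f
 proof (intro relative_model_data.intro relative_model_data_axioms.intro free_gens.intro P.pid_target_axioms
   A.comm_graded_algebra_axioms assms(3) f H0_is_baseD[OF assms(3,5)])
  show "cone_acyclic R A dA B dB f i" if "i < 2" for i
   using that ac0 ac1 by (cases i) (auto simp: less_Suc_eq numeral_2_eq_2)
  show "fin_gen_cohom R A dA i" for i using fin_gen_module_cohom[OF assms(3,9)] .
  show "fin_gen_cohom R B dB i" for i using fin_gen_module_cohom[OF assms(4,10)] .
  show "\<exists>j\<ge>N. dg j = n" for n N
   using le_prod_encode_2[of N n] by (intro exI[of _ "prod_encode (n, N)"]) (simp add: dg_def)
 qed
 obtain X d \<phi> where m: "cdga_model R B dB (gen_ext A dg X) d \<phi>"
  and ac: "!!i. cone_acyclic R (gen_ext A dg X) d B dB \<phi> i"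
  and d_incl: "!!a. a .: A ==> d (D.incl a) = D.incl (dA a)"
  and phi_incl: "!!a. a .: A ==> \<phi> (D.incl a) = f a"
  by (rule D.full_model) blast
 interpret Mo: cdga_model R B dB "gen_ext A dg X" d \<phi> by (rule m)
 interpret TM: tensor_model R A dg X
  by (intro tensor_model.intro free_gens.intro A.comm_graded_algebra_axioms generated_module.intro R.is_cring
    tensor_model_axioms.intro assms(2))
 let ?V = "gen_module R dg X" and ?T = "tensor_alg R A (Lambda R (gen_module R dg X))"
 let ?i = "tensor_incl R A (Lambda R (gen_module R dg X))"
 note T = TM.T_comm_graded_algebra and S = Mo.K.cdga_axioms and iso = TM.to_model_iso
 interpret T: comm_graded_algebra R ?T by (rule T)
 let ?d = "iso_diff ?T TM.to_model d" and ?\<phi> = "%t. \<phi> (TM.to_model t)"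
 have cdgaT: "cdga R ?T ?d" by (rule iso_cdga[OF T S iso])
 have inj: "t = t'" if "TM.to_model t = TM.to_model t'" "t .: ?T" "t' .: ?T" for t t'
  using iso_inj[OF T S iso] that by (rule inj_onD)
 have incl_hom: "cdga_hom R A dA ?T ?d ?i"
  unfolding cdga_hom_def
 proof (intro conjI ballI allI)
  show "?i \<in> ring_hom A ?T"
  proof (rule ring_hom_memI)
   fix x y assume x: "x .: A" and y: "y .: A"
   show "?i (x \<otimes>\<^bsub>A\<^esub> y) = ?i x \<otimes>\<^bsub>?T\<^esub> ?i y"
    using x y D.incl_mult[OF x y, of X]
    by (intro inj) (simp_all add: TM.ti_closed TM.to_model_ti iso_mult[OF T S iso])
   show "?i (x \<oplus>\<^bsub>A\<^esub> y) = ?i x \<oplus>\<^bsub>?T\<^esub> ?i y" using additive_add[OF TM.ti_additive x y] .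
  next
   show "?i \<one>\<^bsub>A\<^esub> = \<one>\<^bsub>?T\<^esub>"
    by (intro inj) (simp_all add: TM.ti_closed TM.to_model_ti iso_one[OF T S iso] TM.incl_one)
  qed (rule TM.ti_closed)
 next
  fix r x assume "r .: R" "x .: A"
  thus "?i (r \<odot>\<^bsub>A\<^esub> x) = r \<odot>\<^bsub>?T\<^esub> ?i x"
   by (intro inj) (simp_all add: TM.ti_closed TM.to_model_ti iso_smult[OF T S iso] TM.incl_smult)
 next
  fix n
  show "?i ` grade A n \<subseteq> grade ?T n"
   using TM.ti_homogeneous TM.pt_grade[OF _ TM.L_one_grade] by auto
 next
  fix x assume x: "x .: A"
  thus "?i (dA x) = ?d (?i x)"
   by (intro inj) (simp_all add: TM.ti_closed TM.to_model_ti iso_diff[OF T S iso] iso_diff_closed[OF T S iso] d_incl)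
 qed
 have incl_inj: "inj_on ?i (carrier A)"
 proof (rule inj_onI)
  fix x y assume x: "x .: A" and y: "y .: A" and eq: "?i x = ?i y"
  have "D.incl x = D.incl y" using TM.to_model_ti[OF x] TM.to_model_ti[OF y] eq by simp
  thus "x = y" using D.incl_simps(1) by metis
 qed
 have qi: "quasi_iso R ?T ?d B dB ?\<phi>"
 proof (rule quasi_iso_from_cone[OF cdgaT assms(4) iso_comp_hom[OF T S iso Mo.phi]])
  show "cone_acyclic R ?T ?d B dB ?\<phi> n" for n by (rule iso_cone_acyclic[OF T S iso ac])
  fix t assume t: "t \<in> grade ?T 0" "?d t = \<zero>\<^bsub>?T\<^esub>" "?\<phi> t = \<zero>\<^bsub>B\<^esub>"
  have tc: "t .: ?T" using t(1) T.grade_carrier by blast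
  have "TM.to_model t \<in> grade (gen_ext A dg X) 0" using iso_grade_iff[OF T S iso tc] t(1) by simp
  moreover have "d (TM.to_model t) = \<zero>\<^bsub>gen_ext A dg X\<^esub>"
   using iso_diff[OF T S iso tc] t(2) iso_zero[OF T S iso] by simp
  ultimately obtain r where r: "r .: R" "TM.to_model t = r \<odot>\<^bsub>gen_ext A dg X\<^esub> \<one>\<^bsub>gen_ext A dg X\<^esub>"
   using Mo.K_H0 by blast
  have "r \<odot>\<^bsub>B\<^esub> \<one>\<^bsub>B\<^esub> = \<zero>\<^bsub>B\<^esub>" using t(3) r Mo.phi_smult Mo.phi_one by simp
  hence "TM.to_model t = \<zero>\<^bsub>gen_ext A dg X\<^esub>" using r P.B_scalars[of r] by simp
  thus "t = \<zero>\<^bsub>?T\<^esub>" using tc iso_zero[OF T S iso] by (intro inj) simp_all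
 qed
 have comp: "?\<phi> (?i a) = f a" if "a .: A" for a
  using that phi_incl by (simp add: TM.to_model_ti)
 have "free_graded_module R ?V" by (rule TM.GM.V_free[OF R.one_not_zero])
 thus ?thesis using cdgaT incl_hom incl_inj qi comp by blast
qed

end
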